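(* Let $X$ be a finite-dimensional real Banach space, $p\in(1,\infty)$, $H$ a separable real Hilbert space, $W^H$ an $H$-cylindrical Brownian motion, and $\Phi:\mathbb R_+\times\Omega\to\mathcal L(H,X)$ progressively measurable with $\mathbb E\big(\int_0^\infty\|\Phi(t)\|_{HS}^2dt\big)^{p/2}<\infty$. Let $A\in\mathcal L(H)$ be self-adjoint. Then $$\big(\mathbb E\|((\Phi A)\cdot W^H)_\infty\|^p\big)^{1/p}\le\beta_{p,X}\|A\|\big(\mathbb E\|(\Phi\cdot W^H)_\infty\|^p\big)^{1/p}.$$
   Context: An $H$-cylindrical Brownian motion is a map $W^H:\mathbb R_+\times H\to L^2(\Omega)$ such that $(W^Hh_1,\dots,W^Hh_d)$ is a $d$-dimensional Wiener process for all $h_1,\dots,h_d\in H$ and $\mathbb E\,W^H(t)h\,W^H(s)g=\langle h,g\rangle\min\{t,s\}$. For elementary progressive $\Phi=\sum_{k,m}\mathbf 1_{(t_{k-1},t_k]\times B_{mk}}\sum_n h_n\otimes x_{kmn}$ ($B_{mk}\in\mathcal F_{t_{k-1}}$, orthogonal $h_n$), $(\Phi\cdot W^H)_t=\sum_{k,m}\mathbf 1_{B_{mk}}\sum_n(W^H(t_k\wedge t)h_n-W^H(t_{k-1}\wedge t)h_n)x_{kmn}$, extended to general integrands by the Itô isomorphism; $\|\cdot\|_{HS}$ is the Hilbert–Schmidt norm with respect to any fixed Euclidean norm on $X$. $\beta_{p,X}$ is the UMD$_p$ constant of $X$: the least $\beta$ with $\big(\mathbb E\|\sum_{j=1}^n\varepsilon_jd_j\|^p\big)^{1/p}\le\beta\big(\mathbb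 E\|\sum_{j=1}^nd_j\|^p\big)^{1/p}$ for all $X$-valued $L^p$ martingale difference sequences and scalars $|\varepsilon_j|=1$. *)

theory Defs
  imports "HOL-Probability.Probability"
begin

definition is_norm_fun :: "('x::real_vector \<Rightarrow> real) \<Rightarrow> bool" where
  "is_norm_fun N \<longleftrightarrow> (\<forall>x. 0 \<le> N x) \<and> (\<forall>x. N x = 0 \<longleftrightarrow> x = 0)
     \<and> (\<forall>a x. N (a *\<^sub>R x) = \<bar>a\<bar> * N x) \<and> (\<forall>x y. N (x + y) \<le> N x + N y)"

definition separable_space :: "'h::metric_space itself \<Rightarrow> bool" where
  "separable_space _ \<longleftrightarrow> (\<exists>D::'h set. countable D \<and> closure D = UNIV)"

definition orthonormal_set :: "'h::real_inner set \<Rightarrow> bool" where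
  "orthonormal_set S \<longleftrightarrow> (\<forall>x\<in>S. norm x = 1) \<and> (\<forall>x\<in>S. \<forall>y\<in>S. x \<noteq> y \<longrightarrow> x \<bullet> y = 0)"

definition hs_sq :: "('h::real_inner \<Rightarrow> 'x::euclidean_space) \<Rightarrow> ennreal" where
  "hs_sq T = (SUP S \<in> {S. finite S \<and> orthonormal_set S}. ennreal (\<Sum>h\<in>S. (norm (T h))\<^sup>2))"

definition epowr :: "ennreal \<Rightarrow> real \<Rightarrow> ennreal" where
  "epowr x r = (if x = \<infinity> then \<infinity> else ennreal (enn2real x powr r))"

definition hs_Lp_pow :: "'w measure \<Rightarrow> real \<Rightarrow> (real \<Rightarrow> 'w \<Rightarrow> 'h::real_inner \<Rightarrow> 'x::euclidean_space) \<Rightarrow> ennreal" where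
  "hs_Lp_pow M p \<Phi> = (\<integral>\<^sup>+ \<omega>. epowr (\<integral>\<^sup>+ t. indicator {0..} t * hs_sq (\<Phi> t \<omega>) \<partial>lborel) (p / 2) \<partial>M)"

definition is_filtr :: "'w measure \<Rightarrow> (real \<Rightarrow> 'w measure) \<Rightarrow> bool" where
  "is_filtr M F \<longleftrightarrow> (\<forall>t\<ge>0. subalgebra M (F t)) \<and> (\<forall>s t. 0 \<le> s \<longrightarrow> s \<le> t \<longrightarrow> sets (F s) \<subseteq> sets (F t))"

definition centered_gaussian :: "'w measure \<Rightarrow> ('w \<Rightarrow> real) \<Rightarrow> bool" where
  "centered_gaussian M X \<longleftrightarrow> X \<in> borel_measurable M \<and>
     ((\<exists>\<sigma>>0. distributed M lborel X (normal_density 0 \<sigma>)) \<or> (AE \<omega> in M. X \<omega> = 0))"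

definition wiener_proc :: "'w measure \<Rightarrow> (real \<Rightarrow> 'w measure) \<Rightarrow> nat \<Rightarrow> (real \<Rightarrow> nat \<Rightarrow> 'w \<Rightarrow> real) \<Rightarrow> bool" where
  "wiener_proc M F d Y \<longleftrightarrow>
     (\<forall>i<d. AE \<omega> in M. Y 0 i \<omega> = 0)
   \<and> (\<forall>t\<ge>0. \<forall>i<d. Y t i \<in> borel_measurable (F t))
   \<and> (\<exists>V. (\<forall>t\<ge>0. \<forall>i<d. AE \<omega> in M. V t i \<omega> = Y t i \<omega>)
          \<and> (\<forall>\<omega>\<in>space M. \<forall>i<d. continuous_on {0..} (\<lambda>t. V t i \<omega>)))
   \<and> (\<forall>s t. 0 \<le> s \<longrightarrow> s \<le> t \<longrightarrow>
        (\<forall>c::nat \<Rightarrow> real. centered_gaussian M (\<lambda>\<omega>. \<Sum>i<d. c i * (Y t i \<omega> - Y s i \<omega>)))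
      \<and> (\<forall>A\<in>sets (F s). \<forall>B\<in>sets (PiM {..<d} (\<lambda>_. borel)).
           measure M (A \<inter> {\<omega>\<in>space M. (\<lambda>i\<in>{..<d}. Y t i \<omega> - Y s i \<omega>) \<in> B})
           = measure M A * measure M {\<omega>\<in>space M. (\<lambda>i\<in>{..<d}. Y t i \<omega> - Y s i \<omega>) \<in> B}))
   \<and> (\<exists>Q::nat \<Rightarrow> nat \<Rightarrow> real. \<forall>s t. 0 \<le> s \<longrightarrow> s \<le> t \<longrightarrow> (\<forall>i<d. \<forall>j<d.
        (\<integral>\<omega>. (Y t i \<omega> - Y s i \<omega>) * (Y t j \<omega> - Y s j \<omega>) \<partial>M) = (t - s) * Q i j))"

definition cyl_bm :: "'w measure \<Rightarrow> (real \<Rightarrow> 'w measure) \<Rightarrow> (real \<Rightarrow> 'h::real_inner \<Rightarrow> 'w \<Rightarrow> real) \<Rightarrow> bool" where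
  "cyl_bm M F W \<longleftrightarrow>
     (\<forall>hs::'h list. wiener_proc M F (length hs) (\<lambda>t i. W t (hs ! i)))
   \<and> (\<forall>t h. 0 \<le> t \<longrightarrow> integrable M (\<lambda>\<omega>. (W t h \<omega>)\<^sup>2))
   \<and> (\<forall>t s h g. 0 \<le> t \<longrightarrow> 0 \<le> s \<longrightarrow>
        (\<integral>\<omega>. W t h \<omega> * W s g \<omega> \<partial>M) = (h \<bullet> g) * min t s)"

definition progressive_op :: "(real \<Rightarrow> 'w measure) \<Rightarrow> (real \<Rightarrow> 'w \<Rightarrow> 'h::real_normed_vector \<Rightarrow> 'x::euclidean_space) \<Rightarrow> 'w measure \<Rightarrow> bool" where
  "progressive_op F \<Phi> M \<longleftrightarrow>
     (\<forall>t\<ge>0. \<forall>\<omega>\<in>space M. bounded_linear (\<Phi> t \<omega>))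
   \<and> (\<forall>h t. 0 \<le> t \<longrightarrow>
        (\<lambda>(s, \<omega>). \<Phi> s \<omega> h) \<in> borel_measurable (restrict_space borel {0..t} \<Otimes>\<^sub>M F t))"

definition elem_valid :: "(real \<Rightarrow> 'w measure) \<Rightarrow> nat \<Rightarrow> (nat \<Rightarrow> real) \<Rightarrow> nat \<Rightarrow> (nat \<Rightarrow> nat \<Rightarrow> 'w set)
    \<Rightarrow> nat \<Rightarrow> (nat \<Rightarrow> 'h::real_inner) \<Rightarrow> bool" where
  "elem_valid F K ts Mm B Nn hs \<longleftrightarrow> 0 \<le> ts 0 \<and> (\<forall>k<K. ts k < ts (Suc k))
     \<and> (\<forall>k\<in>{1..K}. \<forall>m<Mm. B m k \<in> sets (F (ts (k - 1))))
     \<and> (\<forall>n<Nn. \<forall>n'<Nn. n \<noteq> n' \<longrightarrow> hs n \<bullet> hs n' = 0)"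

definition elem_proc :: "nat \<Rightarrow> (nat \<Rightarrow> real) \<Rightarrow> nat \<Rightarrow> (nat \<Rightarrow> nat \<Rightarrow> 'w set) \<Rightarrow> nat \<Rightarrow> (nat \<Rightarrow> 'h::real_inner)
    \<Rightarrow> (nat \<Rightarrow> nat \<Rightarrow> nat \<Rightarrow> 'x::real_vector) \<Rightarrow> real \<Rightarrow> 'w \<Rightarrow> 'h \<Rightarrow> 'x" where
  "elem_proc K ts Mm B Nn hs x = (\<lambda>t \<omega> g. \<Sum>k\<in>{1..K}. \<Sum>m<Mm.
      indicator ({ts (k - 1)<..ts k} \<times> B m k) (t, \<omega>) *\<^sub>R (\<Sum>n<Nn. (g \<bullet> hs n) *\<^sub>R x k m n))"

definition elem_int :: "(real \<Rightarrow> 'h::real_inner \<Rightarrow> 'w \<Rightarrow> real) \<Rightarrow> nat \<Rightarrow> (nat \<Rightarrow> real) \<Rightarrow> nat \<Rightarrow> (nat \<Rightarrow> nat \<Rightarrow> 'w set)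
    \<Rightarrow> nat \<Rightarrow> (nat \<Rightarrow> 'h) \<Rightarrow> (nat \<Rightarrow> nat \<Rightarrow> nat \<Rightarrow> 'x::real_vector) \<Rightarrow> 'w \<Rightarrow> 'x" where
  "elem_int W K ts Mm B Nn hs x = (\<lambda>\<omega>. \<Sum>k\<in>{1..K}. \<Sum>m<Mm.
      indicator (B m k) \<omega> *\<^sub>R (\<Sum>n<Nn. (W (ts k) (hs n) \<omega> - W (ts (k - 1)) (hs n) \<omega>) *\<^sub>R x k m n))"

text \<open>\<open>\<xi> = (\<Phi>\<cdot>W)_\<infinity>\<close>: the L^p-limit of integrals of elementary progressive processes
  approximating \<Phi> in \<open>L^p(\<Omega>; L^2(R_+; HS(H,X)))\<close> (Ito isomorphism extension).\<close>
definition is_stoch_int :: "'w measure \<Rightarrow> (real \<Rightarrow> 'w measure) \<Rightarrow> (real \<Rightarrow> 'h::real_inner \<Rightarrow> 'w \<Rightarrow> real) \<Rightarrow> real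
    \<Rightarrow> (real \<Rightarrow> 'w \<Rightarrow> 'h \<Rightarrow> 'x::euclidean_space) \<Rightarrow> ('w \<Rightarrow> 'x) \<Rightarrow> bool" where
  "is_stoch_int M F W p \<Phi> \<xi> \<longleftrightarrow> \<xi> \<in> borel_measurable M \<and>
     (\<exists>K ts Mm B Nn hs x.
        (\<forall>j. elem_valid F (K j) (ts j) (Mm j) (B j) (Nn j) (hs j))
      \<and> (\<lambda>j. hs_Lp_pow M p (\<lambda>t \<omega> g. \<Phi> t \<omega> g - elem_proc (K j) (ts j) (Mm j) (B j) (Nn j) (hs j) (x j) t \<omega> g))
          \<longlonglongrightarrow> 0
      \<and> (\<lambda>j. \<integral>\<^sup>+ \<omega>. ennreal (norm (\<xi> \<omega> - elem_int W (K j) (ts j) (Mm j) (B j) (Nn j) (hs j) (x j) \<omega>) powr p) \<partial>M)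
          \<longlonglongrightarrow> 0)"

definition stoch_int :: "'w measure \<Rightarrow> (real \<Rightarrow> 'w measure) \<Rightarrow> (real \<Rightarrow> 'h::real_inner \<Rightarrow> 'w \<Rightarrow> real) \<Rightarrow> real
    \<Rightarrow> (real \<Rightarrow> 'w \<Rightarrow> 'h \<Rightarrow> 'x::euclidean_space) \<Rightarrow> 'w \<Rightarrow> 'x" where
  "stoch_int M F W p \<Phi> = (SOME \<xi>. is_stoch_int M F W p \<Phi> \<xi>)"

text \<open>Martingale difference sequences are taken on probability spaces over the type real
  (every joint law on the finite-dimensional X^n is realisable there).\<close>
definition umd_const :: "real \<Rightarrow> ('x::euclidean_space \<Rightarrow> real) \<Rightarrow> real" where
  "umd_const p N = Inf {\<beta>. \<forall>(P::real measure) (G::nat \<Rightarrow> real measure) (d::nat \<Rightarrow> real \<Rightarrow> 'x) (n::nat) (\<epsilon>::nat \<Rightarrow> real).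
      (prob_space P \<and> (\<forall>j. subalgebra P (G j)) \<and> (\<forall>i j. i \<le> j \<longrightarrow> sets (G i) \<subseteq> sets (G j))
       \<and> (\<forall>j\<in>{1..n}. d j \<in> borel_measurable (G j) \<and> integrable P (d j)
              \<and> integrable P (\<lambda>\<omega>. N (d j \<omega>) powr p))
       \<and> (\<forall>j\<in>{2..n}. \<forall>A\<in>sets (G (j - 1)). (\<integral>\<omega>. indicator A \<omega> *\<^sub>R d j \<omega> \<partial>P) = 0)
       \<and> (\<forall>j. \<bar>\<epsilon> j\<bar> = 1))
      \<longrightarrow> (\<integral>\<omega>. N (\<Sum>j=1..n. \<epsilon> j *\<^sub>R d j \<omega>) powr p \<partial>P) powr (1 / p)
          \<le> \<beta> * (\<integral>\<omega>. N (\<Sum>j=1..n. d j \<omega>) powr p \<partial>P) powr (1 / p)}"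

end

theory Submission imports Defs begin

text \<open>A self-adjoint \<open>A\<close> compressed to the finite-dimensional span of the vectors occurring in an
  elementary integrand has an orthonormal eigenbasis. Integrating along that basis, direction by
  direction on each time step, makes the elementary integral a sum of a martingale difference
  sequence, and composing the integrand with \<open>A\<close> multiplies each difference by an eigenvalue, a
  scalar in \<open>[-\<parallel>A\<parallel>, \<parallel>A\<parallel>]\<close>. Convexity in the multipliers reduces these to signs, so the UMD property
  gives the inequality for elementary integrands. The general case follows by approximation in
  \<open>L\<^sup>p(\<Omega>; L\<^sup>2(HS))\<close>, in which the integral is continuous by an Ito-type moment inequality.

  Two facts make the constants meaningful: \<open>umd_const\<close> is an infimum over a nonempty set, by
  Burkholder's theorem for scalar martingales applied to coordinates, and martingale difference
  sequences on arbitrary probability spaces can be copied to probability measures on the reals.\<close>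

section \<open>Martingale transforms and the UMD constant\<close>

text \<open>A self-adjoint operator on an infinite-dimensional space may have no eigenvectors, but
  an elementary integral sees \<open>A\<close> only through numbers \<open>A x \<bullet> e\<close>
  with \<open>x\<close>, \<open>e\<close> in a finite-dimensional span. There the quadratic form of
  \<open>A\<close> can be diagonalised, even though \<open>A\<close> need not map the span into
  itself. Three obstacles shape the proof. \<open>cyl_bm\<close> makes an increment vector
  independent of the past, but says nothing about independence of its components; running through
  the directions one by one requires deriving it from the covariances, by characteristic functions.
  \<open>stoch_int\<close> chooses some limit along some unknown approximating sequence, so two
  stochastic integrals can be compared only once every choice is known to be the limit along a
  prescribed sequence, here \<open>L j\<close> for one and \<open>lcomp A (L j)\<close> for the
  other. And the moment inequality is wanted also for \<open>p < 2\<close>, where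
  \<open>\<bar>x\<bar> powr p\<close> has no second derivative at 0: therefore an even power of the
  martingale is expanded and a power of its bracket corrects the exponent.\<close>

lemma powr_add_le_two_powr:
  fixes x y p :: real
  assumes "0 \<le> x" "0 \<le> y" "0 < p"
  shows "(x + y) powr p \<le> 2 powr p * (x powr p + y powr p)"
proof -
  have "(x + y) powr p \<le> (2 * max x y) powr p"
    using assms by (intro powr_mono2) auto
  also have "\<dots> = 2 powr p * max x y powr p" using assms by (simp add: powr_mult)
  also have "\<dots> \<le> 2 powr p * (x powr p + y powr p)" using assms by (auto simp: max_def)
  finally show ?thesis .
qed

text \<open>Convexity through tangents, with \<open>sgn\<close> making the slope 0 at the origin. If
  \<open>x\<close> and \<open>y\<close> have the same sign, this is convexity on a half line. For
  \<open>y \<le> 0 < x\<close> the tangent at \<open>x\<close> is already negative at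
  \<open>y\<close>, because its zero lies at \<open>(p - 1) * x / p > 0\<close>.\<close>

lemma abs_powr_tangent:
  fixes x y p :: real
  assumes "1 < p"
  shows "\<bar>x\<bar> powr p + p * sgn x * \<bar>x\<bar> powr (p - 1) * (y - x) \<le> \<bar>y\<bar> powr p"
proof -
  have pos: "x powr p + p * x powr (p - 1) * (y - x) \<le> \<bar>y\<bar> powr p" if x: "0 < x" for x y :: real
  proof (cases "y > 0")
    case True
    have "convex_on {0<..} (\<lambda>x::real. x powr p)"
      by (rule convex_on_realI[where f' = "\<lambda>x. p * x powr (p - 1)"])
         (use assms in \<open>auto intro!: derivative_eq_intros powr_mono2 simp: field_simps\<close>)
    moreover have "((\<lambda>x. x powr p) has_real_derivative p * x powr (p - 1)) (at x within {0<..})"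
      using x by (auto intro!: derivative_eq_intros)
    ultimately have "y powr p - x powr p \<ge> p * x powr (p - 1) * (y - x)"
      using x True by (intro convex_on_imp_above_tangent[of "{0<..}"]) (auto simp: interior_open)
    with True show ?thesis by simp
  next
    case False
    have "x powr p = x powr (p - 1) * x" using x by (simp add: powr_mult_base mult.commute)
    then have "x powr p + p * x powr (p - 1) * (y - x) = x powr (p - 1) * (p * y - (p - 1) * x)"
      by (simp add: algebra_simps)
    also have "\<dots> \<le> 0" using False assms x
      by (intro mult_nonneg_nonpos) (auto intro!: order_trans[of "p * y" 0 "(p - 1) * x"] mult_nonneg_nonpos)
    finally show ?thesis by (meson order_trans powr_ge_zero)
  qed
  consider "x > 0" | "x = 0" | "x < 0" by linarith
  then show ?thesis
  proof cases
    case 3 with pos[of "-x" "-y"] show ?thesis by (simp add: algebra_simps)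
  qed (use pos in auto)
qed

text \<open>Zigzag coordinates: if \<open>g\<close> is a sign transform of \<open>f\<close>, each
  step changes only one of \<open>f + g\<close> and \<open>f - g\<close>. For the expectation to
  increase along the pair, convexity in each variable separately is then enough.\<close>

definition burk :: "real \<Rightarrow> real \<Rightarrow> real \<Rightarrow> real \<Rightarrow> real \<Rightarrow> real" where
  "burk p a b u v = a * max \<bar>u\<bar> \<bar>v\<bar> powr p + b * u * v * max \<bar>u\<bar> \<bar>v\<bar> powr (p - 2)"

text \<open>The slope of \<open>burk\<close> in its last argument. On the corner
  \<open>\<bar>u\<bar> = \<bar>v\<bar>\<close> the value is taken from the outer side; under the
  condition of \<open>burk_tangent\<close> it is still a subgradient there.\<close>

definition burk_deriv :: "real \<Rightarrow> real \<Rightarrow> real \<Rightarrow> real \<Rightarrow> real \<Rightarrow> real" where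
  "burk_deriv p a b u v =
    (if \<bar>u\<bar> \<le> \<bar>v\<bar> then a * p * sgn v * \<bar>v\<bar> powr (p - 1) + b * (p - 1) * u * \<bar>v\<bar> powr (p - 2)
     else b * sgn u * \<bar>u\<bar> powr (p - 1))"

text \<open>For fixed \<open>u > 0\<close>, \<open>burk\<close> as a function of \<open>v\<close> is
  an affine function plus two one-sided pieces of the form \<open>R (max v u)\<close>, one for
  \<open>v\<close> and one for \<open>- v\<close>. Each piece is flat up to \<open>u\<close> and
  convex beyond it: \<open>R' u \<ge> 0\<close> and the sign of the second derivative both reduce to
  \<open>lin\<close>, whose worst case \<open>s = u\<close> is supplied by \<open>ap\<close> for
  either sign of \<open>\<sigma>\<close>.\<close>

lemma burk_piece_tangent:
  fixes p a \<sigma> u :: real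
  assumes p: "1 < p" and u: "0 < u" and ap: "\<bar>\<sigma>\<bar> * \<bar>p - 2\<bar> \<le> a * p"
  defines "R \<equiv> \<lambda>s. a * s powr p + \<sigma> * u * s powr (p - 1) - \<sigma> * u powr (p - 1) * s"
    and "R' \<equiv> \<lambda>s. a * p * s powr (p - 1) + \<sigma> * u * (p - 1) * s powr (p - 2) - \<sigma> * u powr (p - 1)"
  shows "R (max v u) + (if u \<le> v then R' v else 0) * (w - v) \<le> R (max w u)"
proof -
  have spow: "s powr (p - 1) = s powr (p - 2) * s" "s powr (p - 2) = s powr (p - 3) * s"
    "s powr p = s powr (p - 1) * s" if "s > 0" for s :: real
    using that powr_add[of s _ 1] by (auto simp flip: powr_add simp: powr_mult_base mult.commute)
  have lin: "0 \<le> a * p * s + \<sigma> * u * (p - 2)" if "u \<le> s" for s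
  proof -
    have "- (\<sigma> * (p - 2)) \<le> a * p" using ap by (metis abs_le_D2 abs_mult)
    then have "- (\<sigma> * (p - 2)) * u \<le> a * p * u" using u by (intro mult_right_mono) auto
    moreover have "0 \<le> a * p" using ap by (metis abs_ge_zero abs_mult order_trans)
    then have "a * p * u \<le> a * p * s" using that by (intro mult_left_mono)
    ultimately show ?thesis by (simp add: algebra_simps)
  qed
  have dR: "(R has_real_derivative R' s) (at s)" if "s > 0" for s
    unfolding R_def R'_def using that
    by (auto intro!: derivative_eq_intros simp: algebra_simps)
  have dR': "(R' has_real_derivative (p - 1) * s powr (p - 3) * (a * p * s + \<sigma> * u * (p - 2))) (at s)" if "s > 0" for s
  proof -
    have "(R' has_real_derivative a * p * ((p - 1) * s powr (p - 2)) + \<sigma> * u * (p - 1) * ((p - 2) * s powr (p - 3))) (at s)"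
      unfolding R'_def using that by (auto intro!: derivative_eq_intros)
    then show ?thesis using spow(2)[OF that] by (simp add: algebra_simps)
  qed
  have R'mono: "R' s \<le> R' t" if "u \<le> s" "s \<le> t" for s t
    using that u p lin
    by (intro DERIV_nonneg_imp_nondecreasing[OF \<open>s \<le> t\<close>])
       (meson dR' less_le_trans mult_nonneg_nonneg powr_ge_zero order_trans diff_ge_0_iff_ge less_imp_le)
  have R'u: "0 \<le> R' u"
  proof -
    have "R' u = u powr (p - 2) * (a * p * u + \<sigma> * u * (p - 2))"
      unfolding R'_def using spow(1)[OF u] by (simp add: algebra_simps)
    then show ?thesis using lin[of u] by simp
  qed
  have tang: "R s + R' s * (t - s) \<le> R t" if s: "u \<le> s" and t: "u \<le> t" for s t
  proof -
    consider "s = t" | "s < t" | "t < s" by linarith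
    then show ?thesis
    proof cases
      case 2
      from MVT2[OF this, of R R'] obtain z where z: "s < z" "z < t" "R t - R s = (t - s) * R' z"
        using dR s u by force
      have "(t - s) * R' s \<le> (t - s) * R' z" using R'mono[of s z] z s 2 by (intro mult_left_mono) auto
      with z show ?thesis by (simp add: algebra_simps)
    next
      case 3
      from MVT2[OF this, of R R'] obtain z where z: "t < z" "z < s" "R s - R t = (s - t) * R' z"
        using dR t u by force
      have "(s - t) * R' z \<le> (s - t) * R' s" using R'mono[of z s] z t 3 by (intro mult_left_mono) auto
      with z show ?thesis by (simp add: algebra_simps)
    qed simp
  qed
  show ?thesis
  proof (cases "u \<le> v")
    case True
    have "R v + R' v * (w - v) \<le> R v + R' v * (max w u - v)"
      using R'mono[of u v] R'u True by (intro add_left_mono mult_left_mono) auto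
    also have "\<dots> \<le> R (max w u)" using tang[of v "max w u"] True by auto
    finally show ?thesis using True by (simp add: max_absorb1)
  next
    case False
    have "R u \<le> R u + R' u * (max w u - u)" using R'u by auto
    also have "\<dots> \<le> R (max w u)" using tang[of u "max w u"] by auto
    finally show ?thesis using False by (simp add: max_absorb2)
  qed
qed

text \<open>For \<open>u > 0\<close> the two one-sided pieces are added. For \<open>u = 0\<close>
  only \<open>a * \<bar>v\<bar> powr p\<close> remains, and negative \<open>u\<close> follows by
  reflection, since \<open>burk\<close> does not change under
  \<open>(u, v) \<mapsto> (- u, - v)\<close>.\<close>

lemma burk_tangent:
  assumes p: "1 < p" and ap: "\<bar>b\<bar> * \<bar>p - 2\<bar> \<le> a * p"
  shows "burk p a b u v + burk_deriv p a b u v * (w - v) \<le> burk p a b u w"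
proof -
  have pos: "burk p a b u v + burk_deriv p a b u v * (w - v) \<le> burk p a b u w" if u: "0 < u" for u v w
  proof -
    define R where "R \<sigma> s = a * s powr p + \<sigma> * u * s powr (p - 1) - \<sigma> * u powr (p - 1) * s" for \<sigma> s
    define R' where "R' \<sigma> s = a * p * s powr (p - 1) + \<sigma> * u * (p - 1) * s powr (p - 2) - \<sigma> * u powr (p - 1)" for \<sigma> s
    have spow: "s powr (p - 1) = s powr (p - 2) * s" if "s > 0" for s :: real
      using that powr_add[of s "p - 2" 1] by (simp add: mult.commute)
    \<comment> \<open>The affine remainder removes one of the two copies of
      \<open>a * u powr p\<close> and restores the slope \<open>b * u powr (p - 1)\<close> of the
      middle region \<open>\<bar>v\<bar> < u\<close>, where both pieces are constant.\<close>
    have eq: "burk p a b u v = R b (max v u) + R (- b) (max (- v) u) - a * u powr p + b * u powr (p - 1) * v" for v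
    proof -
      consider "u \<le> v" | "\<bar>v\<bar> < u" | "u \<le> - v" by linarith
      then show ?thesis
        using u spow[of u] spow[of v] spow[of "-v"]
        by cases (auto simp: burk_def R_def max_def abs_if algebra_simps)
    qed
    have deq: "burk_deriv p a b u v = b * u powr (p - 1) + (if u \<le> v then R' b v else 0) - (if u \<le> - v then R' (- b) (- v) else 0)" for v
    proof -
      consider "u \<le> v" | "\<bar>v\<bar> < u" | "u \<le> - v" by linarith
      then show ?thesis
        using u by cases (auto simp: burk_deriv_def R'_def abs_if algebra_simps)
    qed
    have 1: "R b (max v u) + (if u \<le> v then R' b v else 0) * (w - v) \<le> R b (max w u)"
      using burk_piece_tangent[OF p u ap, of v w] unfolding R_def R'_def .
    have 2: "R (- b) (max (- v) u) + (if u \<le> - v then R' (- b) (- v) else 0) * ((- w) - (- v)) \<le> R (- b) (max (- w) u)"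
      using burk_piece_tangent[OF p u, of "- b" a "- v" "- w"] ap unfolding R_def R'_def by simp
    show ?thesis unfolding eq deq using 1 2 by (simp add: algebra_simps)
  qed
  consider "u > 0" | "u = 0" | "u < 0" by linarith
  then show ?thesis
  proof cases
    case 1 then show ?thesis by (rule pos)
  next
    case 2
    have "0 \<le> a" using ap p by (smt (verit) abs_ge_zero mult_nonneg_nonneg zero_le_mult_iff)
    then have "a * (\<bar>v\<bar> powr p + p * sgn v * \<bar>v\<bar> powr (p - 1) * (w - v)) \<le> a * \<bar>w\<bar> powr p"
      by (intro mult_left_mono abs_powr_tangent p)
    with 2 show ?thesis by (simp add: burk_def burk_deriv_def algebra_simps)
  next
    case 3
    have "burk p a b (- u) (- v) = burk p a b u v" "burk p a b (- u) (- w) = burk p a b u w"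
      "burk_deriv p a b (- u) (- v) = - burk_deriv p a b u v"
      by (auto simp: burk_def burk_deriv_def sgn_minus algebra_simps)
    with pos[of "- u" "- v" "- w"] 3 show ?thesis by (simp add: algebra_simps)
  qed
qed

text \<open>Growth of order \<open>p - 1\<close>: the product of this slope with an increment in
  \<open>L^p\<close> is then integrable.\<close>

lemma burk_deriv_bound:
  assumes "1 < p" "0 \<le> a" "0 \<le> b"
  shows "\<bar>burk_deriv p a b u v\<bar> \<le> (a * p + b * p) * max \<bar>u\<bar> \<bar>v\<bar> powr (p - 1)"
proof (cases "\<bar>u\<bar> \<le> \<bar>v\<bar>")
  case True
  have *: "\<bar>u\<bar> * \<bar>v\<bar> powr (p - 2) \<le> \<bar>v\<bar> powr (p - 1)"
  proof (cases "v = 0")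
    case False
    then have "\<bar>v\<bar> powr (p - 1) = \<bar>v\<bar> * \<bar>v\<bar> powr (p - 2)" using powr_add[of "\<bar>v\<bar>" 1 "p - 2"] by simp
    with True show ?thesis by (auto intro: mult_right_mono)
  qed auto
  have "\<bar>burk_deriv p a b u v\<bar> \<le> \<bar>a * p * sgn v * \<bar>v\<bar> powr (p - 1)\<bar> + \<bar>b * (p - 1) * u * \<bar>v\<bar> powr (p - 2)\<bar>"
    unfolding burk_deriv_def using True by (simp add: abs_triangle_ineq)
  also have "\<dots> \<le> a * p * \<bar>v\<bar> powr (p - 1) + b * p * (\<bar>u\<bar> * \<bar>v\<bar> powr (p - 2))"
    using assms by (intro add_mono) (auto simp: abs_mult sgn_if mult.assoc intro!: mult_mono mult_left_mono mult_nonneg_nonneg)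
  also have "\<dots> \<le> a * p * \<bar>v\<bar> powr (p - 1) + b * p * \<bar>v\<bar> powr (p - 1)"
    using * assms by (intro add_left_mono mult_left_mono) auto
  finally show ?thesis using True by (simp add: max_absorb2 algebra_simps)
next
  case False
  then have "\<bar>burk_deriv p a b u v\<bar> = b * \<bar>u\<bar> powr (p - 1)"
    using assms by (auto simp: burk_deriv_def abs_mult sgn_if)
  also have "\<dots> \<le> (a * p + b * p) * \<bar>u\<bar> powr (p - 1)"
    using assms mult_left_mono[of 1 p b] by (intro mult_right_mono) (auto simp: add_increasing)
  finally show ?thesis using False by (simp add: max_absorb1)
qed

lemma burk_bound:
  assumes "1 < p" "0 \<le> a" "0 \<le> b"
  shows "\<bar>burk p a b u v\<bar> \<le> (a + b) * max \<bar>u\<bar> \<bar>v\<bar> powr p"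
proof -
  define m where "m = max \<bar>u\<bar> \<bar>v\<bar>"
  have "\<bar>u\<bar> * \<bar>v\<bar> * m powr (p - 2) \<le> m powr p"
  proof (cases "m = 0")
    case False
    then have "m > 0" unfolding m_def by auto
    then have "m powr p = m * m * m powr (p - 2)"
      using powr_add[of m 2 "p - 2"] by (simp add: powr_numeral power2_eq_square)
    moreover have "\<bar>u\<bar> * \<bar>v\<bar> \<le> m * m" unfolding m_def by (intro mult_mono) auto
    ultimately show ?thesis by (auto intro: mult_right_mono)
  qed auto
  then have "b * (\<bar>u\<bar> * \<bar>v\<bar> * m powr (p - 2)) \<le> b * m powr p" using assms by (intro mult_left_mono)
  moreover have "\<bar>burk p a b u v\<bar> \<le> a * m powr p + b * (\<bar>u\<bar> * \<bar>v\<bar> * m powr (p - 2))"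
    unfolding burk_def m_def[symmetric] using assms
    by (intro order_trans[OF abs_triangle_ineq]) (simp add: abs_mult mult.assoc)
  ultimately show ?thesis by (simp add: m_def algebra_simps)
qed

text \<open>With \<open>u = x + y\<close> and \<open>v = x - y\<close>, \<open>- burk\<close> is Burkholder's function
  \<open>(\<bar>y\<bar> - c \<bar>x\<bar>) (\<bar>x\<bar> + \<bar>y\<bar>)\<^sup>p\<^sup>-\<^sup>1\<close>.\<close>

lemma burk_majorant:
  assumes p: "1 < p" and c: "1 \<le> c"
  shows "burk p ((c - 1) / 2) ((c + 1) / 2) (x + y) (x - y)
    \<le> c * (1 + 2 * c) powr (p - 1) * \<bar>x\<bar> powr p - \<bar>y\<bar> powr p / 2"
proof -
  define m where "m = \<bar>x\<bar> + \<bar>y\<bar>"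
  have m: "max \<bar>x + y\<bar> \<bar>x - y\<bar> = m" unfolding m_def by auto
  have "burk p ((c - 1) / 2) ((c + 1) / 2) (x + y) (x - y) = (c * \<bar>x\<bar> - \<bar>y\<bar>) * m powr (p - 1)"
  proof (cases "m = 0")
    case False
    then have m0: "m > 0" unfolding m_def by auto
    then have e: "m powr p = m * m * m powr (p - 2)" "m powr (p - 1) = m * m powr (p - 2)"
      using powr_add[of m 2 "p - 2"] powr_add[of m 1 "p - 2"] by (auto simp: powr_numeral power2_eq_square)
    have "(c - 1) / 2 * (m * m) + (c + 1) / 2 * ((x + y) * (x - y)) = (c * \<bar>x\<bar> - \<bar>y\<bar>) * m"
      unfolding m_def by (auto simp: field_simps abs_if)
    then have "((c - 1) / 2 * (m * m) + (c + 1) / 2 * ((x + y) * (x - y))) * m powr (p - 2) = (c * \<bar>x\<bar> - \<bar>y\<bar>) * m * m powr (p - 2)"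
      by (rule arg_cong)
    then show ?thesis unfolding burk_def m e by (simp add: distrib_right mult.assoc)
  qed (auto simp: burk_def m)
  also have "\<dots> \<le> c * (1 + 2 * c) powr (p - 1) * \<bar>x\<bar> powr p - \<bar>y\<bar> powr p / 2"
  \<comment> \<open>Beyond this threshold \<open>\<bar>y\<bar> - c * \<bar>x\<bar>\<close> is at
    least \<open>\<bar>y\<bar> / 2\<close>, which yields the negative term; below it
    \<open>m \<le> (1 + 2 * c) * \<bar>x\<bar>\<close>, which is the origin of the constant in front
    of \<open>\<bar>x\<bar> powr p\<close>.\<close>
  proof (cases "2 * c * \<bar>x\<bar> \<le> \<bar>y\<bar>")
    case True
    show ?thesis
    proof (cases "y = 0")
      case False
      have "\<bar>y\<bar> powr p / 2 = \<bar>y\<bar> / 2 * \<bar>y\<bar> powr (p - 1)" using False powr_add[of "\<bar>y\<bar>" 1 "p - 1"] by simp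
      also have "\<dots> \<le> (\<bar>y\<bar> - c * \<bar>x\<bar>) * m powr (p - 1)"
        using True p unfolding m_def by (intro mult_mono powr_mono2) auto
      finally have "(c * \<bar>x\<bar> - \<bar>y\<bar>) * m powr (p - 1) \<le> - (\<bar>y\<bar> powr p / 2)" by (simp add: algebra_simps)
      also have "\<dots> \<le> c * (1 + 2 * c) powr (p - 1) * \<bar>x\<bar> powr p - \<bar>y\<bar> powr p / 2" using c by simp
      finally show ?thesis .
    qed (use True c in \<open>auto simp: mult_le_0_iff\<close>)
  next
    case False
    have x: "\<bar>x\<bar> > 0" using False by (cases "x = 0") auto
    have e: "\<bar>x\<bar> powr p = \<bar>x\<bar> * \<bar>x\<bar> powr (p - 1)" using x powr_add[of "\<bar>x\<bar>" 1 "p - 1"] by simp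
    have "m powr (p - 1) \<le> ((1 + 2 * c) * \<bar>x\<bar>) powr (p - 1)"
      using False p unfolding m_def by (intro powr_mono2) (auto simp: algebra_simps)
    then have "c * \<bar>x\<bar> * m powr (p - 1) \<le> c * \<bar>x\<bar> * ((1 + 2 * c) powr (p - 1) * \<bar>x\<bar> powr (p - 1))"
      using c by (intro mult_left_mono) (auto simp: powr_mult)
    moreover have "\<bar>y\<bar> powr p / 2 \<le> \<bar>y\<bar> * m powr (p - 1)"
    proof (cases "y = 0")
      case False
      have "\<bar>y\<bar> powr p = \<bar>y\<bar> * \<bar>y\<bar> powr (p - 1)" using False powr_add[of "\<bar>y\<bar>" 1 "p - 1"] by simp
      also have "\<dots> \<le> \<bar>y\<bar> * m powr (p - 1)" unfolding m_def using p by (intro mult_left_mono powr_mono2) auto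
      finally show ?thesis using powr_ge_zero[of "\<bar>y\<bar>" p] by linarith
    qed auto
    ultimately show ?thesis unfolding e by (simp add: algebra_simps)
  qed
  finally show ?thesis .
qed

section \<open>General norms on a Euclidean space and their L^p classes\<close>

lemma norm_funD:
  assumes "is_norm_fun N"
  shows "0 \<le> N x" "N x = 0 \<longleftrightarrow> x = 0" "N (r *\<^sub>R x) = \<bar>r\<bar> * N x" "N (x + y) \<le> N x + N y"
  using assms unfolding is_norm_fun_def by auto

lemma norm_fun_sum:
  assumes N: "is_norm_fun N"
  shows "N (\<Sum>i\<in>I. f i) \<le> (\<Sum>i\<in>I. N (f i))"
proof (induction I rule: infinite_finite_induct)
  case (insert x F)
  then show ?case using norm_funD(4)[OF N, of "f x" "sum f F"] by simp
qed (use norm_funD(2)[OF N, of 0] in auto)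

lemma norm_fun_le_norm:
  fixes N :: "'x::euclidean_space \<Rightarrow> real"
  assumes N: "is_norm_fun N"
  obtains c where "0 < c" "\<And>x. N x \<le> c * norm x"
proof
  show "0 < (\<Sum>b\<in>Basis. N b) + (1::real)"
    by (intro add_nonneg_pos sum_nonneg norm_funD(1)[OF N]) auto
  show "N x \<le> ((\<Sum>b\<in>Basis. N b) + 1) * norm x" for x
  proof -
    have "N x = N (\<Sum>b\<in>Basis. (x \<bullet> b) *\<^sub>R b)" by (simp add: euclidean_representation)
    also have "\<dots> \<le> (\<Sum>b\<in>Basis. N ((x \<bullet> b) *\<^sub>R b))" by (rule norm_fun_sum[OF N])
    also have "\<dots> \<le> (\<Sum>b\<in>Basis. norm x * N b)"
      by (intro sum_mono) (simp add: norm_funD[OF N] Basis_le_norm mult_right_mono)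
    also have "\<dots> \<le> ((\<Sum>b\<in>Basis. N b) + 1) * norm x"
      by (simp only: sum_distrib_left[symmetric]) (simp add: algebra_simps)
    finally show ?thesis .
  qed
qed

lemma norm_fun_continuous:
  fixes N :: "'x::euclidean_space \<Rightarrow> real"
  assumes N: "is_norm_fun N"
  shows "continuous_on UNIV N"
proof -
  obtain c where c: "0 < c" "\<And>x. N x \<le> c * norm x" using norm_fun_le_norm[OF N] by blast
  have sym: "N (x - y) = N (y - x)" for x y using norm_funD(3)[OF N, of "-1" "x - y"] by simp
  have d: "\<bar>N x - N y\<bar> \<le> c * dist x y" for x y
    using norm_funD(4)[OF N, of "x - y" y] norm_funD(4)[OF N, of "y - x" x] c(2)[of "x - y"] sym[of x y]
    by (simp add: dist_norm abs_le_iff)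
  have "c-lipschitz_on UNIV N" using d c(1) by (intro lipschitz_onI) (auto simp: dist_real_def)
  then show ?thesis by (rule lipschitz_on_continuous_on)
qed

lemma norm_fun_measurable:
  fixes N :: "'x::euclidean_space \<Rightarrow> real"
  assumes N: "is_norm_fun N"
  shows "N \<in> borel_measurable borel"
  using norm_fun_continuous[OF N] by (rule borel_measurable_continuous_onI)

lemma norm_le_norm_fun:
  fixes N :: "'x::euclidean_space \<Rightarrow> real"
  assumes N: "is_norm_fun N"
  obtains c where "0 < c" "\<And>x. norm x \<le> c * N x"
proof -
  have "\<exists>x\<in>sphere 0 1. \<forall>y\<in>sphere 0 (1::real). N x \<le> N (y :: 'x)"
    using norm_fun_continuous[OF N] by (intro continuous_attains_inf) (auto intro: continuous_on_subset)
  then obtain z where z: "norm z = 1" "\<And>y. norm y = 1 \<Longrightarrow> N z \<le> N y" by (auto simp: dist_norm)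
  have z0: "0 < N z" using norm_funD(1,2)[OF N, of z] z(1) by (auto simp: order_less_le)
  show ?thesis
  proof
    show "norm x \<le> 1 / N z * N x" for x
    proof (cases "x = 0")
      case False
      have "N z \<le> N ((1 / norm x) *\<^sub>R x)" using False by (intro z(2)) simp
      also have "\<dots> = N x / norm x" using False by (simp only: norm_funD(3)[OF N]) simp
      finally show ?thesis using z0 False by (simp add: field_simps)
    qed (simp add: norm_funD[OF N])
  qed (use z0 in auto)
qed

lemma is_norm_fun_abs: "is_norm_fun (abs :: real \<Rightarrow> real)"
  unfolding is_norm_fun_def by (auto simp: abs_mult)

lemma Lp_add:
  fixes N :: "'x::euclidean_space \<Rightarrow> real"
  assumes N: "is_norm_fun N" and p: "0 < p"
    and [measurable]: "f \<in> borel_measurable M" "g \<in> borel_measurable M"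
    and "integrable M (\<lambda>\<omega>. N (f \<omega>) powr p)" "integrable M (\<lambda>\<omega>. N (g \<omega>) powr p)"
  shows "integrable M (\<lambda>\<omega>. N (f \<omega> + g \<omega>) powr p)"
proof (rule Bochner_Integration.integrable_bound)
  have [measurable]: "N \<in> borel_measurable borel" by (rule norm_fun_measurable[OF N])
  show "(\<lambda>\<omega>. N (f \<omega> + g \<omega>) powr p) \<in> borel_measurable M" by measurable
  show "integrable M (\<lambda>\<omega>. 2 powr p * (N (f \<omega>) powr p + N (g \<omega>) powr p))" using assms by simp
  show "AE \<omega> in M. norm (N (f \<omega> + g \<omega>) powr p) \<le> norm (2 powr p * (N (f \<omega>) powr p + N (g \<omega>) powr p))"
  proof (rule AE_I2)
    fix \<omega>
    have "N (f \<omega> + g \<omega>) powr p \<le> (N (f \<omega>) + N (g \<omega>)) powr p"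
      using p by (intro powr_mono2 norm_funD[OF N]) auto
    also have "\<dots> \<le> 2 powr p * (N (f \<omega>) powr p + N (g \<omega>) powr p)"
      using p by (intro powr_add_le_two_powr norm_funD[OF N])
    finally show "norm (N (f \<omega> + g \<omega>) powr p) \<le> norm (2 powr p * (N (f \<omega>) powr p + N (g \<omega>) powr p))" by simp
  qed
qed

lemma Lp_scale:
  assumes N: "is_norm_fun N" and "integrable M (\<lambda>\<omega>. N (f \<omega>) powr p)"
  shows "integrable M (\<lambda>\<omega>. N (r *\<^sub>R f \<omega>) powr p)"
  using assms(2) by (simp add: norm_funD[OF N] powr_mult)

lemma Lp_sum:
  fixes N :: "'x::euclidean_space \<Rightarrow> real"
  assumes N: "is_norm_fun N" and p: "0 < p"
    and "\<And>i. i \<in> I \<Longrightarrow> f i \<in> borel_measurable M"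
    and "\<And>i. i \<in> I \<Longrightarrow> integrable M (\<lambda>\<omega>. N (f i \<omega>) powr p)"
  shows "integrable M (\<lambda>\<omega>. N (\<Sum>i\<in>I. f i \<omega>) powr p)"
  using assms(3,4)
proof (induction I rule: infinite_finite_induct)
  case (insert x F)
  have "integrable M (\<lambda>\<omega>. N (f x \<omega> + (\<Sum>i\<in>F. f i \<omega>)) powr p)"
    using insert by (intro Lp_add[OF N p]) auto
  then show ?case using insert by simp
qed (use norm_funD(2)[OF N, of 0] in auto)

text \<open>The hypotheses inside \<open>umd_const\<close>, over an arbitrary sample space instead
  of \<open>real\<close>. Orthogonality to the past starts at index 2, so the first difference need
  not be centred.\<close>

definition mds :: "'a measure \<Rightarrow> (nat \<Rightarrow> 'a measure) \<Rightarrow> real \<Rightarrow> ('x::euclidean_space \<Rightarrow> real) \<Rightarrow> (nat \<Rightarrow> 'a \<Rightarrow> 'x) \<Rightarrow> nat \<Rightarrow> bool" where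
  "mds P G p N d n \<longleftrightarrow> prob_space P \<and> (\<forall>j. subalgebra P (G j)) \<and> (\<forall>i j. i \<le> j \<longrightarrow> sets (G i) \<subseteq> sets (G j))
     \<and> (\<forall>j\<in>{1..n}. d j \<in> borel_measurable (G j) \<and> integrable P (d j) \<and> integrable P (\<lambda>\<omega>. N (d j \<omega>) powr p))
     \<and> (\<forall>j\<in>{2..n}. \<forall>A\<in>sets (G (j - 1)). (\<integral>\<omega>. indicator A \<omega> *\<^sub>R d j \<omega> \<partial>P) = 0)"

lemma umd_const_eq:
  "umd_const p N = Inf {\<beta>. \<forall>(P::real measure) G d n \<epsilon>. mds P G p N d n \<and> (\<forall>j. \<bar>\<epsilon> j\<bar> = 1) \<longrightarrow>
     (\<integral>\<omega>. N (\<Sum>j=1..n. \<epsilon> j *\<^sub>R d j \<omega>) powr p \<partial>P) powr (1 / p)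
       \<le> \<beta> * (\<integral>\<omega>. N (\<Sum>j=1..n. d j \<omega>) powr p \<partial>P) powr (1 / p)}"
  unfolding umd_const_def mds_def by (simp only: conj_assoc)

lemma mdsD:
  assumes "mds P G p N d n"
  shows "prob_space P" "subalgebra P (G j)" "i \<le> j \<Longrightarrow> sets (G i) \<subseteq> sets (G j)"
    "1 \<le> j \<Longrightarrow> j \<le> n \<Longrightarrow> d j \<in> borel_measurable (G j)"
    "1 \<le> j \<Longrightarrow> j \<le> n \<Longrightarrow> d j \<in> borel_measurable P"
    "1 \<le> j \<Longrightarrow> j \<le> n \<Longrightarrow> integrable P (d j)"
    "1 \<le> j \<Longrightarrow> j \<le> n \<Longrightarrow> integrable P (\<lambda>\<omega>. N (d j \<omega>) powr p)"
    "2 \<le> j \<Longrightarrow> j \<le> n \<Longrightarrow> A \<in> sets (G (j - 1)) \<Longrightarrow> (\<integral>\<omega>. indicator A \<omega> *\<^sub>R d j \<omega> \<partial>P) = 0"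
proof -
  show "subalgebra P (G j)" for j using assms unfolding mds_def by blast
  then show "1 \<le> j \<Longrightarrow> j \<le> n \<Longrightarrow> d j \<in> borel_measurable P"
    using assms unfolding mds_def by (meson atLeastAtMost_iff measurable_from_subalg)
qed (use assms in \<open>auto simp: mds_def\<close>)

text \<open>Testing \<open>h\<close> against the sets of \<open>G\<close> says that its conditional
  expectation is 0. Integrability of the product is what allows a possibly unbounded
  \<open>D\<close> to be pulled out.\<close>

lemma integral_mult_orthogonal:
  fixes D h :: "'a \<Rightarrow> real"
  assumes "prob_space P" and sub: "subalgebra P G" and D: "D \<in> borel_measurable G"
    and h: "integrable P h" and 0: "\<And>A. A \<in> sets G \<Longrightarrow> (\<integral>\<omega>. indicator A \<omega> * h \<omega> \<partial>P) = 0"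
    and Dh: "integrable P (\<lambda>\<omega>. D \<omega> * h \<omega>)"
  shows "(\<integral>\<omega>. D \<omega> * h \<omega> \<partial>P) = 0"
proof -
  interpret P: prob_space P by fact
  interpret sigma_finite_subalgebra P G
    by (intro finite_measure_subalgebra_is_sigma_finite finite_measure_subalgebra.intro
        finite_measure_subalgebra_axioms.intro P.finite_measure_axioms sub)
  have "AE x in P. real_cond_exp P G h x = 0"
    by (rule real_cond_exp_charact) (use h 0 in \<open>auto simp: set_lebesgue_integral_def\<close>)
  then have "(\<integral>\<omega>. D \<omega> * real_cond_exp P G h \<omega> \<partial>P) = (\<integral>\<omega>. 0 \<partial>P)"
    using measurable_from_subalg[OF sub D] by (intro integral_cong_AE) (auto simp: borel_measurable_cond_exp2)
  then show ?thesis using real_cond_exp_intg(2)[OF Dh D] h by simp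
qed

text \<open>In each step only one zigzag coordinate moves, and the tangent term \<open>D * h\<close>
  in that coordinate integrates to 0. Hence the expectation of \<open>burk\<close> does not
  decrease; it starts nonnegative, and \<open>burk_majorant\<close> converts its sign at time
  \<open>n\<close> into the inequality. The condition on \<open>c\<close> is that of
  \<open>burk_tangent\<close> for \<open>a = (c - 1) / 2\<close> and
  \<open>b = (c + 1) / 2\<close>.\<close>

lemma burkholder_scalar:
  fixes d :: "nat \<Rightarrow> 'a \<Rightarrow> real"
  assumes p: "1 < p" and mds: "mds P G p abs d n" and \<epsilon>: "\<And>j. \<bar>\<epsilon> j\<bar> = 1"
    and c: "1 \<le> c" "(c + 1) * \<bar>p - 2\<bar> \<le> (c - 1) * p"
  shows "(\<integral>\<omega>. \<bar>\<Sum>j=1..n. \<epsilon> j * d j \<omega>\<bar> powr p \<partial>P)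
    \<le> 2 * c * (1 + 2 * c) powr (p - 1) * (\<integral>\<omega>. \<bar>\<Sum>j=1..n. d j \<omega>\<bar> powr p \<partial>P)"
proof (cases "n = 0")
  case False
  interpret prob_space P by (rule mdsD(1)[OF mds])
  define a where "a = (c - 1) / 2"
  define b where "b = (c + 1) / 2"
  have ab: "0 \<le> a" "0 \<le> b" "\<bar>b\<bar> * \<bar>p - 2\<bar> \<le> a * p" using c unfolding a_def b_def by auto
  define f where "f k \<omega> = (\<Sum>j=1..k. d j \<omega>)" for k \<omega>
  define g where "g k \<omega> = (\<Sum>j=1..k. \<epsilon> j * d j \<omega>)" for k \<omega>
  have dm: "d j \<in> borel_measurable (G k)" if "1 \<le> j" "j \<le> k" "k \<le> n" for j k
  proof -
    have "subalgebra (G k) (G j)"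
      using mdsD(2,3)[OF mds] that unfolding subalgebra_def by auto
    then show ?thesis using mdsD(4)[OF mds, of j] that by (auto intro: measurable_from_subalg)
  qed
  have fm: "f k \<in> borel_measurable (G k)" "g k \<in> borel_measurable (G k)" if "k \<le> n" for k
    unfolding f_def g_def using dm that by (auto intro!: borel_measurable_sum borel_measurable_times)
  have [measurable]: "f k \<in> borel_measurable P" "g k \<in> borel_measurable P" if "k \<le> n" for k
    using fm[OF that] mdsD(2)[OF mds] by (auto intro: measurable_from_subalg)
  have p0: "0 < p" using p by simp
  have fL: "integrable P (\<lambda>\<omega>. \<bar>f k \<omega>\<bar> powr p)" "integrable P (\<lambda>\<omega>. \<bar>g k \<omega>\<bar> powr p)" if "k \<le> n" for k
    unfolding f_def g_def using that mdsD(5,7)[OF mds]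
    by (auto intro!: Lp_sum[OF is_norm_fun_abs p0] Lp_scale[OF is_norm_fun_abs, where f = "d _", simplified])
  have gpm: "integrable P (\<lambda>\<omega>. \<bar>f k \<omega> + g k \<omega>\<bar> powr p)" "integrable P (\<lambda>\<omega>. \<bar>f k \<omega> - g k \<omega>\<bar> powr p)" if "k \<le> n" for k
    using Lp_add[OF is_norm_fun_abs p0 _ _ fL[OF that]] that
      Lp_add[OF is_norm_fun_abs p0 _ _ fL(1)[OF that], of "\<lambda>\<omega>. - g k \<omega>"] fL(2)[OF that] by auto
  define S where "S k \<omega> = \<bar>f k \<omega> + g k \<omega>\<bar> powr p + \<bar>f k \<omega> - g k \<omega>\<bar> powr p" for k \<omega>
  have S: "integrable P (S k)" if "k \<le> n" for k
    unfolding S_def using gpm[OF that] by auto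
  have maxS: "max \<bar>f k \<omega> + g k \<omega>\<bar> \<bar>f k \<omega> - g k \<omega>\<bar> powr p \<le> S k \<omega>" for k \<omega>
    unfolding S_def max_def by auto
  have burkm [measurable]: "(\<lambda>\<omega>. burk p a b (f k \<omega> + g k \<omega>) (f k \<omega> - g k \<omega>)) \<in> borel_measurable P" if "k \<le> n" for k
    unfolding burk_def using that by measurable
  have Z: "integrable P (\<lambda>\<omega>. burk p a b (f k \<omega> + g k \<omega>) (f k \<omega> - g k \<omega>))" if "k \<le> n" for k
  proof (rule Bochner_Integration.integrable_bound[OF _ burkm[OF that]])
    show "integrable P (\<lambda>\<omega>. (a + b) * S k \<omega>)" using S[OF that] by simp
    show "AE \<omega> in P. norm (burk p a b (f k \<omega> + g k \<omega>) (f k \<omega> - g k \<omega>)) \<le> norm ((a + b) * S k \<omega>)"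
    proof (rule AE_I2)
      fix \<omega>
      have "\<bar>burk p a b (f k \<omega> + g k \<omega>) (f k \<omega> - g k \<omega>)\<bar> \<le> (a + b) * max \<bar>f k \<omega> + g k \<omega>\<bar> \<bar>f k \<omega> - g k \<omega>\<bar> powr p"
        by (rule burk_bound) (use p ab in auto)
      also have "\<dots> \<le> (a + b) * S k \<omega>" using maxS[of k \<omega>] ab by (intro mult_left_mono) auto
      finally show "norm (burk p a b (f k \<omega> + g k \<omega>) (f k \<omega> - g k \<omega>)) \<le> norm ((a + b) * S k \<omega>)" by simp
    qed
  qed
  have comm: "burk p a b u v = burk p a b v u" for u v by (simp add: burk_def max.commute mult_ac)
  have key: "0 \<le> (\<integral>\<omega>. burk p a b (f k \<omega> + g k \<omega>) (f k \<omega> - g k \<omega>) \<partial>P)" if "1 \<le> k" "k \<le> n" for k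
    using that
  proof (induction k rule: dec_induct)
    \<comment> \<open>At time 1 one has
      \<open>\<bar>g 1 \<omega>\<bar> = \<bar>f 1 \<omega>\<bar>\<close>, so one coordinate vanishes
      and only the term with \<open>a\<close> survives. Starting here leaves the first difference
      free of any centring.\<close>
    case base
    have "0 \<le> burk p a b (f 1 \<omega> + g 1 \<omega>) (f 1 \<omega> - g 1 \<omega>)" for \<omega>
      using \<epsilon>[of 1] ab by (auto simp: f_def g_def burk_def abs_if split: if_splits)
    then show ?case by (simp add: integral_nonneg_AE)
  next
    case (step k)
    define e where "e = \<epsilon> (Suc k)"
    have e: "e = 1 \<or> e = - 1" using \<epsilon>[of "Suc k"] unfolding e_def by linarith
    \<comment> \<open>For \<open>e = 1\<close> the coordinate \<open>f + g\<close> moves by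
      \<open>2 * d\<close> and \<open>f - g\<close> stays; for \<open>e = - 1\<close> it is the
      reverse. Since \<open>burk\<close> is symmetric, the slope in the last argument serves both
      cases.\<close>
    define D where "D \<omega> = (if e = 1 then burk_deriv p a b (f k \<omega> - g k \<omega>) (f k \<omega> + g k \<omega>)
      else burk_deriv p a b (f k \<omega> + g k \<omega>) (f k \<omega> - g k \<omega>))" for \<omega>
    define h where "h \<omega> = 2 * d (Suc k) \<omega>" for \<omega>
    have fS: "f (Suc k) \<omega> = f k \<omega> + d (Suc k) \<omega>" "g (Suc k) \<omega> = g k \<omega> + e * d (Suc k) \<omega>" for \<omega>
      by (simp_all add: f_def g_def e_def)
    have le: "burk p a b (f k \<omega> + g k \<omega>) (f k \<omega> - g k \<omega>) + D \<omega> * h \<omega>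
        \<le> burk p a b (f (Suc k) \<omega> + g (Suc k) \<omega>) (f (Suc k) \<omega> - g (Suc k) \<omega>)" for \<omega>
    proof (cases "e = 1")
      case True
      then show ?thesis
        using burk_tangent[OF p ab(3), of "f k \<omega> - g k \<omega>" "f k \<omega> + g k \<omega>" "f (Suc k) \<omega> + g (Suc k) \<omega>"]
        by (simp add: fS D_def h_def comm[of "f k \<omega> - g k \<omega>"] algebra_simps)
    next
      case False
      with e have e1: "e = - 1" by simp
      then show ?thesis
        using burk_tangent[OF p ab(3), of "f k \<omega> + g k \<omega>" "f k \<omega> - g k \<omega>" "f (Suc k) \<omega> - g (Suc k) \<omega>"]
        by (simp add: fS D_def h_def algebra_simps)
    qed
    have [measurable]: "f k \<in> borel_measurable (G k)" "g k \<in> borel_measurable (G k)"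
      using fm step by auto
    have Dm: "D \<in> borel_measurable (G k)" unfolding D_def burk_deriv_def by measurable
    have dm': "d (Suc k) \<in> borel_measurable P" using mdsD(5)[OF mds, of "Suc k"] step by auto
    have [measurable]: "D \<in> borel_measurable P" "h \<in> borel_measurable P"
      unfolding h_def using measurable_from_subalg[OF mdsD(2)[OF mds] Dm] dm' by auto
    have Dh: "integrable P (\<lambda>\<omega>. D \<omega> * h \<omega>)"
    proof (rule Bochner_Integration.integrable_bound)
      show "integrable P (\<lambda>\<omega>. (a * p + b * p) * (S k \<omega> + \<bar>h \<omega>\<bar> powr p))"
        using S[of k] step mdsD(7)[OF mds, of "Suc k"]
        unfolding h_def by (auto simp: abs_mult powr_mult)
      show "(\<lambda>\<omega>. D \<omega> * h \<omega>) \<in> borel_measurable P" by measurable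
      show "AE \<omega> in P. norm (D \<omega> * h \<omega>) \<le> norm ((a * p + b * p) * (S k \<omega> + \<bar>h \<omega>\<bar> powr p))"
      proof (rule AE_I2)
        fix \<omega>
        define m where "m = max \<bar>f k \<omega> + g k \<omega>\<bar> \<bar>f k \<omega> - g k \<omega>\<bar>"
        have m0: "0 \<le> m" unfolding m_def by auto
        have "\<bar>D \<omega>\<bar> \<le> (a * p + b * p) * m powr (p - 1)"
          unfolding D_def m_def using burk_deriv_bound[OF p ab(1,2), of "f k \<omega> - g k \<omega>" "f k \<omega> + g k \<omega>"]
            burk_deriv_bound[OF p ab(1,2), of "f k \<omega> + g k \<omega>" "f k \<omega> - g k \<omega>"]
          by (auto simp: max.commute)
        then have "\<bar>D \<omega> * h \<omega>\<bar> \<le> (a * p + b * p) * m powr (p - 1) * \<bar>h \<omega>\<bar>"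
          by (simp add: abs_mult mult_right_mono)
        \<comment> \<open>A crude Young inequality, by comparing
          \<open>\<bar>h \<omega>\<bar>\<close> with \<open>m\<close>.\<close>
        also have "m powr (p - 1) * \<bar>h \<omega>\<bar> \<le> m powr p + \<bar>h \<omega>\<bar> powr p"
        proof (cases "\<bar>h \<omega>\<bar> \<le> m")
          case True
          have "m powr (p - 1) * \<bar>h \<omega>\<bar> \<le> m powr (p - 1) * m" using True by (intro mult_left_mono) auto
          also have "\<dots> = m powr p" using m0 by (simp add: powr_mult_base mult.commute)
          finally show ?thesis by (simp add: add_increasing2)
        next
          case False
          have "m powr (p - 1) * \<bar>h \<omega>\<bar> \<le> \<bar>h \<omega>\<bar> powr (p - 1) * \<bar>h \<omega>\<bar>"
            using False m0 p by (intro mult_right_mono powr_mono2) auto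
          also have "\<dots> = \<bar>h \<omega>\<bar> powr p" by (simp add: powr_mult_base mult.commute)
          finally show ?thesis by (simp add: add_increasing)
        qed
        then have "(a * p + b * p) * m powr (p - 1) * \<bar>h \<omega>\<bar> \<le> (a * p + b * p) * (m powr p + \<bar>h \<omega>\<bar> powr p)"
          unfolding mult.assoc using ab p by (intro mult_left_mono) auto
        also have "\<dots> \<le> (a * p + b * p) * (S k \<omega> + \<bar>h \<omega>\<bar> powr p)"
          using maxS[of k \<omega>] ab p unfolding m_def by (intro mult_left_mono) auto
        finally show "norm (D \<omega> * h \<omega>) \<le> norm ((a * p + b * p) * (S k \<omega> + \<bar>h \<omega>\<bar> powr p))" by simp
      qed
    qed
    have "(\<integral>\<omega>. D \<omega> * h \<omega> \<partial>P) = 0"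
    proof (rule integral_mult_orthogonal[OF mdsD(1,2)[OF mds] Dm _ _ Dh])
      show "integrable P h" unfolding h_def using mdsD(6)[OF mds, of "Suc k"] step by auto
      fix A assume "A \<in> sets (G k)"
      then have "(\<integral>\<omega>. indicator A \<omega> * d (Suc k) \<omega> \<partial>P) = 0"
        using mdsD(8)[OF mds, of "Suc k" A] step by simp
      then show "(\<integral>\<omega>. indicator A \<omega> * h \<omega> \<partial>P) = 0"
        unfolding h_def by (simp add: mult.left_commute[of _ 2])
    qed
    then have "(\<integral>\<omega>. burk p a b (f k \<omega> + g k \<omega>) (f k \<omega> - g k \<omega>) \<partial>P)
       = (\<integral>\<omega>. burk p a b (f k \<omega> + g k \<omega>) (f k \<omega> - g k \<omega>) + D \<omega> * h \<omega> \<partial>P)"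
      using Z[of k] Dh step by simp
    also have "\<dots> \<le> (\<integral>\<omega>. burk p a b (f (Suc k) \<omega> + g (Suc k) \<omega>) (f (Suc k) \<omega> - g (Suc k) \<omega>) \<partial>P)"
      using Z[of k] Z[of "Suc k"] Dh step le by (intro integral_mono) auto
    finally show ?case using step by simp
  qed
  have "0 \<le> (\<integral>\<omega>. burk p a b (f n \<omega> + g n \<omega>) (f n \<omega> - g n \<omega>) \<partial>P)"
    using key[of n] False by auto
  also have "\<dots> \<le> (\<integral>\<omega>. c * (1 + 2 * c) powr (p - 1) * \<bar>f n \<omega>\<bar> powr p - \<bar>g n \<omega>\<bar> powr p / 2 \<partial>P)"
    using Z[of n] fL[of n] burk_majorant[OF p c(1)] unfolding a_def b_def
    by (intro integral_mono) auto
  also have "\<dots> = c * (1 + 2 * c) powr (p - 1) * (\<integral>\<omega>. \<bar>f n \<omega>\<bar> powr p \<partial>P) - (\<integral>\<omega>. \<bar>g n \<omega>\<bar> powr p \<partial>P) / 2"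
    using fL[of n] by simp
  finally show ?thesis unfolding f_def g_def by simp
qed simp

section \<open>Finiteness of the UMD constant\<close>

lemma sum_powr_le:
  fixes a :: "'b \<Rightarrow> real"
  assumes "finite S" "\<And>i. i \<in> S \<Longrightarrow> 0 \<le> a i" "0 < p"
  shows "(\<Sum>i\<in>S. a i) powr p \<le> real (card S) powr p * (\<Sum>i\<in>S. a i powr p)"
proof (cases "S = {}")
  case False
  define m where "m = Max (a ` S)"
  have m: "m \<in> a ` S" "\<And>i. i \<in> S \<Longrightarrow> a i \<le> m" using assms False unfolding m_def by auto
  then obtain k where k: "k \<in> S" "m = a k" by auto
  have "(\<Sum>i\<in>S. a i) \<le> real (card S) * m" using m(2) by (rule sum_bounded_above)
  then have "(\<Sum>i\<in>S. a i) powr p \<le> (real (card S) * m) powr p"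
    using assms by (intro powr_mono2) (auto intro: sum_nonneg)
  also have "\<dots> = real (card S) powr p * a k powr p" using k assms by (simp add: powr_mult)
  also have "\<dots> \<le> real (card S) powr p * (\<Sum>i\<in>S. a i powr p)"
    using k assms by (intro mult_left_mono member_le_sum) auto
  finally show ?thesis .
qed simp

text \<open>The set of admissible constants with the type of the sample space left open;
  \<open>umd_const\<close> is the infimum in the case of \<open>real\<close>.\<close>

definition umd_set :: "'a itself \<Rightarrow> real \<Rightarrow> ('x::euclidean_space \<Rightarrow> real) \<Rightarrow> real set" where
  "umd_set _ p N = {\<beta>. \<forall>(P::'a measure) G d n \<epsilon>. mds P G p N d n \<and> (\<forall>j. \<bar>\<epsilon> j\<bar> = 1) \<longrightarrow>
     (\<integral>\<omega>. N (\<Sum>j=1..n. \<epsilon> j *\<^sub>R d j \<omega>) powr p \<partial>P) powr (1 / p)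
       \<le> \<beta> * (\<integral>\<omega>. N (\<Sum>j=1..n. d j \<omega>) powr p \<partial>P) powr (1 / p)}"

text \<open>Equivalence of norms reduces the claim to the coordinates, at the price of
  \<open>c1\<close>, \<open>c2\<close> and powers of the dimension in \<open>K\<close>. Only
  finiteness matters here, not the size.\<close>

lemma umd_set_nonempty:
  fixes N :: "'x::euclidean_space \<Rightarrow> real"
  assumes N: "is_norm_fun N" and p: "1 < p"
  shows "umd_set TYPE('a) p N \<noteq> {}"
proof -
  obtain c1 where c1: "0 < c1" "\<And>x. N x \<le> c1 * norm x" using norm_fun_le_norm[OF N] by blast
  obtain c2 where c2: "0 < c2" "\<And>x. norm x \<le> c2 * N x" using norm_le_norm_fun[OF N] by blast
  have [measurable]: "N \<in> borel_measurable borel" by (rule norm_fun_measurable[OF N])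
  have p0: "0 < p" using p by simp
  \<comment> \<open>The second condition below means \<open>c \<ge> p - 1\<close> for
    \<open>p \<ge> 2\<close> and \<open>c * (p - 1) \<ge> 1\<close> for \<open>p < 2\<close>. The
    sum dominates both values, and it is at least 1.\<close>
  define c where "c = p + 1 / (p - 1)"
  have c: "1 \<le> c" "(c + 1) * \<bar>p - 2\<bar> \<le> (c - 1) * p"
  proof -
    have "0 < 1 / (p - 1)" using p by simp
    then show "1 \<le> c" using p unfolding c_def by linarith
    show "(c + 1) * \<bar>p - 2\<bar> \<le> (c - 1) * p"
    proof (cases "2 \<le> p")
      case True
      then have "(c + 1) * \<bar>p - 2\<bar> - (c - 1) * p = 2 * (p - 1 - c)" by (simp add: algebra_simps)
      also have "p \<le> c" using \<open>0 < 1 / (p - 1)\<close> unfolding c_def by simp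
      then have "2 * (p - 1 - c) \<le> 0" by simp
      finally show ?thesis by simp
    next
      case False
      then have "(c - 1) * p - (c + 1) * \<bar>p - 2\<bar> = 2 * (c * (p - 1) - 1)" by (simp add: algebra_simps)
      also have "c * (p - 1) = p * (p - 1) + 1" using p by (simp add: c_def field_simps)
      finally have "(c - 1) * p - (c + 1) * \<bar>p - 2\<bar> = 2 * (p * (p - 1))" by simp
      moreover have "0 \<le> p * (p - 1)" using p by simp
      ultimately show ?thesis by linarith
    qed
  qed
  define C where "C = 2 * c * (1 + 2 * c) powr (p - 1)"
  have C: "0 \<le> C" using c unfolding C_def by simp
  define K where "K = c1 powr p * real DIM('x) powr p * C * real DIM('x) * c2 powr p"
  have K: "0 \<le> K" using C unfolding K_def by simp
  have main: "(\<integral>\<omega>. N (\<Sum>j=1..n. \<epsilon> j *\<^sub>R d j \<omega>) powr p \<partial>P) \<le> K * (\<integral>\<omega>. N (\<Sum>j=1..n. d j \<omega>) powr p \<partial>P)"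
    if mds: "mds P G p N d n" and \<epsilon>: "\<And>j. \<bar>\<epsilon> j\<bar> = 1"
    for P :: "'a measure" and G d n and \<epsilon> :: "nat \<Rightarrow> real"
  proof -
    note dm [measurable] = mdsD(5)[OF mds]
    define g where "g \<omega> = (\<Sum>j=1..n. \<epsilon> j *\<^sub>R d j \<omega>)" for \<omega>
    define f where "f \<omega> = (\<Sum>j=1..n. d j \<omega>)" for \<omega>
    have fgm [measurable]: "f \<in> borel_measurable P" "g \<in> borel_measurable P"
      unfolding f_def g_def using dm by (auto intro!: borel_measurable_sum borel_measurable_scaleR)
    have fL: "integrable P (\<lambda>\<omega>. N (f \<omega>) powr p)"
      unfolding f_def using dm mdsD(7)[OF mds] by (auto intro!: Lp_sum[OF N p0])
    have cb: "\<bar>x \<bullet> b\<bar> powr p \<le> c2 powr p * N x powr p" if "b \<in> Basis" for b x :: 'x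
    proof -
      have "\<bar>x \<bullet> b\<bar> \<le> c2 * N x" using Basis_le_norm[OF that, of x] c2(2)[of x] by simp
      then show ?thesis using p c2 norm_funD(1)[OF N, of x]
        by (simp flip: powr_mult) (intro powr_mono2, auto)
    qed
    have cLp: "integrable P (\<lambda>\<omega>. \<bar>h \<omega> \<bullet> b\<bar> powr p)"
      if "b \<in> Basis" "h \<in> borel_measurable P" "integrable P (\<lambda>\<omega>. N (h \<omega>) powr p)" for b and h :: "'a \<Rightarrow> 'x"
    proof (rule Bochner_Integration.integrable_bound)
      show "integrable P (\<lambda>\<omega>. c2 powr p * N (h \<omega>) powr p)" using that by simp
      show "(\<lambda>\<omega>. \<bar>h \<omega> \<bullet> b\<bar> powr p) \<in> borel_measurable P" using that(2) by measurable
      show "AE \<omega> in P. norm (\<bar>h \<omega> \<bullet> b\<bar> powr p) \<le> norm (c2 powr p * N (h \<omega>) powr p)"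
        using cb[OF that(1)] by auto
    qed
    have cm: "mds P G p abs (\<lambda>j \<omega>. d j \<omega> \<bullet> b) n" if b: "b \<in> Basis" for b
      unfolding mds_def
    proof (intro conjI ballI allI impI)
      fix j assume "j \<in> {1..n}"
      then have j: "1 \<le> j" "j \<le> n" by auto
      show "(\<lambda>\<omega>. d j \<omega> \<bullet> b) \<in> borel_measurable (G j)" using mdsD(4)[OF mds j] by measurable
      show "integrable P (\<lambda>\<omega>. d j \<omega> \<bullet> b)" using mdsD(6)[OF mds j] by simp
      show "integrable P (\<lambda>\<omega>. \<bar>d j \<omega> \<bullet> b\<bar> powr p)" using cLp[OF b] mdsD(5,7)[OF mds j] by auto
    next
      fix j A assume j: "j \<in> {2..n}" and A: "A \<in> sets (G (j - 1))"
      then have Am: "A \<in> sets P" using mdsD(2)[OF mds, of "j - 1"] unfolding subalgebra_def by auto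
      have "integrable P (\<lambda>\<omega>. indicator A \<omega> *\<^sub>R d j \<omega>)"
        using mdsD(6)[OF mds, of j] j Am by (intro integrable_mult_indicator) auto
      then have "(\<integral>\<omega>. (indicator A \<omega> *\<^sub>R d j \<omega>) \<bullet> b \<partial>P) = (\<integral>\<omega>. indicator A \<omega> *\<^sub>R d j \<omega> \<partial>P) \<bullet> b"
        by (intro integral_inner_left)
      also have "\<dots> = 0" using mdsD(8)[OF mds, of j A] j A by simp
      finally show "(\<integral>\<omega>. indicator A \<omega> *\<^sub>R (d j \<omega> \<bullet> b) \<partial>P) = 0" by simp
    qed (use mdsD(1,2,3)[OF mds] in auto)
    have gc: "N (g \<omega>) powr p \<le> c1 powr p * (real DIM('x) powr p * (\<Sum>b\<in>Basis. \<bar>g \<omega> \<bullet> b\<bar> powr p))" for \<omega>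
    proof -
      have "N (g \<omega>) powr p \<le> (c1 * (\<Sum>b\<in>Basis. \<bar>g \<omega> \<bullet> b\<bar>)) powr p"
        using c1(1) p by (intro powr_mono2 norm_funD[OF N] order_trans[OF c1(2)] mult_left_mono norm_le_l1) auto
      also have "\<dots> = c1 powr p * (\<Sum>b\<in>Basis. \<bar>g \<omega> \<bullet> b\<bar>) powr p" using c1 by (simp add: powr_mult sum_nonneg)
      also have "\<dots> \<le> c1 powr p * (real DIM('x) powr p * (\<Sum>b\<in>Basis. \<bar>g \<omega> \<bullet> b\<bar> powr p))"
        using p by (intro mult_left_mono sum_powr_le) auto
      finally show ?thesis .
    qed
    have gL: "integrable P (\<lambda>\<omega>. N (g \<omega>) powr p)"
      unfolding g_def using dm mdsD(7)[OF mds] by (auto intro!: Lp_sum[OF N p0] Lp_scale[OF N] borel_measurable_scaleR)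
    have "(\<integral>\<omega>. N (g \<omega>) powr p \<partial>P) \<le> (\<integral>\<omega>. c1 powr p * (real DIM('x) powr p * (\<Sum>b\<in>Basis. \<bar>g \<omega> \<bullet> b\<bar> powr p)) \<partial>P)"
      using gL gc cLp[OF _ fgm(2) gL] by (intro integral_mono) auto
    also have "\<dots> = c1 powr p * (real DIM('x) powr p * (\<Sum>b\<in>Basis. (\<integral>\<omega>. \<bar>g \<omega> \<bullet> b\<bar> powr p \<partial>P)))"
      using cLp[OF _ fgm(2) gL] by simp
    also have "\<dots> \<le> c1 powr p * (real DIM('x) powr p * (\<Sum>b::'x\<in>Basis. C * (c2 powr p * (\<integral>\<omega>. N (f \<omega>) powr p \<partial>P))))"
    proof (intro mult_left_mono sum_mono)
      fix b :: 'x assume b: "b \<in> Basis"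
      have "(\<integral>\<omega>. \<bar>g \<omega> \<bullet> b\<bar> powr p \<partial>P) = (\<integral>\<omega>. \<bar>\<Sum>j=1..n. \<epsilon> j * (d j \<omega> \<bullet> b)\<bar> powr p \<partial>P)"
        by (simp add: g_def inner_sum_left)
      also have "\<dots> \<le> C * (\<integral>\<omega>. \<bar>\<Sum>j=1..n. d j \<omega> \<bullet> b\<bar> powr p \<partial>P)"
        unfolding C_def by (rule burkholder_scalar[OF p cm[OF b] \<epsilon> c])
      also have "\<dots> = C * (\<integral>\<omega>. \<bar>f \<omega> \<bullet> b\<bar> powr p \<partial>P)"
        by (simp add: f_def inner_sum_left)
      also have "\<dots> \<le> C * (\<integral>\<omega>. c2 powr p * N (f \<omega>) powr p \<partial>P)"
        using C cb[OF b] fL cLp[OF b fgm(1) fL] by (intro mult_left_mono integral_mono) auto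
      finally show "(\<integral>\<omega>. \<bar>g \<omega> \<bullet> b\<bar> powr p \<partial>P) \<le> C * (c2 powr p * (\<integral>\<omega>. N (f \<omega>) powr p \<partial>P))" by simp
    qed auto
    also have "\<dots> = K * (\<integral>\<omega>. N (f \<omega>) powr p \<partial>P)" unfolding K_def by simp
    finally show ?thesis unfolding f_def g_def .
  qed
  have "K powr (1 / p) \<in> umd_set TYPE('a) p N"
    unfolding umd_set_def mem_Collect_eq
  proof (intro allI impI, elim conjE)
    fix P :: "'a measure" and G d n and \<epsilon> :: "nat \<Rightarrow> real"
    assume a: "mds P G p N d n" "\<forall>j. \<bar>\<epsilon> j\<bar> = 1"
    have "(\<integral>\<omega>. N (\<Sum>j=1..n. \<epsilon> j *\<^sub>R d j \<omega>) powr p \<partial>P) powr (1 / p) \<le> (K * (\<integral>\<omega>. N (\<Sum>j=1..n. d j \<omega>) powr p \<partial>P)) powr (1 / p)"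
      using main[OF a(1), of \<epsilon>] a(2) p by (intro powr_mono2) auto
    also have "\<dots> = K powr (1 / p) * (\<integral>\<omega>. N (\<Sum>j=1..n. d j \<omega>) powr p \<partial>P) powr (1 / p)"
      using K by (simp add: powr_mult)
    finally show "(\<integral>\<omega>. N (\<Sum>j=1..n. \<epsilon> j *\<^sub>R d j \<omega>) powr p \<partial>P) powr (1 / p) \<le> K powr (1 / p) * (\<integral>\<omega>. N (\<Sum>j=1..n. d j \<omega>) powr p \<partial>P) powr (1 / p)" .
  qed
  then show ?thesis by auto
qed

text \<open>The witness is a Dirac measure with one constant, nonzero difference. The bound makes
  \<open>umd_const\<close> positive, as needed when p-th powers are taken.\<close>

lemma umd_set_ge_one:
  fixes N :: "'x::euclidean_space \<Rightarrow> real"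
  assumes N: "is_norm_fun N" and p: "1 < p" and \<beta>: "\<beta> \<in> umd_set TYPE(real) p N"
  shows "1 \<le> \<beta>"
proof -
  define P where "P = return borel (0::real)"
  obtain b :: 'x where b: "b \<in> Basis" using nonempty_Basis by blast
  have Nb: "0 < N b" using norm_funD(1,2)[OF N, of b] nonzero_Basis[OF b] by (auto simp: order_less_le)
  interpret prob_space P unfolding P_def by (rule prob_space_return) simp
  have "mds P (\<lambda>_. P) p N (\<lambda>_ _. b) 1"
    unfolding mds_def by (auto simp: subalgebra_def prob_space_axioms)
  moreover have "\<forall>(P::real measure) G d n \<epsilon>. mds P G p N d n \<and> (\<forall>j. \<bar>\<epsilon> j\<bar> = 1) \<longrightarrow>
     (\<integral>\<omega>. N (\<Sum>j=1..n. \<epsilon> j *\<^sub>R d j \<omega>) powr p \<partial>P) powr (1 / p)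
       \<le> \<beta> * (\<integral>\<omega>. N (\<Sum>j=1..n. d j \<omega>) powr p \<partial>P) powr (1 / p)"
    using \<beta> unfolding umd_set_def by simp
  note this[THEN spec[of _ P], THEN spec[of _ "\<lambda>_. P"], THEN spec[of _ "\<lambda>_ _. b"], THEN spec[of _ 1], THEN spec[of _ "\<lambda>_. 1"]]
  ultimately have "N b \<le> \<beta> * N b" using Nb p prob_space by (simp add: powr_powr)
  then show ?thesis using Nb by simp
qed

lemma umd_const_ge_one:
  assumes "is_norm_fun N" "1 < p"
  shows "1 \<le> umd_const p N"
  using umd_set_nonempty[OF assms, where 'a = real] umd_set_ge_one[OF assms]
  unfolding umd_const_eq umd_set_def[symmetric] by (intro cInf_greatest) (auto simp: umd_set_def)

text \<open>The infimum is itself admissible: divide by the right-hand factor and pass to the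
  infimum. If that factor is 0, any member of the set already forces the left side to be 0.\<close>

lemma umd_const_ineq_real:
  fixes P :: "real measure"
  assumes N: "is_norm_fun N" and p: "1 < p" and mds: "mds P G p N d n" and \<epsilon>: "\<And>j. \<bar>\<epsilon> j\<bar> = 1"
  shows "(\<integral>\<omega>. N (\<Sum>j=1..n. \<epsilon> j *\<^sub>R d j \<omega>) powr p \<partial>P) powr (1 / p)
    \<le> umd_const p N * (\<integral>\<omega>. N (\<Sum>j=1..n. d j \<omega>) powr p \<partial>P) powr (1 / p)" (is "?L \<le> _ * ?R")
proof -
  let ?S = "umd_set TYPE(real) p N"
  have ne: "?S \<noteq> {}" by (rule umd_set_nonempty[OF N p])
  have le: "?L \<le> \<beta> * ?R" if "\<beta> \<in> ?S" for \<beta>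
    using that mds \<epsilon> unfolding umd_set_def by blast
  have eq: "umd_const p N = Inf ?S" unfolding umd_const_eq umd_set_def ..
  show ?thesis
  proof (cases "?R = 0")
    case True
    then show ?thesis using le ne by fastforce
  next
    case False
    then have R: "0 < ?R" using powr_ge_zero[of _ "1 / p"] by (metis order_less_le)
    have "?L / ?R \<le> Inf ?S" using ne le R by (intro cInf_greatest) (auto simp: divide_le_eq)
    then show ?thesis using R unfolding eq by (simp add: divide_le_eq)
  qed
qed

text \<open>Base 3 with digits 0 and 1 only: after multiplication by \<open>3 ^ i\<close> the tail
  is at most 1/2, so the floor never meets the carry ambiguity that binary expansions have.\<close>

lemma floor_ternary_digit:
  fixes b :: "nat \<Rightarrow> bool"
  defines "y \<equiv> (\<Sum>k. of_bool (b k) * (1 / 3) ^ k :: real)"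
  shows "\<lfloor>3 ^ i * y\<rfloor> mod 3 = of_bool (b i)"
proof -
  define t where "t k = (of_bool (b k) * (1 / 3) ^ k :: real)" for k
  have geo: "summable (\<lambda>k. (1 / 3) ^ k :: real)" by (rule summable_geometric) simp
  have st: "summable t"
    by (rule summable_comparison_test'[OF geo, of 0]) (simp add: t_def)
  have "y = (\<Sum>k. t (k + Suc i)) + (\<Sum>k<Suc i. t k)"
    unfolding y_def t_def[symmetric] by (rule suminf_split_initial_segment[OF st])
  then have "3 ^ i * y = 3 ^ i * ((\<Sum>k. t (k + Suc i)) + (\<Sum>k<Suc i. t k))"
    by (rule arg_cong)
  also have "\<dots> = (\<Sum>k<Suc i. 3 ^ i * t k) + 3 ^ i * (\<Sum>k. t (k + Suc i))"
    by (simp only: distrib_left sum_distrib_left add.commute)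
  also have "(\<Sum>k<Suc i. 3 ^ i * t k) = of_int (\<Sum>k<Suc i. of_bool (b k) * 3 ^ (i - k))"
    unfolding of_int_sum
  proof (intro sum.cong refl)
    fix k assume "k \<in> {..<Suc i}"
    then have "(3::real) ^ i = 3 ^ (i - k) * 3 ^ k" by (simp flip: power_add)
    then show "3 ^ i * t k = real_of_int (of_bool (b k) * 3 ^ (i - k))" by (simp add: t_def power_divide)
  qed
  finally have eq: "3 ^ i * y = of_int (\<Sum>k<Suc i. of_bool (b k) * 3 ^ (i - k)) + 3 ^ i * (\<Sum>k. t (k + Suc i))" .
  have sts: "summable (\<lambda>k. t (k + Suc i))" using st by (rule summable_ignore_initial_segment)
  have 0: "0 \<le> 3 ^ i * (\<Sum>k. t (k + Suc i))"
    by (intro mult_nonneg_nonneg suminf_nonneg sts) (auto simp: t_def)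
  have "(\<Sum>k. t (k + Suc i)) \<le> (\<Sum>k. (1 / 3) ^ k * (1 / 3) ^ Suc i :: real)"
    by (intro suminf_le sts summable_mult2 geo) (auto simp: t_def power_add)
  also have "\<dots> = (3 / 2) * (1 / 3) ^ Suc i"
    using suminf_mult2[OF geo, of "(1 / 3) ^ Suc i"] suminf_geometric[of "1 / 3 :: real"] by simp
  finally have "3 ^ i * (\<Sum>k. t (k + Suc i)) \<le> 3 ^ i * ((3 / 2) * (1 / 3) ^ Suc i)"
    by (intro mult_left_mono) auto
  also have "\<dots> = 1 / 2" by (simp add: power_divide)
  finally have "\<lfloor>3 ^ i * y\<rfloor> = (\<Sum>k<Suc i. of_bool (b k) * 3 ^ (i - k))"
    using 0 unfolding eq by (intro floor_unique) auto
  also have "\<dots> = of_bool (b i) + (\<Sum>k<i. of_bool (b k) * 3 ^ (i - k))" by simp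
  also have "(\<Sum>k<i. of_bool (b k) * 3 ^ (i - k)) = 3 * (\<Sum>k<i. of_bool (b k) * 3 ^ (i - Suc k) :: int)"
    unfolding sum_distrib_left
  proof (intro sum.cong refl)
    fix k assume "k \<in> {..<i}"
    then have "i - k = Suc (i - Suc k)" by auto
    then show "of_bool (b k) * 3 ^ (i - k) = 3 * (of_bool (b k) * 3 ^ (i - Suc k) :: int)" by simp
  qed
  finally show ?thesis by simp
qed

text \<open>A real number recovered from its rational lower cut. Being a countable supremum, the
  recovery is measurable in the truth values of the cut; \<open>- \<infinity>\<close> marks a
  rational that lies above \<open>x\<close>.\<close>

lemma SUP_rat_below: "(SUP q::rat. if of_rat q \<le> x then ereal (of_rat q) else - \<infinity>) = ereal x"
proof (rule antisym)
  show "ereal x \<le> (SUP q::rat. if of_rat q \<le> x then ereal (of_rat q) else - \<infinity>)"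
  proof (rule le_SUP_iff[THEN iffD2], intro allI impI)
    fix y assume "y < ereal x"
    then obtain r where r: "y < ereal r" "r < x" using ereal_dense2 by fastforce
    obtain q where "r < of_rat q" "of_rat q < x" using of_rat_dense[OF r(2)] by auto
    with r show "\<exists>q\<in>UNIV. y < (if of_rat q \<le> x then ereal (of_rat q) else - \<infinity>)"
      by (intro bexI[of _ q]) (auto intro: less_trans)
  qed
qed (rule SUP_least, simp)

text \<open>Finitely many random vectors are measurable functions of a single real random variable,
  whose ternary digits encode the rational lower cuts of all their coordinates.\<close>

lemma finite_family_factors_through_real:
  fixes d :: "nat \<Rightarrow> 'a \<Rightarrow> 'x::euclidean_space"
  assumes dm: "\<And>j. j \<in> J \<Longrightarrow> d j \<in> borel_measurable P"
  obtains c :: "'a \<Rightarrow> real" and d' :: "nat \<Rightarrow> real \<Rightarrow> 'x"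
  where "c \<in> borel_measurable P" "\<And>j. d' j \<in> borel_measurable borel"
    "\<And>j \<omega>. j \<in> J \<Longrightarrow> d' j (c \<omega>) = d j \<omega>"
proof -
  define T where "T = J \<times> (Basis :: 'x set) \<times> (UNIV :: rat set)"
  have T: "countable T" unfolding T_def by (intro countable_SIGMA) (auto intro: countable_finite)
  \<comment> \<open>The membership test matters only for empty \<open>T\<close>, where the
    enumeration returns an arbitrary element; all digits are then 0.\<close>
  define bit where "bit i \<omega> = (from_nat_into T i \<in> T \<and>
     (case from_nat_into T i of (j, b, q) \<Rightarrow> of_rat q \<le> d j \<omega> \<bullet> b))" for i \<omega>
  define c where "c \<omega> = (\<Sum>k. of_bool (bit k \<omega>) * (1 / 3) ^ k :: real)" for \<omega>
  \<comment> \<open>The decoder is defined on all reals and is measurable as a countable supremum.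
    Only its values at codes \<open>c \<omega>\<close> count; at other reals the supremum may be
    infinite, and \<open>real_of_ereal\<close> then gives 0.\<close>
  define d' where "d' j y = (\<Sum>b\<in>Basis. real_of_ereal (SUP q::rat.
     if \<lfloor>3 ^ (to_nat_on T (j, b, q)) * y\<rfloor> mod 3 = 1 then ereal (of_rat q) else - \<infinity>) *\<^sub>R (b::'x))" for j and y :: real
  show thesis
  proof
    have [measurable]: "Measurable.pred P (bit i)" for i
    proof (cases "from_nat_into T i \<in> T")
      case True
      then obtain j b q where e: "from_nat_into T i = (j, b, q)" "j \<in> J" unfolding T_def by auto
      have [measurable]: "d j \<in> borel_measurable P" using dm e by auto
      show ?thesis unfolding bit_def using True e by simp
    next
      case False
      then show ?thesis unfolding bit_def by simp
    qed
    show "c \<in> borel_measurable P" unfolding c_def by measurable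
    have [measurable]: "(\<lambda>y::real. \<lfloor>3 ^ i * y\<rfloor>) \<in> measurable borel (count_space UNIV)" for i :: nat
      by measurable
    show "d' j \<in> borel_measurable borel" for j
      unfolding d'_def by measurable
    show "d' j (c \<omega>) = d j \<omega>" if j: "j \<in> J" for j \<omega>
    proof -
      have "\<lfloor>3 ^ (to_nat_on T (j, b, q)) * c \<omega>\<rfloor> mod 3 = 1 \<longleftrightarrow> of_rat q \<le> d j \<omega> \<bullet> b"
        if b: "b \<in> Basis" for b q
      proof -
        have "(j, b, q) \<in> T" using j b unfolding T_def by simp
        then have "bit (to_nat_on T (j, b, q)) \<omega> = (of_rat q \<le> d j \<omega> \<bullet> b)"
          unfolding bit_def by (simp add: from_nat_into_to_nat_on[OF T])
        then show ?thesis unfolding c_def by (simp add: floor_ternary_digit)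
      qed
      then have "d' j (c \<omega>) = (\<Sum>b\<in>Basis. (d j \<omega> \<bullet> b) *\<^sub>R b)"
        unfolding d'_def by (intro sum.cong refl) (simp only: SUP_rat_below real_of_ereal.simps)
      then show ?thesis by (simp add: euclidean_representation)
    qed
  qed
qed

text \<open>\<open>G' j\<close> collects the Borel sets that \<open>c\<close> pulls back into
  \<open>G j\<close>. In this way the filtration is pushed forward although \<open>c\<close> itself
  is not adapted: \<open>d' j\<close> is measurable for \<open>G' j\<close> because its composition
  with \<open>c\<close> is \<open>d j\<close>, and the vanishing integrals pass through the change
  of variables.\<close>

lemma mds_real_copy:
  fixes P :: "'a measure" and d :: "nat \<Rightarrow> 'a \<Rightarrow> 'x::euclidean_space"
  assumes N: "is_norm_fun N" and mds: "mds P G p N d n"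
  obtains P' :: "real measure" and G' d' c where "mds P' G' p N d' n"
    "c \<in> measurable P P'" "distr P P' c = P'" "\<And>j. d' j \<in> borel_measurable P'"
    "\<And>j \<omega>. j \<in> {1..n} \<Longrightarrow> d' j (c \<omega>) = d j \<omega>"
proof -
  interpret prob_space P by (rule mdsD(1)[OF mds])
  have [measurable]: "N \<in> borel_measurable borel" by (rule norm_fun_measurable[OF N])
  obtain c :: "'a \<Rightarrow> real" and d' where c[measurable]: "c \<in> borel_measurable P"
    and d'[measurable]: "\<And>j. d' j \<in> borel_measurable borel"
    and cd: "\<And>j \<omega>. j \<in> {1..n} \<Longrightarrow> d' j (c \<omega>) = d j \<omega>"
    using finite_family_factors_through_real[of "{1..n}" d P] mdsD(5)[OF mds] by auto
  define P' where "P' = distr P borel c"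
  define S where "S j = {B \<in> sets borel. c -` B \<inter> space P \<in> sets (G j)}" for j
  define G' where "G' j = sigma UNIV (S j)" for j
  have spG: "space (G j) = space P" "sets (G j) \<subseteq> sets P" for j
    using mdsD(2)[OF mds, of j] unfolding subalgebra_def by auto
  have "sigma_algebra UNIV (S j)" for j
  proof (unfold sigma_algebra_iff2, intro conjI ballI allI impI)
    show "S j \<subseteq> Pow UNIV" by auto
    show "{} \<in> S j" unfolding S_def by simp
    fix B assume B: "B \<in> S j"
    have "c -` (UNIV - B) \<inter> space P = space (G j) - (c -` B \<inter> space P)" using spG by auto
    then show "UNIV - B \<in> S j" using B unfolding S_def by auto
  next
    fix B :: "nat \<Rightarrow> real set" assume B: "range B \<subseteq> S j"
    have "c -` (\<Union>i. B i) \<inter> space P = (\<Union>i. c -` B i \<inter> space P)" by auto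
    moreover have "(\<Union>i. c -` B i \<inter> space P) \<in> sets (G j)" using B unfolding S_def by (intro sets.countable_UN) auto
    moreover have "(\<Union>i. B i) \<in> sets borel" using B unfolding S_def by (intro sets.countable_UN) auto
    ultimately show "(\<Union>i. B i) \<in> S j" unfolding S_def by simp
  qed
  then have setsG': "sets (G' j) = S j" for j unfolding G'_def by (simp add: sigma_algebra.sigma_sets_eq)
  have spG': "space (G' j) = UNIV" for j unfolding G'_def by (simp add: space_measure_of_conv)
  have cP: "c \<in> measurable P P'" unfolding P'_def by simp
  have d'P: "d' j \<in> borel_measurable P'" for j unfolding P'_def by simp
  have "mds P' G' p N d' n"
    unfolding mds_def
  proof (intro conjI allI impI ballI)
    show "prob_space P'" unfolding P'_def by (rule prob_space_distr) simp
    show "subalgebra P' (G' j)" for j unfolding subalgebra_def using spG' setsG' by (auto simp: P'_def S_def)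
    show "sets (G' i) \<subseteq> sets (G' j)" if "i \<le> j" for i j
      using mdsD(3)[OF mds that] unfolding setsG' S_def by auto
  next
    fix j assume j: "j \<in> {1..n}"
    show "d' j \<in> borel_measurable (G' j)"
    proof (rule measurableI)
      fix B :: "'x set" assume B: "B \<in> sets borel"
      have "c -` (d' j -` B) \<inter> space P = d j -` B \<inter> space (G j)" using cd[OF j] spG by auto
      also have "\<dots> \<in> sets (G j)" using mdsD(4)[OF mds, of j] j B by (auto intro: measurable_sets)
      finally show "d' j -` B \<inter> space (G' j) \<in> sets (G' j)"
        using measurable_sets[OF d' B, of j] by (simp add: spG' setsG' S_def)
    qed simp
    show "integrable P' (d' j)"
      unfolding P'_def using mdsD(6)[OF mds, of j] j cd[OF j] by (subst integrable_distr_eq) auto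
    show "integrable P' (\<lambda>\<omega>. N (d' j \<omega>) powr p)"
      unfolding P'_def using mdsD(7)[OF mds, of j] j cd[OF j] by (subst integrable_distr_eq) auto
  next
    fix j A assume j: "j \<in> {2..n}" and A: "A \<in> sets (G' (j - 1))"
    have [measurable]: "A \<in> sets borel" and Ac: "c -` A \<inter> space P \<in> sets (G (j - 1))"
      using A unfolding setsG' S_def by auto
    have "(\<integral>y. indicator A y *\<^sub>R d' j y \<partial>P') = (\<integral>\<omega>. indicator A (c \<omega>) *\<^sub>R d' j (c \<omega>) \<partial>P)"
      unfolding P'_def by (rule integral_distr) auto
    also have "\<dots> = (\<integral>\<omega>. indicator (c -` A \<inter> space P) \<omega> *\<^sub>R d j \<omega> \<partial>P)"
      using cd j by (intro Bochner_Integration.integral_cong) (auto simp: indicator_def)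
    also have "\<dots> = 0" using mdsD(8)[OF mds, of j] j Ac by auto
    finally show "(\<integral>y. indicator A y *\<^sub>R d' j y \<partial>P') = 0" .
  qed
  moreover have "distr P P' c = P'"
    unfolding P'_def by (rule distr_cong) auto
  ultimately show thesis using that cP d'P cd by blast
qed

text \<open>\<open>P'\<close> is the image of \<open>P\<close> under \<open>c\<close>, and every
  \<open>d j\<close> is \<open>d' j\<close> after \<open>c\<close>, so both integrals equal their
  counterparts over the reals. Raising to the power \<open>p\<close> removes the roots.\<close>

lemma umd_const_ineq:
  fixes P :: "'a measure"
  assumes N: "is_norm_fun N" and p: "1 < p" and mds: "mds P G p N d n" and \<epsilon>: "\<And>j. \<bar>\<epsilon> j\<bar> = 1"
  shows "(\<integral>\<omega>. N (\<Sum>j=1..n. \<epsilon> j *\<^sub>R d j \<omega>) powr p \<partial>P)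
    \<le> umd_const p N powr p * (\<integral>\<omega>. N (\<Sum>j=1..n. d j \<omega>) powr p \<partial>P)" (is "?L \<le> _ * ?R")
proof -
  have [measurable]: "N \<in> borel_measurable borel" by (rule norm_fun_measurable[OF N])
  obtain P' :: "real measure" and G' d' c where c: "mds P' G' p N d' n"
    "c \<in> measurable P P'" "distr P P' c = P'" "\<And>j. d' j \<in> borel_measurable P'"
    "\<And>j \<omega>. j \<in> {1..n} \<Longrightarrow> d' j (c \<omega>) = d j \<omega>"
    by (rule mds_real_copy[OF N mds]) blast
  note [measurable] = c(2,4)
  have eq: "(\<integral>y. N (\<Sum>j=1..n. r j *\<^sub>R d' j y) powr p \<partial>P') = (\<integral>\<omega>. N (\<Sum>j=1..n. r j *\<^sub>R d j \<omega>) powr p \<partial>P)" for r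
  proof -
    have "(\<integral>y. N (\<Sum>j=1..n. r j *\<^sub>R d' j y) powr p \<partial>distr P P' c) = (\<integral>\<omega>. N (\<Sum>j=1..n. r j *\<^sub>R d' j (c \<omega>)) powr p \<partial>P)"
      by (rule integral_distr) auto
    then show ?thesis using c(5) by (simp add: c(3))
  qed
  have eq1: "(\<integral>y. N (\<Sum>j=1..n. d' j y) powr p \<partial>P') = ?R" using eq[of "\<lambda>_. 1"] by simp
  have "?L powr (1 / p) \<le> umd_const p N * ?R powr (1 / p)"
    using umd_const_ineq_real[OF N p c(1) \<epsilon>] unfolding eq eq1 .
  then have "(?L powr (1 / p)) powr p \<le> (umd_const p N * ?R powr (1 / p)) powr p"
    using p by (intro powr_mono2) auto
  then show ?thesis using p umd_const_ge_one[OF N p]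
    by (simp add: powr_mult powr_powr)
qed

section \<open>From signs to bounded multipliers\<close>

lemma powr_convex_combination:
  fixes a b \<theta> p :: real
  assumes "1 < p" "0 \<le> a" "0 \<le> b" "0 \<le> \<theta>" "\<theta> \<le> 1"
  shows "(\<theta> * a + (1 - \<theta>) * b) powr p \<le> \<theta> * a powr p + (1 - \<theta>) * b powr p"
proof -
  define z where "z = \<theta> * a + (1 - \<theta>) * b"
  have z: "0 \<le> z" using assms unfolding z_def by (intro add_nonneg_nonneg mult_nonneg_nonneg) auto
  define D where "D = p * sgn z * \<bar>z\<bar> powr (p - 1)"
  have "z powr p + D * (a - z) \<le> a powr p" "z powr p + D * (b - z) \<le> b powr p"
    using abs_powr_tangent[OF assms(1), of z a] abs_powr_tangent[OF assms(1), of z b] assms z by (auto simp: D_def)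
  then have "\<theta> * (z powr p + D * (a - z)) + (1 - \<theta>) * (z powr p + D * (b - z)) \<le> \<theta> * a powr p + (1 - \<theta>) * b powr p"
    using assms by (intro add_mono mult_left_mono) auto
  also have "\<theta> * (z powr p + D * (a - z)) + (1 - \<theta>) * (z powr p + D * (b - z)) = z powr p + D * (\<theta> * a + (1 - \<theta>) * b - z)"
    by (simp add: algebra_simps)
  finally show ?thesis unfolding z_def by simp
qed

text \<open>A multiplier in \<open>[-1, 1]\<close> is a convex combination of the signs 1 and -1,
  and the p-th power of \<open>N\<close> is convex. Replacing the multipliers one at a time costs
  nothing, so the constant for signs survives; \<open>L\<close> enters by homogeneity.\<close>

lemma umd_const_multiplier:
  fixes P :: "'a measure"
  assumes N: "is_norm_fun N" and p: "1 < p" and mds: "mds P G p N d n" and \<mu>: "\<And>j. \<bar>\<mu> j\<bar> \<le> L"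
  shows "(\<integral>\<omega>. N (\<Sum>j=1..n. \<mu> j *\<^sub>R d j \<omega>) powr p \<partial>P)
    \<le> (umd_const p N * L) powr p * (\<integral>\<omega>. N (\<Sum>j=1..n. d j \<omega>) powr p \<partial>P)"
proof -
  have [measurable]: "N \<in> borel_measurable borel" by (rule norm_fun_measurable[OF N])
  let ?R = "(\<integral>\<omega>. N (\<Sum>j=1..n. d j \<omega>) powr p \<partial>P)"
  let ?I = "\<lambda>\<mu>. (\<integral>\<omega>. N (\<Sum>j=1..n. \<mu> j *\<^sub>R d j \<omega>) powr p \<partial>P)"
  have int: "integrable P (\<lambda>\<omega>. N (\<Sum>j=1..n. r j *\<^sub>R d j \<omega>) powr p)" for r
    using mdsD(5,7)[OF mds] p by (auto intro!: Lp_sum[OF N] Lp_scale[OF N] borel_measurable_scaleR)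
  \<comment> \<open>Here \<open>k\<close> bounds the indices whose multiplier may still differ from
    a sign; the induction lowers it.\<close>
  have unit: "?I \<mu> \<le> umd_const p N powr p * ?R"
    if "\<And>j. \<bar>\<mu> j\<bar> \<le> 1" "\<And>j. k < j \<Longrightarrow> \<bar>\<mu> j\<bar> = 1" for k \<mu>
    using that
  proof (induction k arbitrary: \<mu>)
    case 0
    \<comment> \<open>Index 0 does not occur in the sum. Setting its multiplier to 1 turns all of
      them into signs.\<close>
    have "?I \<mu> = ?I (\<mu>(0 := 1))" by (intro Bochner_Integration.integral_cong refl arg_cong[where f = "\<lambda>x. N x powr p"] sum.cong) auto
    also have "\<dots> \<le> umd_const p N powr p * ?R"
      using 0 by (intro umd_const_ineq[OF N p mds]) auto
    finally show ?case .
  next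
    case (Suc k)
    define \<theta> where "\<theta> = (1 + \<mu> (Suc k)) / 2"
    have \<theta>: "0 \<le> \<theta>" "\<theta> \<le> 1" using Suc(2)[of "Suc k"] unfolding \<theta>_def by (auto simp: abs_le_iff)
    define u where "u = \<mu>(Suc k := 1)"
    define v where "v = \<mu>(Suc k := - 1)"
    have IHu: "?I u \<le> umd_const p N powr p * ?R"
    proof (rule Suc.IH)
      show "\<bar>u j\<bar> \<le> 1" for j using Suc(2)[of j] unfolding u_def by auto
      show "\<bar>u j\<bar> = 1" if "k < j" for j using Suc(3)[of j] that unfolding u_def by auto
    qed
    have IHv: "?I v \<le> umd_const p N powr p * ?R"
    proof (rule Suc.IH)
      show "\<bar>v j\<bar> \<le> 1" for j using Suc(2)[of j] unfolding v_def by auto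
      show "\<bar>v j\<bar> = 1" if "k < j" for j using Suc(3)[of j] that unfolding v_def by auto
    qed
    have comb: "\<mu> j = \<theta> * u j + (1 - \<theta>) * v j" for j
      unfolding u_def v_def \<theta>_def by (auto simp: field_simps)
    have "N (\<Sum>j=1..n. \<mu> j *\<^sub>R d j \<omega>) powr p
        \<le> \<theta> * N (\<Sum>j=1..n. u j *\<^sub>R d j \<omega>) powr p + (1 - \<theta>) * N (\<Sum>j=1..n. v j *\<^sub>R d j \<omega>) powr p" for \<omega>
    proof -
      have "(\<Sum>j=1..n. \<mu> j *\<^sub>R d j \<omega>) = \<theta> *\<^sub>R (\<Sum>j=1..n. u j *\<^sub>R d j \<omega>) + (1 - \<theta>) *\<^sub>R (\<Sum>j=1..n. v j *\<^sub>R d j \<omega>)"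
        by (simp add: comb scaleR_add_left sum.distrib scaleR_sum_right)
      then have "N (\<Sum>j=1..n. \<mu> j *\<^sub>R d j \<omega>) \<le> \<theta> * N (\<Sum>j=1..n. u j *\<^sub>R d j \<omega>) + (1 - \<theta>) * N (\<Sum>j=1..n. v j *\<^sub>R d j \<omega>)"
        using norm_funD(4)[OF N, of "\<theta> *\<^sub>R (\<Sum>j=1..n. u j *\<^sub>R d j \<omega>)" "(1 - \<theta>) *\<^sub>R (\<Sum>j=1..n. v j *\<^sub>R d j \<omega>)"] \<theta>
        by (simp add: norm_funD(3)[OF N])
      then have "N (\<Sum>j=1..n. \<mu> j *\<^sub>R d j \<omega>) powr p \<le> (\<theta> * N (\<Sum>j=1..n. u j *\<^sub>R d j \<omega>) + (1 - \<theta>) * N (\<Sum>j=1..n. v j *\<^sub>R d j \<omega>)) powr p"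
        using p by (intro powr_mono2 norm_funD[OF N]) auto
      also have "\<dots> \<le> \<theta> * N (\<Sum>j=1..n. u j *\<^sub>R d j \<omega>) powr p + (1 - \<theta>) * N (\<Sum>j=1..n. v j *\<^sub>R d j \<omega>) powr p"
        using \<theta> by (intro powr_convex_combination p norm_funD[OF N])
      finally show ?thesis .
    qed
    then have "?I \<mu> \<le> (\<integral>\<omega>. \<theta> * N (\<Sum>j=1..n. u j *\<^sub>R d j \<omega>) powr p + (1 - \<theta>) * N (\<Sum>j=1..n. v j *\<^sub>R d j \<omega>) powr p \<partial>P)"
      using int by (intro integral_mono) auto
    also have "\<dots> = \<theta> * ?I u + (1 - \<theta>) * ?I v" using int by simp
    also have "\<dots> \<le> \<theta> * (umd_const p N powr p * ?R) + (1 - \<theta>) * (umd_const p N powr p * ?R)"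
      using IHu IHv \<theta> by (intro add_mono mult_left_mono) auto
    also have "\<dots> = umd_const p N powr p * ?R" by (simp add: algebra_simps)
    finally show ?case .
  qed
  have L0: "0 \<le> L" using \<mu>[of 0] by linarith
  show ?thesis
  proof (cases "L = 0")
    case True
    then have "\<mu> j = 0" for j using \<mu>[of j] by simp
    then have "?I \<mu> = 0" using norm_funD(2)[OF N, of 0] by simp
    then show ?thesis using True by simp
  next
    case False
    with L0 have L: "0 < L" by simp
    \<comment> \<open>Outside \<open>1..n\<close> the value 1 is harmless and makes
      \<open>unit\<close> applicable with \<open>k = n\<close>.\<close>
    define \<nu> where "\<nu> j = (if 1 \<le> j \<and> j \<le> n then \<mu> j / L else 1)" for j
    have \<nu>: "\<bar>\<nu> j\<bar> \<le> 1" "n < j \<Longrightarrow> \<bar>\<nu> j\<bar> = 1" for j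
      using \<mu>[of j] L unfolding \<nu>_def by auto
    have "N (\<Sum>j=1..n. \<mu> j *\<^sub>R d j \<omega>) powr p = L powr p * N (\<Sum>j=1..n. \<nu> j *\<^sub>R d j \<omega>) powr p" for \<omega>
    proof -
      have "(\<Sum>j=1..n. \<mu> j *\<^sub>R d j \<omega>) = L *\<^sub>R (\<Sum>j=1..n. \<nu> j *\<^sub>R d j \<omega>)"
        unfolding scaleR_sum_right using L by (intro sum.cong) (auto simp: \<nu>_def)
      then show ?thesis using L by (simp add: norm_funD[OF N] powr_mult)
    qed
    then have "?I \<mu> = L powr p * ?I \<nu>" by simp
    also have "\<dots> \<le> L powr p * (umd_const p N powr p * ?R)"
      using unit[of \<nu> n] \<nu> by (intro mult_left_mono) auto
    finally show ?thesis using umd_const_ge_one[OF N p] L by (simp add: powr_mult mult_ac)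
  qed
qed

section \<open>Independence from characteristic functions\<close>

text \<open>Adding a constant to \<open>g\<close> and normalising gives a probability density. The
  hypothesis at frequency 0 says that \<open>g\<close> has mean 0, and at all frequencies that
  \<open>Z\<close> has the same characteristic function under the new measure as under
  \<open>M\<close>. By uniqueness the laws agree, and their difference on \<open>A\<close> is a
  multiple of the integral in question.\<close>

lemma (in prob_space) real_fourier_zero:
  fixes g Z :: "'a \<Rightarrow> real"
  assumes [measurable]: "g \<in> borel_measurable M" "Z \<in> borel_measurable M" "A \<in> sets borel"
    and B: "\<And>\<omega>. \<bar>g \<omega>\<bar> \<le> B"
    and 0: "\<And>t. (CLINT \<omega>|M. complex_of_real (g \<omega>) * iexp (t * Z \<omega>)) = 0"
  shows "(\<integral>\<omega>. g \<omega> * indicator A (Z \<omega>) \<partial>M) = 0"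
proof -
  \<comment> \<open>The extra 1 keeps the normalising constant positive when
    \<open>B = 0\<close>.\<close>
  define b where "b = B + 1"
  have b: "0 < b" "\<And>\<omega>. 0 \<le> (b + g \<omega>) / b" using B order_trans[OF abs_ge_zero B]
    unfolding b_def by (auto simp: abs_le_iff intro!: divide_nonneg_pos) (smt (verit) B abs_le_iff)
  define \<nu> where "\<nu> = density M (\<lambda>\<omega>. ennreal ((b + g \<omega>) / b))"
  have gint: "integrable M g" by (rule integrable_const_bound[of _ B]) (use B in auto)
  have intd: "integrable M (\<lambda>\<omega>. (b + g \<omega>) / b)" using gint by simp
  have g0: "(\<integral>\<omega>. g \<omega> \<partial>M) = 0"
  proof -
    have "complex_of_real (\<integral>\<omega>. g \<omega> \<partial>M) = 0" using 0[of 0] by simp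
    then show ?thesis by simp
  qed
  have "prob_space \<nu>"
  proof
    have "emeasure \<nu> (space \<nu>) = (\<integral>\<^sup>+\<omega>. ennreal ((b + g \<omega>) / b) \<partial>M)"
      unfolding \<nu>_def by (simp add: emeasure_density cong: nn_integral_cong)
    also have "\<dots> = ennreal (\<integral>\<omega>. (b + g \<omega>) / b \<partial>M)" by (rule nn_integral_eq_integral) (use intd b in auto)
    also have "(\<integral>\<omega>. (b + g \<omega>) / b \<partial>M) = 1" using b g0 gint by (simp add: prob_space)
    finally show "emeasure \<nu> (space \<nu>) = 1" by simp
  qed
  then interpret \<nu>: prob_space \<nu> .
  have [measurable]: "Z \<in> borel_measurable \<nu>" unfolding \<nu>_def by simp
  have eq: "distr \<nu> borel Z = distr M borel Z"
  proof (rule Levy_uniqueness)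
    show "real_distribution (distr \<nu> borel Z)" by simp
    show "real_distribution (distr M borel Z)" by simp
    show "char (distr \<nu> borel Z) = char (distr M borel Z)"
    proof
      fix t
      have int1: "integrable M (\<lambda>\<omega>. iexp (t * Z \<omega>))"
        by (rule integrable_const_bound[of _ 1]) auto
      have int2: "integrable M (\<lambda>\<omega>. complex_of_real (g \<omega>) * iexp (t * Z \<omega>))"
        by (rule integrable_const_bound[of _ B]) (use B in \<open>auto simp: norm_mult\<close>)
      have "char (distr \<nu> borel Z) t = (CLINT \<omega>|\<nu>. iexp (t * Z \<omega>))"
        unfolding char_def by (subst integral_distr) auto
      also have "\<dots> = (CLINT \<omega>|M. ((b + g \<omega>) / b) *\<^sub>R iexp (t * Z \<omega>))"
        unfolding \<nu>_def using b by (subst integral_density) auto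
      also have "\<dots> = (CLINT \<omega>|M. iexp (t * Z \<omega>) + (1 / b) *\<^sub>R (complex_of_real (g \<omega>) * iexp (t * Z \<omega>)))"
        using b by (intro Bochner_Integration.integral_cong refl) (simp add: scaleR_conv_of_real add_divide_distrib distrib_right)
      also have "\<dots> = (CLINT \<omega>|M. iexp (t * Z \<omega>)) + (1 / b) *\<^sub>R (CLINT \<omega>|M. complex_of_real (g \<omega>) * iexp (t * Z \<omega>))"
        by (subst Bochner_Integration.integral_add[OF int1 integrable_scaleR_right[OF int2]]) simp
      also have "\<dots> = char (distr M borel Z) t"
        unfolding char_def 0 by (subst integral_distr) auto
      finally show "char (distr \<nu> borel Z) t = char (distr M borel Z) t" .
    qed
  qed
  have "(\<integral>x. indicator A x \<partial>distr \<nu> borel Z) = (\<integral>\<omega>. ((b + g \<omega>) / b) *\<^sub>R indicator A (Z \<omega>) \<partial>M :: real)"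
  proof -
    have "(\<integral>x. indicator A x \<partial>distr \<nu> borel Z) = (\<integral>\<omega>. indicator A (Z \<omega>) \<partial>\<nu> :: real)" by (subst integral_distr) auto
    also have "\<dots> = (\<integral>\<omega>. ((b + g \<omega>) / b) *\<^sub>R indicator A (Z \<omega>) \<partial>M)"
      unfolding \<nu>_def using b by (subst integral_density) auto
    finally show ?thesis .
  qed
  moreover have "(\<integral>x. indicator A x \<partial>distr M borel Z) = (\<integral>\<omega>. indicator A (Z \<omega>) \<partial>M :: real)" by (subst integral_distr) auto
  ultimately have "(\<integral>\<omega>. ((b + g \<omega>) / b) *\<^sub>R indicator A (Z \<omega>) \<partial>M) = (\<integral>\<omega>. indicator A (Z \<omega>) \<partial>M :: real)" using eq by simp
  also have "(\<integral>\<omega>. ((b + g \<omega>) / b) *\<^sub>R indicator A (Z \<omega>) \<partial>M) = (\<integral>\<omega>. indicator A (Z \<omega>) + (1 / b) * (g \<omega> * indicator A (Z \<omega>)) \<partial>M)"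
    using b by (intro Bochner_Integration.integral_cong refl) (simp add: add_divide_distrib distrib_right)
  also have "\<dots> = (\<integral>\<omega>. indicator A (Z \<omega>) \<partial>M) + (1 / b) * (\<integral>\<omega>. g \<omega> * indicator A (Z \<omega>) \<partial>M)"
  proof -
    have "integrable M (\<lambda>\<omega>. indicator A (Z \<omega>) :: real)" by (rule integrable_const_bound[of _ 1]) auto
    moreover have "integrable M (\<lambda>\<omega>. g \<omega> * indicator A (Z \<omega>))"
      by (rule integrable_const_bound[of _ B]) (use B order_trans[OF abs_ge_zero B] in \<open>auto simp: abs_mult indicator_def\<close>)
    ultimately show ?thesis by simp
  qed
  finally show ?thesis using b by simp
qed

text \<open>Conjugation with \<open>t\<close> replaced by \<open>- t\<close> shows that
  \<open>cnj (f \<omega>)\<close> has vanishing transform as well. Hence so do the real and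
  imaginary parts, as linear combinations, and the real version applies to each.\<close>

lemma (in prob_space) complex_fourier_zero:
  fixes f :: "'a \<Rightarrow> complex" and Z :: "'a \<Rightarrow> real"
  assumes [measurable]: "f \<in> borel_measurable M" "Z \<in> borel_measurable M" "A \<in> sets borel"
    and B: "\<And>\<omega>. cmod (f \<omega>) \<le> B"
    and 0: "\<And>t. (CLINT \<omega>|M. f \<omega> * iexp (t * Z \<omega>)) = 0"
  shows "(CLINT \<omega>|M. f \<omega> * indicator A (Z \<omega>)) = 0"
proof -
  have cnj0: "(CLINT \<omega>|M. cnj (f \<omega>) * iexp (t * Z \<omega>)) = 0" for t
  proof -
    have "(CLINT \<omega>|M. cnj (f \<omega> * iexp (- t * Z \<omega>))) = cnj (CLINT \<omega>|M. f \<omega> * iexp (- t * Z \<omega>))"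
      by (rule Bochner_Integration.integral_cnj)
    then show ?thesis using 0[of "- t"] by (simp add: exp_cnj)
  qed
  have [measurable]: "(\<lambda>\<omega>. cnj (f \<omega>)) \<in> borel_measurable M"
    by (intro borel_measurable_continuous_on[where f = cnj] continuous_intros assms)
  have int: "integrable M (\<lambda>\<omega>. f \<omega> * iexp (t * Z \<omega>))" "integrable M (\<lambda>\<omega>. cnj (f \<omega>) * iexp (t * Z \<omega>))" for t
    by (rule integrable_const_bound[of _ B]; use B in \<open>auto simp: norm_mult\<close>)+
  have "(\<integral>\<omega>. Re (f \<omega>) * indicator A (Z \<omega>) \<partial>M) = 0"
  proof (rule real_fourier_zero[where B = B])
    show "\<bar>Re (f \<omega>)\<bar> \<le> B" for \<omega> using abs_Re_le_cmod B order_trans by blast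
    fix t
    have "(CLINT \<omega>|M. complex_of_real (Re (f \<omega>)) * iexp (t * Z \<omega>))
        = (CLINT \<omega>|M. (1 / 2) * (f \<omega> * iexp (t * Z \<omega>)) + (1 / 2) * (cnj (f \<omega>) * iexp (t * Z \<omega>)))"
      by (intro Bochner_Integration.integral_cong refl) (simp add: complex_eq_iff field_simps)
    also have "\<dots> = 0" using int[of t] 0[of t] cnj0[of t] by simp
    finally show "(CLINT \<omega>|M. complex_of_real (Re (f \<omega>)) * iexp (t * Z \<omega>)) = 0" .
  qed auto
  moreover have "(\<integral>\<omega>. Im (f \<omega>) * indicator A (Z \<omega>) \<partial>M) = 0"
  proof (rule real_fourier_zero[where B = B])
    show "\<bar>Im (f \<omega>)\<bar> \<le> B" for \<omega> using abs_Im_le_cmod B order_trans by blast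
    fix t
    have "(CLINT \<omega>|M. complex_of_real (Im (f \<omega>)) * iexp (t * Z \<omega>))
        = (CLINT \<omega>|M. (- \<i> / 2) * (f \<omega> * iexp (t * Z \<omega>)) + (\<i> / 2) * (cnj (f \<omega>) * iexp (t * Z \<omega>)))"
      by (intro Bochner_Integration.integral_cong refl) (simp add: complex_eq_iff field_simps)
    also have "\<dots> = 0" using int[of t] 0[of t] cnj0[of t] by simp
    finally show "(CLINT \<omega>|M. complex_of_real (Im (f \<omega>)) * iexp (t * Z \<omega>)) = 0" .
  qed auto
  moreover have "integrable M (\<lambda>\<omega>. f \<omega> * indicator A (Z \<omega>))"
    by (rule integrable_const_bound[of _ B]) (use B order_trans[OF norm_ge_zero B] in \<open>auto simp: norm_mult indicator_def\<close>)
  moreover have "Re (f \<omega> * indicator A (Z \<omega>)) = Re (f \<omega>) * indicator A (Z \<omega>)"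
    "Im (f \<omega> * indicator A (Z \<omega>)) = Im (f \<omega>) * indicator A (Z \<omega>)" for \<omega>
    by (auto simp: indicator_def)
  ultimately show ?thesis by (simp add: complex_eq_iff flip: integral_Re integral_Im)
qed

lemma (in prob_space) complex_integral_indicator:
  assumes "S \<in> sets M"
  shows "(CLINT \<omega>|M. indicator S \<omega>) = complex_of_real (prob S)"
proof -
  have "(CLINT \<omega>|M. indicator S \<omega>) = (CLINT \<omega>|M. complex_of_real (indicator S \<omega>))"
    by (intro Bochner_Integration.integral_cong refl) (simp add: indicator_def)
  also have "\<dots> = complex_of_real (\<integral>\<omega>. indicator S \<omega> \<partial>M)" by (rule integral_complex_of_real)
  also have "(\<integral>\<omega>. indicator S \<omega> \<partial>M) = prob S" using assms by simp
  finally show ?thesis .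
qed

text \<open>The exponentials are exchanged for indicators one variable at a time. With all other
  factors held fixed, the product formula for every frequency of \<open>Z k\<close> is a vanishing
  Fourier transform, which may be tested against the indicator of \<open>A k\<close>
  instead.\<close>

lemma (in prob_space) characteristic_product_imp_indep:
  fixes Z :: "nat \<Rightarrow> 'a \<Rightarrow> real"
  assumes Z [measurable]: "\<And>j. j < n \<Longrightarrow> Z j \<in> borel_measurable M"
    and char: "\<And>c. (CLINT \<omega>|M. iexp (\<Sum>j<n. c j * Z j \<omega>)) = (\<Prod>j<n. (CLINT \<omega>|M. iexp (c j * Z j \<omega>)))"
    and A: "\<And>j. j < n \<Longrightarrow> A j \<in> sets borel"
  shows "prob {\<omega> \<in> space M. \<forall>j<n. Z j \<omega> \<in> A j} = (\<Prod>j<n. prob (Z j -` A j \<inter> space M))"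
proof -
  define \<phi> where "\<phi> j t = (CLINT \<omega>|M. iexp (t * Z j \<omega>))" for j t
  define w where "w k \<omega> = (\<Prod>j<k. indicator (A j) (Z j \<omega>) :: complex)" for k \<omega>
  define pr where "pr k = complex_of_real (\<Prod>j<k. prob (Z j -` A j \<inter> space M))" for k
  have wm [measurable]: "w k \<in> borel_measurable M" if "k \<le> n" for k
    unfolding w_def using that A by (intro borel_measurable_prod) auto
  have w1: "cmod (w k \<omega>) \<le> 1" for k \<omega>
    unfolding w_def prod_norm[symmetric] by (intro prod_le_1) (auto simp: indicator_def)
  \<comment> \<open>The intermediate statement: the first \<open>k\<close> variables appear through
    indicators, collected in \<open>w k\<close>, and the remaining ones still through exponentials
    with free frequencies.\<close>
  have H: "(CLINT \<omega>|M. w k \<omega> * iexp (\<Sum>j=k..<n. c j * Z j \<omega>)) = pr k * (\<Prod>j=k..<n. \<phi> j (c j))" if "k \<le> n" for k c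
    using that
  proof (induction k arbitrary: c)
    case 0
    then show ?case using char[of c] by (simp add: w_def pr_def \<phi>_def atLeast0LessThan)
  next
    case (Suc k)
    then have k: "k < n" "k \<le> n" by auto
    note [measurable] = Z[OF k(1)] A[OF k(1)]
    define E where "E \<omega> = iexp (\<Sum>j=Suc k..<n. c j * Z j \<omega>)" for \<omega>
    have [measurable]: "E \<in> borel_measurable M" unfolding E_def
      by (intro borel_measurable_continuous_on[where f = "\<lambda>x. iexp x"] borel_measurable_sum continuous_intros) auto
    have E1: "cmod (E \<omega>) = 1" for \<omega> unfolding E_def by simp
    define \<kappa> where "\<kappa> = pr k * (\<Prod>j=Suc k..<n. \<phi> j (c j))"
    \<comment> \<open>Subtracting the constant \<open>\<kappa>\<close> turns the product formula
      into a vanishing transform against \<open>Z k\<close>.\<close>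
    define f where "f \<omega> = w k \<omega> * E \<omega> - \<kappa>" for \<omega>
    have [measurable]: "w k \<in> borel_measurable M" using wm k by simp
    have "(CLINT \<omega>|M. f \<omega> * iexp (t * Z k \<omega>)) = 0" for t
    proof -
      have split: "{k..<n} = insert k {Suc k..<n}" using k by auto
      have "(CLINT \<omega>|M. w k \<omega> * E \<omega> * iexp (t * Z k \<omega>)) = (CLINT \<omega>|M. w k \<omega> * iexp (\<Sum>j=k..<n. (c(k := t)) j * Z j \<omega>))"
      proof (intro Bochner_Integration.integral_cong refl)
        fix \<omega>
        have "(\<Sum>j=k..<n. (c(k := t)) j * Z j \<omega>) = t * Z k \<omega> + (\<Sum>j=Suc k..<n. c j * Z j \<omega>)"
          unfolding split by (subst sum.insert) (auto intro!: sum.cong)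
        then show "w k \<omega> * E \<omega> * iexp (t * Z k \<omega>) = w k \<omega> * iexp (\<Sum>j=k..<n. (c(k := t)) j * Z j \<omega>)"
          unfolding E_def by (simp add: exp_add distrib_left mult_ac)
      qed
      also have "\<dots> = pr k * (\<Prod>j=k..<n. \<phi> j ((c(k := t)) j))" using Suc.IH k by simp
      also have "(\<Prod>j=k..<n. \<phi> j ((c(k := t)) j)) = \<phi> k t * (\<Prod>j=Suc k..<n. \<phi> j (c j))"
        unfolding split by (subst prod.insert) (auto intro!: prod.cong)
      finally have 1: "(CLINT \<omega>|M. w k \<omega> * E \<omega> * iexp (t * Z k \<omega>)) = \<kappa> * \<phi> k t" by (simp add: \<kappa>_def mult_ac)
      have i1: "integrable M (\<lambda>\<omega>. w k \<omega> * E \<omega> * iexp (t * Z k \<omega>))"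
        by (rule integrable_const_bound[of _ 1]) (use w1 E1 in \<open>auto simp: norm_mult\<close>)
      have i2: "integrable M (\<lambda>\<omega>. \<kappa> * iexp (t * Z k \<omega>))"
        by (rule integrable_const_bound[of _ "cmod \<kappa>"]) (auto simp: norm_mult)
      show ?thesis unfolding f_def left_diff_distrib
        using 1 by (subst Bochner_Integration.integral_diff[OF i1 i2]) (simp add: \<phi>_def)
    qed
    then have "(CLINT \<omega>|M. f \<omega> * indicator (A k) (Z k \<omega>)) = 0"
    proof (intro complex_fourier_zero[where B = "1 + cmod \<kappa>"])
      show "cmod (f \<omega>) \<le> 1 + cmod \<kappa>" for \<omega>
        unfolding f_def using w1[of k \<omega>] E1[of \<omega>] by (intro order_trans[OF norm_triangle_ineq4]) (simp add: norm_mult)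
      show "f \<in> borel_measurable M" unfolding f_def by measurable
    qed auto
    also have "(CLINT \<omega>|M. f \<omega> * indicator (A k) (Z k \<omega>)) = (CLINT \<omega>|M. w (Suc k) \<omega> * E \<omega> - \<kappa> * indicator (A k) (Z k \<omega>))"
      by (intro Bochner_Integration.integral_cong refl) (simp add: f_def w_def algebra_simps)
    also have "\<dots> = (CLINT \<omega>|M. w (Suc k) \<omega> * E \<omega>) - \<kappa> * prob (Z k -` A k \<inter> space M)"
    proof -
      have "w (Suc k) \<in> borel_measurable M" using wm Suc by simp
      then have i1: "integrable M (\<lambda>\<omega>. w (Suc k) \<omega> * E \<omega>)"
        by (intro integrable_const_bound[of _ 1]) (use w1 E1 in \<open>auto simp: norm_mult\<close>)
      have "indicator (A k) (Z k \<omega>) = (indicator (Z k -` A k \<inter> space M) \<omega> :: complex)" if "\<omega> \<in> space M" for \<omega>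
        using that by (auto simp: indicator_def)
      then have "(CLINT \<omega>|M. indicator (A k) (Z k \<omega>)) = (CLINT \<omega>|M. indicator (Z k -` A k \<inter> space M) \<omega>)"
        by (intro Bochner_Integration.integral_cong refl) auto
      also have "\<dots> = prob (Z k -` A k \<inter> space M)" by (intro complex_integral_indicator) simp
      finally have i2: "(CLINT \<omega>|M. indicator (A k) (Z k \<omega>)) = prob (Z k -` A k \<inter> space M)" .
      have "integrable M (\<lambda>\<omega>. \<kappa> * indicator (A k) (Z k \<omega>))"
        by (rule integrable_const_bound[of _ "cmod \<kappa>"]) (auto simp: norm_mult indicator_def)
      with i1 i2 show ?thesis by simp
    qed
    finally show ?case unfolding E_def \<kappa>_def pr_def by (simp add: mult_ac)
  qed
  have "complex_of_real (prob {\<omega> \<in> space M. \<forall>j<n. Z j \<omega> \<in> A j}) = (CLINT \<omega>|M. w n \<omega>)"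
  proof -
    have "{\<omega> \<in> space M. \<forall>j<n. Z j \<omega> \<in> A j} = space M \<inter> (\<Inter>j\<in>{..<n}. {\<omega> \<in> space M. Z j \<omega> \<in> A j})" by auto
    also have "\<dots> \<in> sets M"
    proof (cases "n = 0")
      case False
      then show ?thesis using A Z by (intro sets.Int sets.finite_INT) auto
    qed simp
    finally have S: "{\<omega> \<in> space M. \<forall>j<n. Z j \<omega> \<in> A j} \<in> sets M" .
    have "w n \<omega> = indicator {\<omega> \<in> space M. \<forall>j<n. Z j \<omega> \<in> A j} \<omega>" if "\<omega> \<in> space M" for \<omega>
      unfolding w_def using that by (auto simp: indicator_def intro!: prod.neutral prod_zero)
    then have "(CLINT \<omega>|M. w n \<omega>) = (CLINT \<omega>|M. indicator {\<omega> \<in> space M. \<forall>j<n. Z j \<omega> \<in> A j} \<omega>)"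
      by (intro Bochner_Integration.integral_cong refl) auto
    also have "\<dots> = prob {\<omega> \<in> space M. \<forall>j<n. Z j \<omega> \<in> A j}" 
      using S by (rule complex_integral_indicator)
    finally show ?thesis by simp
  qed
  also have "\<dots> = pr n" using H[of n "\<lambda>_. 0"] by simp
  finally show ?thesis unfolding pr_def by (simp only: of_real_eq_iff)
qed

text \<open>One formula covers the degenerate alternative of \<open>centered_gaussian\<close> too,
  with second moment 0. Thus covariances alone will determine joint characteristic
  functions.\<close>

lemma (in prob_space) centered_gaussian_char:
  assumes X: "centered_gaussian M X"
  shows "(CLINT \<omega>|M. iexp (X \<omega>)) = complex_of_real (exp (- (\<integral>\<omega>. (X \<omega>)\<^sup>2 \<partial>M) / 2))"
proof -
  have [measurable]: "X \<in> borel_measurable M" using X unfolding centered_gaussian_def by auto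
  consider \<sigma> where "\<sigma> > 0" "distributed M lborel X (normal_density 0 \<sigma>)" | "AE \<omega> in M. X \<omega> = 0"
    using X unfolding centered_gaussian_def by auto
  then show ?thesis
  proof cases
    case (1 \<sigma>)
    have "(\<integral>\<omega>. (X \<omega>)\<^sup>2 \<partial>M) = (\<integral>x. normal_density 0 \<sigma> x * x\<^sup>2 \<partial>lborel)"
      by (rule distributed_integral[OF 1(2), symmetric]) auto
    also have "\<dots> = \<sigma>\<^sup>2" using integral_normal_moment_even[OF 1(1), of 0 1] 1(1)
      by (simp add: power2_eq_square)
    finally have var: "(\<integral>\<omega>. (X \<omega>)\<^sup>2 \<partial>M) = \<sigma>\<^sup>2" .
    have "distributed M lborel (\<lambda>x. X x / \<sigma>) std_normal_density"
      using 1(2) normal_standard_normal_convert[OF 1(1), of X 0] by simp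
    then have d: "distr M lborel (\<lambda>x. X x / \<sigma>) = std_normal_distribution"
      by (simp add: distributed_distr_eq_density)
    have "(CLINT \<omega>|M. iexp (X \<omega>)) = (CLINT \<omega>|M. iexp (\<sigma> * (X \<omega> / \<sigma>)))" using 1 by simp
    also have "\<dots> = (CLINT x|distr M lborel (\<lambda>x. X x / \<sigma>). iexp (\<sigma> * x))"
      by (subst integral_distr) auto
    also have "\<dots> = char std_normal_distribution \<sigma>" unfolding d char_def ..
    finally show ?thesis unfolding char_std_normal_distribution var .
  next
    case 2
    have "(CLINT \<omega>|M. iexp (X \<omega>)) = (CLINT \<omega>|M. 1)"
      by (rule integral_cong_AE) (use 2 in auto)
    moreover have "(\<integral>\<omega>. (X \<omega>)\<^sup>2 \<partial>M) = (\<integral>\<omega>. 0 \<partial>M)"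
      by (rule integral_cong_AE) (use 2 in auto)
    ultimately show ?thesis by (simp add: prob_space)
  qed
qed

text \<open>The increments of all time steps and all directions are lined up in a single sequence.
  \<open>G j\<close> is the information available just before \<open>g j\<close>, and
  \<open>g j\<close> becomes known at \<open>Suc j\<close>; this is the form in which both the UMD
  inequality and the moment inequality are applied.\<close>

definition gauss_seq :: "'w measure \<Rightarrow> (nat \<Rightarrow> 'w measure) \<Rightarrow> (nat \<Rightarrow> 'w \<Rightarrow> real) \<Rightarrow> (nat \<Rightarrow> real) \<Rightarrow> nat \<Rightarrow> bool" where
  "gauss_seq M G g \<sigma> n \<longleftrightarrow> (\<forall>j. subalgebra M (G j)) \<and> (\<forall>i j. i \<le> j \<longrightarrow> sets (G i) \<subseteq> sets (G j)) \<and>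
     (\<forall>j<n. g j \<in> borel_measurable (G (Suc j)) \<and> 0 < \<sigma> j \<and> distributed M lborel (g j) (normal_density 0 (\<sigma> j)) \<and>
        (\<forall>A\<in>sets (G j). \<forall>B\<in>sets borel. measure M (A \<inter> (g j -` B \<inter> space M)) = measure M A * measure M (g j -` B \<inter> space M)))"

text \<open>A class closed under sums and products, as plain integrability is not. Even exponents
  avoid absolute values.\<close>

definition all_moments :: "'w measure \<Rightarrow> ('w \<Rightarrow> real) \<Rightarrow> bool" where
  "all_moments M f \<longleftrightarrow> f \<in> borel_measurable M \<and> (\<forall>k::nat. integrable M (\<lambda>\<omega>. (f \<omega>) ^ (2 * k)))"

section \<open>Moments and products along a Gaussian sequence\<close>

context prob_space begin

lemma all_moments_integrable:
  assumes "all_moments M f" shows "integrable M f"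
proof (rule Bochner_Integration.integrable_bound)
  have "integrable M (\<lambda>\<omega>. (f \<omega>) ^ (2 * 1))"
    using assms[unfolded all_moments_def, THEN conjunct2, THEN spec, of 1] .
  then show "integrable M (\<lambda>\<omega>. 1 + (f \<omega>) ^ (2 * 1))" by (intro Bochner_Integration.integrable_add) auto
  show "AE \<omega> in M. norm (f \<omega>) \<le> norm (1 + (f \<omega>) ^ (2 * 1))"
  proof (rule AE_I2)
    fix \<omega>
    have "0 \<le> (\<bar>f \<omega>\<bar> - 1)\<^sup>2" by simp
    then have "\<bar>f \<omega>\<bar> \<le> 1 + (f \<omega>)\<^sup>2" by (simp add: power2_diff)
    then show "norm (f \<omega>) \<le> norm (1 + (f \<omega>) ^ (2 * 1))" by simp
  qed
qed (use assms in \<open>auto simp: all_moments_def\<close>)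

lemma all_moments_add:
  assumes f: "all_moments M f" and g: "all_moments M g"
  shows "all_moments M (\<lambda>\<omega>. f \<omega> + g \<omega>)"
  unfolding all_moments_def
proof (intro conjI allI)
  have [measurable]: "f \<in> borel_measurable M" "g \<in> borel_measurable M" using f g unfolding all_moments_def by auto
  show "(\<lambda>\<omega>. f \<omega> + g \<omega>) \<in> borel_measurable M" by measurable
  fix k :: nat
  show "integrable M (\<lambda>\<omega>. (f \<omega> + g \<omega>) ^ (2 * k))"
  proof (rule Bochner_Integration.integrable_bound)
    show "integrable M (\<lambda>\<omega>. 2 ^ (2 * k) * ((f \<omega>) ^ (2 * k) + (g \<omega>) ^ (2 * k)))"
      using f g unfolding all_moments_def by auto
    show "AE \<omega> in M. norm ((f \<omega> + g \<omega>) ^ (2 * k)) \<le> norm (2 ^ (2 * k) * ((f \<omega>) ^ (2 * k) + (g \<omega>) ^ (2 * k)))"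
    proof (rule AE_I2)
      fix \<omega>
      define m where "m = max \<bar>f \<omega>\<bar> \<bar>g \<omega>\<bar>"
      have "\<bar>f \<omega> + g \<omega>\<bar> ^ (2 * k) \<le> (2 * m) ^ (2 * k)" by (rule power_mono) (auto simp: m_def)
      also have "\<dots> = 2 ^ (2 * k) * m ^ (2 * k)" by (simp add: power_mult_distrib)
      also have "\<dots> \<le> 2 ^ (2 * k) * (\<bar>f \<omega>\<bar> ^ (2 * k) + \<bar>g \<omega>\<bar> ^ (2 * k))"
        unfolding m_def by (intro mult_left_mono) (auto simp: max_def)
      finally show "norm ((f \<omega> + g \<omega>) ^ (2 * k)) \<le> norm (2 ^ (2 * k) * ((f \<omega>) ^ (2 * k) + (g \<omega>) ^ (2 * k)))"
        by (simp add: power_abs abs_mult power_even_abs)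
    qed
  qed measurable
qed

lemma all_moments_mult:
  assumes f: "all_moments M f" and g: "all_moments M g"
  shows "all_moments M (\<lambda>\<omega>. f \<omega> * g \<omega>)"
  unfolding all_moments_def
proof (intro conjI allI)
  have [measurable]: "f \<in> borel_measurable M" "g \<in> borel_measurable M" using f g unfolding all_moments_def by auto
  show "(\<lambda>\<omega>. f \<omega> * g \<omega>) \<in> borel_measurable M" by measurable
  fix k :: nat
  show "integrable M (\<lambda>\<omega>. (f \<omega> * g \<omega>) ^ (2 * k))"
  proof (rule Bochner_Integration.integrable_bound)
    show "integrable M (\<lambda>\<omega>. (f \<omega>) ^ (2 * (2 * k)) + (g \<omega>) ^ (2 * (2 * k)))"
      using f[unfolded all_moments_def, THEN conjunct2, THEN spec, of "2 * k"]
        g[unfolded all_moments_def, THEN conjunct2, THEN spec, of "2 * k"]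
      by (intro Bochner_Integration.integrable_add)
    show "AE \<omega> in M. norm ((f \<omega> * g \<omega>) ^ (2 * k)) \<le> norm ((f \<omega>) ^ (2 * (2 * k)) + (g \<omega>) ^ (2 * (2 * k)))"
    proof (rule AE_I2)
      fix \<omega>
      define a b where "a = (f \<omega>) ^ (2 * k)" and "b = (g \<omega>) ^ (2 * k)"
      have "2 * a * b \<le> a\<^sup>2 + b\<^sup>2" by (rule sum_squares_bound)
      moreover have ab: "0 \<le> a" "0 \<le> b" unfolding a_def b_def by (auto simp: power_mult)
      then have "0 \<le> a * b" by simp
      ultimately have "a * b \<le> a\<^sup>2 + b\<^sup>2" "0 \<le> a * b" by auto
      moreover have "(f \<omega>) ^ (2 * (2 * k)) = a\<^sup>2" "(g \<omega>) ^ (2 * (2 * k)) = b\<^sup>2"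
        unfolding a_def b_def by (simp_all flip: power_mult add: mult_ac)
      ultimately show "norm ((f \<omega> * g \<omega>) ^ (2 * k)) \<le> norm ((f \<omega>) ^ (2 * (2 * k)) + (g \<omega>) ^ (2 * (2 * k)))"
        by (simp add: power_mult_distrib a_def[symmetric] b_def[symmetric])
    qed
  qed measurable
qed

lemma all_moments_bounded:
  assumes [measurable]: "f \<in> borel_measurable M" and B: "\<And>\<omega>. \<bar>f \<omega>\<bar> \<le> B"
  shows "all_moments M f"
  unfolding all_moments_def
proof (intro conjI allI)
  show "integrable M (\<lambda>\<omega>. (f \<omega>) ^ (2 * k))" for k
  proof (rule integrable_const_bound[of _ "B ^ (2 * k)"])
    show "AE \<omega> in M. norm (f \<omega> ^ (2 * k)) \<le> B ^ (2 * k)"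
      unfolding real_norm_def power_abs by (intro AE_I2 power_mono B) simp
  qed measurable
qed measurable

lemma all_moments_power:
  assumes f: "all_moments M f" shows "all_moments M (\<lambda>\<omega>. f \<omega> ^ k)"
proof (induction k)
  case 0 then show ?case by (auto intro: all_moments_bounded[of _ 1])
next
  case (Suc k) then show ?case using all_moments_mult[OF f] by simp
qed

lemma all_moments_sum:
  assumes "\<And>i. i \<in> I \<Longrightarrow> all_moments M (f i)"
  shows "all_moments M (\<lambda>\<omega>. \<Sum>i\<in>I. f i \<omega>)"
  using assms
proof (induction I rule: infinite_finite_induct)
  case (insert x F)
  then show ?case using all_moments_add[of "f x" "\<lambda>\<omega>. \<Sum>i\<in>F. f i \<omega>"] by simp
qed (auto intro: all_moments_bounded[of _ 0])

lemma gaussian_even_moment: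
  assumes X: "distributed M lborel X (normal_density 0 \<sigma>)" and \<sigma>: "0 < \<sigma>"
  shows "has_bochner_integral M (\<lambda>\<omega>. X \<omega> ^ (2 * k)) (fact (2 * k) / (2 ^ k * fact k) * \<sigma> ^ (2 * k))"
proof -
  have "integrable M (\<lambda>\<omega>. X \<omega> ^ (2 * k))"
    using distributed_integrable[OF X, of "\<lambda>x. x ^ (2 * k)"] integrable_normal_moment[OF \<sigma>, of 0 "2 * k"] by simp
  moreover have "(\<integral>\<omega>. X \<omega> ^ (2 * k) \<partial>M) = (\<integral>x. normal_density 0 \<sigma> x * x ^ (2 * k) \<partial>lborel)"
    using distributed_integral[OF X, of "\<lambda>x. x ^ (2 * k)"] by simp
  moreover have "(\<integral>x. normal_density 0 \<sigma> x * x ^ (2 * k) \<partial>lborel) = fact (2 * k) / (2 ^ k * fact k) * \<sigma> ^ (2 * k)"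
    using integral_normal_moment_even[OF \<sigma>, of 0 k] \<sigma> by (simp add: power_divide power_mult)
  ultimately show ?thesis by (simp add: has_bochner_integral_iff)
qed

lemma gaussian_mean_zero:
  assumes X: "distributed M lborel X (normal_density 0 \<sigma>)" and \<sigma>: "0 < \<sigma>"
  shows "(\<integral>\<omega>. X \<omega> \<partial>M) = 0"
  using distributed_integral[OF X, of "\<lambda>x. x"] integral_normal_moment_nz_1[OF \<sigma>, of 0] by simp

lemma gauss_seq_all_moments:
  assumes "gauss_seq M G g \<sigma> n" "j < n" shows "all_moments M (g j)"
  unfolding all_moments_def
proof (intro conjI allI)
  have d: "distributed M lborel (g j) (normal_density 0 (\<sigma> j))" "0 < \<sigma> j" using assms unfolding gauss_seq_def by auto
  show "g j \<in> borel_measurable M" using distributed_measurable[OF d(1)] by simp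
  show "integrable M (\<lambda>\<omega>. (g j \<omega>) ^ (2 * k))" for k
    using gaussian_even_moment[OF d, of k] by (simp add: has_bochner_integral_iff)
qed

text \<open>Independence is given on events only; it extends to \<open>X\<close> and
  \<open>h (g j)\<close> because preimages of Borel sets form Int-stable generators. The factor
  \<open>X\<close> may be unbounded, as happens when it contains powers of the martingale.\<close>

lemma gauss_seq_integral_mult:
  fixes X :: "'a \<Rightarrow> real" and h :: "real \<Rightarrow> real"
  assumes G: "gauss_seq M G g \<sigma> n" and j: "j < n" and X: "X \<in> borel_measurable (G j)" "integrable M X"
    and [measurable]: "h \<in> borel_measurable borel" and h: "integrable M (\<lambda>\<omega>. h (g j \<omega>))"
  shows "(\<integral>\<omega>. X \<omega> * h (g j \<omega>) \<partial>M) = (\<integral>\<omega>. X \<omega> \<partial>M) * (\<integral>\<omega>. h (g j \<omega>) \<partial>M)"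
    "integrable M (\<lambda>\<omega>. X \<omega> * h (g j \<omega>))"
proof -
  have sub: "subalgebra M (G j)" and gd: "distributed M lborel (g j) (normal_density 0 (\<sigma> j))"
    and ind: "\<And>A B. A \<in> sets (G j) \<Longrightarrow> B \<in> sets borel \<Longrightarrow> prob (A \<inter> (g j -` B \<inter> space M)) = prob A * prob (g j -` B \<inter> space M)"
    using G j unfolding gauss_seq_def by auto
  have gm [measurable]: "g j \<in> borel_measurable M" using distributed_measurable[OF gd] by simp
  have Xm [measurable]: "X \<in> borel_measurable M" using measurable_from_subalg[OF sub X(1)] .
  have spG: "space (G j) = space M" using sub unfolding subalgebra_def by auto
  have "indep_var borel X borel (\<lambda>\<omega>. h (g j \<omega>))"
    unfolding indep_var_eq
  proof (intro conjI indep_set_sigma_sets)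
    show "indep_set {X -` A \<inter> space M |A. A \<in> sets borel} {(\<lambda>\<omega>. h (g j \<omega>)) -` A \<inter> space M |A. A \<in> sets borel}"
    proof (rule indep_setI; safe)
      fix A B :: "real set" assume [measurable]: "A \<in> sets borel" "B \<in> sets borel"
      have "X -` A \<inter> space M \<in> sets (G j)" using measurable_sets[OF X(1), of A] spG by simp
      moreover have "(\<lambda>\<omega>. h (g j \<omega>)) -` B \<inter> space M = g j -` (h -` B) \<inter> space M" by auto
      moreover have "h -` B \<in> sets borel" using measurable_sets[of h borel borel B] by simp
      ultimately show "prob ((X -` A \<inter> space M) \<inter> ((\<lambda>\<omega>. h (g j \<omega>)) -` B \<inter> space M)) = prob (X -` A \<inter> space M) * prob ((\<lambda>\<omega>. h (g j \<omega>)) -` B \<inter> space M)"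
        using ind by simp
    next
      fix A :: "real set" assume [measurable]: "A \<in> sets borel"
      show "X -` A \<inter> space M \<in> sets M" "(\<lambda>\<omega>. h (g j \<omega>)) -` A \<inter> space M \<in> sets M" by measurable
    qed
    show "Int_stable {X -` A \<inter> space M |A. A \<in> sets borel}"
    proof (rule Int_stableI, safe)
      fix A B :: "real set" assume "A \<in> sets borel" "B \<in> sets borel"
      then show "\<exists>C. X -` A \<inter> space M \<inter> (X -` B \<inter> space M) = X -` C \<inter> space M \<and> C \<in> sets borel"
        by (intro exI[of _ "A \<inter> B"]) auto
    qed
    show "Int_stable {(\<lambda>\<omega>. h (g j \<omega>)) -` A \<inter> space M |A. A \<in> sets borel}"
    proof (rule Int_stableI, safe)
      fix A B :: "real set" assume "A \<in> sets borel" "B \<in> sets borel"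
      then show "\<exists>C. (\<lambda>\<omega>. h (g j \<omega>)) -` A \<inter> space M \<inter> ((\<lambda>\<omega>. h (g j \<omega>)) -` B \<inter> space M) = (\<lambda>\<omega>. h (g j \<omega>)) -` C \<inter> space M \<and> C \<in> sets borel"
        by (intro exI[of _ "A \<inter> B"]) auto
    qed
  qed measurable
  from indep_var_lebesgue_integral[OF this X(2) h] indep_var_integrable[OF this X(2) h]
  show "(\<integral>\<omega>. X \<omega> * h (g j \<omega>) \<partial>M) = (\<integral>\<omega>. X \<omega> \<partial>M) * (\<integral>\<omega>. h (g j \<omega>) \<partial>M)"
    "integrable M (\<lambda>\<omega>. X \<omega> * h (g j \<omega>))" .
qed

lemma all_moments_powr_abs:
  assumes f: "all_moments M f" and p: "0 < p"
  shows "integrable M (\<lambda>\<omega>. \<bar>f \<omega>\<bar> powr p)"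
proof -
  obtain k :: nat where k: "p \<le> real k" using real_arch_simple by blast
  have [measurable]: "f \<in> borel_measurable M" using f unfolding all_moments_def by auto
  show ?thesis
  proof (rule Bochner_Integration.integrable_bound)
    show "integrable M (\<lambda>\<omega>. 1 + (f \<omega>) ^ (2 * k))"
      using f[unfolded all_moments_def, THEN conjunct2, THEN spec, of k]
      by (intro Bochner_Integration.integrable_add) auto
    show "AE \<omega> in M. norm (\<bar>f \<omega>\<bar> powr p) \<le> norm (1 + (f \<omega>) ^ (2 * k))"
    proof (rule AE_I2)
      fix \<omega>
      have "\<bar>f \<omega>\<bar> powr p \<le> 1 + \<bar>f \<omega>\<bar> ^ (2 * k)"
      proof (cases "\<bar>f \<omega>\<bar> \<le> 1")
        case True
        then have "\<bar>f \<omega>\<bar> powr p \<le> 1" using p by (intro powr_le1) auto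
        then show ?thesis by (simp add: add_increasing2)
      next
        case False
        then have "\<bar>f \<omega>\<bar> powr p \<le> \<bar>f \<omega>\<bar> powr real (2 * k)" using k p by (intro powr_mono) auto
        also have "\<dots> = \<bar>f \<omega>\<bar> ^ (2 * k)" using False by (intro powr_realpow) auto
        finally show ?thesis by simp
      qed
      then show "norm (\<bar>f \<omega>\<bar> powr p) \<le> norm (1 + (f \<omega>) ^ (2 * k))" by (simp add: power_even_abs)
    qed
  qed measurable
qed

end

text \<open>In the binomial expansion the terms of order 2 and higher in \<open>h\<close> have mixed
  factors \<open>\<bar>h\<bar> ^ k * \<bar>x\<bar> ^ (N - k)\<close>, each dominated by one of its
  two extremes according to which of \<open>\<bar>h\<bar>\<close>, \<open>\<bar>x\<bar>\<close> is
  larger. \<open>C\<close> is the sum of their binomial coefficients.\<close>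

lemma even_power_add_upper:
  fixes n :: nat
  assumes n: "1 \<le> n"
  obtains C :: real where "0 \<le> C"
    "\<And>x h. (x + h) ^ (2 * n) \<le> x ^ (2 * n) + real (2 * n) * x ^ (2 * n - 1) * h + C * (x ^ (2 * n - 2) * h\<^sup>2 + h ^ (2 * n))"
proof -
  define N where "N = 2 * n - 2"
  have N: "2 * n = Suc (Suc N)" "2 * n - 1 = Suc N" "2 * n - 2 = N" and ev: "even N" using n unfolding N_def by auto
  define C where "C = (\<Sum>k\<le>N. real (Suc (Suc N) choose Suc (Suc k)))"
  show thesis
  proof
    show "0 \<le> C" unfolding C_def by (intro sum_nonneg) auto
    fix x h :: real
    have trm: "h ^ Suc (Suc k) * x ^ (N - k) \<le> x ^ N * h\<^sup>2 + h ^ Suc (Suc N)" if k: "k \<le> N" for k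
    proof -
      have "h ^ Suc (Suc k) * x ^ (N - k) \<le> \<bar>h ^ Suc (Suc k) * x ^ (N - k)\<bar>" by simp
      also have "\<dots> = \<bar>h\<bar> ^ k * \<bar>x\<bar> ^ (N - k) * \<bar>h\<bar>\<^sup>2" by (simp add: abs_mult power_abs power2_eq_square mult_ac)
      also have "\<dots> \<le> \<bar>x\<bar> ^ N * \<bar>h\<bar>\<^sup>2 + \<bar>h\<bar> ^ N * \<bar>h\<bar>\<^sup>2"
      proof (cases "\<bar>h\<bar> \<le> \<bar>x\<bar>")
        case True
        have "\<bar>h\<bar> ^ k * \<bar>x\<bar> ^ (N - k) \<le> \<bar>x\<bar> ^ k * \<bar>x\<bar> ^ (N - k)" using True by (intro mult_right_mono power_mono) auto
        also have "\<dots> = \<bar>x\<bar> ^ N" using k by (simp flip: power_add)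
        finally have "\<bar>h\<bar> ^ k * \<bar>x\<bar> ^ (N - k) * \<bar>h\<bar>\<^sup>2 \<le> \<bar>x\<bar> ^ N * \<bar>h\<bar>\<^sup>2"
          by (rule mult_right_mono) simp
        moreover have "0 \<le> \<bar>h\<bar> ^ N * \<bar>h\<bar>\<^sup>2" by simp
        ultimately show ?thesis by linarith
      next
        case False
        have "\<bar>h\<bar> ^ k * \<bar>x\<bar> ^ (N - k) \<le> \<bar>h\<bar> ^ k * \<bar>h\<bar> ^ (N - k)" using False by (intro mult_left_mono power_mono) auto
        also have "\<dots> = \<bar>h\<bar> ^ N" using k by (simp flip: power_add)
        finally have "\<bar>h\<bar> ^ k * \<bar>x\<bar> ^ (N - k) * \<bar>h\<bar>\<^sup>2 \<le> \<bar>h\<bar> ^ N * \<bar>h\<bar>\<^sup>2"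
          by (rule mult_right_mono) simp
        moreover have "0 \<le> \<bar>x\<bar> ^ N * \<bar>h\<bar>\<^sup>2" by simp
        ultimately show ?thesis by linarith
      qed
      also have "\<dots> = x ^ N * h\<^sup>2 + h ^ Suc (Suc N)"
        using ev by (simp add: power_even_abs power2_eq_square mult_ac)
      finally show ?thesis .
    qed
    have "(x + h) ^ (2 * n) = (\<Sum>k\<le>Suc (Suc N). of_nat (Suc (Suc N) choose k) * h ^ k * x ^ (Suc (Suc N) - k))"
      unfolding N(1) by (subst add.commute) (rule binomial_ring)
    also have "\<dots> = x ^ Suc (Suc N) + real (Suc (Suc N)) * h * x ^ Suc N
        + (\<Sum>k\<le>N. real (Suc (Suc N) choose Suc (Suc k)) * (h ^ Suc (Suc k) * x ^ (N - k)))"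
      by (subst sum.atMost_Suc_shift, subst sum.atMost_Suc_shift) (simp add: mult.assoc)
    also have "(\<Sum>k\<le>N. real (Suc (Suc N) choose Suc (Suc k)) * (h ^ Suc (Suc k) * x ^ (N - k)))
        \<le> (\<Sum>k\<le>N. real (Suc (Suc N) choose Suc (Suc k)) * (x ^ N * h\<^sup>2 + h ^ Suc (Suc N)))"
      using trm by (intro sum_mono mult_left_mono) auto
    also have "\<dots> = C * (x ^ N * h\<^sup>2 + h ^ Suc (Suc N))" unfolding C_def by (rule sum_distrib_right[symmetric])
    finally show "(x + h) ^ (2 * n) \<le> x ^ (2 * n) + real (2 * n) * x ^ (2 * n - 1) * h + C * (x ^ (2 * n - 2) * h\<^sup>2 + h ^ (2 * n))"
      unfolding N by (simp add: mult_ac)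
  qed
qed

text \<open>The tangent of a convex even power. For \<open>k = 0\<close> both sides are 1; that case
  occurs below when \<open>n = 1\<close>.\<close>

lemma even_power_add_lower:
  fixes x h :: real
  shows "x ^ (2 * k) + real (2 * k) * x ^ (2 * k - 1) * h \<le> (x + h) ^ (2 * k)"
proof -
  have "((\<lambda>x. x ^ (2 * k)) has_real_derivative real (2 * k) * x ^ (2 * k - 1)) (at x within UNIV)"
    by (auto intro!: derivative_eq_intros)
  from convex_on_imp_above_tangent[OF convex_power_even[of "2 * k"] _ _ _ this, of "x + h"]
  show ?thesis by simp
qed

text \<open>A discrete form of \<open>d(q^r) = r q^(r-1) dq\<close> with the power taken at the
  right end \<open>q + s\<close>. For \<open>r \<ge> 1\<close> the constant is 1 by monotonicity;
  for \<open>r < 1\<close> it is \<open>r\<close> by the mean value theorem, because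
  \<open>z powr (r - 1)\<close> decreases.\<close>

lemma powr_add_increment:
  fixes q s r :: real
  assumes "0 < q" "0 \<le> s" "0 < r"
  shows "min 1 r * (s * (q + s) powr (r - 1)) \<le> (q + s) powr r - q powr r"
proof (cases "1 \<le> r")
  case True
  have "q powr r = q * q powr (r - 1)" using assms powr_add[of q 1 "r - 1"] by simp
  also have "\<dots> \<le> q * (q + s) powr (r - 1)" using assms True by (intro mult_left_mono powr_mono2) auto
  also have "\<dots> = (q + s) powr r - s * (q + s) powr (r - 1)"
    using assms powr_add[of "q + s" 1 "r - 1"] by (simp add: algebra_simps)
  finally show ?thesis using True by (simp add: min_absorb1)
next
  case False
  show ?thesis
  proof (cases "s = 0")
    case s: False
    then have "q < q + s" using assms by simp
    moreover have "((\<lambda>x. x powr r) has_real_derivative r * x powr (r - 1)) (at x)" if "q \<le> x" for x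
      using assms that by (auto intro!: derivative_eq_intros)
    ultimately have "\<exists>z>q. z < q + s \<and> (q + s) powr r - q powr r = (q + s - q) * (r * z powr (r - 1))"
      by (intro MVT2) auto
    then obtain z where z: "q < z" "z < q + s" "(q + s) powr r - q powr r = s * (r * z powr (r - 1))"
      by auto
    have "(q + s) powr (r - 1) \<le> z powr (r - 1)" using z assms False by (intro powr_mono2') auto
    then have "s * (r * (q + s) powr (r - 1)) \<le> s * (r * z powr (r - 1))" using assms by (intro mult_left_mono) auto
    then show ?thesis unfolding z(3) using False by (simp add: min_absorb2 mult_ac)
  qed simp
qed

section \<open>The moment inequality for Gaussian martingale transforms\<close>

context prob_space begin

text \<open>\<open>f\<close> is the martingale and \<open>q\<close> its regularised bracket. A second-order expansion of
  \<open>f\<^sup>2\<^sup>n q\<^sup>m\<^sup>-\<^sup>n\<close> costs \<open>f\<^sup>2\<^sup>n\<^sup>-\<^sup>2\<close> times the increment of \<open>q\<^sup>r\<close> and a multiple of the increment of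
  \<open>q\<^sup>m\<close>; the two subtracted terms of \<open>U\<close> compensate for these.\<close>

lemma ito_supermartingale:
  fixes y :: "nat \<Rightarrow> 'a \<Rightarrow> real" and m \<delta> :: real
  assumes G: "gauss_seq M G g \<sigma> K"
    and ym: "\<And>j. j < K \<Longrightarrow> y j \<in> borel_measurable (G j)" and yB: "\<And>j \<omega>. j < K \<Longrightarrow> \<bar>y j \<omega>\<bar> \<le> B"
    and n: "1 \<le> n" and m: "real n - 1 < m" "m \<le> real n" and \<delta>: "0 < \<delta>"
    and C: "0 \<le> C" "\<And>x h. (x + h) ^ (2 * n) \<le> x ^ (2 * n) + real (2 * n) * x ^ (2 * n - 1) * h + C * (x ^ (2 * n - 2) * h\<^sup>2 + h ^ (2 * n))"
    and k: "k \<le> K"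
  defines "f \<equiv> \<lambda>k \<omega>. \<Sum>j<k. g j \<omega> * y j \<omega>" and "q \<equiv> \<lambda>k \<omega>. \<delta> + (\<Sum>j<k. (\<sigma> j * y j \<omega>)\<^sup>2)"
    and "r \<equiv> m - real n + 1" and "\<mu> \<equiv> fact (2 * n) / (2 ^ n * fact n)"
  defines "U \<equiv> \<lambda>k \<omega>. f k \<omega> ^ (2 * n) * q k \<omega> powr (m - real n) - C / r * (f k \<omega> ^ (2 * n - 2) * q k \<omega> powr r)
      - C * \<mu> / min 1 m * q k \<omega> powr m"
  shows "all_moments M (U k) \<and> (\<integral>\<omega>. U k \<omega> \<partial>M) \<le> 0"
proof -
  have r: "0 < r" "r \<le> 1" using m unfolding r_def by auto
  have m0: "0 < m" "0 < min 1 m" using m n by auto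
  have \<mu>: "0 \<le> \<mu>" unfolding \<mu>_def by simp
  have sub: "subalgebra M (G j)" for j using G unfolding gauss_seq_def by auto
  have subG: "subalgebra (G j) (G i)" if "i \<le> j" for i j
    using G that sub[of i] sub[of j] unfolding gauss_seq_def subalgebra_def by auto
  have ymM: "y j \<in> borel_measurable (G i)" if "j \<le> i" "j < K" for i j
    using measurable_from_subalg[OF subG ym] that by auto
  have gm: "g j \<in> borel_measurable (G i)" if "j < i" "j < K" for i j
  proof -
    have "g j \<in> borel_measurable (G (Suc j))" using G that unfolding gauss_seq_def by blast
    then show ?thesis using measurable_from_subalg[OF subG[of "Suc j" i]] that by simp
  qed
  have yM: "all_moments M (y j)" if "j < K" for j
    using that yB measurable_from_subalg[OF sub ym] by (intro all_moments_bounded[of _ B]) auto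
  have gM: "all_moments M (g j)" if "j < K" for j using gauss_seq_all_moments[OF G that] .
  have fG: "f k \<in> borel_measurable (G k)" if "k \<le> K" for k
    unfolding f_def using that by (intro borel_measurable_sum borel_measurable_times gm ymM) auto
  have fM: "all_moments M (f k)" if "k \<le> K" for k
    unfolding f_def using that by (intro all_moments_sum all_moments_mult gM yM) auto
  \<comment> \<open>The bracket is predictable: its increment at step \<open>k\<close> uses
    \<open>y k\<close> but not \<open>g k\<close>. Coefficients with \<open>q (Suc k)\<close> can
    therefore be taken out when averaging over \<open>g k\<close>.\<close>
  have qG: "q (Suc k) \<in> borel_measurable (G k)" if "k < K" for k
    unfolding q_def using that by (intro borel_measurable_add borel_measurable_sum borel_measurable_power borel_measurable_times ymM) auto
  have qM: "q k \<in> borel_measurable M" if "k \<le> K" for k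
    unfolding q_def using that measurable_from_subalg[OF sub ym]
    by (intro borel_measurable_add borel_measurable_sum borel_measurable_power borel_measurable_times) auto
  have q\<delta>: "\<delta> \<le> q k \<omega>" for k \<omega> unfolding q_def by (simp add: sum_nonneg)
  have q0: "0 < q k \<omega>" for k \<omega> using q\<delta> \<delta> by (rule order_less_le_trans[rotated])
  define Q where "Q = \<delta> + (\<Sum>j<K. (\<sigma> j)\<^sup>2 * B\<^sup>2)"
  have qQ: "q k \<omega> \<le> Q" if "k \<le> K" for k \<omega>
  proof -
    have "(\<Sum>j<k. (\<sigma> j * y j \<omega>)\<^sup>2) \<le> (\<Sum>j<k. (\<sigma> j)\<^sup>2 * B\<^sup>2)"
    proof (rule sum_mono)
      fix j assume "j \<in> {..<k}"
      then have "\<bar>y j \<omega>\<bar> \<le> B" using yB that by auto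
      then have "(y j \<omega>)\<^sup>2 \<le> B\<^sup>2" by (metis abs_ge_zero power2_abs power_mono)
      then show "(\<sigma> j * y j \<omega>)\<^sup>2 \<le> (\<sigma> j)\<^sup>2 * B\<^sup>2" by (simp add: power_mult_distrib mult_left_mono)
    qed
    also have "\<dots> \<le> (\<Sum>j<K. (\<sigma> j)\<^sup>2 * B\<^sup>2)" using that by (intro sum_mono2) auto
    finally show ?thesis unfolding q_def Q_def by simp
  qed
  \<comment> \<open>Since \<open>q\<close> stays between \<open>\<delta>\<close> and
    \<open>Q\<close>, its negative powers are bounded as well; this is the purpose of the
    regularisation.\<close>
  have qp: "all_moments M (\<lambda>\<omega>. q k \<omega> powr e)" if "k \<le> K" for k e
  proof (rule all_moments_bounded)
    show "(\<lambda>\<omega>. q k \<omega> powr e) \<in> borel_measurable M" using qM[OF that] by measurable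
    show "\<bar>q k \<omega> powr e\<bar> \<le> \<delta> powr e + Q powr e" for \<omega>
    proof (cases "0 \<le> e")
      case True
      then have "q k \<omega> powr e \<le> Q powr e" using q0[of k \<omega>] qQ[OF that] by (intro powr_mono2) auto
      then show ?thesis by (simp add: add_increasing)
    next
      case False
      then have "q k \<omega> powr e \<le> \<delta> powr e" using q\<delta> \<delta> by (intro powr_mono2') auto
      then show ?thesis by (simp add: add_increasing2)
    qed
  qed
  have cM: "all_moments M (\<lambda>\<omega>. c)" for c :: real by (rule all_moments_bounded[of _ "\<bar>c\<bar>"]) auto
  have diffM: "all_moments M (\<lambda>\<omega>. a \<omega> - b \<omega>)" if "all_moments M a" "all_moments M b" for a b
    using all_moments_add[OF that(1) all_moments_mult[OF cM[of "-1"] that(2)]] by simp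
  note MI = all_moments_add all_moments_mult diffM all_moments_power cM fM gM yM qp
  have UM: "all_moments M (U k)" if "k \<le> K" for k
    unfolding U_def using that by (intro MI) auto
  have "(\<integral>\<omega>. U k \<omega> \<partial>M) \<le> 0" using k
  proof (induction k)
    case 0
    have "U 0 \<omega> \<le> 0" for \<omega>
    proof -
      have "0 \<le> C / r * (f 0 \<omega> ^ (2 * n - 2) * q 0 \<omega> powr r)"
        using C(1) r by (intro mult_nonneg_nonneg) (auto simp: f_def)
      moreover have "0 \<le> C * \<mu> / min 1 m * q 0 \<omega> powr m"
        using C(1) \<mu> m0 by (intro mult_nonneg_nonneg divide_nonneg_pos) auto
      moreover have z: "f 0 \<omega> ^ (2 * n) = 0" using n by (simp add: f_def)
      ultimately show ?thesis unfolding U_def z by simp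
    qed
    then have "0 \<le> (\<integral>\<omega>. - U 0 \<omega> \<partial>M)" by (intro integral_nonneg_AE AE_I2) simp
    then show ?case by simp
  next
    case (Suc k)
    then have k: "k < K" "k \<le> K" "Suc k \<le> K" by auto
    define x where "x = f k"
    define Qk where "Qk = q (Suc k)"
    define s where "s \<omega> = (\<sigma> k)\<^sup>2 * (y k \<omega>)\<^sup>2" for \<omega>
    have \<sigma>: "0 < \<sigma> k" and gd: "distributed M lborel (g k) (normal_density 0 (\<sigma> k))" using G k unfolding gauss_seq_def by auto
    \<comment> \<open>\<open>T0\<close>, \<open>T1\<close>, \<open>T2\<close>, \<open>T3\<close>
      collect the coefficients of the powers 0, 1, 2 and \<open>2 * n\<close> of \<open>g k\<close>
      in an upper bound for \<open>U (Suc k)\<close>. The truncated exponent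
      \<open>2 * n - 3\<close> is harmless for \<open>n = 1\<close>, because its factor
      \<open>2 * n - 2\<close> is then 0.\<close>
    define T1 where "T1 \<omega> = Qk \<omega> powr (m - real n) * (real (2 * n) * (x \<omega> ^ (2 * n - 1) * y k \<omega>))
       - C / r * (Qk \<omega> powr r * (real (2 * n - 2) * (x \<omega> ^ (2 * n - 3) * y k \<omega>)))" for \<omega>
    define T2 where "T2 \<omega> = Qk \<omega> powr (m - real n) * (C * (x \<omega> ^ (2 * n - 2) * (y k \<omega>)\<^sup>2))" for \<omega>
    define T3 where "T3 \<omega> = Qk \<omega> powr (m - real n) * (C * y k \<omega> ^ (2 * n))" for \<omega>
    define T0 where "T0 \<omega> = Qk \<omega> powr (m - real n) * x \<omega> ^ (2 * n) - C / r * (Qk \<omega> powr r * x \<omega> ^ (2 * n - 2))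
       - C * \<mu> / min 1 m * Qk \<omega> powr m" for \<omega>
    have TM: "all_moments M T0" "all_moments M T1" "all_moments M T2" "all_moments M T3"
      unfolding T0_def T1_def T2_def T3_def x_def Qk_def using k
      by (auto intro!: MI simp del: times_divide_eq_left times_divide_eq_right)
    have TG: "T1 \<in> borel_measurable (G k)" "T2 \<in> borel_measurable (G k)" "T3 \<in> borel_measurable (G k)"
      using fG[OF k(2)] qG[OF k(1)] ym[OF k(1)] unfolding T1_def T2_def T3_def x_def Qk_def by measurable
    note gi = gauss_seq_integral_mult[OF G k(1)]
    have gmom: "integrable M (\<lambda>\<omega>. g k \<omega> ^ i)" for i
      using all_moments_integrable[OF all_moments_power[OF gM[OF k(1)]]] .
    have i1: "(\<integral>\<omega>. T1 \<omega> * g k \<omega> \<partial>M) = 0" "integrable M (\<lambda>\<omega>. T1 \<omega> * g k \<omega>)"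
      using gi[OF TG(1) all_moments_integrable[OF TM(2)], of "\<lambda>x. x"] gmom[of 1] gaussian_mean_zero[OF gd \<sigma>] by auto
    have v2: "(\<integral>\<omega>. (g k \<omega>)\<^sup>2 \<partial>M) = (\<sigma> k)\<^sup>2"
      using gaussian_even_moment[OF gd \<sigma>, of 1] by (simp add: has_bochner_integral_iff)
    have i2: "(\<integral>\<omega>. T2 \<omega> * (g k \<omega>)\<^sup>2 \<partial>M) = (\<integral>\<omega>. T2 \<omega> * (\<sigma> k)\<^sup>2 \<partial>M)" "integrable M (\<lambda>\<omega>. T2 \<omega> * (g k \<omega>)\<^sup>2)"
      using gi[OF TG(2) all_moments_integrable[OF TM(3)], of "\<lambda>x. x\<^sup>2"] gmom[of 2] v2 by auto
    have v3: "(\<integral>\<omega>. g k \<omega> ^ (2 * n) \<partial>M) = \<mu> * \<sigma> k ^ (2 * n)"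
      using gaussian_even_moment[OF gd \<sigma>, of n] by (simp add: has_bochner_integral_iff \<mu>_def)
    have i3: "(\<integral>\<omega>. T3 \<omega> * g k \<omega> ^ (2 * n) \<partial>M) = (\<integral>\<omega>. T3 \<omega> * (\<mu> * \<sigma> k ^ (2 * n)) \<partial>M)" "integrable M (\<lambda>\<omega>. T3 \<omega> * g k \<omega> ^ (2 * n))"
      using gi[OF TG(3) all_moments_integrable[OF TM(4)], of "\<lambda>x. x ^ (2 * n)"] gmom[of "2 * n"] v3 by auto
    note Ti = TM[THEN all_moments_integrable]
    \<comment> \<open>The binomial bound serves the leading power; convexity serves the lower power,
      which is subtracted and so has to be bounded from below.\<close>
    have upper: "U (Suc k) \<omega> \<le> T0 \<omega> + T1 \<omega> * g k \<omega> + T2 \<omega> * (g k \<omega>)\<^sup>2 + T3 \<omega> * g k \<omega> ^ (2 * n)" for \<omega>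
    proof -
      define h where "h = g k \<omega> * y k \<omega>"
      have fS: "f (Suc k) \<omega> = x \<omega> + h" unfolding f_def x_def h_def by simp
      have "Qk \<omega> powr (m - real n) * (x \<omega> + h) ^ (2 * n)
         \<le> Qk \<omega> powr (m - real n) * (x \<omega> ^ (2 * n) + real (2 * n) * x \<omega> ^ (2 * n - 1) * h + C * (x \<omega> ^ (2 * n - 2) * h\<^sup>2 + h ^ (2 * n)))"
        by (intro mult_left_mono C(2)) simp
      moreover have "C / r * (Qk \<omega> powr r * (x \<omega> ^ (2 * n - 2) + real (2 * n - 2) * x \<omega> ^ (2 * n - 3) * h))
         \<le> C / r * (Qk \<omega> powr r * (x \<omega> + h) ^ (2 * n - 2))"
        using even_power_add_lower[of "x \<omega>" "n - 1" h] C(1) r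
        by (intro mult_left_mono) (auto simp: diff_mult_distrib2 eval_nat_numeral)
      ultimately have "U (Suc k) \<omega> \<le> Qk \<omega> powr (m - real n) * (x \<omega> ^ (2 * n) + real (2 * n) * x \<omega> ^ (2 * n - 1) * h + C * (x \<omega> ^ (2 * n - 2) * h\<^sup>2 + h ^ (2 * n)))
         - C / r * (Qk \<omega> powr r * (x \<omega> ^ (2 * n - 2) + real (2 * n - 2) * x \<omega> ^ (2 * n - 3) * h)) - C * \<mu> / min 1 m * Qk \<omega> powr m"
        unfolding U_def fS Qk_def[symmetric] by (simp add: mult.commute)
      also have "\<dots> = T0 \<omega> + T1 \<omega> * g k \<omega> + T2 \<omega> * (g k \<omega>)\<^sup>2 + T3 \<omega> * g k \<omega> ^ (2 * n)"
        unfolding T0_def T1_def T2_def T3_def h_def power_mult_distrib by (simp only: distrib_left distrib_right left_diff_distrib right_diff_distrib mult_ac)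
      finally show ?thesis .
    qed
    \<comment> \<open>After averaging, one estimate for each term of \<open>U\<close>:
      \<open>a1\<close> lowers the base of a nonpositive exponent, \<open>a2\<close> pays the
      quadratic term with the increment of \<open>q powr r\<close>, and \<open>a3\<close> pays the
      top-order term with the increment of \<open>q powr m\<close>.\<close>
    have lower: "T0 \<omega> + T2 \<omega> * (\<sigma> k)\<^sup>2 + T3 \<omega> * (\<mu> * \<sigma> k ^ (2 * n)) \<le> U k \<omega>" for \<omega>
    proof -
      define q' where "q' = q k \<omega>"
      define s' where "s' = s \<omega>"
      have q': "0 < q'" "0 \<le> s'" unfolding q'_def s'_def s_def using q0 by auto
      have Qk: "Qk \<omega> = q' + s'" unfolding Qk_def q'_def q_def s'_def s_def by (simp add: power_mult_distrib)
      have X: "0 \<le> x \<omega> ^ (2 * n)" "0 \<le> x \<omega> ^ (2 * n - 2)"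
        using zero_le_even_power[of "2 * n - 2" "x \<omega>"] by auto
      define cR where "cR = C / r"
      define cM where "cM = C * \<mu> / min 1 m"
      have r_e: "m - real n = r - 1" unfolding r_def by simp
      have a1: "(q' + s') powr (m - real n) * x \<omega> ^ (2 * n) \<le> x \<omega> ^ (2 * n) * q' powr (m - real n)"
        using q' m X by (subst mult.commute) (intro mult_left_mono powr_mono2', auto)
      have "r * (s' * (q' + s') powr (r - 1)) \<le> (q' + s') powr r - q' powr r"
        using powr_add_increment[OF q' r(1)] r by simp
      then have "C / r * x \<omega> ^ (2 * n - 2) * (r * (s' * (q' + s') powr (r - 1))) \<le> C / r * x \<omega> ^ (2 * n - 2) * ((q' + s') powr r - q' powr r)"
        using C(1) r X by (intro mult_left_mono) auto
      then have a2: "C * x \<omega> ^ (2 * n - 2) * (s' * (q' + s') powr (m - real n)) \<le> C / r * x \<omega> ^ (2 * n - 2) * ((q' + s') powr r - q' powr r)"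
        using r unfolding r_e by simp
      \<comment> \<open>All but one of the factors \<open>s'\<close> are replaced by
        \<open>q' + s'\<close>, which leaves exactly the shape of an increment of
        \<open>q powr m\<close>.\<close>
      have "s' ^ n * (q' + s') powr (m - real n) \<le> s' * (q' + s') powr (m - 1)"
      proof -
        have "s' ^ n = s' * s' ^ (n - 1)" using n by (cases n) auto
        also have "\<dots> \<le> s' * (q' + s') ^ (n - 1)" using q' by (intro mult_left_mono power_mono) auto
        also have "(q' + s') ^ (n - 1) = (q' + s') powr (real n - 1)"
          using q' n by (simp add: powr_realpow[symmetric] of_nat_diff)
        finally have "s' ^ n * (q' + s') powr (m - real n) \<le> s' * (q' + s') powr (real n - 1) * (q' + s') powr (m - real n)"
          by (rule mult_right_mono) simp
        also have "\<dots> = s' * (q' + s') powr (m - 1)" by (simp add: mult.assoc flip: powr_add)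
        finally show ?thesis .
      qed
      moreover have "min 1 m * (s' * (q' + s') powr (m - 1)) \<le> (q' + s') powr m - q' powr m"
        using powr_add_increment[OF q' m0(1)] .
      ultimately have "min 1 m * (s' ^ n * (q' + s') powr (m - real n)) \<le> (q' + s') powr m - q' powr m"
        using m0 by (meson mult_left_mono order_trans less_imp_le)
      then have "cM * (min 1 m * (s' ^ n * (q' + s') powr (m - real n))) \<le> cM * ((q' + s') powr m - q' powr m)"
        using C(1) \<mu> m0 unfolding cM_def by (intro mult_left_mono divide_nonneg_pos) auto
      moreover have "cM * (min 1 m * z) = C * \<mu> * z" for z using m0 by (simp add: cM_def)
      ultimately have a3: "C * \<mu> * (s' ^ n * (q' + s') powr (m - real n)) \<le> cM * ((q' + s') powr m - q' powr m)"
        by simp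
      have e2: "T2 \<omega> * (\<sigma> k)\<^sup>2 = C * x \<omega> ^ (2 * n - 2) * (s' * (q' + s') powr (m - real n))"
        unfolding T2_def Qk s'_def s_def by (simp add: mult_ac)
      have e3: "T3 \<omega> * (\<mu> * \<sigma> k ^ (2 * n)) = C * \<mu> * (s' ^ n * (q' + s') powr (m - real n))"
        unfolding T3_def Qk s'_def s_def power_mult power_mult_distrib by (simp only: mult_ac)
      show ?thesis using a1 a2 a3 unfolding e2 e3 unfolding T0_def U_def Qk x_def[symmetric] q'_def[symmetric] cR_def[symmetric] cM_def[symmetric]
        by (simp add: algebra_simps)
    qed
    have "(\<integral>\<omega>. U (Suc k) \<omega> \<partial>M) \<le> (\<integral>\<omega>. T0 \<omega> + T1 \<omega> * g k \<omega> + T2 \<omega> * (g k \<omega>)\<^sup>2 + T3 \<omega> * g k \<omega> ^ (2 * n) \<partial>M)"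
      using all_moments_integrable[OF UM[OF k(3)]] Ti i1(2) i2(2) i3(2) upper by (intro integral_mono) auto
    also have "\<dots> = (\<integral>\<omega>. T0 \<omega> + T2 \<omega> * (\<sigma> k)\<^sup>2 + T3 \<omega> * (\<mu> * \<sigma> k ^ (2 * n)) \<partial>M)"
      using Ti i1 i2 i3 by simp
    also have "\<dots> \<le> (\<integral>\<omega>. U k \<omega> \<partial>M)"
      using all_moments_integrable[OF UM[OF k(2)]] Ti lower by (intro integral_mono) auto
    also have "\<dots> \<le> 0" using Suc by simp
    finally show ?case .
  qed
  then show ?thesis using UM[OF k] by simp
qed

end

text \<open>Put \<open>z = f^2 / q\<close> with \<open>q\<close> the regularised bracket. Divided by
  \<open>q powr m\<close>, the function of the supermartingale lemma becomes
  \<open>z^n - a z^(n-1) - b\<close>. Its leading term dominates \<open>z powr m\<close> up to a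
  constant and absorbs the middle one, so its nonpositive mean bounds the moment of \<open>f\<close>
  by that of \<open>q\<close>; finally \<open>\<delta>\<close> tends to 0.\<close>

lemma ito_inequality_scalar:
  fixes p :: real
  assumes p: "0 < p"
  obtains C where "0 \<le> C" "\<And>(M :: 'w measure) G g \<sigma> K (y :: nat \<Rightarrow> 'w \<Rightarrow> real) B. prob_space M \<Longrightarrow> gauss_seq M G g \<sigma> K \<Longrightarrow>
     (\<And>j. j < K \<Longrightarrow> y j \<in> borel_measurable (G j)) \<Longrightarrow> (\<And>j \<omega>. j < K \<Longrightarrow> \<bar>y j \<omega>\<bar> \<le> B) \<Longrightarrow>
     (\<integral>\<omega>. \<bar>\<Sum>j<K. g j \<omega> * y j \<omega>\<bar> powr p \<partial>M) \<le> C * (\<integral>\<omega>. (\<Sum>j<K. (\<sigma> j * y j \<omega>)\<^sup>2) powr (p / 2) \<partial>M)"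
proof -
  define m where "m = p / 2"
  \<comment> \<open>The least integer not below \<open>m = p / 2\<close>: then
    \<open>m - real n\<close> lies in \<open>(-1, 0]\<close> and \<open>r\<close> in
    \<open>(0, 1]\<close>.\<close>
  define n where "n = nat \<lceil>m\<rceil>"
  have n: "1 \<le> n" "real n - 1 < m" "m \<le> real n" using p unfolding n_def m_def by linarith+
  obtain C where C: "0 \<le> C" "\<And>x h :: real. (x + h) ^ (2 * n) \<le> x ^ (2 * n) + real (2 * n) * x ^ (2 * n - 1) * h + C * (x ^ (2 * n - 2) * h\<^sup>2 + h ^ (2 * n))"
    using even_power_add_upper[OF n(1)] by blast
  define r where "r = m - real n + 1"
  define a where "a = C / r"
  define \<mu> where "\<mu> = (fact (2 * n) / (2 ^ n * fact n) :: real)"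
  define b where "b = C * \<mu> / min 1 m"
  have r: "0 < r" using n unfolding r_def by auto
  have m0: "0 < m" using p unfolding m_def by simp
  have a: "0 \<le> a" using C(1) r unfolding a_def by simp
  have b: "0 \<le> b" using C(1) m0 unfolding b_def \<mu>_def by (intro divide_nonneg_pos mult_nonneg_nonneg) auto
  \<comment> \<open>A bound for \<open>a * z ^ (n - 1)\<close> when \<open>z < 2 * a\<close>; for
    larger \<open>z\<close> half of \<open>z ^ n\<close> absorbs that term.\<close>
  define c0 where "c0 = a * (2 * a) ^ (n - 1)"
  have c0: "0 \<le> c0" using a unfolding c0_def by simp
  define D where "D = (1 + 2 * (c0 + b)) * 2 powr m"
  have D: "0 \<le> D" using c0 b unfolding D_def by simp
  show thesis
  proof (rule that[OF D])
    fix M :: "'w measure" and G g \<sigma> K and y :: "nat \<Rightarrow> 'w \<Rightarrow> real" and B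
    assume "prob_space M" and G: "gauss_seq M G g \<sigma> K"
      and ym: "\<And>j. j < K \<Longrightarrow> y j \<in> borel_measurable (G j)" and yB: "\<And>j \<omega>. j < K \<Longrightarrow> \<bar>y j \<omega>\<bar> \<le> B"
    interpret prob_space M by fact
    have yM [measurable]: "y j \<in> borel_measurable M" if "j < K" for j
      using G ym[OF that] unfolding gauss_seq_def by (meson measurable_from_subalg)
    define f where "f \<omega> = (\<Sum>j<K. g j \<omega> * y j \<omega>)" for \<omega>
    define S where "S \<omega> = (\<Sum>j<K. (\<sigma> j * y j \<omega>)\<^sup>2)" for \<omega>
    have fM: "all_moments M f"
      unfolding f_def using yB by (intro all_moments_sum all_moments_mult gauss_seq_all_moments[OF G] all_moments_bounded[of "y _" B]) auto
    have Sm [measurable]: "S \<in> borel_measurable M" unfolding S_def by measurable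
    define Q where "Q = (\<Sum>j<K. (\<sigma> j)\<^sup>2 * B\<^sup>2)"
    have S: "0 \<le> S \<omega>" "S \<omega> \<le> Q" for \<omega>
    proof -
      show "0 \<le> S \<omega>" unfolding S_def by (intro sum_nonneg) auto
      show "S \<omega> \<le> Q" unfolding S_def Q_def
      proof (rule sum_mono)
        fix j assume "j \<in> {..<K}"
        then have "\<bar>y j \<omega>\<bar> \<le> B" using yB by auto
        then have "(y j \<omega>)\<^sup>2 \<le> B\<^sup>2" by (metis abs_ge_zero power2_abs power_mono)
        then show "(\<sigma> j * y j \<omega>)\<^sup>2 \<le> (\<sigma> j)\<^sup>2 * B\<^sup>2" by (simp add: power_mult_distrib mult_left_mono)
      qed
    qed
    have Sint: "integrable M (\<lambda>\<omega>. (c + S \<omega>) powr m)" if "0 \<le> c" for c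
      using S that m0 by (intro integrable_const_bound[of _ "(c + Q) powr m"] AE_I2) (auto intro!: powr_mono2 add_nonneg_nonneg)
    have step: "(\<integral>\<omega>. \<bar>f \<omega>\<bar> powr p \<partial>M) \<le> D * (\<delta> powr m + (\<integral>\<omega>. S \<omega> powr m \<partial>M))" if \<delta>: "0 < \<delta>" for \<delta>
    proof -
      define U where "U \<omega> = f \<omega> ^ (2 * n) * (\<delta> + S \<omega>) powr (m - real n) - a * (f \<omega> ^ (2 * n - 2) * (\<delta> + S \<omega>) powr r)
        - b * (\<delta> + S \<omega>) powr m" for \<omega>
      have U: "all_moments M U" "(\<integral>\<omega>. U \<omega> \<partial>M) \<le> 0"
        using ito_supermartingale[OF G ym yB n(1) n(2,3) \<delta> C order_refl]
        unfolding U_def f_def S_def a_def b_def r_def \<mu>_def by auto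
      have pw: "\<bar>f \<omega>\<bar> powr p \<le> 2 * U \<omega> + (1 + 2 * (c0 + b)) * (\<delta> + S \<omega>) powr m" for \<omega>
      proof -
        define q where "q = \<delta> + S \<omega>"
        have q: "0 < q" using S(1)[of \<omega>] \<delta> unfolding q_def by simp
        \<comment> \<open>The scale-free variable: every term of \<open>U \<omega>\<close> is a
          function of \<open>z\<close> times \<open>q powr m\<close>.\<close>
        define z where "z = (f \<omega>)\<^sup>2 / q"
        have z: "0 \<le> z" using q unfolding z_def by simp
        have f2: "(f \<omega>)\<^sup>2 = z * q" using q unfolding z_def by simp
        have T: "f \<omega> ^ (2 * n) * q powr (m - real n) = z ^ n * q powr m"
          using q by (simp add: power_mult f2 power_mult_distrib powr_diff powr_realpow)
        have R: "f \<omega> ^ (2 * n - 2) * q powr r = z ^ (n - 1) * q powr m"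
        proof -
          have e: "2 * n - 2 = 2 * (n - 1)" "r = m - real (n - 1)" using n unfolding r_def by auto
          show ?thesis unfolding e using q by (simp add: power_mult f2 power_mult_distrib powr_diff powr_realpow)
        qed
        have absorb: "a * z ^ (n - 1) \<le> z ^ n / 2 + c0"
        proof (cases "2 * a \<le> z")
          case True
          have "a * z ^ (n - 1) \<le> z / 2 * z ^ (n - 1)" using True z by (intro mult_right_mono) auto
          also have "\<dots> = z ^ n / 2" using n by (cases n) auto
          finally show ?thesis using c0 by simp
        next
          case False
          have "a * z ^ (n - 1) \<le> c0" unfolding c0_def using False z a by (intro mult_left_mono power_mono) auto
          then show ?thesis using z by (simp add: add_increasing)
        qed
        have "\<bar>f \<omega>\<bar> powr p = ((f \<omega>)\<^sup>2) powr m"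
        proof -
          have "((f \<omega>)\<^sup>2) powr m = (\<bar>f \<omega>\<bar> powr 2) powr m" by (cases "f \<omega> = 0") (auto simp: powr_numeral)
          then show ?thesis unfolding powr_powr m_def by simp
        qed
        also have "\<dots> = z powr m * q powr m" using z q by (simp add: f2 powr_mult)
        also have "\<dots> \<le> (1 + z ^ n) * q powr m"
        proof (rule mult_right_mono)
          show "z powr m \<le> 1 + z ^ n"
          proof (cases "z \<le> 1")
            case True
            then have "z powr m \<le> 1" using z m0 by (intro powr_le1) auto
            then show ?thesis using z by (simp add: add_increasing2)
          next
            case False
            then have "z powr m \<le> z powr real n" using n by (intro powr_mono) auto
            also have "\<dots> = z ^ n" using False by (intro powr_realpow) auto
            finally show ?thesis by simp
          qed
        qed simp
        finally have 1: "\<bar>f \<omega>\<bar> powr p \<le> q powr m + z ^ n * q powr m" by (simp add: algebra_simps)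
        have Ue: "U \<omega> = z ^ n * q powr m - a * (z ^ (n - 1) * q powr m) - b * q powr m"
          unfolding U_def q_def[symmetric] T R ..
        have "a * z ^ (n - 1) * q powr m \<le> (z ^ n / 2 + c0) * q powr m" using absorb by (rule mult_right_mono) simp
        with 1 show ?thesis unfolding Ue q_def[symmetric] by (simp add: algebra_simps)
      qed
      have "(\<integral>\<omega>. \<bar>f \<omega>\<bar> powr p \<partial>M) \<le> (\<integral>\<omega>. 2 * U \<omega> + (1 + 2 * (c0 + b)) * (\<delta> + S \<omega>) powr m \<partial>M)"
        using all_moments_powr_abs[OF fM p] all_moments_integrable[OF U(1)] Sint[of \<delta>] \<delta> pw by (intro integral_mono) auto
      also have "\<dots> = 2 * (\<integral>\<omega>. U \<omega> \<partial>M) + (1 + 2 * (c0 + b)) * (\<integral>\<omega>. (\<delta> + S \<omega>) powr m \<partial>M)"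
        using all_moments_integrable[OF U(1)] Sint[of \<delta>] \<delta> by simp
      also have "\<dots> \<le> (1 + 2 * (c0 + b)) * (\<integral>\<omega>. 2 powr m * (\<delta> powr m + S \<omega> powr m) \<partial>M)"
      proof -
        have "(\<integral>\<omega>. (\<delta> + S \<omega>) powr m \<partial>M) \<le> (\<integral>\<omega>. 2 powr m * (\<delta> powr m + S \<omega> powr m) \<partial>M)"
          using Sint[of \<delta>] Sint[of 0] S(1) \<delta> m0 by (intro integral_mono powr_add_le_two_powr) auto
        then have "(1 + 2 * (c0 + b)) * (\<integral>\<omega>. (\<delta> + S \<omega>) powr m \<partial>M) \<le> (1 + 2 * (c0 + b)) * (\<integral>\<omega>. 2 powr m * (\<delta> powr m + S \<omega> powr m) \<partial>M)"
          using c0 b by (intro mult_left_mono) auto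
        then show ?thesis using U(2) by linarith
      qed
      also have "(\<integral>\<omega>. 2 powr m * (\<delta> powr m + S \<omega> powr m) \<partial>M) = 2 powr m * (\<delta> powr m + (\<integral>\<omega>. S \<omega> powr m \<partial>M))"
        using Sint[of 0] by (simp add: prob_space)
      finally show ?thesis unfolding D_def by (simp add: mult.assoc)
    qed
    have "(\<integral>\<omega>. \<bar>f \<omega>\<bar> powr p \<partial>M) \<le> D * (\<integral>\<omega>. S \<omega> powr m \<partial>M)"
    proof (rule field_le_epsilon)
      fix e :: real assume e: "0 < e"
      \<comment> \<open>Chosen so that \<open>D * \<delta> powr m\<close> is at most
        \<open>e\<close>.\<close>
      define \<delta> where "\<delta> = (e / (D + 1)) powr (1 / m)"
      have "0 < \<delta>" unfolding \<delta>_def using e D by simp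
      have "\<delta> powr m = e / (D + 1)" unfolding \<delta>_def using e D m0 by (simp add: powr_powr)
      then have "D * \<delta> powr m \<le> e" using e D by (simp add: divide_le_eq mult.commute)
      then show "(\<integral>\<omega>. \<bar>f \<omega>\<bar> powr p \<partial>M) \<le> D * (\<integral>\<omega>. S \<omega> powr m \<partial>M) + e"
        using step[OF \<open>0 < \<delta>\<close>] by (simp add: distrib_left)
    qed
    then show "(\<integral>\<omega>. \<bar>\<Sum>j<K. g j \<omega> * y j \<omega>\<bar> powr p \<partial>M) \<le> D * (\<integral>\<omega>. (\<Sum>j<K. (\<sigma> j * y j \<omega>)\<^sup>2) powr (p / 2) \<partial>M)"
      unfolding f_def S_def m_def .
  qed
qed

text \<open>The constant depends on \<open>p\<close> and the dimension alone, neither on the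
  sequence nor on its length; this uniformity is what lets the integral extend by continuity.
  Coordinates suffice, since each has a bracket below that of the whole vector.\<close>

lemma ito_inequality:
  fixes p :: real
  assumes p: "0 < p"
  obtains C where "0 \<le> C" "\<And>(M :: 'w measure) G g \<sigma> K (y :: nat \<Rightarrow> 'w \<Rightarrow> 'x::euclidean_space) B. prob_space M \<Longrightarrow> gauss_seq M G g \<sigma> K \<Longrightarrow>
     (\<And>j. j < K \<Longrightarrow> y j \<in> borel_measurable (G j)) \<Longrightarrow> (\<And>j \<omega>. j < K \<Longrightarrow> norm (y j \<omega>) \<le> B) \<Longrightarrow>
     integrable M (\<lambda>\<omega>. norm (\<Sum>j<K. g j \<omega> *\<^sub>R y j \<omega>) powr p) \<and>
     (\<integral>\<omega>. norm (\<Sum>j<K. g j \<omega> *\<^sub>R y j \<omega>) powr p \<partial>M) \<le> C * (\<integral>\<omega>. (\<Sum>j<K. (\<sigma> j)\<^sup>2 * (norm (y j \<omega>))\<^sup>2) powr (p / 2) \<partial>M)"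
proof -
  obtain C where C: "0 \<le> C" "\<And>(M :: 'w measure) G g \<sigma> K (y :: nat \<Rightarrow> 'w \<Rightarrow> real) B. prob_space M \<Longrightarrow> gauss_seq M G g \<sigma> K \<Longrightarrow>
     (\<And>j. j < K \<Longrightarrow> y j \<in> borel_measurable (G j)) \<Longrightarrow> (\<And>j \<omega>. j < K \<Longrightarrow> \<bar>y j \<omega>\<bar> \<le> B) \<Longrightarrow>
     (\<integral>\<omega>. \<bar>\<Sum>j<K. g j \<omega> * y j \<omega>\<bar> powr p \<partial>M) \<le> C * (\<integral>\<omega>. (\<Sum>j<K. (\<sigma> j * y j \<omega>)\<^sup>2) powr (p / 2) \<partial>M)"
    using ito_inequality_scalar[OF p] by blast
  let ?D = "real DIM('x)"
  show thesis
  proof (rule that[of "?D powr p * (?D * C)"])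
    show "0 \<le> ?D powr p * (?D * C)" using C(1) by simp
    fix M :: "'w measure" and G g \<sigma> K and y :: "nat \<Rightarrow> 'w \<Rightarrow> 'x" and B
    assume M: "prob_space M" and G: "gauss_seq M G g \<sigma> K"
      and ym: "\<And>j. j < K \<Longrightarrow> y j \<in> borel_measurable (G j)" and yB: "\<And>j \<omega>. j < K \<Longrightarrow> norm (y j \<omega>) \<le> B"
    interpret prob_space M by fact
    have yM [measurable]: "y j \<in> borel_measurable M" if "j < K" for j
      using G ym[OF that] unfolding gauss_seq_def by (meson measurable_from_subalg)
    have gM [measurable]: "g j \<in> borel_measurable M" if "j < K" for j
      using gauss_seq_all_moments[OF G that] unfolding all_moments_def by auto
    define f where "f \<omega> = (\<Sum>j<K. g j \<omega> *\<^sub>R y j \<omega>)" for \<omega>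
    have fm [measurable]: "f \<in> borel_measurable M" unfolding f_def by measurable
    have yb: "\<bar>y j \<omega> \<bullet> b\<bar> \<le> norm (y j \<omega>)" if "b \<in> Basis" for b j \<omega> using Basis_le_norm[OF that] .
    have comp: "f \<omega> \<bullet> b = (\<Sum>j<K. g j \<omega> * (y j \<omega> \<bullet> b))" for \<omega> b unfolding f_def by (simp add: inner_sum_left)
    have int: "integrable M (\<lambda>\<omega>. \<bar>f \<omega> \<bullet> b\<bar> powr p)" if b: "b \<in> Basis" for b
      unfolding comp using order_trans[OF yb[OF b] yB]
      by (intro all_moments_powr_abs p all_moments_sum all_moments_mult gauss_seq_all_moments[OF G] all_moments_bounded[of "\<lambda>\<omega>. y _ \<omega> \<bullet> b" B]) auto
    have pw: "norm (f \<omega>) powr p \<le> ?D powr p * (\<Sum>b\<in>Basis. \<bar>f \<omega> \<bullet> b\<bar> powr p)" for \<omega>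
    proof -
      have "norm (f \<omega>) powr p \<le> (\<Sum>b\<in>Basis. \<bar>f \<omega> \<bullet> b\<bar>) powr p"
        using p by (intro powr_mono2 norm_le_l1) auto
      also have "\<dots> \<le> ?D powr p * (\<Sum>b\<in>Basis. \<bar>f \<omega> \<bullet> b\<bar> powr p)"
        using p by (intro sum_powr_le) auto
      finally show ?thesis .
    qed
    have fint: "integrable M (\<lambda>\<omega>. norm (f \<omega>) powr p)"
    proof (rule Bochner_Integration.integrable_bound)
      show "integrable M (\<lambda>\<omega>. ?D powr p * (\<Sum>b\<in>Basis. \<bar>f \<omega> \<bullet> b\<bar> powr p))" using int by simp
      show "AE \<omega> in M. norm (norm (f \<omega>) powr p) \<le> norm (?D powr p * (\<Sum>b\<in>Basis. \<bar>f \<omega> \<bullet> b\<bar> powr p))"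
        using pw by (auto simp: sum_nonneg)
    qed measurable
    define S where "S \<omega> = (\<Sum>j<K. (\<sigma> j)\<^sup>2 * (norm (y j \<omega>))\<^sup>2)" for \<omega>
    have [measurable]: "S \<in> borel_measurable M" unfolding S_def by measurable
    define Q where "Q = (\<Sum>j<K. (\<sigma> j)\<^sup>2 * B\<^sup>2)"
    have S: "0 \<le> S \<omega>" "S \<omega> \<le> Q" for \<omega>
      unfolding S_def Q_def using yB by (auto intro!: sum_nonneg sum_mono mult_left_mono power_mono)
    have SL: "(\<Sum>j<K. (\<sigma> j * (y j \<omega> \<bullet> b))\<^sup>2) \<le> S \<omega>" if b: "b \<in> Basis" for b \<omega>
    proof -
      have "(y j \<omega> \<bullet> b)\<^sup>2 \<le> (norm (y j \<omega>))\<^sup>2" for j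
        using power_mono[OF yb[OF b, of j \<omega>], of 2] by simp
      then show ?thesis unfolding S_def by (auto intro!: sum_mono mult_left_mono simp: power_mult_distrib)
    qed
    have "(\<integral>\<omega>. norm (f \<omega>) powr p \<partial>M) \<le> (\<integral>\<omega>. ?D powr p * (\<Sum>b\<in>Basis. \<bar>f \<omega> \<bullet> b\<bar> powr p) \<partial>M)"
      using fint int pw by (intro integral_mono) auto
    also have "\<dots> = ?D powr p * (\<Sum>b\<in>Basis. \<integral>\<omega>. \<bar>f \<omega> \<bullet> b\<bar> powr p \<partial>M)" using int by simp
    also have "\<dots> \<le> ?D powr p * (\<Sum>b::'x\<in>Basis. C * (\<integral>\<omega>. S \<omega> powr (p / 2) \<partial>M))"
    proof (intro mult_left_mono sum_mono)
      fix b :: 'x assume b: "b \<in> Basis"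
      have "(\<integral>\<omega>. \<bar>f \<omega> \<bullet> b\<bar> powr p \<partial>M) \<le> C * (\<integral>\<omega>. (\<Sum>j<K. (\<sigma> j * (y j \<omega> \<bullet> b))\<^sup>2) powr (p / 2) \<partial>M)"
        unfolding comp
      proof (rule C(2)[OF M G])
        show "(\<lambda>\<omega>. y j \<omega> \<bullet> b) \<in> borel_measurable (G j)" if "j < K" for j using ym[OF that] by measurable
        show "\<bar>y j \<omega> \<bullet> b\<bar> \<le> B" if "j < K" for j \<omega> using order_trans[OF yb[OF b] yB[OF that]] .
      qed
      also have "\<dots> \<le> C * (\<integral>\<omega>. S \<omega> powr (p / 2) \<partial>M)"
      proof (intro mult_left_mono C(1) integral_mono)
        show "integrable M (\<lambda>\<omega>. S \<omega> powr (p / 2))"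
          using S p by (intro integrable_const_bound[of _ "Q powr (p / 2)"] AE_I2) (auto intro!: powr_mono2)
        show "integrable M (\<lambda>\<omega>. (\<Sum>j<K. (\<sigma> j * (y j \<omega> \<bullet> b))\<^sup>2) powr (p / 2))"
          using order_trans[OF SL[OF b] S(2)] p by (intro integrable_const_bound[of _ "Q powr (p / 2)"] AE_I2) (auto intro!: powr_mono2 sum_nonneg)
        show "(\<Sum>j<K. (\<sigma> j * (y j \<omega> \<bullet> b))\<^sup>2) powr (p / 2) \<le> S \<omega> powr (p / 2)" for \<omega>
          using SL[OF b] p by (intro powr_mono2 sum_nonneg) auto
      qed
      finally show "(\<integral>\<omega>. \<bar>f \<omega> \<bullet> b\<bar> powr p \<partial>M) \<le> C * (\<integral>\<omega>. S \<omega> powr (p / 2) \<partial>M)" .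
    qed simp
    also have "\<dots> = ?D powr p * (?D * C) * (\<integral>\<omega>. S \<omega> powr (p / 2) \<partial>M)" by simp
    finally show "integrable M (\<lambda>\<omega>. norm (\<Sum>j<K. g j \<omega> *\<^sub>R y j \<omega>) powr p) \<and> (\<integral>\<omega>. norm (\<Sum>j<K. g j \<omega> *\<^sub>R y j \<omega>) powr p \<partial>M)
        \<le> ?D powr p * (?D * C) * (\<integral>\<omega>. (\<Sum>j<K. (\<sigma> j)\<^sup>2 * (norm (y j \<omega>))\<^sup>2) powr (p / 2) \<partial>M)"
      using fint unfolding f_def S_def by blast
  qed
qed

text \<open>The shift reconciles the numbering from 0 with that of \<open>mds\<close> from 1: the
  difference number \<open>j\<close> uses \<open>g (j - 1)\<close>, known in \<open>G j\<close>, and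
  \<open>G (j - 1)\<close> is precisely the information before it. Orthogonality is checked
  coordinatewise, from independence and the zero mean of the Gaussian.\<close>

lemma gauss_seq_mds:
  fixes N :: "'x::euclidean_space \<Rightarrow> real" and y :: "nat \<Rightarrow> 'w \<Rightarrow> 'x"
  assumes "prob_space M" and N: "is_norm_fun N" and p: "0 < p" and G: "gauss_seq M G g \<sigma> K"
    and ym: "\<And>j. j < K \<Longrightarrow> y j \<in> borel_measurable (G j)" and yB: "\<And>j \<omega>. j < K \<Longrightarrow> norm (y j \<omega>) \<le> B"
  shows "mds M G p N (\<lambda>j \<omega>. g (j - 1) \<omega> *\<^sub>R y (j - 1) \<omega>) K"
proof -
  interpret prob_space M by fact
  have [measurable]: "N \<in> borel_measurable borel" by (rule norm_fun_measurable[OF N])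
  obtain c where c: "0 < c" "\<And>x. N x \<le> c * norm x" using norm_fun_le_norm[OF N] by blast
  have sub: "subalgebra M (G j)" for j using G unfolding gauss_seq_def by auto
  have subG: "subalgebra (G j) (G i)" if "i \<le> j" for i j
    using G that sub[of i] sub[of j] unfolding gauss_seq_def subalgebra_def by auto
  have yM [measurable]: "y j \<in> borel_measurable M" if "j < K" for j
    using measurable_from_subalg[OF sub ym[OF that]] .
  have gM: "all_moments M (g j)" if "j < K" for j using gauss_seq_all_moments[OF G that] .
  have gm [measurable]: "g j \<in> borel_measurable M" if "j < K" for j using gM[OF that] unfolding all_moments_def by auto
  show ?thesis
    unfolding mds_def
  proof (intro conjI allI ballI impI)
    fix j assume "j \<in> {1..K}"
    then obtain i where j: "j = Suc i" and i: "i < K" by (cases j) auto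
    have [measurable]: "g i \<in> borel_measurable (G (Suc i))" using G i unfolding gauss_seq_def by blast
    have [measurable]: "y i \<in> borel_measurable (G (Suc i))" using measurable_from_subalg[OF subG ym[OF i], of "Suc i"] by simp
    note [measurable] = yM[OF i] gm[OF i]
    show "(\<lambda>\<omega>. g (j - 1) \<omega> *\<^sub>R y (j - 1) \<omega>) \<in> borel_measurable (G j)" unfolding j by simp
    show "integrable M (\<lambda>\<omega>. g (j - 1) \<omega> *\<^sub>R y (j - 1) \<omega>)"
    proof (rule Bochner_Integration.integrable_bound)
      show "integrable M (\<lambda>\<omega>. \<bar>g i \<omega>\<bar> * B)" using all_moments_integrable[OF gM[OF i]] by simp
      show "AE \<omega> in M. norm (g (j - 1) \<omega> *\<^sub>R y (j - 1) \<omega>) \<le> norm (\<bar>g i \<omega>\<bar> * B)"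
        unfolding j using yB[OF i] order_trans[OF norm_ge_zero yB[OF i]] by (auto simp: abs_mult intro!: mult_left_mono)
    qed (simp add: j)
    show "integrable M (\<lambda>\<omega>. N (g (j - 1) \<omega> *\<^sub>R y (j - 1) \<omega>) powr p)"
    proof (rule Bochner_Integration.integrable_bound)
      show "integrable M (\<lambda>\<omega>. (c * B) powr p * \<bar>g i \<omega>\<bar> powr p)" using all_moments_powr_abs[OF gM[OF i] p] by simp
      show "AE \<omega> in M. norm (N (g (j - 1) \<omega> *\<^sub>R y (j - 1) \<omega>) powr p) \<le> norm ((c * B) powr p * \<bar>g i \<omega>\<bar> powr p)"
      proof (rule AE_I2)
        fix \<omega>
        have B0: "0 \<le> B" using order_trans[OF norm_ge_zero yB[OF i]] .
        have "N (y i \<omega>) \<le> c * B" using c(2)[of "y i \<omega>"] mult_left_mono[OF yB[OF i, of \<omega>], of c] c(1) by linarith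
        then have "N (g i \<omega> *\<^sub>R y i \<omega>) \<le> \<bar>g i \<omega>\<bar> * (c * B)" by (simp add: norm_funD(3)[OF N] mult_left_mono)
        then have "N (g i \<omega> *\<^sub>R y i \<omega>) powr p \<le> (\<bar>g i \<omega>\<bar> * (c * B)) powr p"
          using p by (intro powr_mono2 norm_funD(1)[OF N]) auto
        then show "norm (N (g (j - 1) \<omega> *\<^sub>R y (j - 1) \<omega>) powr p) \<le> norm ((c * B) powr p * \<bar>g i \<omega>\<bar> powr p)"
          using c(1) B0 by (simp add: j powr_mult mult_ac)
      qed
    qed (simp add: j)
  next
    fix j A assume "j \<in> {2..K}" and A: "A \<in> sets (G (j - 1))"
    then obtain i where j: "j = Suc i" and i: "i < K" by (cases j) auto
    have A': "A \<in> sets (G i)" using A j by simp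
    have AM [measurable]: "A \<in> sets M" using A' sub[of i] unfolding subalgebra_def by auto
    note [measurable] = yM[OF i] gm[OF i]
    have d: "distributed M lborel (g i) (normal_density 0 (\<sigma> i))" "0 < \<sigma> i" using G i unfolding gauss_seq_def by auto
    have int: "integrable M (\<lambda>\<omega>. indicator A \<omega> *\<^sub>R (g i \<omega> *\<^sub>R y i \<omega>))"
    proof (rule Bochner_Integration.integrable_bound)
      show "integrable M (\<lambda>\<omega>. \<bar>g i \<omega>\<bar> * B)" using all_moments_integrable[OF gM[OF i]] by simp
      show "AE \<omega> in M. norm (indicator A \<omega> *\<^sub>R (g i \<omega> *\<^sub>R y i \<omega>)) \<le> norm (\<bar>g i \<omega>\<bar> * B)"
        using yB[OF i] order_trans[OF norm_ge_zero yB[OF i]] by (auto simp: abs_mult indicator_def intro!: mult_left_mono)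
    qed measurable
    have "(\<integral>\<omega>. indicator A \<omega> *\<^sub>R (g i \<omega> *\<^sub>R y i \<omega>) \<partial>M) \<bullet> b = 0 \<bullet> b" if b: "b \<in> Basis" for b
    proof -
      have "(\<integral>\<omega>. indicator A \<omega> *\<^sub>R (g i \<omega> *\<^sub>R y i \<omega>) \<partial>M) \<bullet> b = (\<integral>\<omega>. (indicator A \<omega> *\<^sub>R (g i \<omega> *\<^sub>R y i \<omega>)) \<bullet> b \<partial>M)"
        using int by (intro integral_inner_left[symmetric])
      also have "\<dots> = (\<integral>\<omega>. (indicator A \<omega> * (y i \<omega> \<bullet> b)) * g i \<omega> \<partial>M)"
        by (intro Bochner_Integration.integral_cong refl) (simp add: mult_ac)
      also have "\<dots> = (\<integral>\<omega>. indicator A \<omega> * (y i \<omega> \<bullet> b) \<partial>M) * (\<integral>\<omega>. g i \<omega> \<partial>M)"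
      proof (rule gauss_seq_integral_mult(1)[OF G i, where h = "\<lambda>x. x"])
        show "(\<lambda>\<omega>. indicator A \<omega> * (y i \<omega> \<bullet> b)) \<in> borel_measurable (G i)" using ym[OF i] A' by measurable
        show "integrable M (\<lambda>\<omega>. indicator A \<omega> * (y i \<omega> \<bullet> b))"
          using order_trans[OF Basis_le_norm[OF b] yB[OF i]] order_trans[OF norm_ge_zero yB[OF i]]
          by (intro integrable_const_bound[of _ B] AE_I2) (auto simp: abs_mult indicator_def)
        show "integrable M (g i)" using all_moments_integrable[OF gM[OF i]] .
      qed simp
      also have "\<dots> = 0" using gaussian_mean_zero[OF d] by simp
      finally show ?thesis by simp
    qed
    then have "(\<integral>\<omega>. indicator A \<omega> *\<^sub>R (g i \<omega> *\<^sub>R y i \<omega>) \<partial>M) = 0" by (rule euclidean_eqI)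
    then show "(\<integral>\<omega>. indicator A \<omega> *\<^sub>R (g (j - 1) \<omega> *\<^sub>R y (j - 1) \<omega>) \<partial>M) = 0" unfolding j by simp
  next
    show "prob_space M" by fact
    show "subalgebra M (G j)" for j by (rule sub)
    show "sets (G i) \<subseteq> sets (G j)" if "i \<le> j" for i j using G that unfolding gauss_seq_def by blast
  qed
qed

section \<open>Operator norms and finite-dimensional compressions\<close>

text \<open>The squared operator norm in \<open>ennreal\<close>. Unlike \<open>hs_sq\<close> it is a supremum over a countable dense set, hence
  measurable along an operator-valued process; on operators into a Euclidean space the two are equivalent.\<close>

definition opsq :: "('h::real_normed_vector \<Rightarrow> 'x::real_normed_vector) \<Rightarrow> ennreal" where
  "opsq T = (SUP h. ennreal ((norm (T h) / norm h)\<^sup>2))"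

lemma opsq_leI:
  assumes "\<And>h. (norm (T h))\<^sup>2 \<le> c * (norm h)\<^sup>2" "0 \<le> c"
  shows "opsq T \<le> ennreal c"
  unfolding opsq_def
proof (rule SUP_least, rule ennreal_leI)
  fix h
  show "(norm (T h) / norm h)\<^sup>2 \<le> c"
    using assms(1)[of h] assms(2) by (cases "h = 0") (auto simp: power_divide divide_le_eq)
qed

lemma opsq_leD:
  assumes "linear T" "opsq T \<le> ennreal c" "0 \<le> c"
  shows "(norm (T h))\<^sup>2 \<le> c * (norm h)\<^sup>2"
proof (cases "h = 0")
  case False
  have "ennreal ((norm (T h) / norm h)\<^sup>2) \<le> opsq T" unfolding opsq_def by (rule SUP_upper) simp
  then have "(norm (T h) / norm h)\<^sup>2 \<le> c" using assms by (metis ennreal_le_iff order_trans)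
  then show ?thesis using False by (simp add: power_divide divide_le_eq)
qed (use linear_0[OF assms(1)] in simp)

lemma opsq_le_hs_sq:
  fixes T :: "'h::real_inner \<Rightarrow> 'x::euclidean_space"
  assumes "linear T"
  shows "opsq T \<le> hs_sq T"
  unfolding opsq_def
proof (rule SUP_least)
  fix h :: 'h
  show "ennreal ((norm (T h) / norm h)\<^sup>2) \<le> hs_sq T"
  proof (cases "h = 0")
    case False
    let ?u = "(1 / norm h) *\<^sub>R h"
    have "norm (T ?u) = norm (T h) / norm h" by (simp add: linear_scale[OF assms])
    then have "ennreal ((norm (T h) / norm h)\<^sup>2) = ennreal (\<Sum>h\<in>{?u}. (norm (T h))\<^sup>2)" by simp
    also have "\<dots> \<le> hs_sq T"
      unfolding hs_sq_def using False by (intro SUP_upper) (auto simp: orthonormal_set_def)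
    finally show ?thesis .
  qed simp
qed

lemma orthonormal_sum_norm_sq:
  fixes e :: "'i \<Rightarrow> 'h::real_inner"
  assumes "finite I" "\<And>i j. i \<in> I \<Longrightarrow> j \<in> I \<Longrightarrow> e i \<bullet> e j = of_bool (i = j)"
  shows "(norm (\<Sum>i\<in>I. c i *\<^sub>R e i))\<^sup>2 = (\<Sum>i\<in>I. (c i)\<^sup>2)"
proof -
  have "(norm (\<Sum>i\<in>I. c i *\<^sub>R e i))\<^sup>2 = (\<Sum>i\<in>I. \<Sum>j\<in>I. c i * (c j * (e j \<bullet> e i)))"
    by (simp add: power2_norm_eq_inner inner_sum_left inner_sum_right sum_distrib_left)
  also have "\<dots> = (\<Sum>i\<in>I. \<Sum>j\<in>I. if j = i then (c i)\<^sup>2 else 0)"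
    using assms by (intro sum.cong refl) (auto simp: power2_eq_square)
  also have "\<dots> = (\<Sum>i\<in>I. (c i)\<^sup>2)" using assms(1) by (intro sum.cong refl) auto
  finally show ?thesis .
qed

lemma orthonormal_setD:
  "orthonormal_set S \<Longrightarrow> x \<in> S \<Longrightarrow> y \<in> S \<Longrightarrow> x \<bullet> y = of_bool (x = y)"
  unfolding orthonormal_set_def by (auto simp: norm_eq_1)

text \<open>For one coordinate \<open>b\<close>, the vector \<open>z\<close> represents the
  functional \<open>T h \<bullet> b\<close> on the span of \<open>S\<close>, so that
  \<open>T z \<bullet> b\<close> equals the squared norm of \<open>z\<close>; the operator bound
  then limits this square by \<open>c\<close>. The dimension counts the coordinates.\<close>

lemma hs_sq_le_opsq:
  fixes T :: "'h::real_inner \<Rightarrow> 'x::euclidean_space"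
  assumes T: "linear T"
  shows "hs_sq T \<le> of_nat DIM('x) * opsq T"
proof (cases "opsq T = \<infinity>")
  case False
  then obtain c where c: "opsq T = ennreal c" "0 \<le> c" by (cases "opsq T") auto
  have "(\<Sum>h\<in>S. (norm (T h))\<^sup>2) \<le> real DIM('x) * c" if S: "finite S" "orthonormal_set S" for S
  proof -
    have b: "(\<Sum>h\<in>S. (T h \<bullet> b)\<^sup>2) \<le> c" if b: "b \<in> Basis" for b
    proof -
      define z where "z = (\<Sum>h\<in>S. (T h \<bullet> b) *\<^sub>R h)"
      have z: "(norm z)\<^sup>2 = (\<Sum>h\<in>S. (T h \<bullet> b)\<^sup>2)"
        unfolding z_def using S orthonormal_setD[OF S(2)] by (intro orthonormal_sum_norm_sq) auto
      have "T z \<bullet> b = (\<Sum>h\<in>S. (T h \<bullet> b)\<^sup>2)"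
        by (simp add: z_def linear_sum[OF T] linear_scale[OF T] inner_sum_left power2_eq_square)
      then have "(norm z)\<^sup>2 \<le> norm (T z)" using Basis_le_norm[OF b, of "T z"] z by simp
      then have "((norm z)\<^sup>2)\<^sup>2 \<le> (norm (T z))\<^sup>2" by (intro power_mono) auto
      also have "\<dots> \<le> c * (norm z)\<^sup>2" using opsq_leD[OF T _ c(2)] c by simp
      finally have "(norm z)\<^sup>2 * (norm z)\<^sup>2 \<le> c * (norm z)\<^sup>2" by (simp add: power2_eq_square)
      then have "(norm z)\<^sup>2 \<le> c" using c(2) mult_right_le_imp_le[of "(norm z)\<^sup>2" "(norm z)\<^sup>2" c] by (cases "z = 0") auto
      then show ?thesis using z by simp
    qed
    have "(norm (T h))\<^sup>2 = (\<Sum>b\<in>Basis. (T h \<bullet> b)\<^sup>2)" for h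
      unfolding power2_norm_eq_inner by (subst euclidean_inner) (simp add: power2_eq_square)
    then have "(\<Sum>h\<in>S. (norm (T h))\<^sup>2) = (\<Sum>b\<in>Basis. \<Sum>h\<in>S. (T h \<bullet> b)\<^sup>2)"
      by (simp add: sum.swap[of _ Basis])
    also have "\<dots> \<le> real DIM('x) * c" using b by (rule sum_bounded_above)
    finally show ?thesis .
  qed
  then have "hs_sq T \<le> ennreal (real DIM('x) * c)"
    unfolding hs_sq_def by (intro SUP_least ennreal_leI) auto
  then show ?thesis by (simp add: c ennreal_mult ennreal_of_nat_eq_real_of_nat)
qed (simp add: ennreal_mult_top)

text \<open>For a continuous \<open>T\<close> the vectors obeying a given bound form a closed set,
  so a bound on \<open>D\<close> extends to its closure.\<close>

lemma opsq_countable_dense: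
  fixes T :: "'h::real_normed_vector \<Rightarrow> 'x::real_normed_vector"
  assumes T: "bounded_linear T" and D: "closure D = UNIV"
  shows "opsq T = (SUP h\<in>D. ennreal ((norm (T h) / norm h)\<^sup>2))" (is "_ = ?S")
proof (rule antisym)
  show "opsq T \<le> ?S"
  proof (cases "?S = \<infinity>")
    case False
    then obtain c where c: "?S = ennreal c" "0 \<le> c" by (cases ?S) auto
    have "closed {h. (norm (T h))\<^sup>2 \<le> c * (norm h)\<^sup>2}"
      by (intro closed_Collect_le continuous_intros linear_continuous_on T)
    moreover have "D \<subseteq> {h. (norm (T h))\<^sup>2 \<le> c * (norm h)\<^sup>2}"
    proof safe
      fix h assume "h \<in> D"
      show "(norm (T h))\<^sup>2 \<le> c * (norm h)\<^sup>2"
      proof (cases "h = 0")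
        case False
        have "ennreal ((norm (T h) / norm h)\<^sup>2) \<le> ennreal c" unfolding c(1)[symmetric] using \<open>h \<in> D\<close> by (rule SUP_upper)
        then show ?thesis using False c by (simp add: power_divide divide_le_eq)
      qed (use linear_0[OF bounded_linear.linear[OF T]] in simp)
    qed
    ultimately have "closure D \<subseteq> {h. (norm (T h))\<^sup>2 \<le> c * (norm h)\<^sup>2}" by (intro closure_minimal)
    then show ?thesis unfolding c(1) D using c(2) by (intro opsq_leI) auto
  next
    case True
    show ?thesis unfolding True by simp
  qed
  show "?S \<le> opsq T" unfolding opsq_def by (intro SUP_subset_mono) auto
qed

lemma opsq_compose:
  fixes T :: "'h::real_normed_vector \<Rightarrow> 'x::real_normed_vector"
  assumes T: "linear T" and A: "bounded_linear A"
  shows "opsq (T \<circ> A) \<le> ennreal ((onorm A)\<^sup>2) * opsq T"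
proof (cases "opsq T = \<infinity>")
  case False
  then obtain c where c: "opsq T = ennreal c" "0 \<le> c" by (cases "opsq T") auto
  have "opsq (T \<circ> A) \<le> ennreal ((onorm A)\<^sup>2 * c)"
  proof (rule opsq_leI)
    fix h
    have "(norm (T (A h)))\<^sup>2 \<le> c * (norm (A h))\<^sup>2" using opsq_leD[OF T _ c(2)] c by simp
    also have "\<dots> \<le> c * (onorm A * norm h)\<^sup>2" using c A by (intro mult_left_mono power_mono onorm) auto
    finally show "(norm ((T \<circ> A) h))\<^sup>2 \<le> (onorm A)\<^sup>2 * c * (norm h)\<^sup>2" by (simp add: power_mult_distrib mult_ac)
  qed (use c in simp)
  then show ?thesis by (simp add: c ennreal_mult)
next
  case True
  show ?thesis
  \<comment> \<open>The product in \<open>ennreal\<close> of 0 and infinity is 0, so the claim has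
    content here: the composition must vanish.\<close>
  proof (cases "onorm A = 0")
    case True
    then have "A h = 0" for h using onorm[OF A, of h] by simp
    then have "opsq (T \<circ> A) \<le> ennreal 0" using linear_0[OF T] by (intro opsq_leI) auto
    then show ?thesis by simp
  qed (use True in \<open>simp add: ennreal_mult_top\<close>)
qed

lemma opsq_diff_le:
  fixes S T :: "'h::real_normed_vector \<Rightarrow> 'x::real_normed_vector"
  assumes S: "linear S" and T: "linear T"
  shows "opsq (\<lambda>h. S h - T h) \<le> 2 * opsq S + 2 * opsq T"
proof (cases "opsq S = \<infinity> \<or> opsq T = \<infinity>")
  case False
  then obtain c d where c: "opsq S = ennreal c" "0 \<le> c" and d: "opsq T = ennreal d" "0 \<le> d"
    by (cases "opsq S"; cases "opsq T") auto
  have "opsq (\<lambda>h. S h - T h) \<le> ennreal (2 * c + 2 * d)"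
  proof (rule opsq_leI)
    fix h
    have "(norm (S h - T h))\<^sup>2 \<le> (norm (S h) + norm (T h))\<^sup>2" by (intro power_mono norm_triangle_ineq4) auto
    also have "\<dots> \<le> 2 * (norm (S h))\<^sup>2 + 2 * (norm (T h))\<^sup>2"
      using sum_squares_bound[of "norm (S h)" "norm (T h)"] by (simp add: power2_sum)
    also have "\<dots> \<le> 2 * (c * (norm h)\<^sup>2) + 2 * (d * (norm h)\<^sup>2)"
      using opsq_leD[OF S _ c(2)] opsq_leD[OF T _ d(2)] c d by (intro add_mono mult_left_mono) auto
    finally show "(norm (S h - T h))\<^sup>2 \<le> (2 * c + 2 * d) * (norm h)\<^sup>2" by (simp add: algebra_simps)
  qed (use c d in simp)
  also have "\<dots> = 2 * opsq S + 2 * opsq T" using c d by (simp add: ennreal_mult)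
  finally show ?thesis .
qed (auto simp: ennreal_mult_top)

section \<open>Finite orthonormal systems and diagonalisation of a compressed form\<close>

lemma bessel_inequality:
  fixes x :: "'h::real_inner"
  assumes "finite E" "orthonormal_set E"
  shows "(\<Sum>e\<in>E. (x \<bullet> e)\<^sup>2) \<le> (norm x)\<^sup>2"
proof -
  let ?y = "\<Sum>e\<in>E. (x \<bullet> e) *\<^sub>R e"
  have y: "(norm ?y)\<^sup>2 = (\<Sum>e\<in>E. (x \<bullet> e)\<^sup>2)"
    using assms orthonormal_setD[OF assms(2)] by (intro orthonormal_sum_norm_sq) auto
  have "x \<bullet> ?y = (\<Sum>e\<in>E. (x \<bullet> e)\<^sup>2)" by (simp add: inner_sum_right power2_eq_square)
  moreover have "0 \<le> (norm (x - ?y))\<^sup>2" by simp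
  ultimately show ?thesis using y by (simp add: power2_norm_eq_inner inner_diff inner_commute)
qed

lemma opsq_finite_rank_le:
  fixes z :: "'h::real_inner \<Rightarrow> 'x::real_normed_vector"
  assumes "finite E" "orthonormal_set E"
  shows "opsq (\<lambda>g. \<Sum>e\<in>E. (g \<bullet> e) *\<^sub>R z e) \<le> ennreal (\<Sum>e\<in>E. (norm (z e))\<^sup>2)"
proof (rule opsq_leI)
  fix h
  have "norm (\<Sum>e\<in>E. (h \<bullet> e) *\<^sub>R z e) \<le> (\<Sum>e\<in>E. \<bar>h \<bullet> e\<bar> * norm (z e))"
    by (rule order_trans[OF norm_sum]) simp
  also have "\<dots> \<le> L2_set (\<lambda>e. h \<bullet> e) E * L2_set (\<lambda>e. norm (z e)) E"
    using L2_set_mult_ineq[of "\<lambda>e. h \<bullet> e" "\<lambda>e. norm (z e)" E] by simp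
  finally have "(norm (\<Sum>e\<in>E. (h \<bullet> e) *\<^sub>R z e))\<^sup>2 \<le> (L2_set (\<lambda>e. h \<bullet> e) E * L2_set (\<lambda>e. norm (z e)) E)\<^sup>2"
    by (intro power_mono) auto
  also have "\<dots> = (\<Sum>e\<in>E. (h \<bullet> e)\<^sup>2) * (\<Sum>e\<in>E. (norm (z e))\<^sup>2)"
    by (simp add: power_mult_distrib L2_set_def sum_nonneg)
  also have "\<dots> \<le> (norm h)\<^sup>2 * (\<Sum>e\<in>E. (norm (z e))\<^sup>2)"
    using bessel_inequality[OF assms] by (intro mult_right_mono sum_nonneg) auto
  finally show "(norm (\<Sum>e\<in>E. (h \<bullet> e) *\<^sub>R z e))\<^sup>2 \<le> (\<Sum>e\<in>E. (norm (z e))\<^sup>2) * (norm h)\<^sup>2"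
    by (simp add: mult.commute)
qed (simp add: sum_nonneg)

lemma finite_orthonormal_basis:
  fixes S :: "'h::real_inner set"
  assumes "finite S"
  obtains E where "finite E" "orthonormal_set E" "span E = span S"
proof -
  obtain C where C: "finite C" "span C = span S" "pairwise orthogonal C"
    using basis_orthogonal[OF assms] by blast
  define E where "E = (\<lambda>x. (1 / norm x) *\<^sub>R x) ` (C - {0})"
  have "orthonormal_set E"
    unfolding orthonormal_set_def
  proof (intro conjI ballI impI)
    fix x y assume "x \<in> E" "y \<in> E" "x \<noteq> y"
    then obtain u v where "u \<in> C" "v \<in> C" "u \<noteq> v" "x = (1 / norm u) *\<^sub>R u" "y = (1 / norm v) *\<^sub>R v"
      unfolding E_def by auto
    then show "x \<bullet> y = 0" using C(3) by (simp add: pairwise_def orthogonal_def)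
  qed (auto simp: E_def split: if_split_asm)
  moreover have "span E = span S"
  proof
    show "span E \<subseteq> span S" unfolding C(2)[symmetric]
      by (rule span_minimal) (auto simp: E_def span_base span_scale)
    have "x \<in> span E" if "x \<in> C" for x
    proof (cases "x = 0")
      case False
      then have "norm x *\<^sub>R ((1 / norm x) *\<^sub>R x) \<in> span E"
        using that by (intro span_scale span_base) (auto simp: E_def)
      then show ?thesis using False by simp
    qed (simp add: span_zero)
    then show "span S \<subseteq> span E" unfolding C(2)[symmetric] by (intro span_minimal) auto
  qed
  moreover have "finite E" unfolding E_def using C(1) by simp
  ultimately show thesis using that[of E] by simp
qed

lemma orthonormal_expansion:
  fixes x :: "'h::real_inner"
  assumes E: "finite E" "orthonormal_set E" and x: "x \<in> span E"
  shows "x = (\<Sum>e\<in>E. (x \<bullet> e) *\<^sub>R e)"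
  using x
proof (induction rule: span_induct_alt)
  case (step c e x)
  have "(\<Sum>e'\<in>E. (e \<bullet> e') *\<^sub>R e') = (\<Sum>e'\<in>E. if e' = e then e else 0)"
    using orthonormal_setD[OF E(2) step(1)] by (intro sum.cong refl) auto
  also have "\<dots> = e" using E(1) step(1) by simp
  finally have ee: "(\<Sum>e'\<in>E. (e \<bullet> e') *\<^sub>R e') = e" .
  have "(\<Sum>e'\<in>E. ((c *\<^sub>R e + x) \<bullet> e') *\<^sub>R e') = (\<Sum>e'\<in>E. c *\<^sub>R ((e \<bullet> e') *\<^sub>R e') + (x \<bullet> e') *\<^sub>R e')"
    by (simp add: inner_add_left scaleR_add_left)
  also have "\<dots> = c *\<^sub>R e + (\<Sum>e'\<in>E. (x \<bullet> e') *\<^sub>R e')"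
    by (simp only: sum.distrib scaleR_sum_right[symmetric] ee)
  finally show ?case using step(2) by simp
qed simp

text \<open>Compactness inside an infinite-dimensional space, built up from one segment per vector
  by sums of compact sets. It supplies the maximum of a quadratic form on a finite-dimensional
  sphere.\<close>

lemma compact_orthonormal_cube:
  fixes E :: "'h::real_inner set"
  assumes "finite E"
  shows "compact {(\<Sum>e\<in>E. c e *\<^sub>R e) | c. \<forall>e\<in>E. \<bar>c e\<bar> \<le> (1::real)}"
  using assms
proof (induction E)
  case (insert a E)
  let ?K = "\<lambda>E. {(\<Sum>e\<in>E. c e *\<^sub>R e) | c. \<forall>e\<in>E. \<bar>c e\<bar> \<le> (1::real)}"
  have "?K (insert a E) = {x + y | x y. x \<in> (\<lambda>t. t *\<^sub>R a) ` {-1..1} \<and> y \<in> ?K E}"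
  proof (intro set_eqI iffI)
    fix z assume "z \<in> ?K (insert a E)"
    then obtain c where "\<forall>e\<in>insert a E. \<bar>c e\<bar> \<le> 1" "z = c a *\<^sub>R a + (\<Sum>e\<in>E. c e *\<^sub>R e)"
      using insert by auto
    moreover from this have "c a *\<^sub>R a \<in> (\<lambda>t. t *\<^sub>R a) ` {-1..1}" by (intro imageI) (auto simp: abs_le_iff)
    moreover have "(\<Sum>e\<in>E. c e *\<^sub>R e) \<in> ?K E" using calculation by blast
    ultimately show "z \<in> {x + y | x y. x \<in> (\<lambda>t. t *\<^sub>R a) ` {-1..1} \<and> y \<in> ?K E}" by blast
  next
    fix z assume "z \<in> {x + y | x y. x \<in> (\<lambda>t. t *\<^sub>R a) ` {-1..1} \<and> y \<in> ?K E}"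
    then obtain t c where tc: "t \<in> {-1..1}" "\<forall>e\<in>E. \<bar>c e\<bar> \<le> 1" "z = t *\<^sub>R a + (\<Sum>e\<in>E. c e *\<^sub>R e)" by auto
    have "(\<Sum>e\<in>E. c e *\<^sub>R e) = (\<Sum>e\<in>E. (c(a := t)) e *\<^sub>R e)" using insert by (intro sum.cong) auto
    then have "z = (\<Sum>e\<in>insert a E. (c(a := t)) e *\<^sub>R e)" using insert tc by simp
    moreover have "\<forall>e\<in>insert a E. \<bar>(c(a := t)) e\<bar> \<le> 1" using tc by auto
    ultimately show "z \<in> ?K (insert a E)" by blast
  qed
  moreover have "compact ((\<lambda>t. t *\<^sub>R a) ` {-1..1::real})"
    by (intro compact_continuous_image continuous_intros) auto
  from compact_sums[OF this insert.IH]
  have "compact {x + y | x y. x \<in> (\<lambda>t. t *\<^sub>R a) ` {-1..1} \<and> y \<in> ?K E}" .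
  ultimately show ?case by (simp only:)
qed simp

text \<open>In an orthonormal basis of the span, unit vectors have coordinates of modulus at most 1.
  The set is therefore a closed part of the cube above, the span itself being cut out by the closed
  condition that a vector equals its expansion.\<close>

lemma compact_unit_sphere_subspace:
  fixes S E :: "'h::real_inner set"
  assumes S: "finite S"
  shows "compact {x \<in> span S. norm x = 1 \<and> (\<forall>e\<in>E. x \<bullet> e = 0)}"
proof -
  obtain B where B: "finite B" "orthonormal_set B" "span B = span S"
    using finite_orthonormal_basis[OF S] .
  let ?K = "{(\<Sum>e\<in>B. c e *\<^sub>R e) | c. \<forall>e\<in>B. \<bar>c e\<bar> \<le> (1::real)}"
  have span: "x \<in> span S \<longleftrightarrow> x = (\<Sum>e\<in>B. (x \<bullet> e) *\<^sub>R e)" for x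
    unfolding B(3)[symmetric]
    using orthonormal_expansion[OF B(1,2), of x] by (metis (mono_tags, lifting) span_base span_scale span_sum)
  have "{x \<in> span S. norm x = 1 \<and> (\<forall>e\<in>E. x \<bullet> e = 0)} =
     ?K \<inter> ({x. x = (\<Sum>e\<in>B. (x \<bullet> e) *\<^sub>R e)} \<inter> {x. norm x = 1} \<inter> (\<Inter>e\<in>E. {x. x \<bullet> e = 0}))" (is "?L = ?K \<inter> ?C")
  proof (intro set_eqI iffI)
    fix x assume x: "x \<in> ?L"
    have "\<bar>x \<bullet> e\<bar> \<le> 1" if "e \<in> B" for e
      using Cauchy_Schwarz_ineq2[of x e] B(2) that x by (auto simp: orthonormal_set_def)
    moreover have "x = (\<Sum>e\<in>B. (x \<bullet> e) *\<^sub>R e)" using x span by blast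
    ultimately have "x \<in> ?K" by blast
    then show "x \<in> ?K \<inter> ?C" using x span by auto
  qed (use span in auto)
  moreover have "closed ?C"
    by (intro closed_Int closed_INT ballI closed_Collect_eq continuous_intros)
  ultimately show ?thesis using compact_orthonormal_cube[OF B(1)] by (simp add: compact_Int_closed)
qed

text \<open>The vectors of \<open>E\<close> are eigenvectors of \<open>A\<close> compressed to the
  span of \<open>S\<close>, not of \<open>A\<close> itself. They are found as successive maximisers
  of \<open>A x \<bullet> x\<close> on unit spheres: a system of greatest cardinality satisfying
  \<open>Q\<close> must exhaust the span, as otherwise a maximiser in its orthogonal complement
  could be added.\<close>

lemma symmetric_eigenbasis:
  fixes A :: "'h::real_inner \<Rightarrow> 'h"
  assumes S: "finite S" and A: "bounded_linear A" and sym: "\<And>x y. A x \<bullet> y = x \<bullet> A y"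
  obtains E where "finite E" "orthonormal_set E" "\<And>x. x \<in> S \<Longrightarrow> x = (\<Sum>e\<in>E. (x \<bullet> e) *\<^sub>R e)"
    "\<And>x e. x \<in> S \<Longrightarrow> e \<in> E \<Longrightarrow> A x \<bullet> e = (A e \<bullet> e) * (x \<bullet> e)"
proof -
  note lin = bounded_linear.linear[OF A]
  define V where "V = span S"
  \<comment> \<open>The clause on \<open>x \<in> V\<close> says that the compressed operator keeps
    the span of \<open>E\<close> invariant. With it a vector from the complement can join without
    disturbing the diagonal form.\<close>
  define Q where "Q E \<longleftrightarrow> E \<subseteq> V \<and> finite E \<and> orthonormal_set E \<and>
    (\<forall>e\<in>E. \<forall>x\<in>V. (\<forall>e'\<in>E. x \<bullet> e' = 0) \<longrightarrow> A e \<bullet> x = 0) \<and> (\<forall>e\<in>E. \<forall>e'\<in>E. e \<noteq> e' \<longrightarrow> A e \<bullet> e' = 0)" for E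
  have card: "card E \<le> card S" if "Q E" for E
  proof -
    have "pairwise orthogonal E" "0 \<notin> E"
      using that unfolding Q_def orthonormal_set_def by (auto simp: pairwise_def orthogonal_def)
    then have "independent E" by (rule pairwise_orthogonal_independent)
    then show ?thesis using independent_span_bound[OF S, of E] that unfolding Q_def V_def by auto
  qed
  have "Q {}" unfolding Q_def orthonormal_set_def by auto
  then obtain E where E: "Q E" "\<And>E'. Q E' \<Longrightarrow> card E' \<le> card E"
    using ex_has_greatest_nat[of Q "{}" card "Suc (card S)"] card by (auto simp: less_Suc_eq_le)
  define W where "W = {x \<in> V. \<forall>e\<in>E. x \<bullet> e = 0}"
  have Wsub: "subspace W"
    unfolding W_def V_def subspace_def by (auto simp: span_zero span_add span_scale inner_add_left)
  have W0: "x = 0" if x: "x \<in> W" for x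
  proof (rule ccontr)
    assume x0: "x \<noteq> 0"
    define K where "K = {x \<in> span S. norm x = 1 \<and> (\<forall>e\<in>E. x \<bullet> e = 0)}"
    have KW: "K = {x \<in> W. norm x = 1}" unfolding K_def W_def V_def by auto
    have "(1 / norm x) *\<^sub>R x \<in> K" using x x0 subspace_scale[OF Wsub] unfolding KW by auto
    then have "\<exists>v\<in>K. \<forall>y\<in>K. A y \<bullet> y \<le> A v \<bullet> v"
      using compact_unit_sphere_subspace[OF S, of E] unfolding K_def[symmetric]
      by (intro continuous_attains_sup continuous_intros linear_continuous_on A) auto
    then obtain v where v: "v \<in> K" "\<And>y. y \<in> K \<Longrightarrow> A y \<bullet> y \<le> A v \<bullet> v" by auto
    define a where "a = A v \<bullet> v"
    have vW: "v \<in> W" "norm v = 1" "v \<bullet> v = 1" using v(1) unfolding KW by (auto simp: norm_eq_1)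
    have max: "A y \<bullet> y \<le> a * (norm y)\<^sup>2" if "y \<in> W" for y
    proof (cases "y = 0")
      case False
      have "(1 / norm y) *\<^sub>R y \<in> K" using that False subspace_scale[OF Wsub] unfolding KW by auto
      from v(2)[OF this] have "(A y \<bullet> y) / (norm y)\<^sup>2 \<le> a"
        unfolding a_def by (simp add: linear_scale[OF lin] power2_eq_square)
      then show ?thesis using False by (simp add: divide_le_eq)
    qed (simp add: linear_0[OF lin])
    have orth: "A v \<bullet> y = 0" if y: "y \<in> W" "y \<bullet> v = 0" for y
    proof -
      define b where "b = A v \<bullet> y"
      define c where "c = a * (norm y)\<^sup>2 - A y \<bullet> y"
      \<comment> \<open>The maximum property at \<open>v\<close>, perturbed in the direction
        \<open>y\<close>. It forces \<open>b = 0\<close>: take \<open>t = b\<close> if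
        \<open>c = 0\<close>, and \<open>t = b / c\<close> otherwise.\<close>
      have quad: "2 * t * b \<le> t\<^sup>2 * c" for t
      proof -
        have "v + t *\<^sub>R y \<in> W" using vW y by (intro subspace_add[OF Wsub] subspace_scale[OF Wsub])
        from max[OF this] have "A (v + t *\<^sub>R y) \<bullet> (v + t *\<^sub>R y) \<le> a * (norm (v + t *\<^sub>R y))\<^sup>2" .
        moreover have "(norm (v + t *\<^sub>R y))\<^sup>2 = 1 + t\<^sup>2 * (norm y)\<^sup>2"
          using vW(3) y(2) unfolding power2_norm_eq_inner
          by (simp add: inner_add_left inner_add_right inner_commute power2_eq_square mult.assoc)
        moreover have "A (v + t *\<^sub>R y) \<bullet> (v + t *\<^sub>R y) = a + 2 * t * b + t\<^sup>2 * (A y \<bullet> y)"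
          using sym[of y v] by (simp add: a_def b_def linear_add[OF lin] linear_scale[OF lin] inner_add_left inner_add_right
              inner_commute power2_eq_square algebra_simps)
        ultimately show ?thesis by (simp add: c_def algebra_simps)
      qed
      have "0 \<le> c" using max[OF y(1)] unfolding c_def by simp
      have "b = 0"
      proof (cases "c = 0")
        case True
        then show ?thesis using quad[of b] by (auto simp: mult_le_0_iff)
      next
        case False
        with \<open>0 \<le> c\<close> have c: "0 < c" by simp
        have "2 * (b / c) * b \<le> (b / c)\<^sup>2 * c" by (rule quad)
        also have "\<dots> = (b / c) * b" using c by (simp add: power2_eq_square)
        finally have "b * b / c \<le> 0" by simp
        then have "b * b \<le> 0" using c by (simp add: divide_le_0_iff)
        then show ?thesis by (auto simp: mult_le_0_iff)
      qed
      then show ?thesis unfolding b_def .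
    qed
    have vE: "v \<notin> E" using vW unfolding W_def by auto
    have ve: "v \<bullet> e = 0" "e \<bullet> v = 0" "A e \<bullet> v = 0" "A v \<bullet> e = 0" if "e \<in> E" for e
    proof -
      show "v \<bullet> e = 0" "e \<bullet> v = 0" using that vW(1) unfolding W_def by (auto simp: inner_commute)
      show "A e \<bullet> v = 0" using that E(1) vW(1) unfolding W_def Q_def by auto
      then show "A v \<bullet> e = 0" using sym[of v e] by (simp add: inner_commute)
    qed
    have "Q (insert v E)"
      unfolding Q_def
    proof (intro conjI)
      show "insert v E \<subseteq> V" "finite (insert v E)" using E(1) vW(1) unfolding Q_def W_def by auto
      show "orthonormal_set (insert v E)" using E(1) vW(2) ve unfolding Q_def orthonormal_set_def by auto
      show "\<forall>e\<in>insert v E. \<forall>x\<in>V. (\<forall>e'\<in>insert v E. x \<bullet> e' = 0) \<longrightarrow> A e \<bullet> x = 0"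
        using E(1) orth unfolding Q_def W_def by auto
      show "\<forall>e\<in>insert v E. \<forall>e'\<in>insert v E. e \<noteq> e' \<longrightarrow> A e \<bullet> e' = 0"
        using E(1) ve unfolding Q_def by auto
    qed
    from E(2)[OF this] show False using vE E(1) unfolding Q_def by simp
  qed
  have fin: "finite E" "orthonormal_set E" using E(1) unfolding Q_def by auto
  have exp: "x = (\<Sum>e\<in>E. (x \<bullet> e) *\<^sub>R e)" if x: "x \<in> S" for x
  proof -
    let ?y = "\<Sum>e\<in>E. (x \<bullet> e) *\<^sub>R e"
    have "?y \<in> V" unfolding V_def by (rule span_sum) (use E(1) in \<open>auto simp: Q_def V_def span_scale\<close>)
    then have "x - ?y \<in> V" using x unfolding V_def by (simp add: span_base span_diff)
    moreover have "(x - ?y) \<bullet> e = 0" if e: "e \<in> E" for e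
    proof -
      have "?y \<bullet> e = (\<Sum>e'\<in>E. if e' = e then x \<bullet> e else 0)"
        unfolding inner_sum_left using orthonormal_setD[OF fin(2) _ e] by (intro sum.cong refl) auto
      then show ?thesis using fin(1) e by (simp add: inner_diff_left)
    qed
    ultimately have "x - ?y \<in> W" unfolding W_def by simp
    from W0[OF this] show ?thesis by simp
  qed
  show thesis
  proof (rule that[OF fin exp])
    fix x e assume x: "x \<in> S" and e: "e \<in> E"
    have "A x \<bullet> e = x \<bullet> A e" by (rule sym)
    also have "\<dots> = (\<Sum>e'\<in>E. (x \<bullet> e') *\<^sub>R e') \<bullet> A e" using exp[OF x] by simp
    also have "\<dots> = (\<Sum>e'\<in>E. if e' = e then (A e \<bullet> e) * (x \<bullet> e) else 0)"
      unfolding inner_sum_left using E(1) e by (intro sum.cong refl) (auto simp: Q_def inner_commute)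
    also have "\<dots> = (A e \<bullet> e) * (x \<bullet> e)" using fin(1) e by simp
    finally show "A x \<bullet> e = (A e \<bullet> e) * (x \<bullet> e)" .
  qed auto
qed

text \<open>In the plane of \<open>u\<close> and \<open>w\<close> the test vector \<open>x\<close>
  is proportional to the one representing \<open>f\<close>. Testing the norm bound there shows that
  what \<open>f\<close> spends on \<open>u\<close> is missing on directions orthogonal to
  \<open>u\<close>.\<close>

lemma orthogonal_functional_bound:
  fixes f :: "'h::real_inner \<Rightarrow> real"
  assumes f: "linear f" and F: "\<And>h. (f h)\<^sup>2 \<le> F * (norm h)\<^sup>2" and u: "norm u = 1" "u \<bullet> w = 0"
  shows "(f w)\<^sup>2 \<le> (F - (f u)\<^sup>2) * (norm w)\<^sup>2"
proof -
  define x where "x = (f u * (norm w)\<^sup>2) *\<^sub>R u + f w *\<^sub>R w"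
  define s where "s = (f u)\<^sup>2 * (norm w)\<^sup>2 + (f w)\<^sup>2"
  have fx: "f x = s" unfolding x_def s_def by (simp add: linear_add[OF f] linear_scale[OF f] power2_eq_square algebra_simps)
  have "u \<bullet> u = 1" using u(1) by (simp add: norm_eq_1)
  then have "(norm x)\<^sup>2 = (norm w)\<^sup>2 * s"
    unfolding x_def s_def power2_norm_eq_inner using u(2)
    by (simp add: inner_add_left inner_add_right inner_commute power2_eq_square algebra_simps)
  with F[of x] have "s * s \<le> (F * (norm w)\<^sup>2) * s" by (simp add: fx power2_eq_square mult_ac)
  moreover have "0 \<le> s" unfolding s_def by simp
  moreover have "0 \<le> F" using F[of u] u(1) by (simp add: order_trans[OF zero_le_power2])
  ultimately have "s \<le> F * (norm w)\<^sup>2" by (cases "s = 0") auto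
  then show ?thesis unfolding s_def by (simp add: algebra_simps)
qed

text \<open>Operator convergence is reduced to functionals, one per coordinate of the target. A
  functional nearly attains its norm at some \<open>d\<close> in the dense set, and by
  \<open>orthogonal_functional_bound\<close> it is small on everything orthogonal to
  \<open>d\<close>. Once the span contains \<open>d\<close>, the remainder \<open>h - P h\<close> is
  orthogonal to it, and the estimate is uniform in \<open>h\<close>.\<close>

lemma orthogonal_projections_approximate:
  fixes D :: "'h::real_inner set"
  assumes D: "countable D" "closure D = UNIV"
  obtains E :: "nat \<Rightarrow> 'h set" where "\<And>n. finite (E n)" "\<And>n. orthonormal_set (E n)"
    "\<And>T :: 'h \<Rightarrow> 'x::euclidean_space. bounded_linear T \<Longrightarrow>
       (\<lambda>n. opsq (\<lambda>h. T h - T (\<Sum>e\<in>E n. (h \<bullet> e) *\<^sub>R e))) \<longlonglongrightarrow> 0"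
proof -
  have "D \<noteq> {}" using D(2) by auto
  define S where "S n = from_nat_into D ` {..<n}" for n
  have "\<forall>n. \<exists>E. finite E \<and> orthonormal_set E \<and> span E = span (S n)"
    using finite_orthonormal_basis[of "S _"] unfolding S_def by (metis finite_imageI finite_lessThan)
  then obtain E where E: "\<And>n. finite (E n)" "\<And>n. orthonormal_set (E n)" "\<And>n. span (E n) = span (S n)"
    by metis
  have main: "\<exists>n0. \<forall>n\<ge>n0. \<forall>h. (f (h - (\<Sum>e\<in>E n. (h \<bullet> e) *\<^sub>R e)))\<^sup>2 \<le> \<epsilon> * (norm h)\<^sup>2"
    if f: "bounded_linear f" and \<epsilon>: "0 < \<epsilon>" for f :: "'h \<Rightarrow> real" and \<epsilon>
  proof -
    note lin = bounded_linear.linear[OF f]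
    let ?F = "(onorm f)\<^sup>2"
    have F: "(f h)\<^sup>2 \<le> ?F * (norm h)\<^sup>2" for h
      using power_mono[OF onorm[OF f, of h], of 2] by (simp add: power_mult_distrib)
    \<comment> \<open>If no such \<open>d\<close> existed, the smaller bound
      \<open>?F - \<epsilon>\<close> would extend from \<open>D\<close> to the whole space and
      contradict the definition of the operator norm.\<close>
    have "\<exists>d\<in>D. (?F - \<epsilon>) * (norm d)\<^sup>2 < (f d)\<^sup>2 \<or> ?F \<le> \<epsilon>"
    proof (rule ccontr)
      assume "\<not> ?thesis"
      then have le: "\<And>d. d \<in> D \<Longrightarrow> (f d)\<^sup>2 \<le> (?F - \<epsilon>) * (norm d)\<^sup>2" and big: "\<epsilon> < ?F" using \<open>D \<noteq> {}\<close> by force+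
      have "closed {h. (f h)\<^sup>2 \<le> (?F - \<epsilon>) * (norm h)\<^sup>2}"
        by (intro closed_Collect_le continuous_intros linear_continuous_on f)
      moreover have "D \<subseteq> {h. (f h)\<^sup>2 \<le> (?F - \<epsilon>) * (norm h)\<^sup>2}" using le by auto
      ultimately have "closure D \<subseteq> {h. (f h)\<^sup>2 \<le> (?F - \<epsilon>) * (norm h)\<^sup>2}" by (intro closure_minimal)
      then have all: "(f h)\<^sup>2 \<le> (?F - \<epsilon>) * (norm h)\<^sup>2" for h using D(2) by auto
      have "onorm f \<le> sqrt (?F - \<epsilon>)"
      proof (rule onorm_bound)
        fix h
        have "norm (f h) = sqrt ((f h)\<^sup>2)" by simp
        also have "\<dots> \<le> sqrt ((?F - \<epsilon>) * (norm h)\<^sup>2)" using all by (intro real_sqrt_le_mono)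
        finally show "norm (f h) \<le> sqrt (?F - \<epsilon>) * norm h" by (simp add: real_sqrt_mult)
      qed (use big in simp)
      then have "?F \<le> (sqrt (?F - \<epsilon>))\<^sup>2" using onorm_pos_le[OF f] by (intro power_mono)
      then show False using big \<epsilon> by simp
    qed
    then obtain d where d: "d \<in> D" "(?F - \<epsilon>) * (norm d)\<^sup>2 < (f d)\<^sup>2 \<or> ?F \<le> \<epsilon>" by auto
    obtain m where m: "from_nat_into D m = d" using from_nat_into_surj[OF D(1) d(1)] by auto
    show ?thesis
    proof (intro exI[of _ "Suc m"] allI impI)
      fix n h assume n: "Suc m \<le> n"
      let ?P = "\<Sum>e\<in>E n. (h \<bullet> e) *\<^sub>R e"
      let ?w = "h - ?P"
      have we: "?w \<bullet> e = 0" if e: "e \<in> E n" for e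
      proof -
        have "?P \<bullet> e = (\<Sum>e'\<in>E n. if e' = e then h \<bullet> e else 0)"
          unfolding inner_sum_left using orthonormal_setD[OF E(2) _ e] by (intro sum.cong refl) auto
        then show ?thesis using E(1) e by (simp add: inner_diff_left)
      qed
      have "d \<in> span (E n)" unfolding E(3) by (rule span_base) (use m n in \<open>auto simp: S_def\<close>)
      then have "d = (\<Sum>e\<in>E n. (d \<bullet> e) *\<^sub>R e)" by (rule orthonormal_expansion[OF E(1,2)])
      then have "?w \<bullet> d = (\<Sum>e\<in>E n. (d \<bullet> e) * (?w \<bullet> e))" by (metis (no_types, lifting) inner_scaleR_right inner_sum_right sum.cong)
      then have dw: "d \<bullet> ?w = 0" using we by (simp add: inner_commute)
      have "?w \<bullet> ?P = 0" unfolding inner_sum_right using we by simp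
      then have "h \<bullet> h = ?w \<bullet> ?w + ?P \<bullet> ?P"
        by (simp add: inner_diff inner_commute algebra_simps)
      then have wh: "(norm ?w)\<^sup>2 \<le> (norm h)\<^sup>2" by (simp add: power2_norm_eq_inner)
      have "(f ?w)\<^sup>2 \<le> \<epsilon> * (norm ?w)\<^sup>2"
      proof (cases "?F \<le> \<epsilon>")
        case True
        then show ?thesis using F[of ?w] by (meson mult_right_mono order_trans zero_le_power2)
      next
        case False
        with d have d': "(?F - \<epsilon>) * (norm d)\<^sup>2 < (f d)\<^sup>2" by simp
        have d0: "d \<noteq> 0" using d' linear_0[OF lin] by auto
        let ?u = "(1 / norm d) *\<^sub>R d"
        have "(f ?w)\<^sup>2 \<le> (?F - (f ?u)\<^sup>2) * (norm ?w)\<^sup>2"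
          by (rule orthogonal_functional_bound[OF lin F]) (use d0 dw in auto)
        also have "\<dots> \<le> \<epsilon> * (norm ?w)\<^sup>2"
        proof (rule mult_right_mono)
          have "(f ?u)\<^sup>2 = (f d)\<^sup>2 / (norm d)\<^sup>2" by (simp add: linear_scale[OF lin] power_divide)
          then have "(?F - \<epsilon>) * (norm d)\<^sup>2 < (f ?u)\<^sup>2 * (norm d)\<^sup>2" using d' d0 by simp
          then have "?F - \<epsilon> < (f ?u)\<^sup>2" by (rule mult_right_less_imp_less) simp
          then show "?F - (f ?u)\<^sup>2 \<le> \<epsilon>" by simp
        qed simp
        finally show ?thesis .
      qed
      also have "\<dots> \<le> \<epsilon> * (norm h)\<^sup>2" using wh \<epsilon> by simp
      finally show "(f ?w)\<^sup>2 \<le> \<epsilon> * (norm h)\<^sup>2" .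
    qed
  qed
  show thesis
  proof (rule that[OF E(1,2)])
    fix T :: "'h \<Rightarrow> 'x" assume T: "bounded_linear T"
    note lin = bounded_linear.linear[OF T]
    show "(\<lambda>n. opsq (\<lambda>h. T h - T (\<Sum>e\<in>E n. (h \<bullet> e) *\<^sub>R e))) \<longlonglongrightarrow> 0"
    proof (rule order_tendstoI)
      fix a :: ennreal assume "0 < a"
      then obtain \<delta> where \<delta>: "0 < \<delta>" "ennreal \<delta> < a"
        by (metis ennreal_less_zero_iff ennreal_rat_dense ennreal_0 less_ennreal.rep_eq dense ennreal_cases ennreal_less_top not_less_zero order_less_trans ennreal_less_iff less_le_not_le)
      \<comment> \<open>The error is shared equally among the coordinates of the target.\<close>
      define \<epsilon> where "\<epsilon> = \<delta> / real DIM('x)"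
      have \<epsilon>: "0 < \<epsilon>" using \<delta> unfolding \<epsilon>_def by simp
      have "\<forall>b\<in>Basis. \<exists>n0. \<forall>n\<ge>n0. \<forall>h. (T (h - (\<Sum>e\<in>E n. (h \<bullet> e) *\<^sub>R e)) \<bullet> b)\<^sup>2 \<le> \<epsilon> * (norm h)\<^sup>2"
        using main[OF _ \<epsilon>, of "\<lambda>h. T h \<bullet> _"] T by (auto intro: bounded_linear_inner_left_comp)
      then have "\<forall>b\<in>Basis. \<forall>\<^sub>F n in sequentially. \<forall>h. (T (h - (\<Sum>e\<in>E n. (h \<bullet> e) *\<^sub>R e)) \<bullet> b)\<^sup>2 \<le> \<epsilon> * (norm h)\<^sup>2"
        by (auto simp: eventually_sequentially)
      then have "\<forall>\<^sub>F n in sequentially. \<forall>b\<in>Basis. \<forall>h. (T (h - (\<Sum>e\<in>E n. (h \<bullet> e) *\<^sub>R e)) \<bullet> b)\<^sup>2 \<le> \<epsilon> * (norm h)\<^sup>2"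
        by (rule eventually_ball_finite[OF finite_Basis])
      then show "\<forall>\<^sub>F n in sequentially. opsq (\<lambda>h. T h - T (\<Sum>e\<in>E n. (h \<bullet> e) *\<^sub>R e)) < a"
      proof eventually_elim
        case (elim n)
        have "opsq (\<lambda>h. T h - T (\<Sum>e\<in>E n. (h \<bullet> e) *\<^sub>R e)) \<le> ennreal \<delta>"
        proof (rule opsq_leI)
          fix h
          let ?y = "T h - T (\<Sum>e\<in>E n. (h \<bullet> e) *\<^sub>R e)"
          have "(norm ?y)\<^sup>2 = (\<Sum>b\<in>Basis. (?y \<bullet> b)\<^sup>2)"
            unfolding power2_norm_eq_inner by (subst euclidean_inner) (simp add: power2_eq_square)
          also have "\<dots> \<le> (\<Sum>b::'x\<in>Basis. \<epsilon> * (norm h)\<^sup>2)"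
            using elim by (intro sum_mono) (auto simp: linear_diff[OF lin])
          also have "\<dots> = \<delta> * (norm h)\<^sup>2" by (simp add: \<epsilon>_def)
          finally show "(norm ?y)\<^sup>2 \<le> \<delta> * (norm h)\<^sup>2" .
        qed (use \<delta> in simp)
        with \<delta>(2) show ?case by simp
      qed
    qed simp
  qed
qed

section \<open>Cylindrical Brownian motion and elementary integrals\<close>

lemma cyl_bm_measurable:
  assumes F: "is_filtr M F" and W: "cyl_bm M F W" and t: "0 \<le> t"
  shows "W t h \<in> borel_measurable (F t)" "W t h \<in> borel_measurable M"
proof -
  have "wiener_proc M F (length [h]) (\<lambda>t i. W t ([h] ! i))"
    using W[unfolded cyl_bm_def, THEN conjunct1, THEN spec, of "[h]"] .
  then have "\<forall>t\<ge>0. \<forall>i<length [h]. W t ([h] ! i) \<in> borel_measurable (F t)"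
    unfolding wiener_proc_def by (elim conjE) assumption
  then show "W t h \<in> borel_measurable (F t)" using t by auto
  then show "W t h \<in> borel_measurable M" using F t unfolding is_filtr_def by (meson measurable_from_subalg)
qed

lemma cyl_bm_product:
  assumes F: "is_filtr M F" and W: "cyl_bm M F W" and t: "0 \<le> t" "0 \<le> s"
  shows "integrable M (\<lambda>\<omega>. W t h \<omega> * W s g \<omega>)" "(\<integral>\<omega>. W t h \<omega> * W s g \<omega> \<partial>M) = (h \<bullet> g) * min t s"
proof -
  note [measurable] = cyl_bm_measurable(2)[OF F W t(1)] cyl_bm_measurable(2)[OF F W t(2)]
  show "integrable M (\<lambda>\<omega>. W t h \<omega> * W s g \<omega>)"
  proof (rule Bochner_Integration.integrable_bound)
    show "integrable M (\<lambda>\<omega>. (W t h \<omega>)\<^sup>2 + (W s g \<omega>)\<^sup>2)" using W t unfolding cyl_bm_def by auto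
    show "AE \<omega> in M. norm (W t h \<omega> * W s g \<omega>) \<le> norm ((W t h \<omega>)\<^sup>2 + (W s g \<omega>)\<^sup>2)"
    proof (rule AE_I2)
      fix \<omega>
      have "2 * \<bar>W t h \<omega>\<bar> * \<bar>W s g \<omega>\<bar> \<le> (W t h \<omega>)\<^sup>2 + (W s g \<omega>)\<^sup>2"
        using sum_squares_bound[of "\<bar>W t h \<omega>\<bar>" "\<bar>W s g \<omega>\<bar>"] by simp
      moreover have "0 \<le> \<bar>W t h \<omega>\<bar> * \<bar>W s g \<omega>\<bar>" by simp
      ultimately have "\<bar>W t h \<omega>\<bar> * \<bar>W s g \<omega>\<bar> \<le> (W t h \<omega>)\<^sup>2 + (W s g \<omega>)\<^sup>2" by linarith
      then show "norm (W t h \<omega> * W s g \<omega>) \<le> norm ((W t h \<omega>)\<^sup>2 + (W s g \<omega>)\<^sup>2)" by (simp add: abs_mult)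
    qed
  qed measurable
  show "(\<integral>\<omega>. W t h \<omega> * W s g \<omega> \<partial>M) = (h \<bullet> g) * min t s" using W t unfolding cyl_bm_def by blast
qed

lemma cyl_bm_increment_product:
  assumes F: "is_filtr M F" and W: "cyl_bm M F W" and t: "0 \<le> s" "s \<le> t"
  shows "integrable M (\<lambda>\<omega>. (W t h \<omega> - W s h \<omega>) * (W t g \<omega> - W s g \<omega>))"
    "(\<integral>\<omega>. (W t h \<omega> - W s h \<omega>) * (W t g \<omega> - W s g \<omega>) \<partial>M) = (t - s) * (h \<bullet> g)"
proof -
  have t0: "0 \<le> t" using t by simp
  note i = cyl_bm_product[OF F W]
  have eq: "(W t h \<omega> - W s h \<omega>) * (W t g \<omega> - W s g \<omega>) = W t h \<omega> * W t g \<omega> - W t h \<omega> * W s g \<omega> - W s h \<omega> * W t g \<omega> + W s h \<omega> * W s g \<omega>" for \<omega>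
    by (simp add: algebra_simps)
  show "integrable M (\<lambda>\<omega>. (W t h \<omega> - W s h \<omega>) * (W t g \<omega> - W s g \<omega>))"
    unfolding eq using i(1) t0 t(1) by auto
  show "(\<integral>\<omega>. (W t h \<omega> - W s h \<omega>) * (W t g \<omega> - W s g \<omega>) \<partial>M) = (t - s) * (h \<bullet> g)"
    unfolding eq using i t0 t by (simp add: min_absorb1 min_absorb2 inner_commute[of g h] algebra_simps)
qed

text \<open>Linearity in \<open>h\<close> is not part of \<open>cyl_bm\<close>; it follows almost
  everywhere, because the covariance formula gives the defect second moment 0.\<close>

lemma cyl_bm_linear2:
  assumes F: "is_filtr M F" and W: "cyl_bm M F W" and t: "0 \<le> t"
  shows "AE \<omega> in M. W t (a *\<^sub>R h + b *\<^sub>R g) \<omega> = a * W t h \<omega> + b * W t g \<omega>"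
proof -
  let ?v = "a *\<^sub>R h + b *\<^sub>R g"
  define D where "D \<omega> = W t ?v \<omega> - a * W t h \<omega> - b * W t g \<omega>" for \<omega>
  note i = cyl_bm_product[OF F W t t]
  have eq: "(D \<omega>)\<^sup>2 = W t ?v \<omega> * W t ?v \<omega> + a * a * (W t h \<omega> * W t h \<omega>) + b * b * (W t g \<omega> * W t g \<omega>)
     - 2 * a * (W t ?v \<omega> * W t h \<omega>) - 2 * b * (W t ?v \<omega> * W t g \<omega>) + 2 * a * b * (W t h \<omega> * W t g \<omega>)" for \<omega>
    unfolding D_def by (simp add: power2_eq_square algebra_simps)
  have int: "integrable M (\<lambda>\<omega>. (D \<omega>)\<^sup>2)" unfolding eq using i(1) by auto
  have "(\<integral>\<omega>. (D \<omega>)\<^sup>2 \<partial>M) = t * ((?v \<bullet> ?v) + a * a * (h \<bullet> h) + b * b * (g \<bullet> g) - 2 * a * (?v \<bullet> h) - 2 * b * (?v \<bullet> g) + 2 * a * b * (h \<bullet> g))"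
    unfolding eq using i by (simp add: inner_commute[of g h] algebra_simps)
  also have "\<dots> = 0" by (simp add: inner_add_left inner_add_right inner_commute algebra_simps)
  finally have "AE \<omega> in M. (D \<omega>)\<^sup>2 = 0" using integral_nonneg_eq_0_iff_AE[OF int] by simp
  then show ?thesis by eventually_elim (simp add: D_def)
qed

lemma cyl_bm_linear:
  assumes F: "is_filtr M F" and W: "cyl_bm M F W" and t: "0 \<le> t"
  shows "AE \<omega> in M. W t (\<Sum>i\<in>I. c i *\<^sub>R h i) \<omega> = (\<Sum>i\<in>I. c i * W t (h i) \<omega>)"
proof (induction I rule: infinite_finite_induct)
  case (insert x I)
  from insert.IH cyl_bm_linear2[OF F W t, of "c x" "h x" 1 "\<Sum>i\<in>I. c i *\<^sub>R h i"]
  show ?case by eventually_elim (use insert in simp)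
qed (use cyl_bm_linear2[OF F W t, of 0 _ 0] in auto)

lemma cyl_bm_increments_gaussian:
  fixes n :: nat
  assumes W: "cyl_bm M F W" and st: "0 \<le> s" "s \<le> t"
  shows "centered_gaussian M (\<lambda>\<omega>. \<Sum>i<n. c i * (W t (e i) \<omega> - W s (e i) \<omega>))"
    "A \<in> sets (F s) \<Longrightarrow> B \<in> sets (PiM {..<n} (\<lambda>_. borel)) \<Longrightarrow>
       measure M (A \<inter> {\<omega>\<in>space M. (\<lambda>i\<in>{..<n}. W t (e i) \<omega> - W s (e i) \<omega>) \<in> B})
           = measure M A * measure M {\<omega>\<in>space M. (\<lambda>i\<in>{..<n}. W t (e i) \<omega> - W s (e i) \<omega>) \<in> B}"
proof -
  let ?hs = "map e [0..<n]"
  have "wiener_proc M F (length ?hs) (\<lambda>t i. W t (?hs ! i))"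
    using W[unfolded cyl_bm_def, THEN conjunct1, THEN spec, of ?hs] .
  then have *: "centered_gaussian M (\<lambda>\<omega>. \<Sum>i<length ?hs. c i * (W t (?hs ! i) \<omega> - W s (?hs ! i) \<omega>))"
    "\<And>A B. A \<in> sets (F s) \<Longrightarrow> B \<in> sets (PiM {..<length ?hs} (\<lambda>_. borel)) \<Longrightarrow>
       measure M (A \<inter> {\<omega>\<in>space M. (\<lambda>i\<in>{..<length ?hs}. W t (?hs ! i) \<omega> - W s (?hs ! i) \<omega>) \<in> B})
           = measure M A * measure M {\<omega>\<in>space M. (\<lambda>i\<in>{..<length ?hs}. W t (?hs ! i) \<omega> - W s (?hs ! i) \<omega>) \<in> B}"
    unfolding wiener_proc_def using st by blast+
  have e1: "(\<Sum>i<length ?hs. c i * (W t (?hs ! i) \<omega> - W s (?hs ! i) \<omega>)) = (\<Sum>i<n. c i * (W t (e i) \<omega> - W s (e i) \<omega>))" for \<omega>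
    by (intro sum.cong) auto
  have e2: "(\<lambda>i\<in>{..<length ?hs}. W t (?hs ! i) \<omega> - W s (?hs ! i) \<omega>) = (\<lambda>i\<in>{..<n}. W t (e i) \<omega> - W s (e i) \<omega>)" for \<omega>
    by (auto simp: restrict_def)
  show "centered_gaussian M (\<lambda>\<omega>. \<Sum>i<n. c i * (W t (e i) \<omega> - W s (e i) \<omega>))" using *(1) unfolding e1 .
  show "measure M (A \<inter> {\<omega>\<in>space M. (\<lambda>i\<in>{..<n}. W t (e i) \<omega> - W s (e i) \<omega>) \<in> B})
           = measure M A * measure M {\<omega>\<in>space M. (\<lambda>i\<in>{..<n}. W t (e i) \<omega> - W s (e i) \<omega>) \<in> B}"
    if "A \<in> sets (F s)" "B \<in> sets (PiM {..<n} (\<lambda>_. borel))" using *(2)[of A B] that unfolding e2 by simp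
qed

text \<open>All linear combinations of the increments are Gaussian, with variance
  \<open>t - s\<close> times the sum of squared coefficients by orthonormality. The joint
  characteristic function therefore factors, and the components are independent of each other.
  Together with independence of the whole vector from the past, this makes the past and the
  components jointly independent.\<close>

lemma cyl_bm_increments_indep:
  fixes n k :: nat
  assumes "prob_space M" and F: "is_filtr M F" and W: "cyl_bm M F W" and st: "0 \<le> s" "s < t"
    and e: "\<And>i j. i < n \<Longrightarrow> j < n \<Longrightarrow> e i \<bullet> e j = of_bool (i = j)"
  defines "Z \<equiv> \<lambda>i \<omega>. W t (e i) \<omega> - W s (e i) \<omega>"
  assumes k: "k < n"
  shows "distributed M lborel (Z k) (normal_density 0 (sqrt (t - s)))"
    "A \<in> sigma_sets (space M) (sets (F s) \<union> (\<Union>i<k. {Z i -` B \<inter> space M | B. B \<in> sets borel})) \<Longrightarrow> B \<in> sets borel \<Longrightarrow>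
       measure M (A \<inter> (Z k -` B \<inter> space M)) = measure M A * measure M (Z k -` B \<inter> space M)"
proof -
  interpret prob_space M by fact
  have st': "s \<le> t" "0 \<le> t" using st by auto
  have subF: "subalgebra M (F s)" using F st unfolding is_filtr_def by auto
  have Zm [measurable]: "Z i \<in> borel_measurable M" for i
    unfolding Z_def using cyl_bm_measurable(2)[OF F W st'(2)] cyl_bm_measurable(2)[OF F W st(1)] by simp
  have var: "(\<integral>\<omega>. (\<Sum>i<n. c i * Z i \<omega>)\<^sup>2 \<partial>M) = (t - s) * (\<Sum>i<n. (c i)\<^sup>2)" for c
  proof -
    have "(\<Sum>i<n. c i * Z i \<omega>)\<^sup>2 = (\<Sum>i<n. \<Sum>j<n. c i * c j * (Z i \<omega> * Z j \<omega>))" for \<omega>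
      by (simp add: power2_eq_square sum_product mult_ac)
    then have "(\<integral>\<omega>. (\<Sum>i<n. c i * Z i \<omega>)\<^sup>2 \<partial>M) = (\<Sum>i<n. \<Sum>j<n. c i * c j * (\<integral>\<omega>. Z i \<omega> * Z j \<omega> \<partial>M))"
      using cyl_bm_increment_product(1)[OF F W st(1) st'(1)] unfolding Z_def by simp
    also have "\<dots> = (\<Sum>i<n. \<Sum>j<n. if j = i then (t - s) * (c i)\<^sup>2 else 0)"
      using cyl_bm_increment_product(2)[OF F W st(1) st'(1)] e unfolding Z_def
      by (intro sum.cong refl) (auto simp: power2_eq_square)
    also have "\<dots> = (\<Sum>i<n. (t - s) * (c i)\<^sup>2)"
      by (intro sum.cong refl) (subst sum.delta, auto)
    finally show ?thesis by (simp add: sum_distrib_left)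
  qed
  have char: "(CLINT \<omega>|M. iexp (\<Sum>i<n. c i * Z i \<omega>)) = complex_of_real (exp (- ((t - s) * (\<Sum>i<n. (c i)\<^sup>2)) / 2))" for c
    using centered_gaussian_char[OF cyl_bm_increments_gaussian(1)[OF W st(1) st'(1), where n = n and c = c and e = e]] var[of c]
    unfolding Z_def by simp
  \<comment> \<open>Specialising the coefficients to a single nonzero entry gives the marginal
    statements.\<close>
  have single: "(\<Sum>i<n. (if i = j then x else 0) * Z i \<omega>) = x * Z j \<omega>" "(\<Sum>i<n. (if i = j then x else 0)\<^sup>2) = x\<^sup>2" if "j < n" for x :: real and j \<omega>
  proof -
    have "(\<Sum>i<n. (if i = j then x else 0) * Z i \<omega>) = (\<Sum>i<n. if i = j then x * Z j \<omega> else 0)" by (intro sum.cong) auto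
    then show "(\<Sum>i<n. (if i = j then x else 0) * Z i \<omega>) = x * Z j \<omega>" using that by simp
    have "(\<Sum>i<n. (if i = j then x else 0)\<^sup>2) = (\<Sum>i<n. if i = j then x\<^sup>2 else 0)" by (intro sum.cong) auto
    then show "(\<Sum>i<n. (if i = j then x else 0)\<^sup>2) = x\<^sup>2" using that by simp
  qed
  have char1: "(CLINT \<omega>|M. iexp (x * Z j \<omega>)) = complex_of_real (exp (- ((t - s) * x\<^sup>2) / 2))" if "j < n" for x j
    using char[of "\<lambda>i. if i = j then x else 0"] unfolding single[OF that] .
  have "(CLINT \<omega>|M. iexp (\<Sum>j<n. c j * Z j \<omega>)) = (\<Prod>j<n. (CLINT \<omega>|M. iexp (c j * Z j \<omega>)))" for c
  proof -
    have "(\<Prod>j<n. (CLINT \<omega>|M. iexp (c j * Z j \<omega>))) = (\<Prod>j<n. complex_of_real (exp (- ((t - s) * (c j)\<^sup>2) / 2)))"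
      using char1 by (intro prod.cong) auto
    also have "\<dots> = complex_of_real (exp (\<Sum>j<n. - ((t - s) * (c j)\<^sup>2) / 2))" by (simp add: exp_sum)
    also have "(\<Sum>j<n. - ((t - s) * (c j)\<^sup>2) / 2) = - ((t - s) * (\<Sum>i<n. (c i)\<^sup>2)) / 2"
      by (simp add: sum_distrib_left sum_divide_distrib sum_negf)
    finally show ?thesis using char by simp
  qed
  then have box: "prob {\<omega> \<in> space M. \<forall>j<n. Z j \<omega> \<in> A j} = (\<Prod>j<n. prob (Z j -` A j \<inter> space M))"
    if "\<And>j. j < n \<Longrightarrow> A j \<in> sets borel" for A
    using that by (intro characteristic_product_imp_indep) auto
  have "centered_gaussian M (\<lambda>\<omega>. 1 * Z k \<omega>)"
    using cyl_bm_increments_gaussian(1)[OF W st(1) st'(1), where n = n and c = "\<lambda>i. if i = k then 1 else 0" and e = e] single(1)[OF k, of 1]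
    unfolding Z_def by simp
  then have "centered_gaussian M (Z k)" by simp
  moreover have vk: "(\<integral>\<omega>. (Z k \<omega>)\<^sup>2 \<partial>M) = t - s"
    using var[of "\<lambda>i. if i = k then 1 else 0"] single[OF k, of 1] by simp
  \<comment> \<open>The variance \<open>t - s\<close> is positive, which excludes the degenerate
    alternative of \<open>centered_gaussian\<close>.\<close>
  moreover have "\<not> (AE \<omega> in M. Z k \<omega> = 0)"
  proof
    assume "AE \<omega> in M. Z k \<omega> = 0"
    then have "(\<integral>\<omega>. (Z k \<omega>)\<^sup>2 \<partial>M) = (\<integral>\<omega>. 0 \<partial>M)" by (intro integral_cong_AE) auto
    then show False using vk st by simp
  qed
  ultimately obtain \<sigma> where \<sigma>: "\<sigma> > 0" "distributed M lborel (Z k) (normal_density 0 \<sigma>)"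
    unfolding centered_gaussian_def by auto
  have "\<sigma>\<^sup>2 = t - s" using gaussian_even_moment[OF \<sigma>(2,1), of 1] vk by (simp add: has_bochner_integral_iff)
  then have "\<sigma> = sqrt (t - s)" using \<sigma>(1) by (metis less_imp_le real_sqrt_unique)
  then show "distributed M lborel (Z k) (normal_density 0 (sqrt (t - s)))" using \<sigma>(2) by simp
  \<comment> \<open>Slot 0 holds the past and slot \<open>Suc i\<close> the events of direction
    \<open>i\<close>. In a product of events, independence of the vector splits off slot 0 and
    \<open>box\<close> splits the rest.\<close>
  define E where "E i = (case i of 0 \<Rightarrow> sets (F s) | Suc i \<Rightarrow> {Z i -` B \<inter> space M | B. B \<in> sets borel})" for i
  have Eev: "E i \<subseteq> events" "space M \<in> E i" "Int_stable (E i)" for i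
  proof -
    have "space M \<in> sets (F s)" using subF sets.top[of "F s"] unfolding subalgebra_def by simp
    moreover have "space M \<in> {Z i -` B \<inter> space M | B. B \<in> sets borel}" for i
      by (intro CollectI exI[of _ UNIV]) auto
    ultimately show "space M \<in> E i" unfolding E_def by (auto split: nat.split)
    show "E i \<subseteq> events" using subF unfolding E_def subalgebra_def by (auto split: nat.split)
    show "Int_stable (E i)"
    proof (cases i)
      case 0 then show ?thesis unfolding E_def by (auto intro: Int_stableI)
    next
      case (Suc j)
      show ?thesis unfolding E_def Suc nat.case
      proof (rule Int_stableI, safe)
        fix A B :: "real set" assume "A \<in> sets borel" "B \<in> sets borel"
        then show "\<exists>C. Z j -` A \<inter> space M \<inter> (Z j -` B \<inter> space M) = Z j -` C \<inter> space M \<and> C \<in> sets borel"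
          by (intro exI[of _ "A \<inter> B"]) auto
      qed
    qed
  qed
  have "indep_sets E {..n}"
  proof (subst indep_sets_finite)
    show "\<forall>A\<in>Pi {..n} E. prob (\<Inter>j\<in>{..n}. A j) = (\<Prod>j\<in>{..n}. prob (A j))"
    proof
      fix A assume A: "A \<in> Pi {..n} E"
      then have A0: "A 0 \<in> sets (F s)" unfolding E_def by (auto dest!: Pi_mem[of _ _ _ 0])
      have "\<forall>i<n. \<exists>B. B \<in> sets borel \<and> A (Suc i) = Z i -` B \<inter> space M"
      proof (intro allI impI)
        fix i assume "i < n"
        then have "A (Suc i) \<in> E (Suc i)" using A by (intro Pi_mem[OF A]) simp
        then show "\<exists>B. B \<in> sets borel \<and> A (Suc i) = Z i -` B \<inter> space M" unfolding E_def by auto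
      qed
      then obtain B where B: "\<And>i. i < n \<Longrightarrow> B i \<in> sets borel" "\<And>i. i < n \<Longrightarrow> A (Suc i) = Z i -` B i \<inter> space M" by metis
      have A0s: "A 0 \<subseteq> space M" using A0 subF sets.sets_into_space[OF A0] unfolding subalgebra_def by simp
      have set: "{..n} = insert 0 (Suc ` {..<n})"
        by (simp add: lessThan_Suc_atMost[symmetric] lessThan_Suc_eq_insert_0)
      have mem: "(\<lambda>i\<in>{..<n}. Z i \<omega>) \<in> PiE {..<n} B \<longleftrightarrow> (\<forall>j<n. Z j \<omega> \<in> B j)" for \<omega> by (auto simp: PiE_iff)
      have "(\<Inter>j\<in>{..n}. A j) = A 0 \<inter> {\<omega>\<in>space M. (\<lambda>i\<in>{..<n}. Z i \<omega>) \<in> PiE {..<n} B}"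
        unfolding set mem using B(2) A0s by auto
      also have "prob \<dots> = prob (A 0) * prob {\<omega>\<in>space M. (\<lambda>i\<in>{..<n}. Z i \<omega>) \<in> PiE {..<n} B}"
        unfolding Z_def using B(1) by (intro cyl_bm_increments_gaussian(2)[OF W st(1) st'(1) A0] sets_PiM_I_finite) auto
      also have "prob {\<omega>\<in>space M. (\<lambda>i\<in>{..<n}. Z i \<omega>) \<in> PiE {..<n} B} = (\<Prod>j<n. prob (A (Suc j)))"
        unfolding mem using B by (subst box) auto
      also have "prob (A 0) * (\<Prod>j<n. prob (A (Suc j))) = (\<Prod>j\<in>{..n}. prob (A j))"
        by (simp add: prod.atMost_shift)
      finally show "prob (\<Inter>j\<in>{..n}. A j) = (\<Prod>j\<in>{..n}. prob (A j))" .
    qed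
  qed (use Eev in auto)
  \<comment> \<open>The slots are regrouped into two blocks: the past with the directions before
    \<open>k\<close>, and direction \<open>k\<close> alone.\<close>
  then have "indep_sets E (\<Union>b\<in>UNIV. case_bool {..k} {Suc k} b)"
    by (rule indep_sets_mono_index[rotated]) (use k in \<open>auto simp: UNIV_bool\<close>)
  then have "indep_sets (\<lambda>b. sigma_sets (space M) (\<Union>i\<in>case_bool {..k} {Suc k} b. E i)) UNIV"
    by (rule indep_sets_collect_sigma) (use Eev in \<open>auto simp: disjoint_family_on_def split: bool.splits\<close>)
  then have ind: "indep_set (sigma_sets (space M) (\<Union>i\<in>{..k}. E i)) (sigma_sets (space M) (E (Suc k)))"
    unfolding indep_set_def by (rule back_subst[of "\<lambda>f. indep_sets f UNIV"]) (auto split: bool.splits)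
  assume A: "A \<in> sigma_sets (space M) (sets (F s) \<union> (\<Union>i<k. {Z i -` B \<inter> space M | B. B \<in> sets borel}))" and B: "B \<in> sets borel"
  have "sets (F s) \<union> (\<Union>i<k. {Z i -` B \<inter> space M | B. B \<in> sets borel}) \<subseteq> (\<Union>i\<in>{..k}. E i)"
  proof
    fix X assume "X \<in> sets (F s) \<union> (\<Union>i<k. {Z i -` B \<inter> space M | B. B \<in> sets borel})"
    then consider "X \<in> E 0" | i where "i < k" "X \<in> E (Suc i)" unfolding E_def by auto
    then show "X \<in> (\<Union>i\<in>{..k}. E i)"
    proof cases
      case (2 i)
      then show ?thesis by (intro UN_I[of "Suc i"]) auto
    qed auto
  qed
  then have "A \<in> sigma_sets (space M) (\<Union>i\<in>{..k}. E i)" using A sigma_sets_mono'[of _ "\<Union>i\<in>{..k}. E i"] by blast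
  moreover have "Z k -` B \<inter> space M \<in> sigma_sets (space M) (E (Suc k))" using B unfolding E_def by (auto intro: sigma_sets.Basic)
  ultimately show "prob (A \<inter> (Z k -` B \<inter> space M)) = prob A * prob (Z k -` B \<inter> space M)"
    using indep_setD[OF ind] by blast
qed

text \<open>Lexicographic order: position \<open>j\<close> stands for time step
  \<open>j div n\<close> and direction \<open>j mod n\<close>. The information before position
  \<open>j\<close> is the past at the start of the time step, enlarged by the directions already
  used in that step.\<close>

lemma cyl_bm_gauss_seq:
  fixes ts :: "nat \<Rightarrow> real" and n :: nat
  assumes M: "prob_space M" and F: "is_filtr M F" and W: "cyl_bm M F W"
    and ts: "strict_mono ts" "0 \<le> ts 0"
    and e: "\<And>i j. i < n \<Longrightarrow> j < n \<Longrightarrow> e i \<bullet> e j = of_bool (i = j)"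
  obtains G where
    "gauss_seq M G (\<lambda>j \<omega>. W (ts (Suc (j div n))) (e (j mod n)) \<omega> - W (ts (j div n)) (e (j mod n)) \<omega>)
       (\<lambda>j. sqrt (ts (Suc (j div n)) - ts (j div n))) (K * n)"
    "\<And>j. sets (F (ts (j div n))) \<subseteq> sets (G j)" "\<And>j. space (G j) = space M"
proof -
  interpret prob_space M by fact
  define Z where "Z k i \<omega> = W (ts (Suc k)) (e i) \<omega> - W (ts k) (e i) \<omega>" for k i \<omega>
  \<comment> \<open>Only the generators of the information are recorded; they form no sigma-algebra
    in general.\<close>
  define \<G> where "\<G> k i = sets (F (ts k)) \<union> (\<Union>i'<i. {Z k i' -` B \<inter> space M | B. B \<in> sets borel})" for k i
  define G where "G j = sigma (space M) (\<G> (j div n) (j mod n))" for j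
  have ts0: "0 \<le> ts k" for k using ts strict_mono_less_eq[OF ts(1), of 0 k] by simp
  have subF: "subalgebra M (F (ts k))" for k using F ts0 unfolding is_filtr_def by auto
  have Zm: "Z k i \<in> borel_measurable M" for k i
    unfolding Z_def using cyl_bm_measurable(2)[OF F W ts0] by simp
  have \<G>sub: "\<G> k i \<subseteq> sets M" for k i
    unfolding \<G>_def using subF[of k] measurable_sets[OF Zm] unfolding subalgebra_def by auto
  then have \<G>Pow: "\<G> k i \<subseteq> Pow (space M)" for k i using sets.sets_into_space by blast
  have setsG: "sets (G j) = sigma_sets (space M) (\<G> (j div n) (j mod n))" "space (G j) = space M" for j
    unfolding G_def using \<G>Pow by (auto simp: space_measure_of_conv)
  have subG: "subalgebra M (G j)" for j
    unfolding subalgebra_def setsG using \<G>sub by (auto intro!: sets.sigma_sets_subset)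
  have F\<G>: "sets (F (ts (j div n))) \<subseteq> sets (G j)" for j unfolding setsG \<G>_def by auto
  have Fmono: "sets (F (ts k)) \<subseteq> sets (F (ts l))" if "k \<le> l" for k l
    using F ts0 strict_mono_less_eq[OF ts(1)] that unfolding is_filtr_def by auto
  \<comment> \<open>When a time step ends, its increments are absorbed by the filtration at the next
    grid point. This gives monotonicity across steps.\<close>
  have ZF: "Z k i -` B \<inter> space M \<in> sets (F (ts l))" if "k < l" "B \<in> sets borel" for k i l B
  proof -
    have "Z k i \<in> borel_measurable (F (ts (Suc k)))"
    proof -
      have "subalgebra (F (ts (Suc k))) (F (ts k))"
        using subF[of k] subF[of "Suc k"] Fmono[of k "Suc k"] unfolding subalgebra_def by simp
      then have "W (ts k) (e i) \<in> borel_measurable (F (ts (Suc k)))"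
        using cyl_bm_measurable(1)[OF F W ts0] measurable_from_subalg by blast
      then show ?thesis unfolding Z_def using cyl_bm_measurable(1)[OF F W ts0] by simp
    qed
    from measurable_sets[OF this that(2)] have "Z k i -` B \<inter> space M \<in> sets (F (ts (Suc k)))"
      using subF[of "Suc k"] unfolding subalgebra_def by simp
    then show ?thesis using Fmono[of "Suc k" l] that(1) by auto
  qed
  have mono: "sets (G i) \<subseteq> sets (G j)" if "i \<le> j" for i j
    unfolding setsG
  proof (rule sigma_sets_mono)
    have "\<G> (i div n) (i mod n) \<subseteq> \<G> (j div n) (j mod n)"
    proof (cases "i div n = j div n")
      case True
      have "i = n * (j div n) + i mod n" by (metis True mult_div_mod_eq)
      moreover have "j = n * (j div n) + j mod n" by simp
      ultimately have "i mod n \<le> j mod n" using that by linarith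
      then show ?thesis unfolding \<G>_def True by fastforce
    next
      case False
      then have lt: "i div n < j div n" using div_le_mono[OF that, of n] by simp
      then have "\<G> (i div n) (i mod n) \<subseteq> sets (F (ts (j div n)))"
        unfolding \<G>_def using Fmono[of "i div n" "j div n"] ZF by auto
      then show ?thesis unfolding \<G>_def by blast
    qed
    then show "\<G> (i div n) (i mod n) \<subseteq> sigma_sets (space M) (\<G> (j div n) (j mod n))" by auto
  qed
  have "gauss_seq M G (\<lambda>j. Z (j div n) (j mod n)) (\<lambda>j. sqrt (ts (Suc (j div n)) - ts (j div n))) (K * n)"
    unfolding gauss_seq_def
  proof (intro conjI allI impI ballI)
    fix j assume j: "j < K * n"
    then have n: "0 < n" by (cases n) auto
    let ?k = "j div n" and ?i = "j mod n"
    have i: "?i < n" using n by simp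
    have lt: "ts ?k < ts (Suc ?k)" using ts(1) by (simp add: strict_mono_def)
    note ind = cyl_bm_increments_indep[OF M F W ts0 lt e i]
    show "0 < sqrt (ts (Suc ?k) - ts ?k)" using lt by simp
    show "distributed M lborel (Z ?k ?i) (normal_density 0 (sqrt (ts (Suc ?k) - ts ?k)))"
      using ind(1) unfolding Z_def by simp
    show "Z ?k ?i \<in> borel_measurable (G (Suc j))"
    proof (rule measurableI)
      fix B :: "real set" assume B: "B \<in> sets borel"
      have "Z ?k ?i -` B \<inter> space M \<in> sets (G (Suc j))"
      proof (cases "Suc j div n = ?k")
        case True
        have "Suc j = n * (j div n) + Suc j mod n" by (metis True mult_div_mod_eq)
        moreover have "j = n * (j div n) + j mod n" by simp
        ultimately have "Suc j mod n = Suc ?i" by linarith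
        then show ?thesis unfolding setsG True \<G>_def using B by (intro sigma_sets.Basic) auto
      next
        case False
        moreover have "?k \<le> Suc j div n" by (rule div_le_mono) simp
        ultimately have "?k < Suc j div n" by linarith
        from ZF[OF this B] show ?thesis using F\<G>[of "Suc j"] by auto
      qed
      then show "Z ?k ?i -` B \<inter> space (G (Suc j)) \<in> sets (G (Suc j))" by (simp add: setsG(2))
    qed simp
    fix A and B :: "real set" assume "A \<in> sets (G j)" "B \<in> sets borel"
    then show "prob (A \<inter> (Z ?k ?i -` B \<inter> space M)) = prob A * prob (Z ?k ?i -` B \<inter> space M)"
      using ind(2)[of A B] unfolding setsG \<G>_def Z_def by simp
  qed (use subG mono in auto)
  then show thesis using that[of G] F\<G> setsG(2) unfolding Z_def by blast
qed

text \<open>Integrands are manipulated as lists of terms \<open>(s, u, B, h, x)\<close> standing for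
  \<open>1\<^bsub>(s, u] \<times> B\<^esub> h \<otimes> x\<close>; unlike for \<^const>\<open>elem_proc\<close>, no common grid or orthogonality is imposed.\<close>

definition lproc :: "(real \<times> real \<times> 'w set \<times> 'h::real_inner \<times> 'x::real_vector) list \<Rightarrow> real \<Rightarrow> 'w \<Rightarrow> 'h \<Rightarrow> 'x" where
  "lproc L t \<omega> g = (\<Sum>(s, u, B, h, x)\<leftarrow>L. (indicator {s<..u} t * indicator B \<omega> * (g \<bullet> h)) *\<^sub>R x)"

definition lint :: "(real \<Rightarrow> 'h::real_inner \<Rightarrow> 'w \<Rightarrow> real) \<Rightarrow> (real \<times> real \<times> 'w set \<times> 'h \<times> 'x::real_vector) list \<Rightarrow> 'w \<Rightarrow> 'x" where
  "lint W L \<omega> = (\<Sum>(s, u, B, h, x)\<leftarrow>L. (indicator B \<omega> * (W u h \<omega> - W s h \<omega>)) *\<^sub>R x)"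

definition lvalid :: "(real \<Rightarrow> 'w measure) \<Rightarrow> (real \<times> real \<times> 'w set \<times> 'h \<times> 'x) list \<Rightarrow> bool" where
  "lvalid F L \<longleftrightarrow> (\<forall>(s, u, B, h, x)\<in>set L. 0 \<le> s \<and> s \<le> u \<and> B \<in> sets (F s))"

lemma lproc_append: "lproc (L @ L') t \<omega> g = lproc L t \<omega> g + lproc L' t \<omega> g"
  and lint_append: "lint W (L @ L') \<omega> = lint W L \<omega> + lint W L' \<omega>"
  and lvalid_append: "lvalid F (L @ L') \<longleftrightarrow> lvalid F L \<and> lvalid F L'"
  by (simp_all add: lproc_def lint_def lvalid_def ball_Un)

definition lneg :: "(real \<times> real \<times> 'w set \<times> 'h \<times> 'x::real_vector) list \<Rightarrow> (real \<times> real \<times> 'w set \<times> 'h \<times> 'x) list" where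
  "lneg L = map (\<lambda>(s, u, B, h, x). (s, u, B, h, - x)) L"

lemma lproc_lneg: "lproc (lneg L) t \<omega> g = - lproc L t \<omega> g"
  and lint_lneg: "lint W (lneg L) \<omega> = - lint W L \<omega>"
  and lvalid_lneg: "lvalid F (lneg L) \<longleftrightarrow> lvalid F L"
  by (induction L) (auto simp: lproc_def lint_def lvalid_def lneg_def)

definition lcomp :: "('h \<Rightarrow> 'h) \<Rightarrow> (real \<times> real \<times> 'w set \<times> 'h \<times> 'x) list \<Rightarrow> (real \<times> real \<times> 'w set \<times> 'h \<times> 'x) list" where
  "lcomp A L = map (\<lambda>(s, u, B, h, x). (s, u, B, A h, x)) L"

text \<open>Self-adjointness moves \<open>A\<close> from the argument to the vectors of the list, so
  the composed integrand is again a list integrand with the same times, events and values.\<close>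

lemma lproc_lcomp:
  assumes "\<And>x y. A x \<bullet> y = x \<bullet> A y"
  shows "lproc (lcomp A L) t \<omega> g = lproc L t \<omega> (A g)"
  by (induction L) (auto simp: lproc_def lcomp_def assms)

lemma lvalid_lcomp: "lvalid F (lcomp A L) \<longleftrightarrow> lvalid F L"
  by (auto simp: lvalid_def lcomp_def)

text \<open>The grid continues beyond the sorted list by unit steps, so that strict monotonicity
  holds for all indices and no range conditions are needed later. Inserting 0 keeps the list
  nonempty.\<close>

lemma finite_time_grid:
  fixes T :: "real set"
  assumes T: "finite T" "T \<subseteq> {0..}"
  obtains ts K where "strict_mono ts" "0 \<le> ts 0" "T \<subseteq> ts ` {..K::nat}"
proof -
  define S where "S = insert 0 T"
  define l where "l = sorted_list_of_set S"
  have S: "finite S" "S \<noteq> {}" using T(1) unfolding S_def by auto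
  have "set l = S" "sorted_wrt (<) l" "l \<noteq> []" unfolding l_def using S by simp_all
  then have l: "set l = insert 0 T" "sorted_wrt (<) l" "l \<noteq> []" unfolding S_def by simp_all
  define ts where "ts k = (if k < length l then l ! k else last l + real (k - length l + 1))" for k
  show thesis
  proof (rule that[of ts "length l"])
    have "ts k < ts (Suc k)" for k
    proof -
      consider "Suc k < length l" | "Suc k = length l" | "length l \<le> k" by linarith
      then show ?thesis
      proof cases
        case 1 then show ?thesis using sorted_wrt_nth_less[OF l(2), of k "Suc k"] by (simp add: ts_def)
      next
        case 2
        then have "last l = l ! k" using l(3) by (metis diff_Suc_1 last_conv_nth)
        then show ?thesis using 2 by (simp add: ts_def)
      qed (simp add: ts_def)
    qed
    then show "strict_mono ts" by (simp add: strict_mono_Suc_iff)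
    have "ts 0 \<in> set l" using l(3) by (simp add: ts_def)
    then show "0 \<le> ts 0" using l(1) T(2) by auto
    show "T \<subseteq> ts ` {..length l}"
    proof
      fix x assume "x \<in> T"
      then obtain k where "k < length l" "l ! k = x" using l(1) by (metis in_set_conv_nth insertI2)
      then show "x \<in> ts ` {..length l}" by (intro image_eqI[of _ _ k]) (auto simp: ts_def)
    qed
  qed
qed

lemma grid_telescope:
  fixes f :: "nat \<Rightarrow> 'b::real_vector"
  assumes ts: "strict_mono (ts :: nat \<Rightarrow> real)" and ab: "a \<le> b" "b \<le> K"
  shows "(\<Sum>k<K. if ts a \<le> ts k \<and> ts (Suc k) \<le> ts b then f (Suc k) - f k else 0) = f b - f a"
proof -
  have "(\<Sum>k<K. if ts a \<le> ts k \<and> ts (Suc k) \<le> ts b then f (Suc k) - f k else 0) = (\<Sum>k\<in>{a..<b}. f (Suc k) - f k)"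
    using ab strict_mono_less_eq[OF ts] by (intro sum.mono_neutral_cong_right) auto
  also have "\<dots> = f b - f a" by (rule sum_Suc_diff'[OF ab(1)])
  finally show ?thesis .
qed

text \<open>The coefficient of the increment over grid step \<open>k\<close> in direction
  \<open>e i\<close>. When the grid contains all end points of the list, a grid step lies either
  inside an interval of the list or outside it, hence the containment test.\<close>

definition lcoef :: "(real \<times> real \<times> 'w set \<times> 'h::real_inner \<times> 'x::real_vector) list \<Rightarrow> (nat \<Rightarrow> real) \<Rightarrow> (nat \<Rightarrow> 'h) \<Rightarrow> nat \<Rightarrow> nat \<Rightarrow> 'w \<Rightarrow> 'x" where
  "lcoef L ts e k i \<omega> = (\<Sum>(s, u, B, h, x)\<leftarrow>L. (if s \<le> ts k \<and> ts (Suc k) \<le> u then indicator B \<omega> * (h \<bullet> e i) else 0) *\<^sub>R x)"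

definition lgrid :: "(real \<times> real \<times> 'w set \<times> 'h \<times> 'x) list \<Rightarrow> (nat \<Rightarrow> real) \<Rightarrow> nat \<Rightarrow> bool" where
  "lgrid L ts K \<longleftrightarrow> strict_mono ts \<and> 0 \<le> ts 0 \<and> (\<forall>(s, u, B, h, x)\<in>set L. s \<in> ts ` {..K} \<and> u \<in> ts ` {..K})"

lemma lgrid_exists:
  assumes "lvalid F L"
  obtains ts K where "lgrid L ts K"
proof -
  define T where "T = (\<lambda>(s, u, B, h, x). s) ` set L \<union> (\<lambda>(s, u, B, h, x). u) ` set L"
  have "T \<subseteq> {0..}" using assms unfolding T_def lvalid_def by fastforce
  then obtain ts K where "strict_mono ts" "0 \<le> ts 0" "T \<subseteq> ts ` {..K::nat}"
    using finite_time_grid[of T] unfolding T_def by auto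
  then have "lgrid L ts K" unfolding lgrid_def T_def by force
  then show thesis by (rule that)
qed

definition lvecs :: "(real \<times> real \<times> 'w set \<times> 'h \<times> 'x) list \<Rightarrow> 'h set" where
  "lvecs L = (\<lambda>(s, u, B, h, x). h) ` set L"

lemma finite_lvecs: "finite (lvecs L)" unfolding lvecs_def by simp

lemma lvecs_lcomp: "lvecs (lcomp A L) = A ` lvecs L"
  by (force simp: lvecs_def lcomp_def)

lemma lproc_normal_form:
  assumes "lvalid F L" "lgrid L ts K"
    and e: "\<And>h. h \<in> lvecs L \<Longrightarrow> h = (\<Sum>i<n. (h \<bullet> e i) *\<^sub>R e i)"
  shows "lproc L t \<omega> g = (\<Sum>k<K. \<Sum>i<n. (indicator {ts k<..ts (Suc k)} t * (g \<bullet> e i)) *\<^sub>R lcoef L ts e k i \<omega>)"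
  using assms
proof (induction L)
  case Nil then show ?case by (simp add: lproc_def lcoef_def)
next
  case (Cons a L)
  obtain s u B h x where a: "a = (s, u, B, h, x)" by (cases a)
  have IH: "lproc L t \<omega> g = (\<Sum>k<K. \<Sum>i<n. (indicator {ts k<..ts (Suc k)} t * (g \<bullet> e i)) *\<^sub>R lcoef L ts e k i \<omega>)"
  proof (rule Cons.IH)
    show "lvalid F L" using Cons.prems(1) by (simp add: lvalid_def)
    show "lgrid L ts K" using Cons.prems(2) by (simp add: lgrid_def)
    show "h = (\<Sum>i<n. (h \<bullet> e i) *\<^sub>R e i)" if "h \<in> lvecs L" for h
      using Cons.prems(3)[of h] that by (simp add: lvecs_def)
  qed
  have tsm: "strict_mono ts" using Cons.prems(2) unfolding lgrid_def by simp
  obtain p q where pq: "s = ts p" "u = ts q" "p \<le> K" "q \<le> K" "s \<le> u"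
    using Cons.prems(1,2) unfolding lgrid_def lvalid_def a by auto
  then have le: "p \<le> q" using strict_mono_less_eq[OF tsm] by auto
  have ind: "indicator {c<..d} t = (indicator {..d} t - indicator {..c} t :: real)" if "c \<le> d" for c d
    using that by (auto simp: indicator_def)
  have tele: "(\<Sum>k<K. if ts p \<le> ts k \<and> ts (Suc k) \<le> ts q then indicator {ts k<..ts (Suc k)} t else 0) = (indicator {s<..u} t :: real)"
  proof -
    have "(\<Sum>k<K. if ts p \<le> ts k \<and> ts (Suc k) \<le> ts q then indicator {ts k<..ts (Suc k)} t else 0)
       = (\<Sum>k<K. if ts p \<le> ts k \<and> ts (Suc k) \<le> ts q then indicator {..ts (Suc k)} t - indicator {..ts k} t else 0 :: real)"
      using strict_mono_less_eq[OF tsm] by (intro sum.cong refl) (auto simp: ind)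
    also have "\<dots> = indicator {..ts q} t - indicator {..ts p} t"
      using le pq by (intro grid_telescope[OF tsm, of _ _ _ "\<lambda>k. indicator {..ts k} t"]) auto
    finally show ?thesis using ind[of s u] pq by simp
  qed
  have gh: "g \<bullet> h = (\<Sum>i<n. (h \<bullet> e i) * (g \<bullet> e i))"
  proof -
    have "h = (\<Sum>i<n. (h \<bullet> e i) *\<^sub>R e i)" using Cons.prems(3)[of h] by (simp add: a lvecs_def)
    then have "g \<bullet> h = g \<bullet> (\<Sum>i<n. (h \<bullet> e i) *\<^sub>R e i)" by (rule arg_cong)
    then show ?thesis by (simp add: inner_sum_right)
  qed
  have "(\<Sum>k<K. \<Sum>i<n. (indicator {ts k<..ts (Suc k)} t * (g \<bullet> e i)) *\<^sub>R ((if s \<le> ts k \<and> ts (Suc k) \<le> u then indicator B \<omega> * (h \<bullet> e i) else 0) *\<^sub>R x))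
     = (\<Sum>k<K. \<Sum>i<n. ((if ts p \<le> ts k \<and> ts (Suc k) \<le> ts q then indicator {ts k<..ts (Suc k)} t else 0) * (indicator B \<omega> * ((h \<bullet> e i) * (g \<bullet> e i)))) *\<^sub>R x)"
    using pq by (intro sum.cong refl) (simp add: mult_ac)
  also have "\<dots> = (\<Sum>k<K. \<Sum>i<n. (if ts p \<le> ts k \<and> ts (Suc k) \<le> ts q then indicator {ts k<..ts (Suc k)} t else 0) * (indicator B \<omega> * ((h \<bullet> e i) * (g \<bullet> e i)))) *\<^sub>R x"
    by (simp only: scaleR_sum_left)
  also have "\<dots> = (indicator {s<..u} t * indicator B \<omega> * (g \<bullet> h)) *\<^sub>R x"
    unfolding tele[symmetric] gh sum_distrib_left sum_distrib_right mult.assoc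
    by (rule arg_cong[where f = "\<lambda>z. z *\<^sub>R x"], rule sum.swap)
  finally show ?case
    using IH unfolding a lproc_def lcoef_def by (simp add: scaleR_add_right sum.distrib)
qed

text \<open>Telescoping over the grid is exact; the equality holds only almost everywhere because
  expanding \<open>W\<close> along the basis does.\<close>

lemma lint_normal_form:
  assumes "is_filtr M F" "cyl_bm M F W" "lvalid F L" "lgrid L ts K"
    and e: "\<And>h. h \<in> lvecs L \<Longrightarrow> h = (\<Sum>i<n. (h \<bullet> e i) *\<^sub>R e i)"
  shows "AE \<omega> in M. lint W L \<omega> = (\<Sum>k<K. \<Sum>i<n. (W (ts (Suc k)) (e i) \<omega> - W (ts k) (e i) \<omega>) *\<^sub>R lcoef L ts e k i \<omega>)"
  using assms(3-)
proof (induction L)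
  case Nil then show ?case by (simp add: lint_def lcoef_def)
next
  case (Cons a L)
  obtain s u B h x where a: "a = (s, u, B, h, x)" by (cases a)
  have IH: "AE \<omega> in M. lint W L \<omega> = (\<Sum>k<K. \<Sum>i<n. (W (ts (Suc k)) (e i) \<omega> - W (ts k) (e i) \<omega>) *\<^sub>R lcoef L ts e k i \<omega>)"
  proof (rule Cons.IH)
    show "lvalid F L" using Cons.prems(1) by (simp add: lvalid_def)
    show "lgrid L ts K" using Cons.prems(2) by (simp add: lgrid_def)
    show "h = (\<Sum>i<n. (h \<bullet> e i) *\<^sub>R e i)" if "h \<in> lvecs L" for h
      using Cons.prems(3)[of h] that by (simp add: lvecs_def)
  qed
  have tsm: "strict_mono ts" using Cons.prems(2) unfolding lgrid_def by simp
  obtain p q where pq: "s = ts p" "u = ts q" "p \<le> K" "q \<le> K" "s \<le> u" "0 \<le> s"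
    using Cons.prems(1,2) unfolding lgrid_def lvalid_def a by auto
  then have le: "p \<le> q" using strict_mono_less_eq[OF tsm] by auto
  have h: "h = (\<Sum>i<n. (h \<bullet> e i) *\<^sub>R e i)" using Cons.prems(3)[of h] by (simp add: a lvecs_def)
  have lin: "AE \<omega> in M. W r h \<omega> = (\<Sum>i<n. (h \<bullet> e i) * W r (e i) \<omega>)" if "0 \<le> r" for r
    using cyl_bm_linear[OF assms(1,2) that, of "\<lambda>i. h \<bullet> e i" e "{..<n}"] h by simp
  show ?case
    using IH lin[OF pq(6)] lin[OF order_trans[OF pq(6,5)]]
  proof eventually_elim
    case (elim \<omega>)
    have tele: "(\<Sum>k<K. if ts p \<le> ts k \<and> ts (Suc k) \<le> ts q then W (ts (Suc k)) (e i) \<omega> - W (ts k) (e i) \<omega> else 0) = W u (e i) \<omega> - W s (e i) \<omega>" for i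
      using grid_telescope[OF tsm le pq(4), of "\<lambda>k. W (ts k) (e i) \<omega>"] pq by simp
    have "(\<Sum>k<K. \<Sum>i<n. (W (ts (Suc k)) (e i) \<omega> - W (ts k) (e i) \<omega>) *\<^sub>R ((if s \<le> ts k \<and> ts (Suc k) \<le> u then indicator B \<omega> * (h \<bullet> e i) else 0) *\<^sub>R x))
       = (\<Sum>i<n. \<Sum>k<K. ((if ts p \<le> ts k \<and> ts (Suc k) \<le> ts q then W (ts (Suc k)) (e i) \<omega> - W (ts k) (e i) \<omega> else 0) * (indicator B \<omega> * (h \<bullet> e i))) *\<^sub>R x)"
      using pq by (subst sum.swap) (intro sum.cong refl, simp)
    also have "\<dots> = (\<Sum>i<n. (W u (e i) \<omega> - W s (e i) \<omega>) * (indicator B \<omega> * (h \<bullet> e i))) *\<^sub>R x"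
      unfolding tele[symmetric] by (simp only: scaleR_sum_left sum_distrib_right)
    also have "(\<Sum>i<n. (W u (e i) \<omega> - W s (e i) \<omega>) * (indicator B \<omega> * (h \<bullet> e i))) = indicator B \<omega> * (W u h \<omega> - W s h \<omega>)"
      using elim(2,3) by (simp add: sum_distrib_left left_diff_distrib right_diff_distrib sum_subtractf mult_ac)
    finally show ?case
      using elim(1) unfolding a lint_def lcoef_def by (simp add: scaleR_add_right sum.distrib)
  qed
qed

lemma lcoef_measurable:
  fixes L :: "(real \<times> real \<times> 'w set \<times> 'h::real_inner \<times> 'x::euclidean_space) list"
  assumes F: "is_filtr M F" and "lvalid F L" and ts: "0 \<le> ts k"
  shows "lcoef L ts e k i \<in> borel_measurable (F (ts k))"
  using assms(2)
proof (induction L)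
  case Nil then show ?case by (simp add: lcoef_def[abs_def])
next
  case (Cons a L)
  obtain s u B h x where a: "a = (s, u, B, h, x)" by (cases a)
  have "B \<in> sets (F s)" "0 \<le> s" and IH: "lcoef L ts e k i \<in> borel_measurable (F (ts k))"
    using Cons a by (auto simp: lvalid_def)
  then have B: "B \<in> sets (F (ts k))" if "s \<le> ts k" using F that unfolding is_filtr_def by blast
  have "lcoef (a # L) ts e k i = (\<lambda>\<omega>. (if s \<le> ts k \<and> ts (Suc k) \<le> u then indicator B \<omega> * (h \<bullet> e i) else 0) *\<^sub>R x + lcoef L ts e k i \<omega>)"
    by (auto simp: lcoef_def a)
  moreover have "(\<lambda>\<omega>. (if s \<le> ts k \<and> ts (Suc k) \<le> u then indicator B \<omega> * (h \<bullet> e i) else 0) *\<^sub>R x) \<in> borel_measurable (F (ts k))"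
  proof (cases "s \<le> ts k \<and> ts (Suc k) \<le> u")
    case True
    note [measurable] = B[OF conjunct1[OF True]]
    show ?thesis using True by simp
  next
    case False
    then have "(\<lambda>\<omega>. (if s \<le> ts k \<and> ts (Suc k) \<le> u then indicator B \<omega> * (h \<bullet> e i) else 0) *\<^sub>R x) = (\<lambda>\<omega>. 0)" by auto
    then show ?thesis by simp
  qed
  ultimately show ?case using IH by simp
qed

lemma lcoef_bounded:
  assumes "norm (e i) \<le> 1"
  shows "norm (lcoef L ts e k i \<omega>) \<le> (\<Sum>(s, u, B, h, x)\<leftarrow>L. norm h * norm x)"
proof (induction L)
  case (Cons a L)
  obtain s u B h x where a: "a = (s, u, B, h, x)" by (cases a)
  have "\<bar>h \<bullet> e i\<bar> \<le> norm h" using Cauchy_Schwarz_ineq2[of h "e i"] assms mult_left_mono[OF assms, of "norm h"] by simp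
  then have "norm ((if s \<le> ts k \<and> ts (Suc k) \<le> u then indicator B \<omega> * (h \<bullet> e i) else 0) *\<^sub>R x) \<le> norm h * norm x"
    by (auto simp: indicator_def abs_mult intro!: mult_right_mono)
  then have "norm ((if s \<le> ts k \<and> ts (Suc k) \<le> u then indicator B \<omega> * (h \<bullet> e i) else 0) *\<^sub>R x + lcoef L ts e k i \<omega>)
      \<le> norm h * norm x + (\<Sum>(s, u, B, h, x)\<leftarrow>L. norm h * norm x)"
    using Cons by (intro order_trans[OF norm_triangle_ineq] add_mono)
  then show ?case by (simp add: lcoef_def a)
qed (simp add: lcoef_def)

lemma sum_div_mod:
  fixes f :: "nat \<Rightarrow> nat \<Rightarrow> 'b::comm_monoid_add"
  shows "(\<Sum>j<K * n. f (j div n) (j mod n)) = (\<Sum>k<K. \<Sum>i<n. f k i)"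
proof -
  have "(\<Sum>j<K * n. f (j div n) (j mod n)) = (\<Sum>k<K. \<Sum>j\<in>{k * n..<k * n + n}. f (j div n) (j mod n))"
    by (rule sum.nat_group[symmetric])
  also have "\<dots> = (\<Sum>k<K. \<Sum>i<n. f k i)"
  proof (rule sum.cong[OF refl])
    fix k
    have "(\<Sum>j\<in>{k * n..<k * n + n}. f (j div n) (j mod n)) = (\<Sum>i<n. f ((k * n + i) div n) ((k * n + i) mod n))"
      by (rule sum.reindex_bij_witness[where i = "\<lambda>i. k * n + i" and j = "\<lambda>j. j - k * n"]) auto
    also have "\<dots> = (\<Sum>i<n. f k i)" by (intro sum.cong refl) auto
    finally show "(\<Sum>j\<in>{k * n..<k * n + n}. f (j div n) (j mod n)) = (\<Sum>i<n. f k i)" .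
  qed
  finally show ?thesis .
qed

lemma epowr_ennreal: "0 \<le> x \<Longrightarrow> epowr (ennreal x) r = ennreal (x powr r)"
  unfolding epowr_def by simp

lemma epowr_mono:
  assumes "x \<le> y" "0 \<le> r"
  shows "epowr x r \<le> epowr y r"
proof (cases "y = \<infinity>")
  case False
  then obtain b where b: "y = ennreal b" "0 \<le> b" by (cases y) auto
  with assms(1) have "x \<noteq> \<infinity>" by (auto simp: top_unique)
  then obtain a where a: "x = ennreal a" "0 \<le> a" by (cases x) auto
  then show ?thesis using assms a b by (auto simp: epowr_ennreal intro!: ennreal_leI powr_mono2)
qed (simp add: epowr_def)

section \<open>Lists against elementary processes, and estimates for simple integrals\<close>

lemma orthonormal_enumeration:
  fixes E :: "'h::real_inner set"
  assumes "finite E" "orthonormal_set E"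
  obtains e :: "nat \<Rightarrow> 'h" and n where "E = e ` {..<n}" "inj_on e {..<n}"
    "\<And>i j. i < n \<Longrightarrow> j < n \<Longrightarrow> e i \<bullet> e j = of_bool (i = j)" "\<And>i. i < n \<Longrightarrow> norm (e i) = 1"
proof -
  obtain e where e: "bij_betw e {0..<card E} E" using ex_bij_betw_nat_finite[OF assms(1)] by blast
  then have e': "E = e ` {..<card E}" "inj_on e {..<card E}" unfolding bij_betw_def by (auto simp: atLeast0LessThan)
  moreover have "e i \<bullet> e j = of_bool (i = j)" if "i < card E" "j < card E" for i j
  proof -
    have "e i \<in> E" "e j \<in> E" using e'(1) that by blast+
    from orthonormal_setD[OF assms(2) this] show ?thesis using inj_on_eq_iff[OF e'(2), of i j] that by simp
  qed
  moreover have "norm (e i) = 1" if "i < card E" for i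
    using assms(2) e' that unfolding orthonormal_set_def by auto
  ultimately show thesis by (rule that)
qed

text \<open>Returning to the elementary format restores a common grid and orthogonal vectors: list
  entries become the event indices \<open>m\<close>, and their vectors are expanded in an
  orthonormal basis of the span.\<close>

lemma list_to_elem:
  fixes L :: "(real \<times> real \<times> 'w set \<times> 'h::real_inner \<times> 'x::euclidean_space) list"
  assumes F: "is_filtr M F" and W: "cyl_bm M F W" and L: "lvalid F L"
  obtains K ts Mm B Nn hs x where "elem_valid F K ts Mm B Nn hs"
    "\<And>t \<omega> g. elem_proc K ts Mm B Nn hs x t \<omega> g = lproc L t \<omega> g"
    "AE \<omega> in M. elem_int W K ts Mm B Nn hs x \<omega> = lint W L \<omega>"
proof -
  obtain E where E: "finite E" "orthonormal_set E" "span E = span (lvecs L)"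
    using finite_orthonormal_basis[OF finite_lvecs] by blast
  obtain e :: "nat \<Rightarrow> 'h" and n where e: "E = e ` {..<n}" "inj_on e {..<n}" "\<And>i j. i < n \<Longrightarrow> j < n \<Longrightarrow> e i \<bullet> e j = of_bool (i = j)"
    "\<And>i. i < n \<Longrightarrow> norm (e i) = 1"
    using orthonormal_enumeration[OF E(1,2)] by blast
  obtain ts K where g: "lgrid L ts K" using lgrid_exists[OF L] .
  have tsm: "strict_mono ts" "0 \<le> ts 0" using g unfolding lgrid_def by auto
  have exp: "h = (\<Sum>i<n. (h \<bullet> e i) *\<^sub>R e i)" if "h \<in> lvecs L" for h
  proof -
    have "h = (\<Sum>v\<in>E. (h \<bullet> v) *\<^sub>R v)"
      using that by (intro orthonormal_expansion[OF E(1,2)]) (simp add: E(3) span_base)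
    also have "\<dots> = (\<Sum>i<n. (h \<bullet> e i) *\<^sub>R e i)" unfolding e(1) by (rule sum.reindex_cong[OF e(2)]) auto
    finally show ?thesis .
  qed
  \<comment> \<open>The event is empty on grid steps outside the interval of the entry. The step
    numbered \<open>k\<close> runs from \<open>ts (k - 1)\<close> to \<open>ts k\<close>, as in
    \<open>elem_proc\<close>.\<close>
  define B where "B m k = (case L ! m of (s, u, B, h, x) \<Rightarrow> if s \<le> ts (k - 1) \<and> ts k \<le> u then B else {})" for m k
  define X where "X k m i = (case L ! m of (s, u, B, h, x) \<Rightarrow> (h \<bullet> e i) *\<^sub>R x)" for k :: nat and m i
  have coef: "lcoef L ts e k i \<omega> = (\<Sum>m<length L. indicator (B m (Suc k)) \<omega> *\<^sub>R X (Suc k) m i)" for k i \<omega>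
    unfolding lcoef_def sum_list_sum_nth
    by (intro sum.cong) (auto simp: B_def X_def atLeast0LessThan split: prod.split)
  show thesis
  proof (rule that)
    show "elem_valid F K ts (length L) B n e"
      unfolding elem_valid_def
    proof (intro conjI allI ballI impI)
      show "0 \<le> ts 0" by fact
      show "ts k < ts (Suc k)" if "k < K" for k using tsm by (simp add: strict_mono_def)
      show "e i \<bullet> e j = 0" if "i < n" "j < n" "i \<noteq> j" for i j using e(3) that by simp
      fix k m assume k: "k \<in> {1..K}" and m: "m < length L"
      obtain s u C h x where Lm: "L ! m = (s, u, C, h, x)" by (cases "L ! m")
      have "(s, u, C, h, x) \<in> set L" using m Lm nth_mem by fastforce
      then have "C \<in> sets (F s)" "0 \<le> s" using L unfolding lvalid_def by auto
      then show "B m k \<in> sets (F (ts (k - 1)))" using F unfolding B_def Lm is_filtr_def by auto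
    qed
    show "elem_proc K ts (length L) B n e X t \<omega> g = lproc L t \<omega> g" for t \<omega> g
    proof -
      have "elem_proc K ts (length L) B n e X t \<omega> g
         = (\<Sum>k<K. \<Sum>m<length L. indicator ({ts k<..ts (Suc k)} \<times> B m (Suc k)) (t, \<omega>) *\<^sub>R (\<Sum>i<n. (g \<bullet> e i) *\<^sub>R X (Suc k) m i))"
        unfolding elem_proc_def One_nat_def sum.atLeast1_atMost_eq by simp
      also have "\<dots> = (\<Sum>k<K. \<Sum>i<n. \<Sum>m<length L. indicator ({ts k<..ts (Suc k)} \<times> B m (Suc k)) (t, \<omega>) *\<^sub>R ((g \<bullet> e i) *\<^sub>R X (Suc k) m i))"
        unfolding scaleR_sum_right by (rule sum.cong[OF refl], rule sum.swap)
      also have "\<dots> = (\<Sum>k<K. \<Sum>i<n. (indicator {ts k<..ts (Suc k)} t * (g \<bullet> e i)) *\<^sub>R lcoef L ts e k i \<omega>)"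
        unfolding coef scaleR_sum_right by (intro sum.cong refl) (auto simp: indicator_def)
      finally show ?thesis using lproc_normal_form[OF L g exp] by simp
    qed
    have ei: "elem_int W K ts (length L) B n e X \<omega> = (\<Sum>k<K. \<Sum>i<n. (W (ts (Suc k)) (e i) \<omega> - W (ts k) (e i) \<omega>) *\<^sub>R lcoef L ts e k i \<omega>)" for \<omega>
    proof -
      have "elem_int W K ts (length L) B n e X \<omega>
         = (\<Sum>k<K. \<Sum>m<length L. indicator (B m (Suc k)) \<omega> *\<^sub>R (\<Sum>i<n. (W (ts (Suc k)) (e i) \<omega> - W (ts k) (e i) \<omega>) *\<^sub>R X (Suc k) m i))"
        unfolding elem_int_def One_nat_def sum.atLeast1_atMost_eq by simp
      also have "\<dots> = (\<Sum>k<K. \<Sum>i<n. \<Sum>m<length L. indicator (B m (Suc k)) \<omega> *\<^sub>R ((W (ts (Suc k)) (e i) \<omega> - W (ts k) (e i) \<omega>) *\<^sub>R X (Suc k) m i))"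
        unfolding scaleR_sum_right by (rule sum.cong[OF refl], rule sum.swap)
      finally show ?thesis unfolding coef scaleR_sum_right by (simp add: mult.commute)
    qed
    have "AE \<omega> in M. lint W L \<omega> = (\<Sum>k<K. \<Sum>i<n. (W (ts (Suc k)) (e i) \<omega> - W (ts k) (e i) \<omega>) *\<^sub>R lcoef L ts e k i \<omega>)"
      by (rule lint_normal_form[OF F W L g exp])
    then show "AE \<omega> in M. elem_int W K ts (length L) B n e X \<omega> = lint W L \<omega>"
      by eventually_elim (simp add: ei)
  qed
qed

lemma sum_list_map_concat: "(\<Sum>a\<leftarrow>concat xss. f a) = (\<Sum>xs\<leftarrow>xss. \<Sum>a\<leftarrow>xs. f a)"
  by (induction xss) auto

lemma elem_to_list:
  assumes "elem_valid F K ts Mm B Nn hs"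
  obtains L where "lvalid F L" "\<And>t \<omega> g. lproc L t \<omega> g = elem_proc K ts Mm B Nn hs x t \<omega> g"
    "\<And>\<omega>. lint W L \<omega> = elem_int W K ts Mm B Nn hs x \<omega>"
proof -
  define L where "L = concat (map (\<lambda>k. concat (map (\<lambda>m. map (\<lambda>i. (ts (k - 1), ts k, B m k, hs i, x k m i)) [0..<Nn]) [0..<Mm])) [1..<Suc K])"
  have sum: "(\<Sum>a\<leftarrow>L. f a) = (\<Sum>k\<in>{1..K}. \<Sum>m<Mm. \<Sum>i<Nn. f (ts (k - 1), ts k, B m k, hs i, x k m i))" for f :: "_ \<Rightarrow> 'c"
  proof -
    have "(\<Sum>a\<leftarrow>L. f a) = (\<Sum>k\<in>{1..<Suc K}. \<Sum>m\<in>{0..<Mm}. \<Sum>i\<in>{0..<Nn}. f (ts (k - 1), ts k, B m k, hs i, x k m i))"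
      unfolding L_def by (simp add: sum_list_map_concat comp_def interv_sum_list_conv_sum_set_nat del: upt_Suc)
    then show ?thesis by (simp add: atLeastLessThanSuc_atLeastAtMost atLeast0LessThan)
  qed
  have ts0: "0 \<le> ts k" if "k \<le> K" for k
    using that
  proof (induction k)
    case 0 then show ?case using assms unfolding elem_valid_def by simp
  next
    case (Suc k)
    then have "ts k < ts (Suc k)" using assms unfolding elem_valid_def by simp
    then show ?case using Suc by simp
  qed
  show thesis
  proof (rule that)
    show "lvalid F L"
      unfolding lvalid_def
    proof (intro ballI, safe)
      fix s u C h y assume "(s, u, C, h, y) \<in> set L"
      then have "\<exists>k\<in>set [1..<Suc K]. \<exists>m\<in>set [0..<Mm]. \<exists>i\<in>set [0..<Nn].
          (s, u, C, h, y) = (ts (k - 1), ts k, B m k, hs i, x k m i)"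
        unfolding L_def by (fastforce simp del: upt_Suc set_upt)
      then obtain k m i where "k \<in> set [1..<Suc K]" "m \<in> set [0..<Mm]"
        "(s, u, C, h, y) = (ts (k - 1), ts k, B m k, hs i, x k m i)"
        by blast
      then have k: "k \<in> {1..K}" "m < Mm" "s = ts (k - 1)" "u = ts k" "C = B m k"
        by (auto simp del: upt_Suc)
      show "0 \<le> s" using ts0[of "k - 1"] k by auto
      have k1: "k - 1 < K" "Suc (k - 1) = k" using k(1) by auto
      have "ts (k - 1) < ts (Suc (k - 1))" using assms k1(1) unfolding elem_valid_def by blast
      then show "s \<le> u" using k k1 by simp
      show "C \<in> sets (F s)" using assms k unfolding elem_valid_def by auto
    qed
    show "lproc L t \<omega> g = elem_proc K ts Mm B Nn hs x t \<omega> g" for t \<omega> g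
      unfolding lproc_def sum elem_proc_def scaleR_sum_right
      by (intro sum.cong refl) (auto simp: indicator_def)
    show "lint W L \<omega> = elem_int W K ts Mm B Nn hs x \<omega>" for \<omega>
      unfolding lint_def sum elem_int_def scaleR_sum_right
      by (intro sum.cong refl) (auto simp: indicator_def)
  qed
qed

lemma lint_measurable:
  fixes L :: "(real \<times> real \<times> 'w set \<times> 'h::real_inner \<times> 'x::euclidean_space) list"
  assumes F: "is_filtr M F" and W: "cyl_bm M F W" and L: "lvalid F L"
  shows "lint W L \<in> borel_measurable M"
  using L
proof (induction L)
  case Nil then show ?case by (simp add: lint_def[abs_def])
next
  case (Cons a L)
  obtain s u B h x where a: "a = (s, u, B, h, x)" by (cases a)
  have *: "B \<in> sets (F s)" "0 \<le> s" "s \<le> u" and [measurable]: "lint W L \<in> borel_measurable M"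
    using Cons a by (auto simp: lvalid_def)
  have [measurable]: "B \<in> sets M" using F * unfolding is_filtr_def subalgebra_def by auto
  note [measurable] = cyl_bm_measurable(2)[OF F W *(2)] cyl_bm_measurable(2)[OF F W order_trans[OF *(2,3)]]
  have "lint W (a # L) = (\<lambda>\<omega>. (indicator B \<omega> * (W u h \<omega> - W s h \<omega>)) *\<^sub>R x + lint W L \<omega>)"
    by (auto simp: lint_def a)
  then show ?case by simp
qed

text \<open>On each grid step the basis \<open>e\<close> is one competitor in the supremum defining
  \<open>hs_sq\<close>, and the values of the process on it are the coefficients. This inequality is
  the direction needed to bound the bracket.\<close>

lemma lproc_l2_eq:
  assumes L: "lvalid F L" and g: "lgrid L ts K"
    and e: "\<And>i j. i < n \<Longrightarrow> j < n \<Longrightarrow> e i \<bullet> e j = of_bool (i = j)"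
    and exp: "\<And>h. h \<in> lvecs L \<Longrightarrow> h = (\<Sum>i<n. (h \<bullet> e i) *\<^sub>R e i)"
  shows "ennreal (\<Sum>k<K. \<Sum>i<n. (ts (Suc k) - ts k) * (norm (lcoef L ts e k i \<omega>))\<^sup>2)
    \<le> (\<integral>\<^sup>+ t. indicator {0..} t * hs_sq (lproc L t \<omega>) \<partial>lborel)"
proof -
  have tsm: "strict_mono ts" "0 \<le> ts 0" using g unfolding lgrid_def by auto
  have ts0: "0 \<le> ts k" for k using tsm strict_mono_less_eq[OF tsm(1), of 0 k] by simp
  have lt: "ts k < ts (Suc k)" for k using tsm by (simp add: strict_mono_def)
  define c where "c k = (\<Sum>i<n. (norm (lcoef L ts e k i \<omega>))\<^sup>2)" for k
  have c0: "0 \<le> c k" for k unfolding c_def by (simp add: sum_nonneg)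
  have "ennreal (\<Sum>k<K. \<Sum>i<n. (ts (Suc k) - ts k) * (norm (lcoef L ts e k i \<omega>))\<^sup>2) = ennreal (\<Sum>k<K. c k * (ts (Suc k) - ts k))"
    unfolding c_def sum_distrib_right by (simp only: mult.commute)
  also have "\<dots> = (\<Sum>k<K. ennreal (c k) * ennreal (ts (Suc k) - ts k))"
    using c0 lt by (subst sum_ennreal[symmetric]) (auto simp: ennreal_mult less_imp_le)
  also have "\<dots> = (\<Sum>k<K. \<integral>\<^sup>+ t. ennreal (c k) * indicator {ts k<..ts (Suc k)} t \<partial>lborel)"
    using lt by (intro sum.cong refl) (simp add: nn_integral_cmult_indicator less_imp_le)
  also have "\<dots> = (\<integral>\<^sup>+ t. (\<Sum>k<K. ennreal (c k) * indicator {ts k<..ts (Suc k)} t) \<partial>lborel)"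
    by (rule nn_integral_sum[symmetric]) auto
  also have "\<dots> \<le> (\<integral>\<^sup>+ t. indicator {0..} t * hs_sq (lproc L t \<omega>) \<partial>lborel)"
  proof (rule nn_integral_mono)
    fix t :: real
    show "(\<Sum>k<K. ennreal (c k) * indicator {ts k<..ts (Suc k)} t) \<le> indicator {0..} t * hs_sq (lproc L t \<omega>)"
    proof (cases "\<exists>k<K. t \<in> {ts k<..ts (Suc k)}")
      case True
      then obtain k where k: "k < K" "t \<in> {ts k<..ts (Suc k)}" by auto
      have uniq: "t \<in> {ts l<..ts (Suc l)} \<longleftrightarrow> l = k" for l
      proof
        assume l: "t \<in> {ts l<..ts (Suc l)}"
        have "l < Suc k" "k < Suc l" using k l strict_mono_less[OF tsm(1)] by (metis greaterThanAtMost_iff order_less_le_trans)+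
        then show "l = k" by simp
      qed (use k in simp)
      have "(\<Sum>l<K. ennreal (c l) * indicator {ts l<..ts (Suc l)} t) = (\<Sum>l<K. if l = k then ennreal (c k) else 0)"
        using uniq by (intro sum.cong refl) (auto simp: indicator_def)
      also have "\<dots> = ennreal (c k)" using k(1) by simp
      also have "c k = (\<Sum>h\<in>e ` {..<n}. (norm (lproc L t \<omega> h))\<^sup>2)"
      proof -
        have inj: "inj_on e {..<n}"
        proof (rule inj_onI)
          fix i j assume "i \<in> {..<n}" "j \<in> {..<n}" "e i = e j"
          then show "i = j" using e[of i j] e[of j j] by (auto split: if_splits)
        qed
        have "lproc L t \<omega> (e i) = lcoef L ts e k i \<omega>" if i: "i < n" for i
        proof -
          have "lproc L t \<omega> (e i) = (\<Sum>l<K. \<Sum>j<n. (indicator {ts l<..ts (Suc l)} t * (e i \<bullet> e j)) *\<^sub>R lcoef L ts e l j \<omega>)"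
            by (rule lproc_normal_form[OF L g exp])
          also have "\<dots> = (\<Sum>l<K. \<Sum>j<n. if j = i then (if l = k then lcoef L ts e k i \<omega> else 0) else 0)"
            using e i uniq by (intro sum.cong refl) (auto simp: indicator_def)
          also have "\<dots> = lcoef L ts e k i \<omega>" using i k(1) by simp
          finally show ?thesis .
        qed
        then show ?thesis unfolding c_def sum.reindex[OF inj] by simp
      qed
      also have "ennreal \<dots> \<le> hs_sq (lproc L t \<omega>)"
        unfolding hs_sq_def
      proof (rule SUP_upper)
        have "norm (e i) = 1" if "i < n" for i using e[OF that that] by (simp add: norm_eq_1)
        then show "e ` {..<n} \<in> {S. finite S \<and> orthonormal_set S}"
          using e unfolding orthonormal_set_def by (auto split: if_splits) 
      qed
      finally show ?thesis using k ts0[of k] by simp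
    next
      case False
      then have "(\<Sum>k<K. ennreal (c k) * indicator {ts k<..ts (Suc k)} t) = 0" by (intro sum.neutral) auto
      then show ?thesis by simp
    qed
  qed
  finally show ?thesis .
qed

lemma lint_normal_form_flat:
  assumes "is_filtr M F" "cyl_bm M F W" "lvalid F L" "lgrid L ts K"
    and "\<And>h. h \<in> lvecs L \<Longrightarrow> h = (\<Sum>i<n. (h \<bullet> e i) *\<^sub>R e i)"
  shows "AE \<omega> in M. lint W L \<omega> = (\<Sum>j<K * n. (W (ts (Suc (j div n))) (e (j mod n)) \<omega> - W (ts (j div n)) (e (j mod n)) \<omega>)
     *\<^sub>R lcoef L ts e (j div n) (j mod n) \<omega>)"
proof -
  have "(\<Sum>j<K * n. (W (ts (Suc (j div n))) (e (j mod n)) \<omega> - W (ts (j div n)) (e (j mod n)) \<omega>) *\<^sub>R lcoef L ts e (j div n) (j mod n) \<omega>)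
     = (\<Sum>k<K. \<Sum>i<n. (W (ts (Suc k)) (e i) \<omega> - W (ts k) (e i) \<omega>) *\<^sub>R lcoef L ts e k i \<omega>)" for \<omega>
    by (rule sum_div_mod[where f = "\<lambda>k i. (W (ts (Suc k)) (e i) \<omega> - W (ts k) (e i) \<omega>) *\<^sub>R lcoef L ts e k i \<omega>"])
  then show ?thesis using lint_normal_form[OF assms] by simp
qed

text \<open>The continuity half of the Ito isomorphism for simple integrands. In normal form the
  integral is a Gaussian transform whose coefficients are bounded and known at the start of each
  step; its bracket is the quantity of \<open>lproc_l2_eq\<close>.\<close>

lemma lint_bound:
  fixes p :: real and W :: "real \<Rightarrow> 'h::real_inner \<Rightarrow> 'w \<Rightarrow> real"
  assumes M: "prob_space M" and F: "is_filtr M F" and W: "cyl_bm M F W" and p: "0 < p"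
  obtains C where "0 \<le> C" "\<And>L :: (real \<times> real \<times> 'w set \<times> 'h \<times> 'x::euclidean_space) list. lvalid F L \<Longrightarrow>
     integrable M (\<lambda>\<omega>. norm (lint W L \<omega>) powr p) \<and>
     (\<integral>\<^sup>+ \<omega>. ennreal (norm (lint W L \<omega>) powr p) \<partial>M) \<le> ennreal C * hs_Lp_pow M p (lproc L)"
proof -
  interpret prob_space M by fact
  obtain C where C: "0 \<le> C" "\<And>(M :: 'w measure) G g \<sigma> K (y :: nat \<Rightarrow> 'w \<Rightarrow> 'x) B. prob_space M \<Longrightarrow> gauss_seq M G g \<sigma> K \<Longrightarrow>
     (\<And>j. j < K \<Longrightarrow> y j \<in> borel_measurable (G j)) \<Longrightarrow> (\<And>j \<omega>. j < K \<Longrightarrow> norm (y j \<omega>) \<le> B) \<Longrightarrow>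
     integrable M (\<lambda>\<omega>. norm (\<Sum>j<K. g j \<omega> *\<^sub>R y j \<omega>) powr p) \<and>
     (\<integral>\<omega>. norm (\<Sum>j<K. g j \<omega> *\<^sub>R y j \<omega>) powr p \<partial>M) \<le> C * (\<integral>\<omega>. (\<Sum>j<K. (\<sigma> j)\<^sup>2 * (norm (y j \<omega>))\<^sup>2) powr (p / 2) \<partial>M)"
    using ito_inequality[OF p] by blast
  show thesis
  proof (rule that[OF C(1)])
    fix L :: "(real \<times> real \<times> 'w set \<times> 'h \<times> 'x) list" assume L: "lvalid F L"
    obtain E where E: "finite E" "orthonormal_set E" "span E = span (lvecs L)"
      using finite_orthonormal_basis[OF finite_lvecs] by blast
    obtain e :: "nat \<Rightarrow> 'h" and n where e: "E = e ` {..<n}" "inj_on e {..<n}" "\<And>i j. i < n \<Longrightarrow> j < n \<Longrightarrow> e i \<bullet> e j = of_bool (i = j)"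
       "\<And>i. i < n \<Longrightarrow> norm (e i) = 1"
      using orthonormal_enumeration[OF E(1,2)] by blast
    obtain ts K where g: "lgrid L ts K" using lgrid_exists[OF L] .
    have tsm: "strict_mono ts" "0 \<le> ts 0" using g unfolding lgrid_def by auto
    have ts0: "0 \<le> ts k" for k using tsm strict_mono_less_eq[OF tsm(1), of 0 k] by simp
    have lt: "ts k \<le> ts (Suc k)" for k using tsm by (simp add: strict_mono_less_eq)
    have exp: "h = (\<Sum>i<n. (h \<bullet> e i) *\<^sub>R e i)" if "h \<in> lvecs L" for h
    proof -
      have "h = (\<Sum>v\<in>E. (h \<bullet> v) *\<^sub>R v)"
        using that by (intro orthonormal_expansion[OF E(1,2)]) (simp add: E(3) span_base)
      also have "\<dots> = (\<Sum>i<n. (h \<bullet> e i) *\<^sub>R e i)" unfolding e(1) by (rule sum.reindex_cong[OF e(2)]) auto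
      finally show ?thesis .
    qed
    let ?Z = "\<lambda>j \<omega>. W (ts (Suc (j div n))) (e (j mod n)) \<omega> - W (ts (j div n)) (e (j mod n)) \<omega>"
    let ?\<sigma> = "\<lambda>j. sqrt (ts (Suc (j div n)) - ts (j div n))"
    let ?y = "\<lambda>j. lcoef L ts e (j div n) (j mod n)"
    obtain G where G: "gauss_seq M G ?Z ?\<sigma> (K * n)" "\<And>j. sets (F (ts (j div n))) \<subseteq> sets (G j)" "\<And>j. space (G j) = space M"
      using cyl_bm_gauss_seq[OF M F W tsm e(3)] by blast
    have ym: "?y j \<in> borel_measurable (G j)" for j
    proof -
      have "subalgebra (G j) (F (ts (j div n)))"
        using G(2,3) F ts0 unfolding is_filtr_def subalgebra_def by auto
      then show ?thesis using lcoef_measurable[OF F L ts0] by (rule measurable_from_subalg)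
    qed
    have mod: "j mod n < n" if "j < K * n" for j using that by (cases "n = 0") auto
    have yB: "norm (?y j \<omega>) \<le> (\<Sum>(s, u, B, h, x)\<leftarrow>L. norm h * norm x)" if "j < K * n" for j \<omega>
      using e(4)[OF mod[OF that]] by (intro lcoef_bounded) simp
    define S where "S \<omega> = (\<Sum>j<K * n. (?\<sigma> j)\<^sup>2 * (norm (?y j \<omega>))\<^sup>2)" for \<omega>
    have Seq: "S \<omega> = (\<Sum>k<K. \<Sum>i<n. (ts (Suc k) - ts k) * (norm (lcoef L ts e k i \<omega>))\<^sup>2)" for \<omega>
      unfolding S_def using lt by (subst sum_div_mod[symmetric]) simp
    have S0: "0 \<le> S \<omega>" for \<omega> unfolding S_def by (intro sum_nonneg) auto
    have AE: "AE \<omega> in M. lint W L \<omega> = (\<Sum>j<K * n. ?Z j \<omega> *\<^sub>R ?y j \<omega>)"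
      by (rule lint_normal_form_flat[OF F W L g exp])
    have [measurable]: "lint W L \<in> borel_measurable M" by (rule lint_measurable[OF F W L])
    have zm [measurable]: "?Z j \<in> borel_measurable M" for j using cyl_bm_measurable(2)[OF F W ts0] by simp
    have subG: "subalgebra M (G j)" for j using G(1) unfolding gauss_seq_def by blast
    have [measurable]: "?y j \<in> borel_measurable M" for j using measurable_from_subalg[OF subG ym] .
    have main: "integrable M (\<lambda>\<omega>. norm (\<Sum>j<K * n. ?Z j \<omega> *\<^sub>R ?y j \<omega>) powr p)"
      "(\<integral>\<omega>. norm (\<Sum>j<K * n. ?Z j \<omega> *\<^sub>R ?y j \<omega>) powr p \<partial>M) \<le> C * (\<integral>\<omega>. S \<omega> powr (p / 2) \<partial>M)"
      using C(2)[OF M G(1) ym yB] unfolding S_def by auto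
    have Sint: "integrable M (\<lambda>\<omega>. S \<omega> powr (p / 2))"
    proof -
      define Q where "Q = (\<Sum>j<K * n. (?\<sigma> j)\<^sup>2 * (\<Sum>(s, u, B, h, x)\<leftarrow>L. norm h * norm x)\<^sup>2)"
      have "S \<omega> \<le> Q" for \<omega> unfolding S_def Q_def using yB by (intro sum_mono mult_left_mono power_mono) auto
      then show ?thesis using S0 p unfolding S_def
        by (intro integrable_const_bound[of _ "Q powr (p / 2)"] AE_I2) (auto intro!: powr_mono2)
    qed
    have int: "integrable M (\<lambda>\<omega>. norm (lint W L \<omega>) powr p)"
      by (rule integrable_cong_AE_imp[OF main(1)]) (use AE in auto)
    have "(\<integral>\<^sup>+ \<omega>. ennreal (norm (lint W L \<omega>) powr p) \<partial>M) = (\<integral>\<^sup>+ \<omega>. ennreal (norm (\<Sum>j<K * n. ?Z j \<omega> *\<^sub>R ?y j \<omega>) powr p) \<partial>M)"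
      by (rule nn_integral_cong_AE) (use AE in auto)
    also have "\<dots> = ennreal (\<integral>\<omega>. norm (\<Sum>j<K * n. ?Z j \<omega> *\<^sub>R ?y j \<omega>) powr p \<partial>M)"
      using main(1) by (intro nn_integral_eq_integral) auto
    also have "\<dots> \<le> ennreal (C * (\<integral>\<omega>. S \<omega> powr (p / 2) \<partial>M))" using main(2) by (rule ennreal_leI)
    also have "\<dots> = ennreal C * (\<integral>\<^sup>+ \<omega>. ennreal (S \<omega> powr (p / 2)) \<partial>M)"
      using Sint C(1) by (subst nn_integral_eq_integral) (auto simp: ennreal_mult)
    also have "\<dots> \<le> ennreal C * hs_Lp_pow M p (lproc L)"
      unfolding hs_Lp_pow_def
    proof (intro mult_left_mono nn_integral_mono)
      fix \<omega>
      have "ennreal (S \<omega> powr (p / 2)) = epowr (ennreal (S \<omega>)) (p / 2)" using S0 by (simp add: epowr_ennreal)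
      also have "\<dots> \<le> epowr (\<integral>\<^sup>+ t. indicator {0..} t * hs_sq (lproc L t \<omega>) \<partial>lborel) (p / 2)"
        unfolding Seq using p by (intro epowr_mono lproc_l2_eq[OF L g e(3) exp]) auto
      finally show "ennreal (S \<omega> powr (p / 2)) \<le> epowr (\<integral>\<^sup>+ t. indicator {0..} t * hs_sq (lproc L t \<omega>) \<partial>lborel) (p / 2)" .
    qed simp
    finally show "integrable M (\<lambda>\<omega>. norm (lint W L \<omega>) powr p) \<and>
       (\<integral>\<^sup>+ \<omega>. ennreal (norm (lint W L \<omega>) powr p) \<partial>M) \<le> ennreal C * hs_Lp_pow M p (lproc L)"
      using int by blast
  qed
qed

lemma lcoef_lcomp:
  assumes "\<And>h. h \<in> lvecs L \<Longrightarrow> A h \<bullet> e i = c * (h \<bullet> e i)"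
  shows "lcoef (lcomp A L) ts e k i \<omega> = c *\<^sub>R lcoef L ts e k i \<omega>"
  using assms
proof (induction L)
  case (Cons a L)
  obtain s u B h x where a: "a = (s, u, B, h, x)" by (cases a)
  have "A h \<bullet> e i = c * (h \<bullet> e i)" using Cons.prems[of h] by (simp add: a lvecs_def)
  moreover have "lcoef (lcomp A L) ts e k i \<omega> = c *\<^sub>R lcoef L ts e k i \<omega>" 
  proof (rule Cons.IH)
    fix h assume "h \<in> lvecs L"
    then show "A h \<bullet> e i = c * (h \<bullet> e i)" using Cons.prems[of h] by (simp add: lvecs_def)
  qed
  ultimately show ?case by (simp add: lcoef_def lcomp_def a scaleR_add_right mult_ac)
qed (simp add: lcoef_def lcomp_def)

text \<open>Both integrals use the same Gaussian increments in the same basis, and their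
  coefficients differ by the compressed eigenvalue of the direction.\<close>

lemma lint_self_adjoint_bound:
  fixes L :: "(real \<times> real \<times> 'w set \<times> 'h::real_inner \<times> 'x::euclidean_space) list"
  assumes M: "prob_space M" and F: "is_filtr M F" and W: "cyl_bm M F W" and p: "1 < p" and N: "is_norm_fun N"
    and A: "bounded_linear A" "\<And>x y. A x \<bullet> y = x \<bullet> A y" and L: "lvalid F L"
  shows "(\<integral>\<omega>. N (lint W (lcomp A L) \<omega>) powr p \<partial>M) \<le> (umd_const p N * onorm A) powr p * (\<integral>\<omega>. N (lint W L \<omega>) powr p \<partial>M)"
proof -
  interpret prob_space M by fact
  have Nm [measurable]: "N \<in> borel_measurable borel" by (rule norm_fun_measurable[OF N])
  \<comment> \<open>The images under \<open>A\<close> are included so that the integrals before and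
    after composition expand in one basis.\<close>
  have fin: "finite (lvecs L \<union> A ` lvecs L)" using finite_lvecs by auto
  obtain E where E: "finite E" "orthonormal_set E"
    "\<And>x. x \<in> lvecs L \<union> A ` lvecs L \<Longrightarrow> x = (\<Sum>e\<in>E. (x \<bullet> e) *\<^sub>R e)"
    "\<And>x e. x \<in> lvecs L \<union> A ` lvecs L \<Longrightarrow> e \<in> E \<Longrightarrow> A x \<bullet> e = (A e \<bullet> e) * (x \<bullet> e)"
    using symmetric_eigenbasis[OF fin A] by blast
  obtain e :: "nat \<Rightarrow> 'h" and n where e: "E = e ` {..<n}" "inj_on e {..<n}" "\<And>i j. i < n \<Longrightarrow> j < n \<Longrightarrow> e i \<bullet> e j = of_bool (i = j)"
     "\<And>i. i < n \<Longrightarrow> norm (e i) = 1"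
    using orthonormal_enumeration[OF E(1,2)] by blast
  obtain ts K where g: "lgrid L ts K" using lgrid_exists[OF L] .
  have gA: "lgrid (lcomp A L) ts K" using g unfolding lgrid_def lcomp_def by auto
  have LA: "lvalid F (lcomp A L)" using L by (simp add: lvalid_lcomp)
  have tsm: "strict_mono ts" "0 \<le> ts 0" using g unfolding lgrid_def by auto
  have ts0: "0 \<le> ts k" for k using tsm strict_mono_less_eq[OF tsm(1), of 0 k] by simp
  have exp': "h = (\<Sum>i<n. (h \<bullet> e i) *\<^sub>R e i)" if "h \<in> lvecs L \<union> A ` lvecs L" for h
  proof -
    have "h = (\<Sum>v\<in>E. (h \<bullet> v) *\<^sub>R v)" by (rule E(3)[OF that])
    also have "\<dots> = (\<Sum>i<n. (h \<bullet> e i) *\<^sub>R e i)" unfolding e(1) by (rule sum.reindex_cong[OF e(2)]) auto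
    finally show ?thesis .
  qed
  have exp: "h = (\<Sum>i<n. (h \<bullet> e i) *\<^sub>R e i)" if "h \<in> lvecs L" for h
    using exp' that by blast
  have expA: "h = (\<Sum>i<n. (h \<bullet> e i) *\<^sub>R e i)" if "h \<in> lvecs (lcomp A L)" for h
    using exp' that unfolding lvecs_lcomp by blast
  \<comment> \<open>Rayleigh quotients at unit vectors, hence bounded by
    \<open>onorm A\<close>.\<close>
  define \<mu> where "\<mu> i = A (e i) \<bullet> e i" for i
  have \<mu>: "\<bar>\<mu> i\<bar> \<le> onorm A" if "i < n" for i
  proof -
    have "\<bar>\<mu> i\<bar> \<le> norm (A (e i)) * norm (e i)" unfolding \<mu>_def by (rule Cauchy_Schwarz_ineq2)
    then show ?thesis using onorm[OF A(1), of "e i"] e(4)[OF that] by simp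
  qed
  let ?Z = "\<lambda>j \<omega>. W (ts (Suc (j div n))) (e (j mod n)) \<omega> - W (ts (j div n)) (e (j mod n)) \<omega>"
  let ?\<sigma> = "\<lambda>j. sqrt (ts (Suc (j div n)) - ts (j div n))"
  let ?y = "\<lambda>j. lcoef L ts e (j div n) (j mod n)"
  obtain G where G: "gauss_seq M G ?Z ?\<sigma> (K * n)" "\<And>j. sets (F (ts (j div n))) \<subseteq> sets (G j)" "\<And>j. space (G j) = space M"
    using cyl_bm_gauss_seq[OF M F W tsm e(3)] by blast
  have ym: "?y j \<in> borel_measurable (G j)" for j
  proof -
    have "subalgebra (G j) (F (ts (j div n)))"
      using G(2,3) F ts0 unfolding is_filtr_def subalgebra_def by auto
    then show ?thesis using lcoef_measurable[OF F L ts0] by (rule measurable_from_subalg)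
  qed
  have mod: "j mod n < n" if "j < K * n" for j using that by (cases "n = 0") auto
  have yB: "norm (?y j \<omega>) \<le> (\<Sum>(s, u, B, h, x)\<leftarrow>L. norm h * norm x)" if "j < K * n" for j \<omega>
    using e(4)[OF mod[OF that]] by (intro lcoef_bounded) simp
  define d where "d j \<omega> = ?Z (j - 1) \<omega> *\<^sub>R ?y (j - 1) \<omega>" for j \<omega>
  have mds: "mds M G p N d (K * n)"
    unfolding d_def using p by (intro gauss_seq_mds[OF M N _ G(1) ym yB]) auto
  \<comment> \<open>The multiplier lemma asks for the bound at every index; outside the range of the
    sum the value 0 provides it.\<close>
  define \<nu> where "\<nu> j = (if j - 1 < K * n then \<mu> ((j - 1) mod n) else 0)" for j
  have \<nu>: "\<bar>\<nu> j\<bar> \<le> onorm A" for j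
    unfolding \<nu>_def using \<mu>[OF mod] onorm_pos_le[OF A(1)] by auto
  have shift: "(\<Sum>j=1..K * n. r j *\<^sub>R d j \<omega>) = (\<Sum>j<K * n. r (Suc j) *\<^sub>R (?Z j \<omega> *\<^sub>R ?y j \<omega>))" for r \<omega>
    unfolding One_nat_def sum.atLeast1_atMost_eq d_def by simp
  have AE1: "AE \<omega> in M. lint W L \<omega> = (\<Sum>j=1..K * n. d j \<omega>)"
    using lint_normal_form_flat[OF F W L g exp] shift[of "\<lambda>_. 1"] by simp
  have AE2: "AE \<omega> in M. lint W (lcomp A L) \<omega> = (\<Sum>j=1..K * n. \<nu> j *\<^sub>R d j \<omega>)"
  proof -
    have coef: "lcoef (lcomp A L) ts e k i \<omega> = \<mu> i *\<^sub>R lcoef L ts e k i \<omega>" if "i < n" for k i \<omega>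
      unfolding \<mu>_def using e(1) that by (intro lcoef_lcomp E(4)) auto
    have "(\<Sum>j<K * n. ?Z j \<omega> *\<^sub>R lcoef (lcomp A L) ts e (j div n) (j mod n) \<omega>) = (\<Sum>j=1..K * n. \<nu> j *\<^sub>R d j \<omega>)" for \<omega>
      unfolding shift using coef[OF mod] by (intro sum.cong refl) (auto simp: \<nu>_def)
    then show ?thesis using lint_normal_form_flat[OF F W LA gA expA] by simp
  qed
  note [measurable] = lint_measurable[OF F W L] lint_measurable[OF F W LA]
  have dm: "d j \<in> borel_measurable M" if "j \<in> {1..K * n}" for j using mdsD(5)[OF mds, of j] that by auto
  have "(\<integral>\<omega>. N (lint W (lcomp A L) \<omega>) powr p \<partial>M) = (\<integral>\<omega>. N (\<Sum>j=1..K * n. \<nu> j *\<^sub>R d j \<omega>) powr p \<partial>M)"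
  proof (rule integral_cong_AE)
    have [measurable]: "(\<lambda>\<omega>. \<Sum>j=1..K * n. \<nu> j *\<^sub>R d j \<omega>) \<in> borel_measurable M"
      by (intro borel_measurable_sum borel_measurable_scaleR dm) auto
    show "(\<lambda>\<omega>. N (\<Sum>j=1..K * n. \<nu> j *\<^sub>R d j \<omega>) powr p) \<in> borel_measurable M" by measurable
  qed (use AE2 in auto)
  also have "\<dots> \<le> (umd_const p N * onorm A) powr p * (\<integral>\<omega>. N (\<Sum>j=1..K * n. d j \<omega>) powr p \<partial>M)"
    by (rule umd_const_multiplier[OF N p mds \<nu>])
  also have "(\<integral>\<omega>. N (\<Sum>j=1..K * n. d j \<omega>) powr p \<partial>M) = (\<integral>\<omega>. N (lint W L \<omega>) powr p \<partial>M)"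
  proof (rule integral_cong_AE)
    have [measurable]: "(\<lambda>\<omega>. \<Sum>j=1..K * n. d j \<omega>) \<in> borel_measurable M"
      by (intro borel_measurable_sum dm) auto
    show "(\<lambda>\<omega>. N (\<Sum>j=1..K * n. d j \<omega>) powr p) \<in> borel_measurable M" by measurable
  qed (use AE1 in auto)
  finally show ?thesis .
qed

section \<open>Approximation of progressive integrands\<close>

lemma epowr_add_le:
  assumes "0 < r"
  shows "epowr (x + y) r \<le> ennreal (2 powr r) * (epowr x r + epowr y r)"
proof (cases "x = \<infinity> \<or> y = \<infinity>")
  case False
  then obtain a b where ab: "x = ennreal a" "0 \<le> a" "y = ennreal b" "0 \<le> b" by (cases x; cases y) auto
  have "epowr (x + y) r = ennreal ((a + b) powr r)" using ab by (simp add: epowr_ennreal flip: ennreal_plus)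
  also have "\<dots> \<le> ennreal (2 powr r * (a powr r + b powr r))"
    using ab assms by (intro ennreal_leI powr_add_le_two_powr)
  also have "\<dots> = ennreal (2 powr r) * (epowr x r + epowr y r)"
    using ab by (simp add: epowr_ennreal ennreal_mult)
  finally show ?thesis .
qed (auto simp: epowr_def ennreal_mult_top)

lemma epowr_cmult:
  assumes "0 < c"
  shows "epowr (ennreal c * x) r = ennreal (c powr r) * epowr x r"
proof (cases "x = \<infinity>")
  case False
  then obtain a where "x = ennreal a" "0 \<le> a" by (cases x) auto
  then show ?thesis using assms by (simp add: epowr_ennreal powr_mult flip: ennreal_mult)
qed (use assms in \<open>simp add: epowr_def ennreal_mult_top\<close>)

lemma epowr_measurable [measurable]: "(\<lambda>x. epowr x r) \<in> borel_measurable borel"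
  unfolding epowr_def by measurable

lemma epowr_tendsto_0:
  assumes f: "(f \<longlongrightarrow> 0) F" and r: "0 < r"
  shows "((\<lambda>n. epowr (f n) r) \<longlongrightarrow> 0) F"
proof -
  have "eventually (\<lambda>n. f n < 1) F" using order_tendstoD(2)[OF f, of 1] by simp
  then have "eventually (\<lambda>n. epowr (f n) r = ennreal (enn2real (f n) powr r)) F"
    by eventually_elim (auto simp: epowr_def)
  moreover have "((\<lambda>n. ennreal (enn2real (f n) powr r)) \<longlongrightarrow> ennreal 0) F"
  proof (rule tendsto_ennrealI)
    have "((\<lambda>n. enn2real (f n)) \<longlongrightarrow> 0) F" using tendsto_enn2real[of f 0] f by simp
    then show "((\<lambda>n. enn2real (f n) powr r) \<longlongrightarrow> 0) F" using r by (intro tendsto_zero_powrI[OF _ tendsto_const]) auto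
  qed
  ultimately show ?thesis by (simp add: tendsto_cong)
qed

text \<open>A p-th power of a mixed norm whose argument is already squared. As \<open>p / 2\<close>
  may be below 1, only a triangle inequality up to a constant is used.\<close>

definition Lp_L2 :: "'w measure \<Rightarrow> real \<Rightarrow> ('w \<Rightarrow> real \<Rightarrow> ennreal) \<Rightarrow> ennreal" where
  "Lp_L2 M p f = (\<integral>\<^sup>+ \<omega>. epowr (\<integral>\<^sup>+ t. f \<omega> t \<partial>lborel) (p / 2) \<partial>M)"

lemma Lp_L2_mono:
  assumes "\<And>\<omega> t. \<omega> \<in> space M \<Longrightarrow> f \<omega> t \<le> g \<omega> t" "0 < p"
  shows "Lp_L2 M p f \<le> Lp_L2 M p g"
  unfolding Lp_L2_def using assms by (intro nn_integral_mono epowr_mono) auto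

lemma Lp_L2_add_le:
  assumes [measurable]: "case_prod f \<in> borel_measurable (M \<Otimes>\<^sub>M lborel)" "case_prod g \<in> borel_measurable (M \<Otimes>\<^sub>M lborel)"
    and p: "0 < p"
  shows "Lp_L2 M p (\<lambda>\<omega> t. f \<omega> t + g \<omega> t) \<le> ennreal (2 powr (p / 2)) * (Lp_L2 M p f + Lp_L2 M p g)"
proof -
  have "Lp_L2 M p (\<lambda>\<omega> t. f \<omega> t + g \<omega> t) = (\<integral>\<^sup>+ \<omega>. epowr ((\<integral>\<^sup>+ t. f \<omega> t \<partial>lborel) + (\<integral>\<^sup>+ t. g \<omega> t \<partial>lborel)) (p / 2) \<partial>M)"
    unfolding Lp_L2_def by (intro nn_integral_cong arg_cong[where f = "\<lambda>x. epowr x (p / 2)"] nn_integral_add) measurable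
  also have "\<dots> \<le> (\<integral>\<^sup>+ \<omega>. ennreal (2 powr (p / 2)) * (epowr (\<integral>\<^sup>+ t. f \<omega> t \<partial>lborel) (p / 2) + epowr (\<integral>\<^sup>+ t. g \<omega> t \<partial>lborel) (p / 2)) \<partial>M)"
    using p by (intro nn_integral_mono epowr_add_le) auto
  also have "\<dots> = ennreal (2 powr (p / 2)) * (Lp_L2 M p f + Lp_L2 M p g)"
    unfolding Lp_L2_def by (subst nn_integral_cmult) (auto simp: nn_integral_add)
  finally show ?thesis .
qed

lemma Lp_L2_cmult:
  assumes [measurable]: "case_prod f \<in> borel_measurable (M \<Otimes>\<^sub>M lborel)" and c: "0 < c"
  shows "Lp_L2 M p (\<lambda>\<omega> t. ennreal c * f \<omega> t) = ennreal (c powr (p / 2)) * Lp_L2 M p f"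
proof -
  have "Lp_L2 M p (\<lambda>\<omega> t. ennreal c * f \<omega> t) = (\<integral>\<^sup>+ \<omega>. ennreal (c powr (p / 2)) * epowr (\<integral>\<^sup>+ t. f \<omega> t \<partial>lborel) (p / 2) \<partial>M)"
    unfolding Lp_L2_def
  proof (rule nn_integral_cong)
    fix \<omega> assume "\<omega> \<in> space M"
    then have "(\<integral>\<^sup>+ t. ennreal c * f \<omega> t \<partial>lborel) = ennreal c * (\<integral>\<^sup>+ t. f \<omega> t \<partial>lborel)"
      by (intro nn_integral_cmult) measurable
    then show "epowr (\<integral>\<^sup>+ t. ennreal c * f \<omega> t \<partial>lborel) (p / 2) = ennreal (c powr (p / 2)) * epowr (\<integral>\<^sup>+ t. f \<omega> t \<partial>lborel) (p / 2)"
      using epowr_cmult[OF c] by simp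
  qed
  also have "\<dots> = ennreal (c powr (p / 2)) * Lp_L2 M p f"
    unfolding Lp_L2_def by (rule nn_integral_cmult) measurable
  finally show ?thesis .
qed

text \<open>The constant depends on \<open>I\<close> and \<open>p\<close> but not on the family
  \<open>f\<close>, so the accuracy of the summands can be fixed after it.\<close>

lemma Lp_L2_sum_le:
  assumes I: "finite I" and p: "0 < p"
  obtains K where "0 \<le> K" "\<And>f :: 'i \<Rightarrow> 'w \<Rightarrow> real \<Rightarrow> ennreal. (\<And>i. i \<in> I \<Longrightarrow> case_prod (f i) \<in> borel_measurable (M \<Otimes>\<^sub>M lborel)) \<Longrightarrow>
     Lp_L2 M p (\<lambda>\<omega> t. \<Sum>i\<in>I. f i \<omega> t) \<le> ennreal K * (\<Sum>i\<in>I. Lp_L2 M p (f i))"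
  using I
proof (induction I arbitrary: thesis)
  case empty
  have "Lp_L2 M p (\<lambda>\<omega> t. 0) = 0" using p by (simp add: Lp_L2_def epowr_def)
  then show ?case by (intro empty(1)[of 0]) auto
next
  case (insert x I)
  obtain K where K: "0 \<le> K" "\<And>f :: 'i \<Rightarrow> 'w \<Rightarrow> real \<Rightarrow> ennreal. (\<And>i. i \<in> I \<Longrightarrow> case_prod (f i) \<in> borel_measurable (M \<Otimes>\<^sub>M lborel)) \<Longrightarrow>
     Lp_L2 M p (\<lambda>\<omega> t. \<Sum>i\<in>I. f i \<omega> t) \<le> ennreal K * (\<Sum>i\<in>I. Lp_L2 M p (f i))"
    using insert.IH by blast
  show ?case
  proof (rule insert.prems)
    show "0 \<le> 2 powr (p / 2) * (1 + K)" using K by simp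
    fix f :: "'i \<Rightarrow> 'w \<Rightarrow> real \<Rightarrow> ennreal"
    assume f: "\<And>i. i \<in> insert x I \<Longrightarrow> case_prod (f i) \<in> borel_measurable (M \<Otimes>\<^sub>M lborel)"
    have sm: "case_prod (\<lambda>\<omega> t. \<Sum>i\<in>I. f i \<omega> t) \<in> borel_measurable (M \<Otimes>\<^sub>M lborel)"
      using f by (simp add: split_beta') 
    have "Lp_L2 M p (\<lambda>\<omega> t. \<Sum>i\<in>insert x I. f i \<omega> t) = Lp_L2 M p (\<lambda>\<omega> t. f x \<omega> t + (\<Sum>i\<in>I. f i \<omega> t))"
      using insert.hyps by simp
    also have "\<dots> \<le> ennreal (2 powr (p / 2)) * (Lp_L2 M p (f x) + Lp_L2 M p (\<lambda>\<omega> t. \<Sum>i\<in>I. f i \<omega> t))"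
      using f sm p by (intro Lp_L2_add_le) auto
    also have "\<dots> \<le> ennreal (2 powr (p / 2)) * (ennreal (1 + K) * Lp_L2 M p (f x) + ennreal (1 + K) * (\<Sum>i\<in>I. Lp_L2 M p (f i)))"
    proof (intro mult_left_mono add_mono)
      have "1 * Lp_L2 M p (f x) \<le> ennreal (1 + K) * Lp_L2 M p (f x)"
        using K(1) by (intro mult_right_mono) (auto simp flip: ennreal_1)
      then show "Lp_L2 M p (f x) \<le> ennreal (1 + K) * Lp_L2 M p (f x)" by simp
      have "Lp_L2 M p (\<lambda>\<omega> t. \<Sum>i\<in>I. f i \<omega> t) \<le> ennreal K * (\<Sum>i\<in>I. Lp_L2 M p (f i))" using f by (intro K(2)) auto
      also have "\<dots> \<le> ennreal (1 + K) * (\<Sum>i\<in>I. Lp_L2 M p (f i))" by (intro mult_right_mono ennreal_leI) auto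
      finally show "Lp_L2 M p (\<lambda>\<omega> t. \<Sum>i\<in>I. f i \<omega> t) \<le> ennreal (1 + K) * (\<Sum>i\<in>I. Lp_L2 M p (f i))" .
    qed auto
    also have "\<dots> = (ennreal (2 powr (p / 2)) * ennreal (1 + K)) * (Lp_L2 M p (f x) + (\<Sum>i\<in>I. Lp_L2 M p (f i)))"
      by (simp only: distrib_left mult.assoc)
    also have "ennreal (2 powr (p / 2)) * ennreal (1 + K) = ennreal (2 powr (p / 2) * (1 + K))"
      using K(1) by (intro ennreal_mult[symmetric]) auto
    also have "Lp_L2 M p (f x) + (\<Sum>i\<in>I. Lp_L2 M p (f i)) = (\<Sum>i\<in>insert x I. Lp_L2 M p (f i))"
      using insert.hyps by simp
    finally show "Lp_L2 M p (\<lambda>\<omega> t. \<Sum>i\<in>insert x I. f i \<omega> t) \<le> ennreal (2 powr (p / 2) * (1 + K)) * (\<Sum>i\<in>insert x I. Lp_L2 M p (f i))" .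
  qed
qed

text \<open>Dominated convergence twice: in \<open>t\<close> for each \<open>\<omega>\<close> whose
  dominating integral is finite, which is almost every one, and then in
  \<open>\<omega>\<close>.\<close>

lemma Lp_L2_dominated_convergence:
  assumes f [measurable]: "\<And>n. case_prod (f n) \<in> borel_measurable (M \<Otimes>\<^sub>M lborel)"
    and g [measurable]: "case_prod g \<in> borel_measurable (M \<Otimes>\<^sub>M lborel)"
    and p: "0 < p" and le: "\<And>n \<omega> t. \<omega> \<in> space M \<Longrightarrow> f n \<omega> t \<le> g \<omega> t" and fin: "Lp_L2 M p g < \<infinity>"
    and lim: "\<And>\<omega>. \<omega> \<in> space M \<Longrightarrow> AE t in lborel. (\<lambda>n. f n \<omega> t) \<longlonglongrightarrow> 0"
  shows "(\<lambda>n. Lp_L2 M p (f n)) \<longlonglongrightarrow> 0"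
proof -
  have "(\<lambda>n. \<integral>\<^sup>+ \<omega>. epowr (\<integral>\<^sup>+ t. f n \<omega> t \<partial>lborel) (p / 2) \<partial>M) \<longlonglongrightarrow> (\<integral>\<^sup>+ \<omega>. 0 \<partial>M)"
  proof (rule nn_integral_dominated_convergence)
    show "(\<integral>\<^sup>+ \<omega>. epowr (\<integral>\<^sup>+ t. g \<omega> t \<partial>lborel) (p / 2) \<partial>M) < \<infinity>" using fin unfolding Lp_L2_def .
    show "AE \<omega> in M. epowr (\<integral>\<^sup>+ t. f n \<omega> t \<partial>lborel) (p / 2) \<le> epowr (\<integral>\<^sup>+ t. g \<omega> t \<partial>lborel) (p / 2)" for n
      using le p by (intro AE_I2 epowr_mono nn_integral_mono) auto
    have "AE \<omega> in M. epowr (\<integral>\<^sup>+ t. g \<omega> t \<partial>lborel) (p / 2) \<noteq> \<infinity>"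
      using fin unfolding Lp_L2_def by (intro nn_integral_PInf_AE) auto
    with AE_space show "AE \<omega> in M. (\<lambda>n. epowr (\<integral>\<^sup>+ t. f n \<omega> t \<partial>lborel) (p / 2)) \<longlonglongrightarrow> 0"
    proof eventually_elim
      case (elim \<omega>)
      then have "(\<integral>\<^sup>+ t. g \<omega> t \<partial>lborel) < \<infinity>" by (auto simp: epowr_def less_top split: if_splits)
      then have "(\<lambda>n. \<integral>\<^sup>+ t. f n \<omega> t \<partial>lborel) \<longlonglongrightarrow> (\<integral>\<^sup>+ (t::real). 0 \<partial>lborel)"
        using lim[OF elim(1)] le[OF elim(1)] elim(1) by (intro nn_integral_dominated_convergence[where w = "g \<omega>"]) auto
      then show ?case using p by (intro epowr_tendsto_0) auto
    qed
  qed measurable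
  then show ?thesis unfolding Lp_L2_def by simp
qed

text \<open>Lebesgue differentiation, transferred from intervals to the right of a point to
  intervals to the left by the reflection \<open>z \<mapsto> - z\<close>. Left averages are required
  because an approximant may look only into the past.\<close>

lemma left_average_differentiation:
  fixes g :: "real \<Rightarrow> real"
  assumes [measurable]: "g \<in> borel_measurable borel" and c: "\<And>x. \<bar>g x\<bar> \<le> c"
  shows "AE x in lborel. \<forall>e>0. \<exists>d>0. \<forall>h. 0 < h \<and> h < d \<longrightarrow> \<bar>(\<integral>z. indicator {x - h<..x} z * g z \<partial>lborel) - h * g x\<bar> \<le> e * h"
proof -
  have int: "integrable lborel (\<lambda>z. indicator {a..b} z *\<^sub>R g (- z))" for a b :: real
  proof (rule Bochner_Integration.integrable_bound)
    show "integrable lborel (\<lambda>z. indicator {a..b} z * c)"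
      by (intro integrable_mult_left integrable_real_indicator) (auto simp: emeasure_lborel_Icc_eq)
    show "AE z in lborel. norm (indicator {a..b} z *\<^sub>R g (- z)) \<le> norm (indicator {a..b} z * c)"
      using c order_trans[OF abs_ge_zero c] by (auto simp: indicator_def)
  qed measurable
  have HK: "integral {a..b} (\<lambda>z. g (- z)) = (\<integral>z. indicator {a..b} z * g (- z) \<partial>lborel)" "(\<lambda>z. g (- z)) integrable_on {a..b}" for a b
    using set_borel_integral_eq_integral[of "{a..b}" "\<lambda>z. g (- z)"] int[of a b]
    by (auto simp: set_integrable_def set_lebesgue_integral_def)
  obtain N where N: "negligible N" "\<And>x e. x \<notin> N \<Longrightarrow> 0 < e \<Longrightarrow>
      \<exists>d>0. \<forall>h. 0 < h \<and> h < d \<longrightarrow> norm (integral (cbox x (x + h *\<^sub>R One)) (\<lambda>z. g (- z)) /\<^sub>R h ^ DIM(real) - g (- x)) < e"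
    using integrable_ccontinuous_explicit[of "\<lambda>z. g (- z)"] HK(2) by (metis cbox_interval)
  \<comment> \<open>The exceptional set belongs to the reflected function and has to be reflected
    back.\<close>
  have "negligible (uminus ` N)" using N(1)
    by (intro negligible_differentiable_image_negligible differentiable_on_minus differentiable_on_ident) auto
  then have "AE x in lebesgue. x \<notin> uminus ` N" by (simp add: negligible_iff_null_sets AE_not_in)
  then have "AE x in lborel. x \<notin> uminus ` N" by (simp add: AE_completion_iff)
  then show ?thesis
  proof eventually_elim
    case (elim x)
    then have nx: "- x \<notin> N" by (metis imageI minus_minus)
    show ?case
    proof (intro allI impI)
      fix e :: real assume "0 < e"
      from N(2)[OF nx this] obtain d where d: "0 < d" "\<And>h. 0 < h \<Longrightarrow> h < d \<Longrightarrow>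
        \<bar>integral {- x..- x + h} (\<lambda>z. g (- z)) / h - g x\<bar> < e" by (auto simp: divide_inverse_commute)
      show "\<exists>d>0. \<forall>h. 0 < h \<and> h < d \<longrightarrow> \<bar>(\<integral>z. indicator {x - h<..x} z * g z \<partial>lborel) - h * g x\<bar> \<le> e * h"
      proof (intro exI[of _ d] conjI allI impI)
        fix h assume h: "0 < h \<and> h < d"
        have "(\<integral>z. indicator {x - h<..x} z * g z \<partial>lborel) = (\<integral>z. indicator {- x..- x + h} (- z) * g z \<partial>lborel)"
        proof (rule integral_cong_AE)
          show "AE z in lborel. indicator {x - h<..x} z * g z = indicator {- x..- x + h} (- z) * g z"
            using AE_lborel_singleton[of "x - h"] by eventually_elim (auto simp: indicator_def)
        qed measurable
        also have "\<dots> = (\<integral>z. indicator {- x..- x + h} z * g (- z) \<partial>lborel)"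
          using lborel_integral_real_affine[of "- 1" "\<lambda>z. indicator {- x..- x + h} z * g (- z)" 0] by simp
        also have "\<dots> = integral {- x..- x + h} (\<lambda>z. g (- z))" using HK(1) by simp
        finally have eq: "(\<integral>z. indicator {x - h<..x} z * g z \<partial>lborel) = integral {- x..- x + h} (\<lambda>z. g (- z))" .
        have "\<bar>integral {- x..- x + h} (\<lambda>z. g (- z)) - h * g x\<bar> = \<bar>integral {- x..- x + h} (\<lambda>z. g (- z)) / h - g x\<bar> * h"
          using h by (simp add: abs_mult_pos' [symmetric] field_simps flip: abs_mult_pos)
        also have "\<dots> \<le> e * h" using d(2)[of h] h by (intro mult_right_mono) auto
        finally show "\<bar>(\<integral>z. indicator {x - h<..x} z * g z \<partial>lborel) - h * g x\<bar> \<le> e * h" unfolding eq .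
      qed (rule d(1))
    qed
  qed
qed


section \<open>Approximation of scalar progressive processes\<close>

lemma emeasure_lborel_Ioc_finite: "emeasure lborel {a<..b::real} < top"
  by (cases "a \<le> b") auto

lemma Lp_L2_sq_triangle:
  fixes a b c :: "'w \<Rightarrow> real \<Rightarrow> real"
  assumes [measurable]: "case_prod a \<in> borel_measurable (M \<Otimes>\<^sub>M lborel)" "case_prod b \<in> borel_measurable (M \<Otimes>\<^sub>M lborel)"
    "case_prod c \<in> borel_measurable (M \<Otimes>\<^sub>M lborel)" and p: "0 < p"
  shows "Lp_L2 M p (\<lambda>\<omega> t. ennreal ((a \<omega> t - b \<omega> t)\<^sup>2))
    \<le> ennreal (2 powr p) * (Lp_L2 M p (\<lambda>\<omega> t. ennreal ((a \<omega> t - c \<omega> t)\<^sup>2)) + Lp_L2 M p (\<lambda>\<omega> t. ennreal ((c \<omega> t - b \<omega> t)\<^sup>2)))"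
proof -
  let ?A = "\<lambda>\<omega> t. ennreal ((a \<omega> t - c \<omega> t)\<^sup>2)" and ?B = "\<lambda>\<omega> t. ennreal ((c \<omega> t - b \<omega> t)\<^sup>2)"
  have "Lp_L2 M p (\<lambda>\<omega> t. ennreal ((a \<omega> t - b \<omega> t)\<^sup>2)) \<le> Lp_L2 M p (\<lambda>\<omega> t. ennreal 2 * ?A \<omega> t + ennreal 2 * ?B \<omega> t)"
  proof (rule Lp_L2_mono[OF _ p])
    fix \<omega> t
    have "(a \<omega> t - b \<omega> t)\<^sup>2 \<le> 2 * (a \<omega> t - c \<omega> t)\<^sup>2 + 2 * (c \<omega> t - b \<omega> t)\<^sup>2"
      using sum_squares_bound[of "a \<omega> t - c \<omega> t" "c \<omega> t - b \<omega> t"] by (simp add: power2_eq_square algebra_simps)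
    then show "ennreal ((a \<omega> t - b \<omega> t)\<^sup>2) \<le> ennreal 2 * ?A \<omega> t + ennreal 2 * ?B \<omega> t"
      by (simp add: ennreal_leI flip: ennreal_mult ennreal_plus del: ennreal_numeral)
  qed
  also have "\<dots> \<le> ennreal (2 powr (p / 2)) * (Lp_L2 M p (\<lambda>\<omega> t. ennreal 2 * ?A \<omega> t) + Lp_L2 M p (\<lambda>\<omega> t. ennreal 2 * ?B \<omega> t))"
    using p by (intro Lp_L2_add_le) measurable
  also have "\<dots> = ennreal (2 powr (p / 2)) * (ennreal (2 powr (p / 2)) * Lp_L2 M p ?A + ennreal (2 powr (p / 2)) * Lp_L2 M p ?B)"
  proof -
    have mA: "case_prod ?A \<in> borel_measurable (M \<Otimes>\<^sub>M lborel)" and mB: "case_prod ?B \<in> borel_measurable (M \<Otimes>\<^sub>M lborel)"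
      by measurable
    have "Lp_L2 M p (\<lambda>\<omega> t. ennreal 2 * ?A \<omega> t) = ennreal (2 powr (p / 2)) * Lp_L2 M p ?A"
      by (rule Lp_L2_cmult[OF mA]) simp
    moreover have "Lp_L2 M p (\<lambda>\<omega> t. ennreal 2 * ?B \<omega> t) = ennreal (2 powr (p / 2)) * Lp_L2 M p ?B"
      by (rule Lp_L2_cmult[OF mB]) simp
    ultimately show ?thesis by (simp only:)
  qed
  also have "\<dots> = ennreal (2 powr p) * (Lp_L2 M p ?A + Lp_L2 M p ?B)"
    by (simp add: distrib_left mult.assoc[symmetric] ennreal_mult[symmetric] flip: powr_add)
  finally show ?thesis .
qed

definition slist :: "(real \<times> real \<times> 'w set \<times> real) list \<Rightarrow> real \<Rightarrow> 'w \<Rightarrow> real" where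
  "slist l t \<omega> = (\<Sum>(s, u, B, c)\<leftarrow>l. indicator {s<..u} t * indicator B \<omega> * c)"

definition svalid :: "(real \<Rightarrow> 'w measure) \<Rightarrow> (real \<times> real \<times> 'w set \<times> real) list \<Rightarrow> bool" where
  "svalid F l \<longleftrightarrow> (\<forall>(s, u, B, c)\<in>set l. 0 \<le> s \<and> s \<le> u \<and> B \<in> sets (F s))"

lemma slist_measurable:
  assumes F: "is_filtr M F" and "svalid F l"
  shows "(\<lambda>(\<omega>, t). slist l t \<omega>) \<in> borel_measurable (M \<Otimes>\<^sub>M lborel)"
  using assms(2)
proof (induction l)
  case Nil then show ?case by (simp add: slist_def)
next
  case (Cons a l)
  obtain s u B c where a: "a = (s, u, B, c)" by (cases a)
  have *: "0 \<le> s" "B \<in> sets (F s)" "svalid F l" using Cons.prems unfolding svalid_def a by auto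
  have [measurable]: "B \<in> sets M" using F *(1,2) unfolding is_filtr_def subalgebra_def by auto
  have [measurable]: "(\<lambda>(\<omega>, t). slist l t \<omega>) \<in> borel_measurable (M \<Otimes>\<^sub>M lborel)" using Cons.IH[OF *(3)] .
  have "(\<lambda>(\<omega>, t). slist (a # l) t \<omega>) = (\<lambda>(\<omega>, t). indicator {s<..u} t * indicator B \<omega> * c + slist l t \<omega>)"
    by (auto simp: slist_def a)
  then show ?case by simp
qed

text \<open>Progressive measurability concerns the restricted space \<open>{0..r}\<close>. Clamping
  \<open>t\<close> to this interval gives a function on the whole line that agrees with the process
  wherever the indicator is nonzero.\<close>

lemma progressive_clamp_measurable:
  fixes \<phi> :: "real \<Rightarrow> 'w \<Rightarrow> 'b::{second_countable_topology, real_normed_vector}"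
  assumes prog: "(\<lambda>(s, \<omega>). \<phi> s \<omega>) \<in> borel_measurable (restrict_space borel {0..r} \<Otimes>\<^sub>M G)" and r: "0 \<le> r"
  shows "(\<lambda>(\<omega>, t). indicator {0..r} t *\<^sub>R \<phi> t \<omega>) \<in> borel_measurable (G \<Otimes>\<^sub>M lborel)"
proof -
  have "(\<lambda>x. max 0 (min (snd x) r)) \<in> measurable (G \<Otimes>\<^sub>M lborel) (restrict_space borel {0..r})"
    using r by (intro measurable_restrict_space2) auto
  then have "(\<lambda>x. (max 0 (min (snd x) r), fst x)) \<in> measurable (G \<Otimes>\<^sub>M lborel) (restrict_space borel {0..r} \<Otimes>\<^sub>M G)"
    by (intro measurable_Pair) auto
  from measurable_compose[OF this prog]
  have [measurable]: "(\<lambda>x. \<phi> (max 0 (min (snd x) r)) (fst x)) \<in> borel_measurable (G \<Otimes>\<^sub>M lborel)" by simp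
  have "(\<lambda>(\<omega>, t). indicator {0..r} t *\<^sub>R \<phi> t \<omega>) = (\<lambda>x. indicator {0..r} (snd x) *\<^sub>R \<phi> (max 0 (min (snd x) r)) (fst x))"
    by (auto simp: indicator_def fun_eq_iff max_absorb2 min_absorb1)
  then show ?thesis by simp
qed

lemma progressive_joint_measurable:
  fixes \<phi> :: "real \<Rightarrow> 'w \<Rightarrow> 'b::{second_countable_topology, real_normed_vector}"
  assumes F: "is_filtr M F"
    and prog: "\<And>r. 0 \<le> r \<Longrightarrow> (\<lambda>(s, \<omega>). \<phi> s \<omega>) \<in> borel_measurable (restrict_space borel {0..r} \<Otimes>\<^sub>M F r)"
  shows "(\<lambda>(\<omega>, t). indicator {0..} t *\<^sub>R \<phi> t \<omega>) \<in> borel_measurable (M \<Otimes>\<^sub>M lborel)"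
proof (rule borel_measurable_LIMSEQ_metric)
  fix n :: nat
  let ?r = "real n"
  have "subalgebra M (F ?r)" using F unfolding is_filtr_def by simp
  then have "(\<lambda>x. x) \<in> measurable M (F ?r)" by (rule measurable_from_subalg) simp
  then have "(\<lambda>x. (fst x, snd x)) \<in> measurable (M \<Otimes>\<^sub>M lborel) (F ?r \<Otimes>\<^sub>M lborel)"
    by (intro measurable_Pair) (auto intro: measurable_compose[OF measurable_fst])
  from measurable_compose[OF this progressive_clamp_measurable[OF prog[of ?r]]]
  show "(\<lambda>(\<omega>, t). indicator {0..?r} t *\<^sub>R \<phi> t \<omega>) \<in> borel_measurable (M \<Otimes>\<^sub>M lborel)"
    by (simp add: split_beta')
next
  fix x :: "'w \<times> real"
  obtain \<omega> t where x: "x = (\<omega>, t)" by (cases x)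
  obtain n0 :: nat where n0: "t \<le> real n0" using real_arch_simple by blast
  have "eventually (\<lambda>n. indicator {0..real n} t *\<^sub>R \<phi> t \<omega> = indicator {0..} t *\<^sub>R \<phi> t \<omega>) sequentially"
    using eventually_ge_at_top[of n0]
  proof eventually_elim
    case (elim n)
    then have "t \<le> real n" using n0 by (meson of_nat_mono order_trans)
    then show ?case by (auto simp: indicator_def)
  qed
  then show "(\<lambda>n. case x of (\<omega>, t) \<Rightarrow> indicator {0..real n} t *\<^sub>R \<phi> t \<omega>) \<longlonglongrightarrow> (case x of (\<omega>, t) \<Rightarrow> indicator {0..} t *\<^sub>R \<phi> t \<omega>)"
    unfolding x by (simp add: tendsto_eventually)
qed

text \<open>The approximant on \<open>(k/n, (k+1)/n]\<close> is the average of the process over the preceding interval,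
  which is known at time \<open>k/n\<close>, rounded down to a multiple of \<open>1/n\<close>.\<close>

lemma bounded_progressive_approximation:
  fixes g :: "'w \<Rightarrow> real \<Rightarrow> real" and c :: nat
  assumes M: "prob_space M" and F: "is_filtr M F" and p: "0 < p"
    and gm [measurable]: "case_prod g \<in> borel_measurable (M \<Otimes>\<^sub>M lborel)"
    and gF: "\<And>r. 0 \<le> r \<Longrightarrow> (\<lambda>(\<omega>, t). indicator {0..r} t * g \<omega> t) \<in> borel_measurable (F r \<Otimes>\<^sub>M lborel)"
    and gb: "\<And>\<omega> t. \<bar>g \<omega> t\<bar> \<le> real c" and g0: "\<And>\<omega> t. t < 0 \<or> real c < t \<Longrightarrow> g \<omega> t = 0" and e: "0 < (\<epsilon>::real)"
  obtains l where "svalid F l" "Lp_L2 M p (\<lambda>\<omega> t. ennreal ((g \<omega> t - slist l t \<omega>)\<^sup>2)) < ennreal \<epsilon>"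
proof -
  interpret prob_space M by fact
  define V where "V m k \<omega> = real (Suc m) * (\<integral>z. indicator {(real k - 1) / real (Suc m)<..real k / real (Suc m)} z * g \<omega> z \<partial>lborel)" for m k :: nat and \<omega>
  \<comment> \<open>Rounding leaves finitely many values, since the averages are bounded by
    \<open>c\<close>; this makes the approximant a finite list.\<close>
  define Q where "Q m k \<omega> = \<lfloor>real (Suc m) * V m k \<omega>\<rfloor>" for m k \<omega>
  \<comment> \<open>The last cell ends after time \<open>c + 2\<close>, beyond the support of
    \<open>g\<close>, so later times contribute no error.\<close>
  define K where "K m = (c + 2) * Suc m" for m
  define l where "l m = concat (map (\<lambda>k. map (\<lambda>i. (real k / real (Suc m), real (Suc k) / real (Suc m),
      {\<omega> \<in> space M. Q m k \<omega> = i}, real_of_int i / real (Suc m))) [- int (c * Suc m)..int (c * Suc m)]) [1..<Suc (K m)])" for m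
  have gx [measurable]: "g \<omega> \<in> borel_measurable borel" if "\<omega> \<in> space M" for \<omega>
    using measurable_compose[OF measurable_Pair1'[OF that] gm] by simp
  have int: "integrable lborel (\<lambda>z. indicator {a<..b} z * g \<omega> z)" if "\<omega> \<in> space M" for a b \<omega>
  proof (rule Bochner_Integration.integrable_bound)
    show "integrable lborel (\<lambda>z. indicator {a<..b} z * real c)"
      by (intro integrable_mult_left integrable_real_indicator) (auto simp: emeasure_lborel_Ioc_finite)
    show "(\<lambda>z. indicator {a<..b} z * g \<omega> z) \<in> borel_measurable lborel" using gx[OF that] by measurable
    show "AE z in lborel. norm (indicator {a<..b} z * g \<omega> z) \<le> norm (indicator {a<..b} z * real c)"
      using gb by (auto simp: indicator_def)
  qed
  have Vb: "\<bar>V m k \<omega>\<bar> \<le> real c" if \<omega>: "\<omega> \<in> space M" for m k \<omega>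
  proof -
    let ?I = "{(real k - 1) / real (Suc m)<..real k / real (Suc m)}"
    have "\<bar>\<integral>z. indicator ?I z * g \<omega> z \<partial>lborel\<bar> \<le> (\<integral>z. \<bar>indicator ?I z * g \<omega> z\<bar> \<partial>lborel)"
      by (rule integral_abs_bound)
    also have "\<dots> \<le> (\<integral>z. indicator ?I z * real c \<partial>lborel)"
    proof (rule integral_mono)
      show "integrable lborel (\<lambda>z. \<bar>indicator ?I z * g \<omega> z\<bar>)" using int[OF \<omega>] by (rule integrable_abs)
      show "integrable lborel (\<lambda>z. indicator ?I z * real c)"
        by (intro integrable_mult_left integrable_real_indicator) (auto simp: emeasure_lborel_Ioc_finite)
    qed (use gb in \<open>auto simp: indicator_def\<close>)
    also have "\<dots> = real c / real (Suc m)"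
      by (simp add: diff_divide_distrib[symmetric] divide_right_mono)
    finally show ?thesis unfolding V_def abs_mult by (simp add: field_simps)
  qed
  have Vm: "V m k \<in> borel_measurable (F (real k / real (Suc m)))" for m k
  proof -
    let ?r = "real k / real (Suc m)"
    have "(\<lambda>(\<omega>, t). indicator {(real k - 1) / real (Suc m)<..?r} t * (indicator {0..?r} t * g \<omega> t)) \<in> borel_measurable (F ?r \<Otimes>\<^sub>M lborel)"
      using gF[of ?r] by (simp add: split_beta')
    also have "(\<lambda>(\<omega>, t). indicator {(real k - 1) / real (Suc m)<..?r} t * (indicator {0..?r} t * g \<omega> t))
        = (\<lambda>(\<omega>, t). indicator {(real k - 1) / real (Suc m)<..?r} t * g \<omega> t)"
    proof -
      have "0 \<le> t" if "g \<omega> t \<noteq> 0" for \<omega> t using g0[of t \<omega>] that by force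
      then show ?thesis by (auto simp: indicator_def fun_eq_iff)
    qed
    finally have "(\<lambda>\<omega>. \<integral>z. indicator {(real k - 1) / real (Suc m)<..?r} z * g \<omega> z \<partial>lborel) \<in> borel_measurable (F ?r)"
      by (intro lborel.borel_measurable_lebesgue_integral) simp
    then show ?thesis unfolding V_def by simp
  qed
  have Qb: "Q m k \<omega> \<in> {- int (c * Suc m)..int (c * Suc m)}" if "\<omega> \<in> space M" for m k \<omega>
  proof -
    have "\<bar>real (Suc m) * V m k \<omega>\<bar> \<le> real (Suc m) * real c" unfolding abs_mult using Vb[OF that] by (intro mult_mono) auto
    moreover define w where "w = real (Suc m) * V m k \<omega>"
    moreover define A where "A = c * Suc m"
    moreover have "real A = real (Suc m) * real c" unfolding A_def by (simp add: algebra_simps)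
    ultimately have "\<bar>w\<bar> \<le> real A" by simp
    then have "- int A \<le> \<lfloor>w\<rfloor> \<and> \<lfloor>w\<rfloor> \<le> int A" by linarith
    then show ?thesis unfolding Q_def w_def[symmetric] A_def[symmetric] by simp
  qed
  have lv: "svalid F (l m)" for m
    unfolding svalid_def
  proof (intro ballI, safe)
    fix s u B c' assume "(s, u, B, c') \<in> set (l m)"
    then have "\<exists>k i. s = real k / real (Suc m) \<and> u = real (Suc k) / real (Suc m) \<and> B = {\<omega> \<in> space M. Q m k \<omega> = i}"
      unfolding l_def by (auto simp del: upt_Suc)
    then obtain k i where s: "s = real k / real (Suc m)" "u = real (Suc k) / real (Suc m)" "B = {\<omega> \<in> space M. Q m k \<omega> = i}" by blast
    show "0 \<le> s" "s \<le> u" using s by (auto simp: divide_right_mono)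
    have sp: "space (F s) = space M" using F s unfolding is_filtr_def subalgebra_def by auto
    have [measurable]: "V m k \<in> borel_measurable (F s)" using Vm s by simp
    have "{\<omega> \<in> space (F s). Q m k \<omega> = i} \<in> sets (F s)" unfolding Q_def by measurable
    then show "B \<in> sets (F s)" using s sp by simp
  qed
  \<comment> \<open>Cells are open on the left and closed on the right, so the ceiling identifies
    the cell of \<open>t\<close>. Index 0 is missing from the list because no averaging interval
    precedes the first cell.\<close>
  have idx: "t \<in> {real k / real (Suc m)<..real (Suc k) / real (Suc m)} \<longleftrightarrow> \<lceil>t * real (Suc m)\<rceil> = int k + 1" for t and k m :: nat
  proof -
    have "t \<in> {real k / real (Suc m)<..real (Suc k) / real (Suc m)} \<longleftrightarrow> real k < t * real (Suc m) \<and> t * real (Suc m) \<le> real k + 1"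
      by (auto simp: field_simps)
    also have "\<dots> \<longleftrightarrow> \<lceil>t * real (Suc m)\<rceil> = int k + 1" by (auto simp: ceiling_eq_iff)
    finally show ?thesis .
  qed
  have ind: "(indicator {real k / real (Suc m)<..real (Suc k) / real (Suc m)} t :: real) = (if \<lceil>t * real (Suc m)\<rceil> = int k + 1 then 1 else 0)" for t and k m :: nat
    unfolding indicator_def idx by simp
  have sl: "slist (l m) t \<omega> = (\<Sum>k=1..K m. indicator {real k / real (Suc m)<..real (Suc k) / real (Suc m)} t * (real_of_int (Q m k \<omega>) / real (Suc m)))"
    if \<omega>: "\<omega> \<in> space M" for m t \<omega>
  proof -
    have "slist (l m) t \<omega> = (\<Sum>k=1..K m. \<Sum>i\<in>{- int (c * Suc m)..int (c * Suc m)}.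
        indicator {real k / real (Suc m)<..real (Suc k) / real (Suc m)} t * indicator {\<omega> \<in> space M. Q m k \<omega> = i} \<omega> * (real_of_int i / real (Suc m)))"
      unfolding slist_def l_def
      by (simp add: sum_list_map_concat comp_def interv_sum_list_conv_sum_set_nat interv_sum_list_conv_sum_set_int atLeastLessThanSuc_atLeastAtMost del: upt_Suc)
    also have "\<dots> = (\<Sum>k=1..K m. \<Sum>i\<in>{- int (c * Suc m)..int (c * Suc m)}. if i = Q m k \<omega> then
        indicator {real k / real (Suc m)<..real (Suc k) / real (Suc m)} t * (real_of_int (Q m k \<omega>) / real (Suc m)) else 0)"
      using \<omega> by (intro sum.cong refl) (auto simp: indicator_def)
    also have "\<dots> = (\<Sum>k=1..K m. indicator {real k / real (Suc m)<..real (Suc k) / real (Suc m)} t * (real_of_int (Q m k \<omega>) / real (Suc m)))"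
      using Qb[OF \<omega>] by (intro sum.cong refl, subst sum.delta) auto
    finally show ?thesis .
  qed
  have sl_in: "slist (l m) t \<omega> = real_of_int (Q m k \<omega>) / real (Suc m)"
    if \<omega>: "\<omega> \<in> space M" and k: "1 \<le> k" "k \<le> K m" "\<lceil>t * real (Suc m)\<rceil> = int k + 1" for m t k \<omega>
  proof -
    have "slist (l m) t \<omega> = (\<Sum>j=1..K m. if j = k then real_of_int (Q m k \<omega>) / real (Suc m) else 0)"
      unfolding sl[OF \<omega>] ind k(3) by (intro sum.cong refl) auto
    also have "\<dots> = real_of_int (Q m k \<omega>) / real (Suc m)" using k(1,2) by simp
    finally show ?thesis .
  qed
  have sl_out: "slist (l m) t \<omega> = 0"
    if \<omega>: "\<omega> \<in> space M" and k: "\<And>k. 1 \<le> k \<Longrightarrow> k \<le> K m \<Longrightarrow> \<lceil>t * real (Suc m)\<rceil> \<noteq> int k + 1" for m t \<omega>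
    unfolding sl[OF \<omega>] ind using k by (intro sum.neutral ballI) auto
  have Qerr: "\<bar>real_of_int (Q m k \<omega>) / real (Suc m) - V m k \<omega>\<bar> \<le> 1 / real (Suc m)" for m k \<omega>
  proof -
    have "\<bar>real_of_int (Q m k \<omega>) - real (Suc m) * V m k \<omega>\<bar> \<le> 1" unfolding Q_def by linarith
    moreover have "real_of_int (Q m k \<omega>) / real (Suc m) - V m k \<omega> = (real_of_int (Q m k \<omega>) - real (Suc m) * V m k \<omega>) / real (Suc m)"
      by (simp add: field_simps)
    ultimately show ?thesis by (simp add: abs_divide divide_right_mono)
  qed
  have slb: "\<bar>g \<omega> t - slist (l m) t \<omega>\<bar> \<le> (2 * real c + 1) * indicator {0..real c + 3} t" if \<omega>: "\<omega> \<in> space M" for m t \<omega>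
  proof (cases "\<exists>k. 1 \<le> k \<and> k \<le> K m \<and> \<lceil>t * real (Suc m)\<rceil> = int k + 1")
    case True
    then obtain k where k: "1 \<le> k" "k \<le> K m" "\<lceil>t * real (Suc m)\<rceil> = int k + 1" by auto
    have "t \<in> {real k / real (Suc m)<..real (Suc k) / real (Suc m)}" using k(3) idx by simp
    moreover have "real (Suc k) / real (Suc m) \<le> real c + 3"
    proof -
      have "real (Suc k) \<le> real (K m + Suc m)" using k(2) by simp
      also have "\<dots> = (real c + 3) * real (Suc m)" unfolding K_def by (simp add: algebra_simps)
      finally show ?thesis by (simp add: divide_le_eq)
    qed
    moreover have "0 \<le> real k / real (Suc m)" by simp
    ultimately have t: "t \<in> {0..real c + 3}" unfolding atLeastAtMost_iff greaterThanAtMost_iff by linarith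
    have "1 / real (Suc m) \<le> 1" by simp
    then have "\<bar>slist (l m) t \<omega>\<bar> \<le> real c + 1"
      using Qerr[of m k \<omega>] Vb[OF \<omega>, of m k] unfolding sl_in[OF \<omega> k] by linarith
    then show ?thesis using gb[of \<omega> t] t by simp
  next
    case False
    then have "slist (l m) t \<omega> = 0" by (intro sl_out[OF \<omega>]) auto
    then show ?thesis using gb[of \<omega> t] g0[of t \<omega>] by (auto simp: indicator_def not_le)
  qed
  have "(\<lambda>m. Lp_L2 M p (\<lambda>\<omega> t. ennreal ((g \<omega> t - slist (l m) t \<omega>)\<^sup>2))) \<longlonglongrightarrow> 0"
  proof (rule Lp_L2_dominated_convergence[OF _ _ p])
    show "case_prod (\<lambda>\<omega> t. ennreal ((g \<omega> t - slist (l m) t \<omega>)\<^sup>2)) \<in> borel_measurable (M \<Otimes>\<^sub>M lborel)" for m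
      using slist_measurable[OF F lv, of m] by measurable
    let ?D = "\<lambda>(\<omega>::'w) t. ennreal ((2 * real c + 1)\<^sup>2) * indicator {0..real c + 3} t"
    show "case_prod ?D \<in> borel_measurable (M \<Otimes>\<^sub>M lborel)" by measurable
    show "ennreal ((g \<omega> t - slist (l m) t \<omega>)\<^sup>2) \<le> ?D \<omega> t" if "\<omega> \<in> space M" for m \<omega> t
    proof -
      have "(g \<omega> t - slist (l m) t \<omega>)\<^sup>2 \<le> ((2 * real c + 1) * indicator {0..real c + 3} t)\<^sup>2"
        using power_mono[OF slb[OF that, of t m], of 2] by simp
      then show ?thesis by (auto simp: indicator_def intro!: ennreal_leI)
    qed
    have "Lp_L2 M p ?D = (\<integral>\<^sup>+ \<omega>. epowr (ennreal ((2 * real c + 1)\<^sup>2) * ennreal (real c + 3)) (p / 2) \<partial>M)"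
      unfolding Lp_L2_def by (simp add: nn_integral_cmult_indicator)
    also have "ennreal ((2 * real c + 1)\<^sup>2) * ennreal (real c + 3) = ennreal ((2 * real c + 1)\<^sup>2 * (real c + 3))"
      by (rule ennreal_mult[symmetric]) auto
    also have "(\<integral>\<^sup>+ (\<omega>::'w). epowr (ennreal ((2 * real c + 1)\<^sup>2 * (real c + 3))) (p / 2) \<partial>M) < \<infinity>"
      by (subst epowr_ennreal) (auto simp: emeasure_space_1)
    finally show "Lp_L2 M p ?D < \<infinity>" .
    fix \<omega> assume \<omega>: "\<omega> \<in> space M"
    have "AE x in lborel. \<forall>e>0. \<exists>d>0. \<forall>h. 0 < h \<and> h < d \<longrightarrow> \<bar>(\<integral>z. indicator {x - h<..x} z * g \<omega> z \<partial>lborel) - h * g \<omega> x\<bar> \<le> e * h"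
      by (rule left_average_differentiation[OF gx[OF \<omega>] gb])
    with AE_lborel_singleton[of 0]
    show "AE t in lborel. (\<lambda>m. ennreal ((g \<omega> t - slist (l m) t \<omega>)\<^sup>2)) \<longlonglongrightarrow> 0"
    proof eventually_elim
      case (elim t)
      have "(\<lambda>m. g \<omega> t - slist (l m) t \<omega>) \<longlonglongrightarrow> 0"
      proof (cases "t < 0")
        case True
        have "slist (l m) t \<omega> = 0" for m
        proof (rule sl_out[OF \<omega>])
          fix k :: nat
          have "t * real (Suc m) \<le> 0" using True by (intro mult_nonpos_nonneg) auto
          then have "\<lceil>t * real (Suc m)\<rceil> \<le> 0" by (simp add: ceiling_le_iff)
          then show "\<lceil>t * real (Suc m)\<rceil> \<noteq> int k + 1" by linarith
        qed
        then show ?thesis using g0[of t \<omega>] True by simp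
      next
        case False
        with elim have t: "0 < t" by simp
        show ?thesis
        proof (rule LIMSEQ_I)
          fix r :: real assume r: "0 < r"
          \<comment> \<open>The averages will cost \<open>3 * e\<close> and the rounding at most
            \<open>e\<close>, which together stay below \<open>r\<close>.\<close>
          define e where "e = r / 5"
          have e: "0 < e" using r unfolding e_def by simp
          obtain d where d: "0 < d" "\<And>h. 0 < h \<Longrightarrow> h < d \<Longrightarrow> \<bar>(\<integral>z. indicator {t - h<..t} z * g \<omega> z \<partial>lborel) - h * g \<omega> t\<bar> \<le> e * h"
            using elim(2) e by blast
          \<comment> \<open>The term \<open>2 / d\<close> puts both windows ending at
            \<open>t\<close> into the range of the differentiation estimate, \<open>1 / e\<close>
            controls the rounding, and \<open>1 / t\<close> places \<open>t\<close> beyond the first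
            cell.\<close>
          obtain n0 :: nat where n0: "2 / d + 1 / e + 1 / t + 1 < real n0" using reals_Archimedean2 by blast
          show "\<exists>no. \<forall>m\<ge>no. norm (g \<omega> t - slist (l m) t \<omega> - 0) < r"
          proof (intro exI[of _ n0] allI impI)
            fix m assume m: "n0 \<le> m"
            define n1 where "n1 = real (Suc m)"
            have pos: "0 < 2 / d" "0 < 1 / e" "0 < 1 / t" using d(1) e t by auto
            have "2 / d + 1 / e + 1 / t + 1 < n1" using n0 m unfolding n1_def by linarith
            then have n1: "2 / d < n1" "1 / e < n1" "1 / t < n1" "0 < n1" using pos by linarith+
            have nd: "2 / n1 < d" "1 / n1 < e" "1 < t * n1"
              using n1 d(1) e t by (auto simp: field_simps)
            define k where "k = nat (\<lceil>t * n1\<rceil> - 1)"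
            have ck: "\<lceil>t * n1\<rceil> = int k + 1" "1 \<le> k" using nd(3) unfolding k_def by linarith+
            show "norm (g \<omega> t - slist (l m) t \<omega> - 0) < r"
            proof (cases "k \<le> K m")
              case True
              have sl: "slist (l m) t \<omega> = real_of_int (Q m k \<omega>) / n1"
                unfolding n1_def by (rule sl_in[OF \<omega> ck(2) True]) (use ck(1) in \<open>simp add: n1_def\<close>)
              have tk: "real k / n1 < t" "t \<le> (real k + 1) / n1"
                using ck(1) n1(4) by (auto simp: pos_divide_less_eq pos_le_divide_eq ceiling_eq_iff)
              define h1 where "h1 = t - (real k - 1) / n1"
              define h2 where "h2 = t - real k / n1"
              have h: "0 < h2" "h2 \<le> 1 / n1" "h1 = h2 + 1 / n1"
                using tk unfolding h1_def h2_def by (simp_all add: add_divide_distrib diff_divide_distrib)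
              have "1 / n1 < d" "2 / n1 = 1 / n1 + 1 / n1" using nd(1) n1(4) d(1) by (auto simp: field_simps)
              then have hd: "h1 < d" "h2 < d" "0 < h1" using h nd(1) n1(4) by (auto intro: add_pos_pos) 
              \<comment> \<open>The averaging interval does not end at \<open>t\<close>. It is
                written as the difference of two left windows of lengths \<open>h1\<close> and
                \<open>h2\<close> that do, with \<open>h1 \<le> 2 / n1\<close> and
                \<open>h2 \<le> 1 / n1\<close>; hence the factor 3.\<close>
              have split: "indicator {(real k - 1) / n1<..real k / n1} z * g \<omega> z = indicator {t - h1<..t} z * g \<omega> z - indicator {t - h2<..t} z * g \<omega> z" for z
                using tk n1(4) divide_right_mono[of "real k - 1" "real k" n1] unfolding h1_def h2_def by (auto simp: indicator_def)
              have "(\<integral>z. indicator {(real k - 1) / n1<..real k / n1} z * g \<omega> z \<partial>lborel)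
                 = (\<integral>z. indicator {t - h1<..t} z * g \<omega> z \<partial>lborel) - (\<integral>z. indicator {t - h2<..t} z * g \<omega> z \<partial>lborel)"
                unfolding split using int[OF \<omega>] by (intro Bochner_Integration.integral_diff)
              moreover have "\<bar>(\<integral>z. indicator {t - h1<..t} z * g \<omega> z \<partial>lborel) - h1 * g \<omega> t\<bar> \<le> e * h1"
                "\<bar>(\<integral>z. indicator {t - h2<..t} z * g \<omega> z \<partial>lborel) - h2 * g \<omega> t\<bar> \<le> e * h2"
                using d(2) hd h(1) by auto
              moreover have "h1 * g \<omega> t - h2 * g \<omega> t = 1 / n1 * g \<omega> t" unfolding h(3) by (simp add: algebra_simps)
              ultimately have "\<bar>(\<integral>z. indicator {(real k - 1) / n1<..real k / n1} z * g \<omega> z \<partial>lborel) - 1 / n1 * g \<omega> t\<bar> \<le> e * h1 + e * h2"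
                by linarith
              also have "\<dots> \<le> e * (3 / n1)"
                unfolding distrib_left[symmetric] using h e by (intro mult_left_mono) auto
              finally have "n1 * \<bar>(\<integral>z. indicator {(real k - 1) / n1<..real k / n1} z * g \<omega> z \<partial>lborel) - 1 / n1 * g \<omega> t\<bar> \<le> n1 * (e * (3 / n1))"
                using n1(4) by (intro mult_left_mono) auto
              moreover have "n1 * \<bar>(\<integral>z. indicator {(real k - 1) / n1<..real k / n1} z * g \<omega> z \<partial>lborel) - 1 / n1 * g \<omega> t\<bar> = \<bar>V m k \<omega> - g \<omega> t\<bar>"
              proof -
                have "V m k \<omega> - g \<omega> t = n1 * ((\<integral>z. indicator {(real k - 1) / n1<..real k / n1} z * g \<omega> z \<partial>lborel) - 1 / n1 * g \<omega> t)"
                  unfolding V_def n1_def[symmetric] using n1(4) by (simp add: right_diff_distrib)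
                then show ?thesis using n1(4) by (simp add: abs_mult)
              qed
              ultimately have "\<bar>V m k \<omega> - g \<omega> t\<bar> \<le> 3 * e" using n1(4) by simp
              moreover have "\<bar>real_of_int (Q m k \<omega>) / n1 - V m k \<omega>\<bar> \<le> 1 / n1" using Qerr[of m k \<omega>] unfolding n1_def .
              ultimately show ?thesis using nd(2) r unfolding sl e_def by (simp, linarith)
            next
              case False
              have "slist (l m) t \<omega> = 0"
                by (rule sl_out[OF \<omega>]) (use ck(1) False in \<open>auto simp: n1_def\<close>)
              moreover have "real c < t"
              proof -
                have "real (K m) < t * n1" using ck(1) False by (simp add: ceiling_eq_iff) 
                then have "(real c + 2) * n1 < t * n1" unfolding K_def n1_def by (simp add: algebra_simps)
                then have "real c + 2 < t" using n1(4) by simp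
                then show ?thesis by simp
              qed
              ultimately show ?thesis using g0[of t \<omega>] r by simp
            qed
          qed
        qed
      qed
      then have "(\<lambda>m. (g \<omega> t - slist (l m) t \<omega>)\<^sup>2) \<longlonglongrightarrow> 0" using tendsto_power[of _ 0 sequentially 2] by fastforce
      then show ?case using tendsto_ennrealI[of _ 0] by fastforce
    qed
  qed
  then have "eventually (\<lambda>m. Lp_L2 M p (\<lambda>\<omega> t. ennreal ((g \<omega> t - slist (l m) t \<omega>)\<^sup>2)) < ennreal \<epsilon>) sequentially"
    using e by (intro order_tendstoD(2)) auto
  then obtain m where "Lp_L2 M p (\<lambda>\<omega> t. ennreal ((g \<omega> t - slist (l m) t \<omega>)\<^sup>2)) < ennreal \<epsilon>"
    by (meson eventually_sequentially order_refl)
  with lv[of m] show thesis by (rule that)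
qed

text \<open>Truncation in both size and time by the same \<open>c\<close> reduces to the bounded
  case. It is done pointwise, so progressive measurability survives.\<close>

lemma progressive_approximation:
  fixes \<phi> :: "real \<Rightarrow> 'w \<Rightarrow> real"
  assumes M: "prob_space M" and F: "is_filtr M F" and p: "0 < p"
    and prog: "\<And>r. 0 \<le> r \<Longrightarrow> (\<lambda>(s, \<omega>). \<phi> s \<omega>) \<in> borel_measurable (restrict_space borel {0..r} \<Otimes>\<^sub>M F r)"
    and fin: "Lp_L2 M p (\<lambda>\<omega> t. ennreal ((indicator {0..} t * \<phi> t \<omega>)\<^sup>2)) < \<infinity>" and e: "0 < (\<epsilon>::real)"
  obtains l where "svalid F l" "Lp_L2 M p (\<lambda>\<omega> t. ennreal ((indicator {0..} t * \<phi> t \<omega> - slist l t \<omega>)\<^sup>2)) < ennreal \<epsilon>"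
proof -
  define f where "f \<omega> t = indicator {0..} t * \<phi> t \<omega>" for \<omega> t
  define g where "g c \<omega> t = (if \<bar>f \<omega> t\<bar> \<le> real c \<and> t \<le> real c then f \<omega> t else 0)" for c :: nat and \<omega> t
  have fm [measurable]: "case_prod f \<in> borel_measurable (M \<Otimes>\<^sub>M lborel)"
    using progressive_joint_measurable[OF F prog] unfolding f_def by simp
  have gm [measurable]: "case_prod (g c) \<in> borel_measurable (M \<Otimes>\<^sub>M lborel)" for c
    unfolding g_def by measurable
  have "(\<lambda>c. Lp_L2 M p (\<lambda>\<omega> t. ennreal ((f \<omega> t - g c \<omega> t)\<^sup>2))) \<longlonglongrightarrow> 0"
  proof (rule Lp_L2_dominated_convergence[OF _ _ p])
    show "case_prod (\<lambda>\<omega> t. ennreal ((f \<omega> t - g c \<omega> t)\<^sup>2)) \<in> borel_measurable (M \<Otimes>\<^sub>M lborel)" for c by measurable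
    show "case_prod (\<lambda>\<omega> t. ennreal ((f \<omega> t)\<^sup>2)) \<in> borel_measurable (M \<Otimes>\<^sub>M lborel)" by measurable
    show "Lp_L2 M p (\<lambda>\<omega> t. ennreal ((f \<omega> t)\<^sup>2)) < \<infinity>" using fin unfolding f_def .
    show "ennreal ((f \<omega> t - g c \<omega> t)\<^sup>2) \<le> ennreal ((f \<omega> t)\<^sup>2)" for c \<omega> t
      by (intro ennreal_leI) (simp add: g_def)
    show "AE t in lborel. (\<lambda>c. ennreal ((f \<omega> t - g c \<omega> t)\<^sup>2)) \<longlonglongrightarrow> 0" for \<omega>
    proof (rule AE_I2, rule tendsto_eventually)
      fix t
      obtain n0 :: nat where n0: "max \<bar>f \<omega> t\<bar> t \<le> real n0" using real_arch_simple by blast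
      show "eventually (\<lambda>c. ennreal ((f \<omega> t - g c \<omega> t)\<^sup>2) = 0) sequentially"
        using eventually_ge_at_top[of n0]
      proof eventually_elim
        case (elim n)
        then have "max \<bar>f \<omega> t\<bar> t \<le> real n" using n0 by (meson of_nat_mono order_trans)
        then show ?case by (simp add: g_def)
      qed
    qed
  qed
  \<comment> \<open>The triangle inequality costs \<open>2 powr p\<close> on two errors of size
    \<open>\<delta>\<close>, which leaves a total of \<open>\<epsilon> / 2\<close>.\<close>
  define \<delta> where "\<delta> = \<epsilon> / (4 * 2 powr p)"
  have \<delta>: "0 < \<delta>" using e unfolding \<delta>_def by simp
  have "eventually (\<lambda>c. Lp_L2 M p (\<lambda>\<omega> t. ennreal ((f \<omega> t - g c \<omega> t)\<^sup>2)) < ennreal \<delta>) sequentially"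
    using \<delta> \<open>(\<lambda>c. Lp_L2 M p (\<lambda>\<omega> t. ennreal ((f \<omega> t - g c \<omega> t)\<^sup>2))) \<longlonglongrightarrow> 0\<close> by (intro order_tendstoD(2)) auto
  then obtain c where c: "Lp_L2 M p (\<lambda>\<omega> t. ennreal ((f \<omega> t - g c \<omega> t)\<^sup>2)) < ennreal \<delta>"
    by (meson eventually_sequentially order_refl)
  have gF: "(\<lambda>(\<omega>, t). indicator {0..r} t * g c \<omega> t) \<in> borel_measurable (F r \<Otimes>\<^sub>M lborel)" if r: "0 \<le> r" for r
  proof -
    define h where "h \<omega> t = indicator {0..r} t *\<^sub>R \<phi> t \<omega>" for \<omega> t
    have [measurable]: "case_prod h \<in> borel_measurable (F r \<Otimes>\<^sub>M lborel)"
      using progressive_clamp_measurable[OF prog[OF r] r] unfolding h_def .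
    have "(\<lambda>(\<omega>, t). indicator {0..r} t * g c \<omega> t) = (\<lambda>(\<omega>, t). if \<bar>h \<omega> t\<bar> \<le> real c \<and> t \<le> real c then h \<omega> t else 0)"
      by (auto simp: fun_eq_iff g_def f_def h_def indicator_def)
    then show ?thesis by simp
  qed
  obtain l where l: "svalid F l" "Lp_L2 M p (\<lambda>\<omega> t. ennreal ((g c \<omega> t - slist l t \<omega>)\<^sup>2)) < ennreal \<delta>"
  proof (rule bounded_progressive_approximation[OF M F p gm gF _ _ \<delta>, of c])
    show "\<bar>g c \<omega> t\<bar> \<le> real c" for \<omega> t by (auto simp: g_def)
    show "g c \<omega> t = 0" if "t < 0 \<or> real c < t" for \<omega> t using that by (auto simp: g_def f_def)
  qed
  have [measurable]: "(\<lambda>(\<omega>, t). slist l t \<omega>) \<in> borel_measurable (M \<Otimes>\<^sub>M lborel)" by (rule slist_measurable[OF F l(1)])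
  have "Lp_L2 M p (\<lambda>\<omega> t. ennreal ((f \<omega> t - slist l t \<omega>)\<^sup>2))
     \<le> ennreal (2 powr p) * (Lp_L2 M p (\<lambda>\<omega> t. ennreal ((f \<omega> t - g c \<omega> t)\<^sup>2)) + Lp_L2 M p (\<lambda>\<omega> t. ennreal ((g c \<omega> t - slist l t \<omega>)\<^sup>2)))"
    by (rule Lp_L2_sq_triangle[OF _ _ _ p]) auto
  also have "\<dots> \<le> ennreal (2 powr p) * (ennreal \<delta> + ennreal \<delta>)"
    using c l(2) by (intro mult_left_mono add_mono) auto
  also have "ennreal \<delta> + ennreal \<delta> = ennreal (\<delta> + \<delta>)" using \<delta> by (intro ennreal_plus[symmetric]) auto
  also have "ennreal (2 powr p) * ennreal (\<delta> + \<delta>) = ennreal (2 powr p * (\<delta> + \<delta>))"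
    using \<delta> by (intro ennreal_mult[symmetric]) auto
  also have "\<dots> < ennreal \<epsilon>" using e unfolding \<delta>_def by (intro ennreal_lessI) (auto simp: field_simps)
  finally show thesis using that[OF l(1)] unfolding f_def by simp
qed

text \<open>Joint measurability without adaptedness: it is stable under differences and under
  composition with \<open>A\<close>, and it is all that estimates of norms require.\<close>

definition jm_op :: "'w measure \<Rightarrow> (real \<Rightarrow> 'w \<Rightarrow> 'h::real_normed_vector \<Rightarrow> 'x::euclidean_space) \<Rightarrow> bool" where
  "jm_op M \<Phi> \<longleftrightarrow> (\<forall>t\<ge>0. \<forall>\<omega>\<in>space M. bounded_linear (\<Phi> t \<omega>)) \<and>
     (\<forall>h. (\<lambda>(\<omega>, t). indicator {0..} t *\<^sub>R \<Phi> t \<omega> h) \<in> borel_measurable (M \<Otimes>\<^sub>M lborel))"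

lemma progressive_op_jm_op:
  assumes F: "is_filtr M F" and \<Phi>: "progressive_op F \<Phi> M"
  shows "jm_op M \<Phi>"
  unfolding jm_op_def
proof (intro conjI allI impI)
  show "(\<lambda>(\<omega>, t). indicator {0..} t *\<^sub>R \<Phi> t \<omega> h) \<in> borel_measurable (M \<Otimes>\<^sub>M lborel)" for h
    using \<Phi> unfolding progressive_op_def by (intro progressive_joint_measurable[OF F]) auto
qed (use \<Phi> in \<open>auto simp: progressive_op_def\<close>)

lemma bounded_linear_lproc:
  fixes L :: "(real \<times> real \<times> 'w set \<times> 'h::real_inner \<times> 'x::euclidean_space) list"
  shows "bounded_linear (lproc L t \<omega>)"
proof (induction L)
  case Nil then show ?case by (simp add: lproc_def[abs_def])
next
  case (Cons a L)
  obtain s u B h x where a: "a = (s, u, B, h, x)" by (cases a)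
  have "bounded_linear (\<lambda>g. (indicator {s<..u} t * indicator B \<omega> * (g \<bullet> h)) *\<^sub>R x)"
    by (intro bounded_linear_scaleR_const bounded_linear_const_mult bounded_linear_inner_left)
  moreover have "lproc (a # L) t \<omega> = (\<lambda>g. (indicator {s<..u} t * indicator B \<omega> * (g \<bullet> h)) *\<^sub>R x + lproc L t \<omega> g)"
    by (auto simp: lproc_def a)
  ultimately show ?case using Cons by (simp add: bounded_linear_add)
qed

lemma jm_op_lproc:
  fixes L :: "(real \<times> real \<times> 'w set \<times> 'h::real_inner \<times> 'x::euclidean_space) list"
  assumes F: "is_filtr M F" and "lvalid F L"
  shows "jm_op M (lproc L)"
  unfolding jm_op_def
proof (intro conjI allI impI ballI bounded_linear_lproc)
  fix g
  show "(\<lambda>(\<omega>, t). indicator {0..} t *\<^sub>R lproc L t \<omega> g) \<in> borel_measurable (M \<Otimes>\<^sub>M lborel)"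
    using assms(2)
  proof (induction L)
    case Nil then show ?case by (simp add: lproc_def)
  next
    case (Cons a L)
    obtain s u B h x where a: "a = (s, u, B, h, x)" by (cases a)
    have *: "0 \<le> s" "B \<in> sets (F s)" "lvalid F L" using Cons.prems unfolding lvalid_def a by auto
    have [measurable]: "B \<in> sets M" using F *(1,2) unfolding is_filtr_def subalgebra_def by auto
    have [measurable]: "(\<lambda>(\<omega>, t). indicator {0..} t *\<^sub>R lproc L t \<omega> g) \<in> borel_measurable (M \<Otimes>\<^sub>M lborel)" using Cons.IH[OF *(3)] .
    have "(\<lambda>(\<omega>, t). indicator {0..} t *\<^sub>R lproc (a # L) t \<omega> g)
       = (\<lambda>(\<omega>, t). (indicator {0..} t * (indicator {s<..u} t * indicator B \<omega> * (g \<bullet> h))) *\<^sub>R x + indicator {0..} t *\<^sub>R lproc L t \<omega> g)"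
      by (auto simp: lproc_def a scaleR_add_right)
    then show ?case by simp
  qed
qed

lemma jm_op_diff:
  assumes "jm_op M \<Phi>" "jm_op M \<Psi>"
  shows "jm_op M (\<lambda>t \<omega> h. \<Phi> t \<omega> h - \<Psi> t \<omega> h)"
  unfolding jm_op_def
proof (intro conjI allI impI ballI)
  fix h
  have [measurable]: "(\<lambda>(\<omega>, t). indicator {0..} t *\<^sub>R \<Phi> t \<omega> h) \<in> borel_measurable (M \<Otimes>\<^sub>M lborel)"
    "(\<lambda>(\<omega>, t). indicator {0..} t *\<^sub>R \<Psi> t \<omega> h) \<in> borel_measurable (M \<Otimes>\<^sub>M lborel)" using assms unfolding jm_op_def by auto
  have "(\<lambda>(\<omega>, t). indicator {0..} t *\<^sub>R (\<Phi> t \<omega> h - \<Psi> t \<omega> h)) = (\<lambda>(\<omega>, t). indicator {0..} t *\<^sub>R \<Phi> t \<omega> h - indicator {0..} t *\<^sub>R \<Psi> t \<omega> h)"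
    by (auto simp: scaleR_diff_right)
  then show "(\<lambda>(\<omega>, t). indicator {0..} t *\<^sub>R (\<Phi> t \<omega> h - \<Psi> t \<omega> h)) \<in> borel_measurable (M \<Otimes>\<^sub>M lborel)" by simp
qed (use assms in \<open>auto simp: jm_op_def intro: bounded_linear_sub\<close>)

lemma jm_op_comp:
  assumes "jm_op M \<Phi>" "bounded_linear A"
  shows "jm_op M (\<lambda>t \<omega>. \<Phi> t \<omega> \<circ> A)"
  using assms unfolding jm_op_def by (auto simp: comp_def intro: bounded_linear_compose)

abbreviation opsq0 :: "(real \<Rightarrow> 'w \<Rightarrow> 'h::real_normed_vector \<Rightarrow> 'x::euclidean_space) \<Rightarrow> 'w \<Rightarrow> real \<Rightarrow> ennreal" where
  "opsq0 \<Phi> \<omega> t \<equiv> indicator {0..} t * opsq (\<Phi> t \<omega>)"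

lemma opsq0_measurable:
  fixes \<Phi> :: "real \<Rightarrow> 'w \<Rightarrow> 'h::real_normed_vector \<Rightarrow> 'x::euclidean_space"
  assumes sep: "separable_space TYPE('h)" and \<Phi>: "jm_op M \<Phi>"
  shows "case_prod (opsq0 \<Phi>) \<in> borel_measurable (M \<Otimes>\<^sub>M lborel)"
proof -
  obtain D :: "'h set" where D: "countable D" "closure D = UNIV" using sep unfolding separable_space_def by auto
  have [measurable]: "(\<lambda>(\<omega>, t). indicator {0..} t *\<^sub>R \<Phi> t \<omega> h) \<in> borel_measurable (M \<Otimes>\<^sub>M lborel)" for h
    using \<Phi> unfolding jm_op_def by auto
  have "(\<lambda>(\<omega>, t). SUP h\<in>D. ennreal ((norm (indicator {0..} t *\<^sub>R \<Phi> t \<omega> h) / norm h)\<^sup>2)) \<in> borel_measurable (M \<Otimes>\<^sub>M lborel)"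
    unfolding split_beta' using D(1) by measurable
  moreover have "opsq0 \<Phi> \<omega> t = (SUP h\<in>D. ennreal ((norm (indicator {0..} t *\<^sub>R \<Phi> t \<omega> h) / norm h)\<^sup>2))" if "\<omega> \<in> space M" for \<omega> t
  proof (cases "0 \<le> t")
    case True
    then have "bounded_linear (\<Phi> t \<omega>)" using \<Phi> that unfolding jm_op_def by auto
    from opsq_countable_dense[OF this D(2)] show ?thesis using True by simp
  next
    case False
    have "D \<noteq> {}" using D(2) by auto
    then show ?thesis using False by (simp add: SUP_constant bot_ennreal)
  qed
  ultimately show ?thesis by (subst measurable_cong) (auto simp: space_pair_measure)
qed

text \<open>The Hilbert-Schmidt norm enters only through monotonicity of \<open>nn_integral\<close>;
  measurability is asked of the operator norm, where the constant is taken out.\<close>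

lemma hs_Lp_pow_le_Lp_L2:
  fixes \<Phi> :: "real \<Rightarrow> 'w \<Rightarrow> 'h::real_inner \<Rightarrow> 'x::euclidean_space"
  assumes sep: "separable_space TYPE('h)" and \<Phi>: "jm_op M \<Phi>" and p: "0 < p"
  shows "hs_Lp_pow M p \<Phi> \<le> ennreal (real DIM('x) powr (p / 2)) * Lp_L2 M p (opsq0 \<Phi>)"
proof -
  have "hs_Lp_pow M p \<Phi> \<le> Lp_L2 M p (\<lambda>\<omega> t. ennreal (real DIM('x)) * opsq0 \<Phi> \<omega> t)"
    unfolding hs_Lp_pow_def Lp_L2_def
  proof (intro nn_integral_mono epowr_mono)
    fix \<omega> and t :: real assume \<omega>: "\<omega> \<in> space M"
    show "indicator {0..} t * hs_sq (\<Phi> t \<omega>) \<le> ennreal (real DIM('x)) * opsq0 \<Phi> \<omega> t"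
    proof (cases "0 \<le> t")
      case True
      then have "linear (\<Phi> t \<omega>)" using \<Phi> \<omega> unfolding jm_op_def by (auto intro: bounded_linear.linear)
      from hs_sq_le_opsq[OF this] show ?thesis using True by (simp add: ennreal_of_nat_eq_real_of_nat)
    qed simp
  qed (use p in auto)
  also have "\<dots> = ennreal (real DIM('x) powr (p / 2)) * Lp_L2 M p (opsq0 \<Phi>)"
    using opsq0_measurable[OF sep \<Phi>] by (rule Lp_L2_cmult) simp
  finally show ?thesis .
qed

lemma Lp_L2_le_hs_Lp_pow:
  fixes \<Phi> :: "real \<Rightarrow> 'w \<Rightarrow> 'h::real_inner \<Rightarrow> 'x::euclidean_space"
  assumes \<Phi>: "\<And>t \<omega>. 0 \<le> t \<Longrightarrow> \<omega> \<in> space M \<Longrightarrow> linear (\<Phi> t \<omega>)" and p: "0 < p"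
  shows "Lp_L2 M p (opsq0 \<Phi>) \<le> hs_Lp_pow M p \<Phi>"
  unfolding hs_Lp_pow_def Lp_L2_def
proof (intro nn_integral_mono epowr_mono)
  fix \<omega> and t :: real assume \<omega>: "\<omega> \<in> space M"
  show "opsq0 \<Phi> \<omega> t \<le> indicator {0..} t * hs_sq (\<Phi> t \<omega>)"
    using opsq_le_hs_sq[OF \<Phi>, of t \<omega>] \<omega> by (auto simp: indicator_def)
qed (use p in auto)

lemma Lp_L2_opsq_triangle:
  fixes \<Phi> \<Psi> \<Theta> :: "real \<Rightarrow> 'w \<Rightarrow> 'h::real_inner \<Rightarrow> 'x::euclidean_space"
  assumes sep: "separable_space TYPE('h)" and jm: "jm_op M \<Phi>" "jm_op M \<Psi>" "jm_op M \<Theta>" and p: "0 < p"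
  shows "Lp_L2 M p (opsq0 (\<lambda>t \<omega> h. \<Psi> t \<omega> h - \<Theta> t \<omega> h))
    \<le> ennreal (2 powr p) * (Lp_L2 M p (opsq0 (\<lambda>t \<omega> h. \<Phi> t \<omega> h - \<Psi> t \<omega> h)) + Lp_L2 M p (opsq0 (\<lambda>t \<omega> h. \<Phi> t \<omega> h - \<Theta> t \<omega> h)))"
proof -
  let ?A = "opsq0 (\<lambda>t \<omega> h. \<Phi> t \<omega> h - \<Psi> t \<omega> h)" and ?B = "opsq0 (\<lambda>t \<omega> h. \<Phi> t \<omega> h - \<Theta> t \<omega> h)"
  have Am [measurable]: "case_prod ?A \<in> borel_measurable (M \<Otimes>\<^sub>M lborel)" by (rule opsq0_measurable[OF sep jm_op_diff[OF jm(1,2)]])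
  have Bm [measurable]: "case_prod ?B \<in> borel_measurable (M \<Otimes>\<^sub>M lborel)" by (rule opsq0_measurable[OF sep jm_op_diff[OF jm(1,3)]])
  have "Lp_L2 M p (opsq0 (\<lambda>t \<omega> h. \<Psi> t \<omega> h - \<Theta> t \<omega> h)) \<le> Lp_L2 M p (\<lambda>\<omega> t. ennreal 2 * ?A \<omega> t + ennreal 2 * ?B \<omega> t)"
  proof (rule Lp_L2_mono[OF _ p])
    fix \<omega> t assume \<omega>: "\<omega> \<in> space M"
    show "opsq0 (\<lambda>t \<omega> h. \<Psi> t \<omega> h - \<Theta> t \<omega> h) \<omega> t \<le> ennreal 2 * ?A \<omega> t + ennreal 2 * ?B \<omega> t"
    proof (cases "0 \<le> t")
      case True
      have lin: "linear (\<Phi> t \<omega>)" "linear (\<Psi> t \<omega>)" "linear (\<Theta> t \<omega>)"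
        using jm True \<omega> unfolding jm_op_def by (auto intro: bounded_linear.linear)
      have "opsq (\<lambda>h. (\<Phi> t \<omega> h - \<Theta> t \<omega> h) - (\<Phi> t \<omega> h - \<Psi> t \<omega> h)) \<le> 2 * opsq (\<lambda>h. \<Phi> t \<omega> h - \<Theta> t \<omega> h) + 2 * opsq (\<lambda>h. \<Phi> t \<omega> h - \<Psi> t \<omega> h)"
        using lin by (intro opsq_diff_le linear_compose_sub)
      then show ?thesis using True by (simp add: add.commute)
    qed simp
  qed
  also have "\<dots> \<le> ennreal (2 powr (p / 2)) * (Lp_L2 M p (\<lambda>\<omega> t. ennreal 2 * ?A \<omega> t) + Lp_L2 M p (\<lambda>\<omega> t. ennreal 2 * ?B \<omega> t))"
    using p by (intro Lp_L2_add_le) measurable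
  also have "\<dots> = ennreal (2 powr (p / 2)) * (ennreal (2 powr (p / 2)) * Lp_L2 M p ?A + ennreal (2 powr (p / 2)) * Lp_L2 M p ?B)"
    using Lp_L2_cmult[OF Am, of 2 p] Lp_L2_cmult[OF Bm, of 2 p] by (simp only: zero_less_numeral)
  also have "\<dots> = ennreal (2 powr p) * (Lp_L2 M p ?A + Lp_L2 M p ?B)"
    by (simp add: distrib_left mult.assoc[symmetric] ennreal_mult[symmetric] flip: powr_add)
  finally show ?thesis .
qed

lemma opsq_minus_commute: "opsq (\<lambda>h. S h - T h) = opsq (\<lambda>h. T h - S h)"
  unfolding opsq_def by (simp add: norm_minus_commute)

lemma lproc_Nil [simp]: "lproc [] t \<omega> g = 0" by (simp add: lproc_def)

lemma lproc_concat: "lproc (concat Ls) t \<omega> g = (\<Sum>L\<leftarrow>Ls. lproc L t \<omega> g)"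
  by (induction Ls) (auto simp: lproc_append)

text \<open>Composition with the projections \<open>P n\<close> leaves finitely many matrix entries
  \<open>\<phi> i\<close>, with \<open>i\<close> a pair of a basis vector of the projection and one
  of the target. Each entry is a scalar progressive process, and the lists approximating them are
  assembled into one.\<close>

lemma operator_approximation:
  fixes \<Phi> :: "real \<Rightarrow> 'w \<Rightarrow> 'h::real_inner \<Rightarrow> 'x::euclidean_space"
  assumes M: "prob_space M" and F: "is_filtr M F" and p: "0 < p" and sep: "separable_space TYPE('h)"
    and \<Phi>: "progressive_op F \<Phi> M" and fin: "hs_Lp_pow M p \<Phi> < \<infinity>" and e: "0 < (\<epsilon>::real)"
  obtains L where "lvalid F L" "Lp_L2 M p (opsq0 (\<lambda>t \<omega> h. \<Phi> t \<omega> h - lproc L t \<omega> h)) < ennreal \<epsilon>"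
proof -
  obtain D :: "'h set" where D: "countable D" "closure D = UNIV" using sep unfolding separable_space_def by auto
  obtain E :: "nat \<Rightarrow> 'h set" where E: "\<And>n. finite (E n)" "\<And>n. orthonormal_set (E n)"
    "\<And>T :: 'h \<Rightarrow> 'x. bounded_linear T \<Longrightarrow> (\<lambda>n. opsq (\<lambda>h. T h - T (\<Sum>e\<in>E n. (h \<bullet> e) *\<^sub>R e))) \<longlonglongrightarrow> 0"
    using orthogonal_projections_approximate[OF D] by blast
  define P where "P n h = (\<Sum>e\<in>E n. (h \<bullet> e) *\<^sub>R e)" for n and h :: 'h
  have blP: "bounded_linear (P n)" for n
    unfolding P_def by (intro bounded_linear_sum bounded_linear_scaleR_const bounded_linear_inner_left)
  have jm: "jm_op M \<Phi>" by (rule progressive_op_jm_op[OF F \<Phi>])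
  define \<Psi> where "\<Psi> n = (\<lambda>t \<omega>. \<Phi> t \<omega> \<circ> P n)" for n
  have jm\<Psi>: "jm_op M (\<Psi> n)" for n unfolding \<Psi>_def by (rule jm_op_comp[OF jm blP])
  have bl: "bounded_linear (\<Phi> t \<omega>)" if "0 \<le> t" "\<omega> \<in> space M" for t \<omega> using jm that unfolding jm_op_def by auto
  note lin = bounded_linear.linear[OF bl]
  have finO: "Lp_L2 M p (opsq0 \<Phi>) < \<infinity>"
    using Lp_L2_le_hs_Lp_pow[OF lin p] fin by (rule order_le_less_trans)
  \<comment> \<open>The complementary projection is a contraction, so \<open>opsq0 \<Phi>\<close>
    dominates all the errors.\<close>
  have contr: "norm (h - P n h) \<le> norm h" for n h
  proof -
    have "(norm (P n h))\<^sup>2 = (\<Sum>e\<in>E n. (h \<bullet> e)\<^sup>2)"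
      unfolding P_def using E(1,2) orthonormal_setD[OF E(2)] by (intro orthonormal_sum_norm_sq) auto
    moreover have "h \<bullet> P n h = (\<Sum>e\<in>E n. (h \<bullet> e)\<^sup>2)"
      unfolding P_def by (simp add: inner_sum_right power2_eq_square)
    moreover have "(norm (h - P n h))\<^sup>2 = (norm h)\<^sup>2 - 2 * (h \<bullet> P n h) + (norm (P n h))\<^sup>2"
      unfolding power2_norm_eq_inner by (simp add: inner_diff_left inner_diff_right inner_commute[of "P n h" h])
    ultimately have "(norm (h - P n h))\<^sup>2 = (norm h)\<^sup>2 - (norm (P n h))\<^sup>2" by simp
    then have "(norm (h - P n h))\<^sup>2 \<le> (norm h)\<^sup>2" by simp
    then show ?thesis by (rule power2_le_imp_le) simp
  qed
  have "(\<lambda>n. Lp_L2 M p (opsq0 (\<lambda>t \<omega> h. \<Psi> n t \<omega> h - \<Phi> t \<omega> h))) \<longlonglongrightarrow> 0"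
  proof (rule Lp_L2_dominated_convergence[OF _ _ p _ finO])
    show "case_prod (opsq0 (\<lambda>t \<omega> h. \<Psi> n t \<omega> h - \<Phi> t \<omega> h)) \<in> borel_measurable (M \<Otimes>\<^sub>M lborel)" for n
      by (rule opsq0_measurable[OF sep jm_op_diff[OF jm\<Psi> jm]])
    show "case_prod (opsq0 \<Phi>) \<in> borel_measurable (M \<Otimes>\<^sub>M lborel)" by (rule opsq0_measurable[OF sep jm])
    show "opsq0 (\<lambda>t \<omega> h. \<Psi> n t \<omega> h - \<Phi> t \<omega> h) \<omega> t \<le> opsq0 \<Phi> \<omega> t" if \<omega>: "\<omega> \<in> space M" for n \<omega> t
    proof (cases "0 \<le> t")
      case True
      have "opsq (\<lambda>h. \<Psi> n t \<omega> h - \<Phi> t \<omega> h) = opsq (\<Phi> t \<omega> \<circ> (\<lambda>h. h - P n h))"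
        unfolding \<Psi>_def opsq_minus_commute[of "\<Phi> t \<omega> \<circ> P n"] using lin[OF True \<omega>] by (simp add: linear_diff comp_def)
      also have "\<dots> \<le> ennreal ((onorm (\<lambda>h. h - P n h))\<^sup>2) * opsq (\<Phi> t \<omega>)"
        by (intro opsq_compose lin[OF True \<omega>] bounded_linear_sub bounded_linear_ident blP)
      also have "\<dots> \<le> 1 * opsq (\<Phi> t \<omega>)"
      proof (rule mult_right_mono)
        have "onorm (\<lambda>h. h - P n h) \<le> 1" using contr by (intro onorm_bound) auto
        moreover have "0 \<le> onorm (\<lambda>h. h - P n h)" by (intro onorm_pos_le bounded_linear_sub bounded_linear_ident blP)
        ultimately have "(onorm (\<lambda>h. h - P n h))\<^sup>2 \<le> 1" by (simp add: power_le_one)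
        then show "ennreal ((onorm (\<lambda>h. h - P n h))\<^sup>2) \<le> 1" by (simp flip: ennreal_1)
      qed simp
      finally show ?thesis using True by simp
    qed simp
    show "AE t in lborel. (\<lambda>n. opsq0 (\<lambda>t \<omega> h. \<Psi> n t \<omega> h - \<Phi> t \<omega> h) \<omega> t) \<longlonglongrightarrow> 0" if \<omega>: "\<omega> \<in> space M" for \<omega>
    proof (rule AE_I2)
      fix t :: real
      show "(\<lambda>n. opsq0 (\<lambda>t \<omega> h. \<Psi> n t \<omega> h - \<Phi> t \<omega> h) \<omega> t) \<longlonglongrightarrow> 0"
      proof (cases "0 \<le> t")
        case True
        have "opsq (\<lambda>h. \<Psi> n t \<omega> h - \<Phi> t \<omega> h) = opsq (\<lambda>h. \<Phi> t \<omega> h - \<Phi> t \<omega> (\<Sum>e\<in>E n. (h \<bullet> e) *\<^sub>R e))" for n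
          unfolding \<Psi>_def opsq_minus_commute[of "\<Phi> t \<omega> \<circ> P n"] by (simp add: P_def)
        then show ?thesis using E(3)[OF bl[OF True \<omega>]] True by simp
      qed simp
    qed
  qed
  moreover define \<delta> where "\<delta> = \<epsilon> / (4 * 2 powr p)"
  moreover have \<delta>: "0 < \<delta>" using e unfolding \<delta>_def by simp
  ultimately have "eventually (\<lambda>n. Lp_L2 M p (opsq0 (\<lambda>t \<omega> h. \<Psi> n t \<omega> h - \<Phi> t \<omega> h)) < ennreal \<delta>) sequentially"
    by (intro order_tendstoD(2)) auto
  then obtain n where n: "Lp_L2 M p (opsq0 (\<lambda>t \<omega> h. \<Psi> n t \<omega> h - \<Phi> t \<omega> h)) < ennreal \<delta>"
    by (meson eventually_sequentially order_refl)
  define I where "I = E n \<times> (Basis :: 'x set)"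
  have I: "finite I" unfolding I_def using E(1) by simp
  have eI: "norm (fst i) = 1" "snd i \<in> Basis" if "i \<in> I" for i
    using that E(2)[of n] unfolding I_def orthonormal_set_def by auto
  obtain K where K: "0 \<le> K" "\<And>f :: 'h \<times> 'x \<Rightarrow> 'w \<Rightarrow> real \<Rightarrow> ennreal. (\<And>i. i \<in> I \<Longrightarrow> case_prod (f i) \<in> borel_measurable (M \<Otimes>\<^sub>M lborel)) \<Longrightarrow>
     Lp_L2 M p (\<lambda>\<omega> t. \<Sum>i\<in>I. f i \<omega> t) \<le> ennreal K * (\<Sum>i\<in>I. Lp_L2 M p (f i))"
    using Lp_L2_sum_le[OF I p] by blast
  define \<phi> where "\<phi> i t \<omega> = \<Phi> t \<omega> (fst i) \<bullet> snd i" for i t \<omega>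
  \<comment> \<open>The accuracy per entry is such that \<open>K\<close> times the number of entries
    times \<open>\<eta>\<close> stays within \<open>\<delta>\<close>; the added ones keep the
    denominator positive.\<close>
  define \<eta> where "\<eta> = \<delta> / ((K + 1) * (real (card I) + 1))"
  have \<eta>: "0 < \<eta>" using \<delta> K(1) unfolding \<eta>_def by simp
  have "\<exists>l. svalid F l \<and> Lp_L2 M p (\<lambda>\<omega> t. ennreal ((indicator {0..} t * \<phi> i t \<omega> - slist l t \<omega>)\<^sup>2)) < ennreal \<eta>"
    if i: "i \<in> I" for i
  proof -
    obtain l where "svalid F l" "Lp_L2 M p (\<lambda>\<omega> t. ennreal ((indicator {0..} t * \<phi> i t \<omega> - slist l t \<omega>)\<^sup>2)) < ennreal \<eta>"
    proof (rule progressive_approximation[OF M F p _ _ \<eta>, of "\<phi> i"])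
      show "(\<lambda>(s, \<omega>). \<phi> i s \<omega>) \<in> borel_measurable (restrict_space borel {0..r} \<Otimes>\<^sub>M F r)" if "0 \<le> r" for r
      proof -
        have "(\<lambda>(s, \<omega>). \<Phi> s \<omega> (fst i)) \<in> borel_measurable (restrict_space borel {0..r} \<Otimes>\<^sub>M F r)"
          using \<Phi> that unfolding progressive_op_def by blast
        then show ?thesis unfolding \<phi>_def by (simp add: split_beta')
      qed
      have "Lp_L2 M p (\<lambda>\<omega> t. ennreal ((indicator {0..} t * \<phi> i t \<omega>)\<^sup>2)) \<le> Lp_L2 M p (opsq0 \<Phi>)"
      proof (rule Lp_L2_mono[OF _ p])
        fix \<omega> t
        have "\<bar>\<phi> i t \<omega>\<bar> \<le> norm (\<Phi> t \<omega> (fst i))" unfolding \<phi>_def by (rule Basis_le_norm[OF eI(2)[OF i]])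
        then have "(\<phi> i t \<omega>)\<^sup>2 \<le> (norm (\<Phi> t \<omega> (fst i)) / norm (fst i))\<^sup>2"
          using power_mono[of "\<bar>\<phi> i t \<omega>\<bar>" "norm (\<Phi> t \<omega> (fst i))" 2] eI(1)[OF i] by simp
        then have "ennreal ((\<phi> i t \<omega>)\<^sup>2) \<le> ennreal ((norm (\<Phi> t \<omega> (fst i)) / norm (fst i))\<^sup>2)" by (rule ennreal_leI)
        also have "\<dots> \<le> opsq (\<Phi> t \<omega>)" unfolding opsq_def by (rule SUP_upper) simp
        finally show "ennreal ((indicator {0..} t * \<phi> i t \<omega>)\<^sup>2) \<le> opsq0 \<Phi> \<omega> t" by (auto simp: indicator_def)
      qed
      then show "Lp_L2 M p (\<lambda>\<omega> t. ennreal ((indicator {0..} t * \<phi> i t \<omega>)\<^sup>2)) < \<infinity>"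
        using finO by (rule order_le_less_trans)
    qed
    then show ?thesis by blast
  qed
  then have "\<exists>l. \<forall>i\<in>I. svalid F (l i) \<and> Lp_L2 M p (\<lambda>\<omega> t. ennreal ((indicator {0..} t * \<phi> i t \<omega> - slist (l i) t \<omega>)\<^sup>2)) < ennreal \<eta>"
    by (intro bchoice ballI)
  then obtain l where l: "\<And>i. i \<in> I \<Longrightarrow> svalid F (l i)"
    "\<And>i. i \<in> I \<Longrightarrow> Lp_L2 M p (\<lambda>\<omega> t. ennreal ((indicator {0..} t * \<phi> i t \<omega> - slist (l i) t \<omega>)\<^sup>2)) < ennreal \<eta>"
    by blast
  obtain xs where xs: "set xs = I" "distinct xs" using finite_distinct_list[OF I] by blast
  \<comment> \<open>A scalar term of the list for entry \<open>i\<close> becomes an operator term by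
    attaching the vector \<open>fst i\<close> and the target direction \<open>snd i\<close>.\<close>
  define L where "L = concat (map (\<lambda>i. map (\<lambda>(s, u, B, c). (s, u, B, fst i, c *\<^sub>R snd i)) (l i)) xs)"
  have Lv: "lvalid F L"
    unfolding lvalid_def
  proof
    fix a assume "a \<in> set L"
    then obtain i s u B c where i: "i \<in> I" "(s, u, B, c) \<in> set (l i)" "a = (s, u, B, fst i, c *\<^sub>R snd i)"
      unfolding L_def using xs(1) by auto
    then show "case a of (s, u, B, h, x) \<Rightarrow> 0 \<le> s \<and> s \<le> u \<and> B \<in> sets (F s)"
      using l(1)[OF i(1)] unfolding svalid_def by auto
  qed
  have single: "lproc (map (\<lambda>(s, u, B, c). (s, u, B, v, c *\<^sub>R b)) k) t \<omega> h = (slist k t \<omega> * (h \<bullet> v)) *\<^sub>R b" for v b k t \<omega> h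
  proof (induction k)
    case (Cons q k)
    obtain s u B c where q: "q = (s, u, B, c)" by (cases q)
    have "lproc (map (\<lambda>(s, u, B, c). (s, u, B, v, c *\<^sub>R b)) (q # k)) t \<omega> h
       = (indicator {s<..u} t * indicator B \<omega> * (h \<bullet> v) * c) *\<^sub>R b + (slist k t \<omega> * (h \<bullet> v)) *\<^sub>R b"
      using Cons.IH by (simp add: lproc_def q)
    also have "\<dots> = (slist (q # k) t \<omega> * (h \<bullet> v)) *\<^sub>R b"
      unfolding scaleR_add_left[symmetric] by (simp add: slist_def q algebra_simps)
    finally show ?case .
  qed (simp add: slist_def)
  have Lproc: "lproc L t \<omega> h = (\<Sum>v\<in>E n. (h \<bullet> v) *\<^sub>R (\<Sum>b\<in>Basis. slist (l (v, b)) t \<omega> *\<^sub>R b))" for t \<omega> h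
  proof -
    have "lproc L t \<omega> h = (\<Sum>i\<leftarrow>xs. (slist (l i) t \<omega> * (h \<bullet> fst i)) *\<^sub>R snd i)"
      unfolding L_def lproc_concat by (simp add: comp_def single)
    also have "\<dots> = (\<Sum>i\<in>I. (slist (l i) t \<omega> * (h \<bullet> fst i)) *\<^sub>R snd i)"
      using xs by (simp add: sum_list_distinct_conv_sum_set)
    also have "\<dots> = (\<Sum>v\<in>E n. \<Sum>b\<in>Basis. (slist (l (v, b)) t \<omega> * (h \<bullet> v)) *\<^sub>R b)"
      unfolding I_def by (subst sum.cartesian_product) (simp add: split_beta')
    finally show ?thesis by (simp add: scaleR_sum_right mult.commute)
  qed
  have jmL: "jm_op M (lproc L)" by (rule jm_op_lproc[OF F Lv])
  have "Lp_L2 M p (opsq0 (\<lambda>t \<omega> h. \<Psi> n t \<omega> h - lproc L t \<omega> h))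
     \<le> Lp_L2 M p (\<lambda>\<omega> t. \<Sum>i\<in>I. ennreal ((indicator {0..} t * \<phi> i t \<omega> - slist (l i) t \<omega>)\<^sup>2))"
  proof (rule Lp_L2_mono[OF _ p])
    fix \<omega> t assume \<omega>: "\<omega> \<in> space M"
    show "opsq0 (\<lambda>t \<omega> h. \<Psi> n t \<omega> h - lproc L t \<omega> h) \<omega> t \<le> (\<Sum>i\<in>I. ennreal ((indicator {0..} t * \<phi> i t \<omega> - slist (l i) t \<omega>)\<^sup>2))"
    proof (cases "0 \<le> t")
      case True
      let ?z = "\<lambda>v. \<Phi> t \<omega> v - (\<Sum>b\<in>Basis. slist (l (v, b)) t \<omega> *\<^sub>R b)"
      have "(\<lambda>h. \<Psi> n t \<omega> h - lproc L t \<omega> h) = (\<lambda>h. \<Sum>v\<in>E n. (h \<bullet> v) *\<^sub>R ?z v)"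
        unfolding \<Psi>_def P_def Lproc
        by (simp add: linear_sum[OF lin[OF True \<omega>]] linear_scale[OF lin[OF True \<omega>]] scaleR_diff_right sum_subtractf)
      then have "opsq (\<lambda>h. \<Psi> n t \<omega> h - lproc L t \<omega> h) \<le> ennreal (\<Sum>v\<in>E n. (norm (?z v))\<^sup>2)"
        using opsq_finite_rank_le[OF E(1)[of n] E(2)[of n], of ?z] by simp
      also have "(\<Sum>v\<in>E n. (norm (?z v))\<^sup>2) = (\<Sum>v\<in>E n. \<Sum>b\<in>Basis. (\<phi> (v, b) t \<omega> - slist (l (v, b)) t \<omega>)\<^sup>2)"
      proof (rule sum.cong[OF refl])
        fix v
        have "(norm (?z v))\<^sup>2 = (\<Sum>b\<in>Basis. (?z v \<bullet> b)\<^sup>2)"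
          unfolding power2_norm_eq_inner by (subst euclidean_inner) (simp add: power2_eq_square)
        then show "(norm (?z v))\<^sup>2 = (\<Sum>b\<in>Basis. (\<phi> (v, b) t \<omega> - slist (l (v, b)) t \<omega>)\<^sup>2)"
          by (simp add: inner_diff_left \<phi>_def)
      qed
      also have "\<dots> = (\<Sum>i\<in>I. (\<phi> i t \<omega> - slist (l i) t \<omega>)\<^sup>2)"
        unfolding I_def by (subst sum.cartesian_product) (simp add: split_beta')
      also have "ennreal \<dots> = (\<Sum>i\<in>I. ennreal ((\<phi> i t \<omega> - slist (l i) t \<omega>)\<^sup>2))" by (rule sum_ennreal[symmetric]) simp
      finally show ?thesis using True by simp
    qed simp
  qed
  also have "\<dots> \<le> ennreal K * (\<Sum>i\<in>I. Lp_L2 M p (\<lambda>\<omega> t. ennreal ((indicator {0..} t * \<phi> i t \<omega> - slist (l i) t \<omega>)\<^sup>2)))"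
  proof (rule K(2))
    fix i assume i: "i \<in> I"
    have [measurable]: "(\<lambda>(\<omega>, t). slist (l i) t \<omega>) \<in> borel_measurable (M \<Otimes>\<^sub>M lborel)" by (rule slist_measurable[OF F l(1)[OF i]])
    have [measurable]: "(\<lambda>(\<omega>, t). indicator {0..} t *\<^sub>R \<Phi> t \<omega> (fst i)) \<in> borel_measurable (M \<Otimes>\<^sub>M lborel)"
      using jm unfolding jm_op_def by blast
    have "case_prod (\<lambda>\<omega> t. ennreal ((indicator {0..} t * \<phi> i t \<omega> - slist (l i) t \<omega>)\<^sup>2))
       = (\<lambda>(\<omega>, t). ennreal (((indicator {0..} t *\<^sub>R \<Phi> t \<omega> (fst i)) \<bullet> snd i - slist (l i) t \<omega>)\<^sup>2))"
      by (simp add: \<phi>_def fun_eq_iff)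
    then show "case_prod (\<lambda>\<omega> t. ennreal ((indicator {0..} t * \<phi> i t \<omega> - slist (l i) t \<omega>)\<^sup>2)) \<in> borel_measurable (M \<Otimes>\<^sub>M lborel)"
      by (rule ssubst) measurable
  qed
  also have "\<dots> \<le> ennreal K * (\<Sum>i\<in>I. ennreal \<eta>)" by (rule mult_left_mono[OF sum_mono[OF less_imp_le[OF l(2)]]]) auto
  also have "\<dots> = ennreal (K * (real (card I) * \<eta>))"
    using \<eta> K(1) by (simp add: ennreal_mult ennreal_of_nat_eq_real_of_nat)
  also have "\<dots> \<le> ennreal \<delta>"
  proof (rule ennreal_leI)
    have "K * real (card I) \<le> (K + 1) * (real (card I) + 1)" using K(1) by (simp add: algebra_simps)
    then have "K * real (card I) * \<delta> \<le> (K + 1) * (real (card I) + 1) * \<delta>" using \<delta> by (intro mult_right_mono) auto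
    then show "K * (real (card I) * \<eta>) \<le> \<delta>" unfolding \<eta>_def using K(1) by (simp add: divide_le_eq mult_ac)
  qed
  finally have 2: "Lp_L2 M p (opsq0 (\<lambda>t \<omega> h. \<Psi> n t \<omega> h - lproc L t \<omega> h)) \<le> ennreal \<delta>" .
  have "Lp_L2 M p (opsq0 (\<lambda>t \<omega> h. \<Phi> t \<omega> h - lproc L t \<omega> h)) \<le> ennreal (2 powr p) * (Lp_L2 M p (opsq0 (\<lambda>t \<omega> h. \<Psi> n t \<omega> h - \<Phi> t \<omega> h)) + Lp_L2 M p (opsq0 (\<lambda>t \<omega> h. \<Psi> n t \<omega> h - lproc L t \<omega> h)))"
    by (rule Lp_L2_opsq_triangle[OF sep jm\<Psi> jm jmL p])
  also have "\<dots> \<le> ennreal (2 powr p) * (ennreal \<delta> + ennreal \<delta>)" using n 2 by (intro mult_left_mono add_mono) auto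
  also have "ennreal \<delta> + ennreal \<delta> = ennreal (\<delta> + \<delta>)" using \<delta> by (intro ennreal_plus[symmetric]) auto
  also have "ennreal (2 powr p) * ennreal (\<delta> + \<delta>) = ennreal (2 powr p * (\<delta> + \<delta>))"
    using \<delta> by (intro ennreal_mult[symmetric]) auto
  also have "\<dots> < ennreal \<epsilon>" using e unfolding \<delta>_def by (intro ennreal_lessI) (auto simp: field_simps)
  finally show thesis using that[OF Lv] by simp
qed

section \<open>The stochastic integral as a limit\<close>

abbreviation op_dist :: "'w measure \<Rightarrow> real \<Rightarrow> (real \<Rightarrow> 'w \<Rightarrow> 'h::real_normed_vector \<Rightarrow> 'x::euclidean_space)
    \<Rightarrow> (real \<Rightarrow> 'w \<Rightarrow> 'h \<Rightarrow> 'x) \<Rightarrow> ennreal" where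
  "op_dist M p \<Phi> \<Psi> \<equiv> Lp_L2 M p (opsq0 (\<lambda>t \<omega> h. \<Phi> t \<omega> h - \<Psi> t \<omega> h))"

definition lp_dist :: "'w measure \<Rightarrow> real \<Rightarrow> ('w \<Rightarrow> 'x::euclidean_space) \<Rightarrow> ('w \<Rightarrow> 'x) \<Rightarrow> ennreal" where
  "lp_dist M p f g = (\<integral>\<^sup>+ \<omega>. ennreal (norm (f \<omega> - g \<omega>) powr p) \<partial>M)"

lemma lp_dist_triangle:
  assumes p: "0 < p" and [measurable]: "f \<in> borel_measurable M" "g \<in> borel_measurable M" "h \<in> borel_measurable M"
  shows "lp_dist M p f h \<le> ennreal (2 powr p) * (lp_dist M p f g + lp_dist M p g h)"
proof -
  have "lp_dist M p f h \<le> (\<integral>\<^sup>+ \<omega>. ennreal (2 powr p) * (ennreal (norm (f \<omega> - g \<omega>) powr p) + ennreal (norm (g \<omega> - h \<omega>) powr p)) \<partial>M)"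
    unfolding lp_dist_def
  proof (rule nn_integral_mono)
    fix \<omega>
    have "norm (f \<omega> - h \<omega>) \<le> norm (f \<omega> - g \<omega>) + norm (g \<omega> - h \<omega>)" using norm_triangle_ineq[of "f \<omega> - g \<omega>" "g \<omega> - h \<omega>"] by simp
    then have "norm (f \<omega> - h \<omega>) powr p \<le> (norm (f \<omega> - g \<omega>) + norm (g \<omega> - h \<omega>)) powr p"
      using p by (intro powr_mono2) auto
    also have "\<dots> \<le> 2 powr p * (norm (f \<omega> - g \<omega>) powr p + norm (g \<omega> - h \<omega>) powr p)" using p by (intro powr_add_le_two_powr) auto
    finally show "ennreal (norm (f \<omega> - h \<omega>) powr p) \<le> ennreal (2 powr p) * (ennreal (norm (f \<omega> - g \<omega>) powr p) + ennreal (norm (g \<omega> - h \<omega>) powr p))"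
      by (simp flip: ennreal_plus ennreal_mult)
  qed
  also have "\<dots> = ennreal (2 powr p) * (lp_dist M p f g + lp_dist M p g h)"
    unfolding lp_dist_def by (subst nn_integral_cmult, measurable, subst nn_integral_add, measurable)
  finally show ?thesis .
qed

lemma convergent_of_summable_increments:
  fixes f :: "nat \<Rightarrow> 'x::banach"
  assumes "summable (\<lambda>n. norm (f (Suc n) - f n))"
  shows "convergent f"
proof -
  have "summable (\<lambda>n. f (Suc n) - f n)" using assms by (rule summable_norm_cancel)
  then have "(\<lambda>n. \<Sum>k<n. f (Suc k) - f k) \<longlonglongrightarrow> (\<Sum>n. f (Suc n) - f n)" by (rule summable_LIMSEQ)
  then have "(\<lambda>n. (f n - f 0) + f 0) \<longlonglongrightarrow> (\<Sum>n. f (Suc n) - f n) + f 0"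
    unfolding sum_lessThan_telescope by (intro tendsto_add tendsto_const)
  then show ?thesis by (auto intro: convergentI)
qed

text \<open>A Riesz-Fischer argument that also works for \<open>p < 1\<close>, as only p-th powers
  are summed. With weights \<open>2 ^ j\<close> the expected sum is still finite, which makes the
  increments geometrically small almost everywhere; Fatou's lemma then passes the bound to the
  limit.\<close>

lemma lp_dist_complete:
  fixes f :: "nat \<Rightarrow> 'w \<Rightarrow> 'x::euclidean_space"
  assumes p: "0 < p" and f [measurable]: "\<And>j. f j \<in> borel_measurable M" and C: "0 \<le> C"
    and b: "\<And>j k. j \<le> k \<Longrightarrow> lp_dist M p (f k) (f j) \<le> ennreal (C * (1/4) ^ j)"
  obtains \<xi> where "\<xi> \<in> borel_measurable M" "\<And>j. lp_dist M p \<xi> (f j) \<le> ennreal (C * (1/4) ^ j)"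
proof -
  let ?u = "\<lambda>j \<omega>. norm (f (Suc j) \<omega> - f j \<omega>)"
  have "(\<integral>\<^sup>+ \<omega>. (\<Sum>j. ennreal (2 ^ j * ?u j \<omega> powr p)) \<partial>M) = (\<Sum>j. (\<integral>\<^sup>+ \<omega>. ennreal (2 ^ j * ?u j \<omega> powr p) \<partial>M))"
    by (rule nn_integral_suminf) measurable
  also have "\<dots> \<le> (\<Sum>j. ennreal (C * (1/2) ^ j))"
  proof (rule suminf_le)
    fix j :: nat
    have "(\<integral>\<^sup>+ \<omega>. ennreal (2 ^ j * ?u j \<omega> powr p) \<partial>M) = ennreal (2 ^ j) * lp_dist M p (f (Suc j)) (f j)"
      unfolding lp_dist_def by (subst nn_integral_cmult[symmetric]) (auto simp: ennreal_mult)
    also have "\<dots> \<le> ennreal (2 ^ j) * ennreal (C * (1/4) ^ j)" using b[of j "Suc j"] by (intro mult_left_mono) auto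
    also have "\<dots> = ennreal (2 ^ j * (C * (1/4) ^ j))" using C by (intro ennreal_mult[symmetric]) auto
    also have "2 ^ j * (C * (1/4) ^ j) = C * (1/2) ^ j"
      by (simp add: mult.left_commute[of _ C] flip: power_mult_distrib)
    finally show "(\<integral>\<^sup>+ \<omega>. ennreal (2 ^ j * ?u j \<omega> powr p) \<partial>M) \<le> ennreal (C * (1/2) ^ j)" .
  qed auto
  also have "\<dots> = ennreal (\<Sum>j. C * (1/2) ^ j)"
    using C by (intro suminf_ennreal2 summable_mult summable_geometric) auto
  finally have "(\<integral>\<^sup>+ \<omega>. (\<Sum>j. ennreal (2 ^ j * ?u j \<omega> powr p)) \<partial>M) \<noteq> \<infinity>" by (auto simp: top_unique)
  then have "AE \<omega> in M. (\<Sum>j. ennreal (2 ^ j * ?u j \<omega> powr p)) \<noteq> \<infinity>"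
    by (intro nn_integral_noteq_infinite) auto
  then have conv: "AE \<omega> in M. convergent (\<lambda>j. f j \<omega>)"
  proof eventually_elim
    case (elim \<omega>)
    have s: "summable (\<lambda>j. 2 ^ j * ?u j \<omega> powr p)" using elim by (intro summable_suminf_not_top) auto
    define K where "K = (\<Sum>j. 2 ^ j * ?u j \<omega> powr p)"
    have K: "0 \<le> K" unfolding K_def by (intro suminf_nonneg s) auto
    \<comment> \<open>Each weighted term is at most the whole sum \<open>K\<close>; taking p-th
      roots gives geometric decay with ratio \<open>(1/2) powr (1 / p)\<close>.\<close>
    have le: "?u j \<omega> \<le> K powr (1 / p) * ((1/2) powr (1 / p)) ^ j" for j
    proof -
      have "2 ^ j * ?u j \<omega> powr p \<le> K" unfolding K_def using sum_le_suminf[OF s, of "{j}"] by simp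
      then have "?u j \<omega> powr p \<le> K * (1/2) ^ j" by (simp add: field_simps power_one_over)
      then have "(?u j \<omega> powr p) powr (1 / p) \<le> (K * (1/2) ^ j) powr (1 / p)" using p by (intro powr_mono2) auto
      also have "\<dots> = K powr (1 / p) * ((1/2) powr (1 / p)) ^ j"
        using K by (simp add: powr_mult powr_powr powr_realpow[symmetric] mult.commute)
      finally show ?thesis using p by (simp add: powr_powr)
    qed
    show ?case
    proof (rule convergent_of_summable_increments, rule summable_comparison_test)
      show "\<exists>n0. \<forall>n\<ge>n0. norm (?u n \<omega>) \<le> K powr (1 / p) * ((1/2) powr (1 / p)) ^ n" using le by auto
      have "(1/2) powr (1 / p) < (1::real)" using p powr_less_mono2[of "1/p" "1/2::real" 1] by simp
      then show "summable (\<lambda>n. K powr (1 / p) * ((1/2) powr (1 / p)) ^ n)"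
        by (intro summable_mult summable_geometric) simp
    qed
  qed
  define \<xi> where "\<xi> \<omega> = lim (\<lambda>j. f j \<omega>)" for \<omega>
  have \<xi> [measurable]: "\<xi> \<in> borel_measurable M" unfolding \<xi>_def by measurable
  show thesis
  proof (rule that[OF \<xi>])
    fix j
    have "lp_dist M p \<xi> (f j) = (\<integral>\<^sup>+ \<omega>. liminf (\<lambda>k. ennreal (norm (f k \<omega> - f j \<omega>) powr p)) \<partial>M)"
      unfolding lp_dist_def
    proof (rule nn_integral_cong_AE, use conv in eventually_elim)
      case (elim \<omega>)
      then have "(\<lambda>k. f k \<omega>) \<longlonglongrightarrow> \<xi> \<omega>" unfolding \<xi>_def by (simp add: convergent_LIMSEQ_iff)
      then have "(\<lambda>k. ennreal (norm (f k \<omega> - f j \<omega>) powr p)) \<longlonglongrightarrow> ennreal (norm (\<xi> \<omega> - f j \<omega>) powr p)"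
        using p by (intro tendsto_ennrealI tendsto_powr2 tendsto_norm tendsto_diff tendsto_const) auto
      then show ?case using lim_imp_Liminf[OF sequentially_bot] by metis
    qed
    also have "\<dots> \<le> liminf (\<lambda>k. lp_dist M p (f k) (f j))"
      unfolding lp_dist_def by (rule nn_integral_liminf) measurable
    also have "\<dots> \<le> ennreal (C * (1/4) ^ j)"
      using b by (intro Liminf_le) (auto simp: eventually_sequentially intro!: exI[of _ j])
    finally show "lp_dist M p \<xi> (f j) \<le> ennreal (C * (1/4) ^ j)" .
  qed
qed

text \<open>The difference of two simple integrals is the integral of one concatenated list, and its
  integrand is compared through \<open>\<Phi>\<close>. This yields the Cauchy property of
  approximating sequences and the agreement of their limits.\<close>

lemma lint_diff_bound:
  fixes W :: "real \<Rightarrow> 'h::real_inner \<Rightarrow> 'w \<Rightarrow> real"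
  assumes M: "prob_space M" and F: "is_filtr M F" and W: "cyl_bm M F W" and p: "0 < p" and sep: "separable_space TYPE('h)"
  obtains C where "0 \<le> C" "\<And>(\<Phi> :: real \<Rightarrow> 'w \<Rightarrow> 'h \<Rightarrow> 'x::euclidean_space) L L'. jm_op M \<Phi> \<Longrightarrow> lvalid F L \<Longrightarrow> lvalid F L' \<Longrightarrow>
     lp_dist M p (lint W L) (lint W L') \<le> ennreal C * (op_dist M p \<Phi> (lproc L) + op_dist M p \<Phi> (lproc L'))"
proof -
  obtain C where C: "0 \<le> C" "\<And>L :: (real \<times> real \<times> 'w set \<times> 'h \<times> 'x) list. lvalid F L \<Longrightarrow>
     integrable M (\<lambda>\<omega>. norm (lint W L \<omega>) powr p) \<and>
     (\<integral>\<^sup>+ \<omega>. ennreal (norm (lint W L \<omega>) powr p) \<partial>M) \<le> ennreal C * hs_Lp_pow M p (lproc L)"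
    using lint_bound[OF M F W p] by blast
  define D where "D = C * (real DIM('x) powr (p / 2) * 2 powr p)"
  show thesis
  proof (rule that[of D])
    show "0 \<le> D" using C(1) unfolding D_def by simp
    fix \<Phi> :: "real \<Rightarrow> 'w \<Rightarrow> 'h \<Rightarrow> 'x" and L L' :: "(real \<times> real \<times> 'w set \<times> 'h \<times> 'x) list"
    assume \<Phi>: "jm_op M \<Phi>" and L: "lvalid F L" and L': "lvalid F L'"
    have LL: "lvalid F (L @ lneg L')" using L L' by (simp add: lvalid_append lvalid_lneg)
    have jm: "jm_op M (lproc L)" "jm_op M (lproc L')" by (rule jm_op_lproc[OF F L], rule jm_op_lproc[OF F L'])
    have eq: "lproc (L @ lneg L') = (\<lambda>t \<omega> h. lproc L t \<omega> h - lproc L' t \<omega> h)"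
      by (simp add: lproc_append lproc_lneg fun_eq_iff)
    have "lp_dist M p (lint W L) (lint W L') \<le> ennreal C * hs_Lp_pow M p (lproc (L @ lneg L'))"
      using C(2)[OF LL] unfolding lp_dist_def by (simp add: lint_append lint_lneg)
    also have "\<dots> \<le> ennreal C * (ennreal (real DIM('x) powr (p / 2)) * op_dist M p (lproc L) (lproc L'))"
      unfolding eq by (intro mult_left_mono hs_Lp_pow_le_Lp_L2 jm_op_diff jm sep p) simp
    also have "\<dots> \<le> ennreal C * (ennreal (real DIM('x) powr (p / 2)) * (ennreal (2 powr p) * (op_dist M p \<Phi> (lproc L) + op_dist M p \<Phi> (lproc L'))))"
      by (intro mult_left_mono Lp_L2_opsq_triangle sep \<Phi> jm p) simp_all
    also have "\<dots> = ennreal D * (op_dist M p \<Phi> (lproc L) + op_dist M p \<Phi> (lproc L'))"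
      unfolding D_def using C(1) by (simp add: ennreal_mult mult.assoc)
    finally show "lp_dist M p (lint W L) (lint W L') \<le> ennreal D * (op_dist M p \<Phi> (lproc L) + op_dist M p \<Phi> (lproc L'))" .
  qed
qed

text \<open>Both conversions of elementary integrands and both halves of the equivalence between the
  Hilbert-Schmidt and the operator norm are spent here; afterwards neither elementary format nor
  \<open>hs_sq\<close> has to be handled.\<close>

lemma is_stoch_int_lists:
  fixes W :: "real \<Rightarrow> 'h::real_inner \<Rightarrow> 'w \<Rightarrow> real" and \<Phi> :: "real \<Rightarrow> 'w \<Rightarrow> 'h \<Rightarrow> 'x::euclidean_space"
  assumes F: "is_filtr M F" and W: "cyl_bm M F W" and p: "0 < p" and sep: "separable_space TYPE('h)" and \<Phi>: "jm_op M \<Phi>"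
  shows "is_stoch_int M F W p \<Phi> \<xi> \<longleftrightarrow> \<xi> \<in> borel_measurable M \<and>
    (\<exists>L. (\<forall>j. lvalid F (L j)) \<and> (\<lambda>j. op_dist M p \<Phi> (lproc (L j))) \<longlonglongrightarrow> 0 \<and> (\<lambda>j. lp_dist M p \<xi> (lint W (L j))) \<longlonglongrightarrow> 0)"
    (is "_ \<longleftrightarrow> _ \<and> ?R")
proof (intro iffI conjI)
  assume "is_stoch_int M F W p \<Phi> \<xi>"
  then obtain K ts Mm B Nn hs x where \<xi>: "\<xi> \<in> borel_measurable M" and e: "\<And>j. elem_valid F (K j) (ts j) (Mm j) (B j) (Nn j) (hs j)"
    "(\<lambda>j. hs_Lp_pow M p (\<lambda>t \<omega> g. \<Phi> t \<omega> g - elem_proc (K j) (ts j) (Mm j) (B j) (Nn j) (hs j) (x j) t \<omega> g)) \<longlonglongrightarrow> 0"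
    "(\<lambda>j. \<integral>\<^sup>+ \<omega>. ennreal (norm (\<xi> \<omega> - elem_int W (K j) (ts j) (Mm j) (B j) (Nn j) (hs j) (x j) \<omega>) powr p) \<partial>M) \<longlonglongrightarrow> 0"
    unfolding is_stoch_int_def by blast
  have "\<exists>L. lvalid F L \<and> lproc L = elem_proc (K j) (ts j) (Mm j) (B j) (Nn j) (hs j) (x j)
     \<and> lint W L = elem_int W (K j) (ts j) (Mm j) (B j) (Nn j) (hs j) (x j)" for j
    by (rule elem_to_list[OF e(1)[of j], of "x j" W]) (auto simp: fun_eq_iff)
  then obtain L where L: "\<And>j. lvalid F (L j)" "\<And>j. lproc (L j) = elem_proc (K j) (ts j) (Mm j) (B j) (Nn j) (hs j) (x j)"
    "\<And>j. lint W (L j) = elem_int W (K j) (ts j) (Mm j) (B j) (Nn j) (hs j) (x j)" by metis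
  have "(\<lambda>j. op_dist M p \<Phi> (lproc (L j))) \<longlonglongrightarrow> 0"
  proof (rule tendsto_sandwich[OF _ _ tendsto_const e(2)])
    show "eventually (\<lambda>j. op_dist M p \<Phi> (lproc (L j)) \<le> hs_Lp_pow M p (\<lambda>t \<omega> g. \<Phi> t \<omega> g - elem_proc (K j) (ts j) (Mm j) (B j) (Nn j) (hs j) (x j) t \<omega> g)) sequentially"
    proof (rule always_eventually, rule allI)
      fix j
      have "jm_op M (\<lambda>t \<omega> h. \<Phi> t \<omega> h - lproc (L j) t \<omega> h)" by (intro jm_op_diff \<Phi> jm_op_lproc[OF F L(1)])
      then have "op_dist M p \<Phi> (lproc (L j)) \<le> hs_Lp_pow M p (\<lambda>t \<omega> g. \<Phi> t \<omega> g - lproc (L j) t \<omega> g)"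
        by (intro Lp_L2_le_hs_Lp_pow p) (auto simp: jm_op_def intro: bounded_linear.linear)
      then show "op_dist M p \<Phi> (lproc (L j)) \<le> hs_Lp_pow M p (\<lambda>t \<omega> g. \<Phi> t \<omega> g - elem_proc (K j) (ts j) (Mm j) (B j) (Nn j) (hs j) (x j) t \<omega> g)"
        by (simp only: L(2))
    qed
  qed simp
  moreover have "(\<lambda>j. lp_dist M p \<xi> (lint W (L j))) \<longlonglongrightarrow> 0" using e(3) unfolding lp_dist_def L(3) .
  ultimately show ?R using L(1) by blast
  show "\<xi> \<in> borel_measurable M" by (rule \<xi>)
next
  assume R: "\<xi> \<in> borel_measurable M \<and> ?R"
  then have \<xi> [measurable]: "\<xi> \<in> borel_measurable M" by blast
  from R obtain L where L: "\<And>j. lvalid F (L j)" "(\<lambda>j. op_dist M p \<Phi> (lproc (L j))) \<longlonglongrightarrow> 0" "(\<lambda>j. lp_dist M p \<xi> (lint W (L j))) \<longlonglongrightarrow> 0" by blast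
  have "\<forall>j. \<exists>K ts Mm B Nn hs x. elem_valid F K ts Mm B Nn hs \<and> elem_proc K ts Mm B Nn hs x = lproc (L j) \<and>
    (AE \<omega> in M. elem_int W K ts Mm B Nn hs x \<omega> = lint W (L j) \<omega>)"
  proof
    fix j
    obtain K ts Mm B Nn hs x where "elem_valid F K ts Mm B Nn hs"
      and e: "\<And>t \<omega> g. elem_proc K ts Mm B Nn hs x t \<omega> g = lproc (L j) t \<omega> g"
      and "AE \<omega> in M. elem_int W K ts Mm B Nn hs x \<omega> = lint W (L j) \<omega>"
      using list_to_elem[OF F W L(1)[of j]] by blast
    moreover have "elem_proc K ts Mm B Nn hs x = lproc (L j)" using e by (intro ext)
    ultimately show "\<exists>K ts Mm B Nn hs x. elem_valid F K ts Mm B Nn hs \<and> elem_proc K ts Mm B Nn hs x = lproc (L j) \<and>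
      (AE \<omega> in M. elem_int W K ts Mm B Nn hs x \<omega> = lint W (L j) \<omega>)" by blast
  qed
  then obtain K ts Mm B Nn hs x where "\<forall>j. elem_valid F (K j) (ts j) (Mm j) (B j) (Nn j) (hs j)
     \<and> elem_proc (K j) (ts j) (Mm j) (B j) (Nn j) (hs j) (x j) = lproc (L j)
     \<and> (AE \<omega> in M. elem_int W (K j) (ts j) (Mm j) (B j) (Nn j) (hs j) (x j) \<omega> = lint W (L j) \<omega>)"
    unfolding choice_iff by blast
  then have e: "\<And>j. elem_valid F (K j) (ts j) (Mm j) (B j) (Nn j) (hs j)"
    "\<And>j. elem_proc (K j) (ts j) (Mm j) (B j) (Nn j) (hs j) (x j) = lproc (L j)"
    "\<And>j. AE \<omega> in M. elem_int W (K j) (ts j) (Mm j) (B j) (Nn j) (hs j) (x j) \<omega> = lint W (L j) \<omega>"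
    by blast+
  have "(\<lambda>j. hs_Lp_pow M p (\<lambda>t \<omega> g. \<Phi> t \<omega> g - lproc (L j) t \<omega> g)) \<longlonglongrightarrow> 0"
  proof (rule tendsto_sandwich[OF _ _ tendsto_const])
    show "eventually (\<lambda>j. hs_Lp_pow M p (\<lambda>t \<omega> g. \<Phi> t \<omega> g - lproc (L j) t \<omega> g)
        \<le> ennreal (real DIM('x) powr (p / 2)) * op_dist M p \<Phi> (lproc (L j))) sequentially"
      by (intro always_eventually allI hs_Lp_pow_le_Lp_L2 sep p jm_op_diff \<Phi> jm_op_lproc[OF F L(1)])
    show "(\<lambda>j. ennreal (real DIM('x) powr (p / 2)) * op_dist M p \<Phi> (lproc (L j))) \<longlonglongrightarrow> 0"
      using ennreal_tendsto_cmult[OF _ L(2), of "ennreal (real DIM('x) powr (p / 2))"] by simp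
  qed simp
  moreover have "(\<integral>\<^sup>+ \<omega>. ennreal (norm (\<xi> \<omega> - elem_int W (K j) (ts j) (Mm j) (B j) (Nn j) (hs j) (x j) \<omega>) powr p) \<partial>M)
     = lp_dist M p \<xi> (lint W (L j))" for j
    unfolding lp_dist_def using e(3)[of j] by (intro nn_integral_cong_AE) auto
  ultimately show "is_stoch_int M F W p \<Phi> \<xi>"
    unfolding is_stoch_int_def using \<xi> e(1) L(3)
    by (intro conjI exI[of _ K] exI[of _ ts] exI[of _ Mm] exI[of _ B] exI[of _ Nn] exI[of _ hs] exI[of _ x]) (simp_all add: e(2))
qed

text \<open>Two things are proved together. A limit exists, so the choice in
  \<open>stoch_int\<close> is meaningful; and the chosen function, which comes with an unknown
  sequence \<open>L'\<close>, is also the limit along the prescribed sequence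
  \<open>L\<close>.\<close>

lemma stoch_int_limit:
  fixes W :: "real \<Rightarrow> 'h::real_inner \<Rightarrow> 'w \<Rightarrow> real" and \<Phi> :: "real \<Rightarrow> 'w \<Rightarrow> 'h \<Rightarrow> 'x::euclidean_space"
  assumes M: "prob_space M" and F: "is_filtr M F" and W: "cyl_bm M F W" and p: "0 < p" and sep: "separable_space TYPE('h)"
    and \<Phi>: "jm_op M \<Phi>" and L: "\<And>j. lvalid F (L j)" and c: "0 \<le> c" "\<And>j. op_dist M p \<Phi> (lproc (L j)) \<le> ennreal (c * (1/4) ^ j)"
  shows "stoch_int M F W p \<Phi> \<in> borel_measurable M" "(\<lambda>j. lp_dist M p (stoch_int M F W p \<Phi>) (lint W (L j))) \<longlonglongrightarrow> 0"
proof -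
  obtain C where C: "0 \<le> C" "\<And>(\<Phi> :: real \<Rightarrow> 'w \<Rightarrow> 'h \<Rightarrow> 'x) L L'. jm_op M \<Phi> \<Longrightarrow> lvalid F L \<Longrightarrow> lvalid F L' \<Longrightarrow>
     lp_dist M p (lint W L) (lint W L') \<le> ennreal C * (op_dist M p \<Phi> (lproc L) + op_dist M p \<Phi> (lproc L'))"
    using lint_diff_bound[OF M F W p sep] by blast
  note meas [measurable] = lint_measurable[OF F W]
  have geo: "(\<lambda>j. ennreal (k * (1/4) ^ j)) \<longlonglongrightarrow> 0" for k :: real
  proof -
    have "(\<lambda>j. k * (1/4) ^ j) \<longlonglongrightarrow> k * 0" by (intro tendsto_mult_left LIMSEQ_power_zero) simp
    from tendsto_ennrealI[OF this] show ?thesis by simp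
  qed
  have J: "(\<lambda>j. op_dist M p \<Phi> (lproc (L j))) \<longlonglongrightarrow> 0"
    using c(2) by (intro tendsto_sandwich[OF _ _ tendsto_const geo[of c]]) auto
  obtain \<xi> where \<xi>: "\<xi> \<in> borel_measurable M" "\<And>j. lp_dist M p \<xi> (lint W (L j)) \<le> ennreal (2 * C * c * (1/4) ^ j)"
  proof (rule lp_dist_complete[OF p meas[OF L], of "2 * C * c"])
    fix j k :: nat assume jk: "j \<le> k"
    have "lp_dist M p (lint W (L k)) (lint W (L j)) \<le> ennreal C * (op_dist M p \<Phi> (lproc (L k)) + op_dist M p \<Phi> (lproc (L j)))"
      by (rule C(2)[OF \<Phi> L L])
    also have "\<dots> \<le> ennreal C * (ennreal (c * (1/4) ^ j) + ennreal (c * (1/4) ^ j))"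
    proof (intro mult_left_mono add_mono c(2))
      have "c * (1/4) ^ k \<le> c * (1/4) ^ j" using c(1) jk by (intro mult_left_mono power_decreasing) auto
      then show "op_dist M p \<Phi> (lproc (L k)) \<le> ennreal (c * (1/4) ^ j)" using c(2)[of k] by (meson ennreal_leI order_trans)
    qed simp
    also have "\<dots> = ennreal (2 * C * c * (1/4) ^ j)"
      using C(1) c(1) by (simp add: mult_ac flip: ennreal_plus ennreal_mult)
    finally show "lp_dist M p (lint W (L k)) (lint W (L j)) \<le> ennreal (2 * C * c * (1/4) ^ j)" .
  qed (use C(1) c(1) in auto)
  have "(\<lambda>j. lp_dist M p \<xi> (lint W (L j))) \<longlonglongrightarrow> 0"
    using \<xi>(2) by (intro tendsto_sandwich[OF _ _ tendsto_const geo[of "2 * C * c"]]) auto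
  then have "is_stoch_int M F W p \<Phi> \<xi>" unfolding is_stoch_int_lists[OF F W p sep \<Phi>] using \<xi>(1) L J by blast
  then have "is_stoch_int M F W p \<Phi> (stoch_int M F W p \<Phi>)" unfolding stoch_int_def by (rule someI[of "is_stoch_int M F W p \<Phi>"])
  then obtain L' where \<eta> [measurable]: "stoch_int M F W p \<Phi> \<in> borel_measurable M" and L': "\<And>j. lvalid F (L' j)"
    "(\<lambda>j. op_dist M p \<Phi> (lproc (L' j))) \<longlonglongrightarrow> 0" "(\<lambda>j. lp_dist M p (stoch_int M F W p \<Phi>) (lint W (L' j))) \<longlonglongrightarrow> 0"
    unfolding is_stoch_int_lists[OF F W p sep \<Phi>] by blast
  \<comment> \<open>The unknown and the prescribed sequence are compared term by term through
    \<open>\<Phi>\<close>, which both approximate.\<close>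
  let ?b = "\<lambda>j. ennreal (2 powr p) * (lp_dist M p (stoch_int M F W p \<Phi>) (lint W (L' j))
      + ennreal C * (op_dist M p \<Phi> (lproc (L' j)) + op_dist M p \<Phi> (lproc (L j))))"
  have "?b \<longlonglongrightarrow> ennreal (2 powr p) * (0 + ennreal C * (0 + 0))"
    by (intro ennreal_tendsto_cmult tendsto_add L'(2,3) J) auto
  then have b: "?b \<longlonglongrightarrow> 0" by simp
  show "(\<lambda>j. lp_dist M p (stoch_int M F W p \<Phi>) (lint W (L j))) \<longlonglongrightarrow> 0"
  proof (rule tendsto_sandwich[OF _ _ tendsto_const b])
    show "eventually (\<lambda>j. lp_dist M p (stoch_int M F W p \<Phi>) (lint W (L j)) \<le> ?b j) sequentially"
    proof (rule always_eventually, rule allI)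
      fix j
      have "lp_dist M p (stoch_int M F W p \<Phi>) (lint W (L j)) \<le> ennreal (2 powr p) *
         (lp_dist M p (stoch_int M F W p \<Phi>) (lint W (L' j)) + lp_dist M p (lint W (L' j)) (lint W (L j)))"
        using meas[OF L] meas[OF L'(1)] by (intro lp_dist_triangle p) auto
      also have "\<dots> \<le> ?b j" by (intro mult_left_mono add_left_mono C(2) \<Phi> L L'(1)) simp
      finally show "lp_dist M p (stoch_int M F W p \<Phi>) (lint W (L j)) \<le> ?b j" .
    qed
  qed simp
  show "stoch_int M F W p \<Phi> \<in> borel_measurable M" by (rule \<eta>)
qed

text \<open>Convexity applied to \<open>\<theta> * (y / \<theta>) + (1 - \<theta>) * (x / (1 -
  \<theta>))\<close>. The factor of the main term tends to 1 with \<open>\<theta>\<close>, unlike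
  the constant \<open>2 powr p\<close> of the plain estimate.\<close>

lemma powr_add_weighted:
  fixes x y p \<theta> :: real
  assumes p: "1 < p" and xy: "0 \<le> x" "0 \<le> y" and \<theta>: "0 < \<theta>" "\<theta> < 1"
  shows "(x + y) powr p \<le> (1 - \<theta>) powr (1 - p) * x powr p + \<theta> powr (1 - p) * y powr p"
proof -
  have "(\<theta> * (y / \<theta>) + (1 - \<theta>) * (x / (1 - \<theta>))) powr p \<le> \<theta> * (y / \<theta>) powr p + (1 - \<theta>) * (x / (1 - \<theta>)) powr p"
    using assms by (intro powr_convex_combination) auto
  moreover have "a * (z / a) powr p = a powr (1 - p) * z powr p" if "0 < a" "0 \<le> z" for a z :: real
    using that by (simp add: powr_divide powr_diff)
  ultimately show ?thesis using assms by (simp add: add.commute)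
qed

lemma nn_integral_norm_fun_le:
  fixes N :: "'x::euclidean_space \<Rightarrow> real"
  assumes N: "is_norm_fun N" and p: "1 < p" and c: "0 < c" "\<And>x. N x \<le> c * norm x" and \<theta>: "0 < \<theta>" "\<theta> < 1"
    and [measurable]: "f \<in> borel_measurable M" "g \<in> borel_measurable M"
  shows "(\<integral>\<^sup>+ \<omega>. ennreal (N (f \<omega>) powr p) \<partial>M)
    \<le> ennreal ((1 - \<theta>) powr (1 - p)) * (\<integral>\<^sup>+ \<omega>. ennreal (N (g \<omega>) powr p) \<partial>M) + ennreal (\<theta> powr (1 - p) * c powr p) * lp_dist M p f g"
proof -
  have [measurable]: "N \<in> borel_measurable borel" by (rule norm_fun_measurable[OF N])
  have "(\<integral>\<^sup>+ \<omega>. ennreal (N (f \<omega>) powr p) \<partial>M)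
    \<le> (\<integral>\<^sup>+ \<omega>. ennreal ((1 - \<theta>) powr (1 - p)) * ennreal (N (g \<omega>) powr p) + ennreal (\<theta> powr (1 - p) * c powr p) * ennreal (norm (f \<omega> - g \<omega>) powr p) \<partial>M)"
  proof (rule nn_integral_mono)
    fix \<omega>
    have "N (f \<omega>) \<le> N (g \<omega>) + c * norm (f \<omega> - g \<omega>)"
      using norm_funD(4)[OF N, of "g \<omega>" "f \<omega> - g \<omega>"] c(2)[of "f \<omega> - g \<omega>"] by simp
    then have "N (f \<omega>) powr p \<le> (N (g \<omega>) + c * norm (f \<omega> - g \<omega>)) powr p"
      using p norm_funD(1)[OF N] by (intro powr_mono2) auto
    also have "\<dots> \<le> (1 - \<theta>) powr (1 - p) * N (g \<omega>) powr p + \<theta> powr (1 - p) * (c * norm (f \<omega> - g \<omega>)) powr p"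
      using norm_funD(1)[OF N] c(1) by (intro powr_add_weighted p \<theta>) auto
    also have "\<dots> = (1 - \<theta>) powr (1 - p) * N (g \<omega>) powr p + (\<theta> powr (1 - p) * c powr p) * norm (f \<omega> - g \<omega>) powr p"
      using c(1) by (simp add: powr_mult)
    finally show "ennreal (N (f \<omega>) powr p) \<le> ennreal ((1 - \<theta>) powr (1 - p)) * ennreal (N (g \<omega>) powr p)
        + ennreal (\<theta> powr (1 - p) * c powr p) * ennreal (norm (f \<omega> - g \<omega>) powr p)"
      by (simp flip: ennreal_plus ennreal_mult)
  qed
  also have "\<dots> = ennreal ((1 - \<theta>) powr (1 - p)) * (\<integral>\<^sup>+ \<omega>. ennreal (N (g \<omega>) powr p) \<partial>M) + ennreal (\<theta> powr (1 - p) * c powr p) * lp_dist M p f g"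
    unfolding lp_dist_def by (simp add: nn_integral_add nn_integral_cmult)
  finally show ?thesis .
qed

lemma lp_dist_minus_commute: "lp_dist M p f g = lp_dist M p g f"
  unfolding lp_dist_def by (simp add: norm_minus_commute)

text \<open>A fixed factor in the triangle inequality would spoil the constant
  \<open>\<kappa>\<close>. With weights, the main term carries a factor close to 1, and the large
  factor falls on errors that vanish: first \<open>j\<close> tends to infinity, then
  \<open>\<theta>\<close> to 0.\<close>

lemma norm_fun_bound_limit:
  fixes N :: "'x::euclidean_space \<Rightarrow> real"
  assumes N: "is_norm_fun N" and p: "1 < p" and \<kappa>: "0 \<le> \<kappa>"
    and [measurable]: "f \<in> borel_measurable M" "g \<in> borel_measurable M" "\<And>j. u j \<in> borel_measurable M" "\<And>j. v j \<in> borel_measurable M"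
    and u: "\<And>j. integrable M (\<lambda>\<omega>. N (u j \<omega>) powr p)" and v: "\<And>j. integrable M (\<lambda>\<omega>. N (v j \<omega>) powr p)"
    and lu: "(\<lambda>j. lp_dist M p f (u j)) \<longlonglongrightarrow> 0" and lv: "(\<lambda>j. lp_dist M p g (v j)) \<longlonglongrightarrow> 0"
    and le: "\<And>j. (\<integral>\<omega>. N (v j \<omega>) powr p \<partial>M) \<le> \<kappa> * (\<integral>\<omega>. N (u j \<omega>) powr p \<partial>M)"
  shows "(\<integral>\<omega>. N (g \<omega>) powr p \<partial>M) \<le> \<kappa> * (\<integral>\<omega>. N (f \<omega>) powr p \<partial>M)"
proof -
  have [measurable]: "N \<in> borel_measurable borel" by (rule norm_fun_measurable[OF N])
  obtain c where c: "0 < c" "\<And>x. N x \<le> c * norm x" using norm_fun_le_norm[OF N] by blast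
  define I where "I h = (\<integral>\<^sup>+ \<omega>. ennreal (N (h \<omega>) powr p) \<partial>M)" for h
  have IE: "I h = ennreal (\<integral>\<omega>. N (h \<omega>) powr p \<partial>M)" if "integrable M (\<lambda>\<omega>. N (h \<omega>) powr p)" for h
    unfolding I_def using that by (intro nn_integral_eq_integral) auto
  note W = nn_integral_norm_fun_le[where M = M, OF N p c, folded I_def]
  have fin: "integrable M (\<lambda>\<omega>. N (h \<omega>) powr p)"
    if [measurable]: "h \<in> borel_measurable M" "\<And>j. w j \<in> borel_measurable M" and w: "\<And>j. integrable M (\<lambda>\<omega>. N (w j \<omega>) powr p)"
      "(\<lambda>j. lp_dist M p h (w j)) \<longlonglongrightarrow> 0" for h w
  proof -
    have "eventually (\<lambda>j. lp_dist M p h (w j) < 1) sequentially" using order_tendstoD(2)[OF w(2), of 1] by simp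
    then obtain j where j: "lp_dist M p h (w j) < 1" by (meson eventually_sequentially order_refl)
    have "I h \<le> ennreal ((1 - 1/2) powr (1 - p)) * I (w j) + ennreal ((1/2) powr (1 - p) * c powr p) * lp_dist M p h (w j)"
      by (rule W) auto
    also have "\<dots> < \<infinity>"
      using order.strict_trans[OF j ennreal_one_less_top] by (simp add: IE[OF w(1)] ennreal_mult_less_top)
    finally show ?thesis unfolding I_def by (intro integrableI_nonneg) auto
  qed
  have f: "integrable M (\<lambda>\<omega>. N (f \<omega>) powr p)" by (rule fin[of f u]) (use u lu in auto)
  have g: "integrable M (\<lambda>\<omega>. N (g \<omega>) powr p)" by (rule fin[of g v]) (use v lv in auto)
  have leI: "I (v j) \<le> ennreal \<kappa> * I (u j)" for j
    unfolding IE[OF u] IE[OF v] using le[of j] \<kappa> by (simp add: ennreal_mult[symmetric] ennreal_leI)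
  \<comment> \<open>The factor appears twice, for passing from \<open>g\<close> to
    \<open>v j\<close> and from \<open>u j\<close> to \<open>f\<close>.\<close>
  have step: "(\<integral>\<omega>. N (g \<omega>) powr p \<partial>M) \<le> ((1 - \<theta>) powr (1 - p) * \<kappa> * (1 - \<theta>) powr (1 - p)) * (\<integral>\<omega>. N (f \<omega>) powr p \<partial>M)"
    if \<theta>: "0 < \<theta>" "\<theta> < 1" for \<theta>
  proof -
    let ?c = "ennreal ((1 - \<theta>) powr (1 - p))" and ?d = "ennreal (\<theta> powr (1 - p) * c powr p)"
    let ?b = "\<lambda>j. ?c * (ennreal \<kappa> * (?c * I f + ?d * lp_dist M p f (u j))) + ?d * lp_dist M p g (v j)"
    have "I g \<le> ?b j" for j
    proof -
      have "I g \<le> ?c * I (v j) + ?d * lp_dist M p g (v j)" by (rule W[OF \<theta>]) auto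
      also have "\<dots> \<le> ?c * (ennreal \<kappa> * I (u j)) + ?d * lp_dist M p g (v j)" by (intro add_right_mono mult_left_mono leI) simp
      also have "I (u j) \<le> ?c * I f + ?d * lp_dist M p (u j) f" by (rule W[OF \<theta>]) auto
      then have "?c * (ennreal \<kappa> * I (u j)) + ?d * lp_dist M p g (v j) \<le> ?b j"
        unfolding lp_dist_minus_commute[of M p f] by (intro add_right_mono mult_left_mono) auto
      finally show ?thesis .
    qed
    moreover have "?b \<longlonglongrightarrow> ?c * (ennreal \<kappa> * (?c * I f + ?d * 0)) + ?d * 0"
      by (intro tendsto_add ennreal_tendsto_cmult tendsto_const lu lv) auto
    ultimately have "I g \<le> ?c * (ennreal \<kappa> * (?c * I f + ?d * 0)) + ?d * 0" by (intro LIMSEQ_le_const) auto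
    also have "\<dots> = ennreal (((1 - \<theta>) powr (1 - p) * \<kappa> * (1 - \<theta>) powr (1 - p)) * (\<integral>\<omega>. N (f \<omega>) powr p \<partial>M))"
      using \<kappa> by (simp add: IE[OF f] ennreal_mult mult_ac)
    finally show ?thesis unfolding IE[OF g] using \<kappa> by (subst (asm) ennreal_le_iff) auto
  qed
  have "((\<lambda>\<theta>. ((1 - \<theta>) powr (1 - p) * \<kappa> * (1 - \<theta>) powr (1 - p)) * (\<integral>\<omega>. N (f \<omega>) powr p \<partial>M))
      \<longlongrightarrow> ((1 - 0) powr (1 - p) * \<kappa> * (1 - 0) powr (1 - p)) * (\<integral>\<omega>. N (f \<omega>) powr p \<partial>M)) (at_right 0)"
    by (intro tendsto_intros) auto
  moreover have "eventually (\<lambda>\<theta>. (\<integral>\<omega>. N (g \<omega>) powr p \<partial>M) \<le> ((1 - \<theta>) powr (1 - p) * \<kappa> * (1 - \<theta>) powr (1 - p)) * (\<integral>\<omega>. N (f \<omega>) powr p \<partial>M)) (at_right 0)"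
    using step by (auto simp: eventually_at_right[of 0 1] intro!: exI[of _ 1])
  ultimately have "(\<integral>\<omega>. N (g \<omega>) powr p \<partial>M) \<le> ((1 - 0) powr (1 - p) * \<kappa> * (1 - 0) powr (1 - p)) * (\<integral>\<omega>. N (f \<omega>) powr p \<partial>M)"
    by (rule tendsto_lowerbound) (simp add: trivial_limit_at_right_real)
  then show ?thesis by simp
qed

theorem mainTheorem12:
  fixes M :: "'w measure" and F :: "real \<Rightarrow> 'w measure"
    and W :: "real \<Rightarrow> 'h::{real_inner, complete_space} \<Rightarrow> 'w \<Rightarrow> real"
    and \<Phi> :: "real \<Rightarrow> 'w \<Rightarrow> 'h \<Rightarrow> 'x::euclidean_space"
    and N :: "'x \<Rightarrow> real" and A :: "'h \<Rightarrow> 'h" and p :: real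
  assumes "prob_space M" and "is_filtr M F"
    and "is_norm_fun N" and "1 < p"
    and "separable_space TYPE('h)"
    and "cyl_bm M F W"
    and "progressive_op F \<Phi> M"
    and "hs_Lp_pow M p \<Phi> < \<infinity>"
    and "bounded_linear A" and "\<forall>x y. A x \<bullet> y = x \<bullet> A y"
  shows "(\<integral>\<omega>. N (stoch_int M F W p (\<lambda>t \<omega>. \<Phi> t \<omega> \<circ> A) \<omega>) powr p \<partial>M) powr (1 / p)
         \<le> umd_const p N * onorm A * (\<integral>\<omega>. N (stoch_int M F W p \<Phi> \<omega>) powr p \<partial>M) powr (1 / p)"
proof -
  note M = assms(1) and F = assms(2) and N = assms(3) and p = assms(4) and sep = assms(5) and W = assms(6)
    and \<Phi> = assms(7) and A = assms(9)
  have p0: "0 < p" using p by simp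
  have sym: "A x \<bullet> y = x \<bullet> A y" for x y using assms(10) by blast
  let ?\<Psi> = "\<lambda>t \<omega>. \<Phi> t \<omega> \<circ> A"
  have jm: "jm_op M \<Phi>" by (rule progressive_op_jm_op[OF F \<Phi>])
  have jmA: "jm_op M ?\<Psi>" by (rule jm_op_comp[OF jm A])
  \<comment> \<open>The rate is the one required by the completeness argument behind
    \<open>stoch_int_limit\<close>.\<close>
  have "\<exists>L. lvalid F L \<and> op_dist M p \<Phi> (lproc L) < ennreal ((1/4) ^ j)" for j
  proof -
    have "0 < (1/4 :: real) ^ j" by simp
    from operator_approximation[OF M F p0 sep \<Phi> assms(8) this] show ?thesis by blast
  qed
  then have "\<exists>L. \<forall>j. lvalid F (L j) \<and> op_dist M p \<Phi> (lproc (L j)) < ennreal ((1/4) ^ j)" by (intro choice allI)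
  then obtain L where L: "\<And>j. lvalid F (L j)" "\<And>j. op_dist M p \<Phi> (lproc (L j)) < ennreal ((1/4) ^ j)" by blast
  have LA: "lvalid F (lcomp A (L j))" for j using L(1) by (simp add: lvalid_lcomp)
  \<comment> \<open>The added 1 keeps the factor positive when \<open>A\<close> is 0, as taking it
    out of the mixed norm requires.\<close>
  define a where "a = (onorm A)\<^sup>2 + 1"
  have a: "0 < a" unfolding a_def by (simp add: add_nonneg_pos)
  have distA: "op_dist M p ?\<Psi> (lproc (lcomp A (L j))) \<le> ennreal (a powr (p / 2) * (1/4) ^ j)" for j
  proof -
    have jd: "jm_op M (\<lambda>t \<omega> h. \<Phi> t \<omega> h - lproc (L j) t \<omega> h)" by (intro jm_op_diff jm jm_op_lproc[OF F L(1)])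
    have "op_dist M p ?\<Psi> (lproc (lcomp A (L j))) \<le> Lp_L2 M p (\<lambda>\<omega> t. ennreal a * opsq0 (\<lambda>t \<omega> h. \<Phi> t \<omega> h - lproc (L j) t \<omega> h) \<omega> t)"
    proof (rule Lp_L2_mono[OF _ p0])
      fix \<omega> t assume \<omega>: "\<omega> \<in> space M"
      show "opsq0 (\<lambda>t \<omega> h. ?\<Psi> t \<omega> h - lproc (lcomp A (L j)) t \<omega> h) \<omega> t
          \<le> ennreal a * opsq0 (\<lambda>t \<omega> h. \<Phi> t \<omega> h - lproc (L j) t \<omega> h) \<omega> t"
      proof (cases "0 \<le> t")
        case True
        have "linear (\<lambda>h. \<Phi> t \<omega> h - lproc (L j) t \<omega> h)"
          using jd True \<omega> unfolding jm_op_def by (auto intro: bounded_linear.linear)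
        from opsq_compose[OF this A]
        have "opsq (\<lambda>h. ?\<Psi> t \<omega> h - lproc (lcomp A (L j)) t \<omega> h) \<le> ennreal ((onorm A)\<^sup>2) * opsq (\<lambda>h. \<Phi> t \<omega> h - lproc (L j) t \<omega> h)"
          by (simp add: comp_def lproc_lcomp[OF sym])
        also have "\<dots> \<le> ennreal a * opsq (\<lambda>h. \<Phi> t \<omega> h - lproc (L j) t \<omega> h)"
          unfolding a_def by (intro mult_right_mono ennreal_leI) auto
        finally show ?thesis using True by simp
      qed simp
    qed
    also have "\<dots> = ennreal (a powr (p / 2)) * op_dist M p \<Phi> (lproc (L j))"
      by (rule Lp_L2_cmult[OF opsq0_measurable[OF sep jd] a])
    also have "\<dots> \<le> ennreal (a powr (p / 2)) * ennreal ((1/4) ^ j)" using L(2)[of j] by (intro mult_left_mono) auto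
    finally show ?thesis by (simp add: ennreal_mult)
  qed
  have dist: "op_dist M p \<Phi> (lproc (L j)) \<le> ennreal (1 * (1/4) ^ j)" for j using L(2)[of j] by simp
  note lim = stoch_int_limit[OF M F W p0 sep jm L(1) zero_le_one dist]
  \<comment> \<open>The images under \<open>lcomp A\<close> approximate the composed integrand at
    the same rate, so both stochastic integrals are limits along paired lists and the simple
    inequality can be applied for each \<open>j\<close>.\<close>
  note limA = stoch_int_limit[OF M F W p0 sep jmA LA powr_ge_zero distA]
  obtain C where C: "\<And>L :: (real \<times> real \<times> 'w set \<times> 'h \<times> 'x) list. lvalid F L \<Longrightarrow> integrable M (\<lambda>\<omega>. norm (lint W L \<omega>) powr p)"
    using lint_bound[OF M F W p0] by blast
  have NL: "integrable M (\<lambda>\<omega>. N (lint W L \<omega>) powr p)" if L: "lvalid F L" for L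
  proof -
    have [measurable]: "N \<in> borel_measurable borel" "lint W L \<in> borel_measurable M"
      using norm_fun_measurable[OF N] lint_measurable[OF F W L] by auto
    obtain c where c: "0 < c" "\<And>x. N x \<le> c * norm x" using norm_fun_le_norm[OF N] by blast
    have "N (lint W L \<omega>) powr p \<le> c powr p * norm (lint W L \<omega>) powr p" for \<omega>
      using powr_mono2[OF _ norm_funD(1)[OF N] c(2), of p "lint W L \<omega>"] p c(1) by (simp add: powr_mult)
    then show ?thesis
      by (intro Bochner_Integration.integrable_bound[OF integrable_mult_right[OF C[OF L], of "c powr p"]] AE_I2) auto
  qed
  define \<kappa> where "\<kappa> = umd_const p N * onorm A"
  have \<kappa>: "0 \<le> \<kappa>" unfolding \<kappa>_def using umd_const_ge_one[OF N p] onorm_pos_le[OF A] by simp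
  have "(\<integral>\<omega>. N (stoch_int M F W p ?\<Psi> \<omega>) powr p \<partial>M) \<le> \<kappa> powr p * (\<integral>\<omega>. N (stoch_int M F W p \<Phi> \<omega>) powr p \<partial>M)"
  proof (rule norm_fun_bound_limit[OF N p _ lim(1) limA(1) _ _ _ _ lim(2) limA(2)])
    show "(\<integral>\<omega>. N (lint W (lcomp A (L j)) \<omega>) powr p \<partial>M) \<le> \<kappa> powr p * (\<integral>\<omega>. N (lint W (L j) \<omega>) powr p \<partial>M)" for j
      unfolding \<kappa>_def by (rule lint_self_adjoint_bound[OF M F W p N A sym L(1)])
  qed (auto intro: lint_measurable[OF F W] L LA NL)
  then have "(\<integral>\<omega>. N (stoch_int M F W p ?\<Psi> \<omega>) powr p \<partial>M) powr (1 / p)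
     \<le> (\<kappa> powr p * (\<integral>\<omega>. N (stoch_int M F W p \<Phi> \<omega>) powr p \<partial>M)) powr (1 / p)"
    using p0 by (intro powr_mono2 Bochner_Integration.integral_nonneg) auto
  also have "\<dots> = \<kappa> * (\<integral>\<omega>. N (stoch_int M F W p \<Phi> \<omega>) powr p \<partial>M) powr (1 / p)"
    using \<kappa> p0 by (simp add: powr_mult powr_powr)
  finally show ?thesis unfolding \<kappa>_def .
qed

end
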